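(* Let $(E,M,q,\zeta,\sigma,\lambda)$ be a differential bundle in a tangent actegory $(\mathbb X,T_\bullet)$. Then the functor $F_E:\mathbb N^\bullet\to\mathbb X$ and the morphisms $\hat\alpha_{A,\mathbb N^l}:F_E(D_A(\mathbb N^l))\to T_A(F_E(\mathbb N^l))$ ($A\in\mathrm{Weil}$, $l\ge0$) defined in the context form a (lax) differential functor $$\mathrm{Ind}(E)=(F_E,\hat\alpha):(\mathbb N^\bullet,D_\bullet)\to(\mathbb X,T_\bullet).$$
   Context: **Weil algebras and tangent actegories.** $\mathrm{Weil}$ is the category whose objects are the commutative $\mathbb N$-algebras (semirings) $\mathbb N[x_1,\dots,x_n]/\langle x_ix_j\mid i\sim j\rangle$ for an equivalence relation $\sim$ on $\{1,\dots,n\}$, with unital $\mathbb N$-linear semiring homomorphisms as morphisms. It is monoidal under the coproduct $\otimes$ with unit $\mathbb N$ (also terminal). $W=\mathbb N[x]/\langle x^2\rangle$; $W^n=\mathbb N[x_1,\dots,x_n]/\langle x_ix_j \mid \text{all } i,j\rangle$ is the $n$-fold product in $\mathrm{Weil}$; every object has the form $W^{n_1}\otimes\cdots\otimes W^{n_k}$. Distinguished morphisms: $p:W\to\mathbb N$, $ax+b\mapsto b$; $0:\mathbb N\to W$ the inclusion; $+:W\times W\to W$, $ax_1+bx_2+c\mapsto (a+b)x+c$; $\ell:W\to W\otimes W$, $ax+b\mapsto ax_1x_2+b$; $c:W\otimes W\to W\otimes W$ swapping $x_1,x_2$. A $\mathrm{Weil}$-actegory $(\mathbb X,T_\bullet)$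 is a category with a functor $T_\bullet:\mathrm{Weil}\times\mathbb X\to\mathbb X$ and natural isomorphisms $X\cong T_\bullet(\mathbb N,X)$, $T_\bullet(A,T_\bullet(B,X))\cong T_\bullet(A\otimes B,X)$ satisfying the usual associativity and unit coherences. Write $T_A=T_\bullet(A,-)$ and $T_\theta$ for the natural transformation given by a morphism $\theta$ of $\mathrm{Weil}$. It is a tangent actegory if for each object $X$ the functor $T_{(-)}(X)$ sends to pullbacks: (i) the squares exhibiting $A\otimes(B\times C)$ as the pullback of $A\otimes B\to A\leftarrow A\otimes C$, whenever $B\times C$ exists in $\mathrm{Weil}$; (ii) the squares obtained by applying $W^{\otimes n}\otimes-$, $n\ge0$, to the pullback square with top $\nu:W\times W\to W\otimes W$, $\nu(ax_1+bx_2+c)=ax_1x_2+bx_2+c$, right side $1_W\otimes p:W\otimes W\to W$, left side the unique map $W\times W\to\mathbb N$ and bottom $0:\mathbb N\to W$. Tangent categories are identified with tangent actegories, with tangent functor $T:=T_W$ and structure maps $p:=T_p,\ 0:=T_0,\ +:=T_+,\ \ell:=T_\ell,\ c:=T_c$, under the identifications $T_{W\otimes W}=T\circ T$, $T_n:=T_{W^n}$. **Differential bundles.** An additive bundle $(X,A,p,+,0)$: a morphism $p:X\to A$ with pullback powers $X_n$ of $p$ over $A$ ($X_0=A$, $X_1=X$), and $+:X_2\to X$, $0:A\to X$ with $p\circ +=p\circ\pi_0=p\circ\pi_1$, $p\circ0=1_A$, and $+$ associative, commutative and with unit $0$. An additive bundle morphism $(f,g)$ is a pair $f:X\to Y$,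 $g:A\to B$ with $p'f=gp$, $f\circ+=+'\circ f_2$, $f\circ0=0'\circ g$. A differential bundle $(E,M,q,\zeta,\sigma,\lambda)$ in $(\mathbb X,T)$ consists of $q:E\to M$ whose finite pullback powers $E_n$ exist and are preserved by all $T^k$; $\zeta:M\to E$, $\sigma:E_2\to E$ making $(E,M,q,\sigma,\zeta)$ an additive bundle; and $\lambda:E\to TE$ such that $(\lambda,0_M)$ is an additive bundle morphism to $(TE,TM,Tq,T\sigma,T\zeta)$, $(\lambda,\zeta)$ is an additive bundle morphism to $(TE,E,p_E,+_E,0_E)$, $\ell_E\circ\lambda=T(\lambda)\circ\lambda$, and the square with top $T(\sigma)\circ\langle\lambda\pi_0,0\pi_1\rangle:E_2\to TE$, left $q\pi_0:E_2\to M$, bottom $0_M:M\to TM$, right $T(q)$ is a pullback. **Differential functors.** An oplax $\mathrm{Weil}$-linear functor $(F,\hat\alpha):(\mathbb X,T_\bullet)\to(\mathbb X',T'_\bullet)$ is a functor $F$ with a natural transformation $\hat\alpha:F\circ T_\bullet\Rightarrow T'_\bullet\circ(1\times F)$, components $\hat\alpha_{A,X}:F(T_AX)\to T'_A(FX)$ natural in $A$ and $X$, satisfying (modulo the structure isomorphisms) $\hat\alpha_{A\otimes B,X}=T'_A(\hat\alpha_{B,X})\circ\hat\alpha_{A,T_BX}$ and $\hat\alpha_{\mathbb N,X}=1_{FX}$. Suppose $\mathbb X$ has a terminal object $*$. $(F,\hat\alpha)$ is a (lax) differential functor if for all $A\in\mathrm{Weil}$: (a) $T'_A\circ F$ preserves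 pullbacks over $*$, and (b) all naturality squares of $\hat\alpha_{A,-}:F\circ T_A\Rightarrow T'_A\circ F$ are pullbacks. **The tangent actegory $\mathbb N^\bullet$.** Objects $\mathbb N^k$ ($k\ge0$), morphisms $\mathbb N^m\to\mathbb N^n$ the $n\times m$ matrices over $\mathbb N$, composition matrix multiplication; $\mathbb N^0$ is terminal. Action: $D_\bullet(A,\mathbb N^k)=\underline A\otimes\mathbb N^k$ with $\underline A$ the underlying additive monoid of $A$; so $D_W(\mathbb N^k)=\mathbb N^k\times\mathbb N^k$ with $p=\pi_0$, $0=\langle1,0\rangle$, $+=\langle\pi_0,\pi_1+\pi_2\rangle$, $\ell=\langle\pi_0,0,0,\pi_1\rangle$, $c=\langle\pi_0,\pi_2,\pi_1,\pi_3\rangle$. **Definition of $F_E$ and $\hat\alpha$.** $F_E(\mathbb N^k)=E_k$ ($E_0=M$), and a matrix $(a_{ij}):\mathbb N^m\to\mathbb N^n$ is sent to the map $E_m\to E_n$ over $M$ with $i$-th component $\sum_{j=1}^m a_{ij}\cdot\pi_j$, where $\pi_j:E_m\to E$ is the $j$-th projection and sums and $\mathbb N$-multiples are taken in the commutative monoid of maps $E_m\to E$ over $M$, with addition $f+g=\sigma\circ\langle f,g\rangle$ and zero the structure map $E_m\to M$ followed by $\zeta$. The components $\hat\alpha_{A,\mathbb N^l}:F_E(D_A(\mathbb N^l))\to T_A(E_l)$ are: $\hat\alpha_{\mathbb N,\mathbb N^l}=1$; $\hat\alpha_{W,\mathbb N^1}=T(\sigma)\circ\langle0\pi_0,\lambda\pi_1\rangle:E_2\to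 TE$; $\hat\alpha_{W^k,\mathbb N^0}:M\to T_{W^k}M$ the zero map induced by $\mathbb N\to W^k$; $\hat\alpha_{W^k,\mathbb N^1}:E_{k+1}\to T_kE$ the $k$-fold fibre power of $\hat\alpha_{W,\mathbb N^1}$ over $E$ (via $\pi_0:E_2\to E$ and $p_E:TE\to E$); $\hat\alpha_{W^k,\mathbb N^l}$ the $l$-fold fibre power of $\hat\alpha_{W^k,\mathbb N^1}$ over $\hat\alpha_{W^k,\mathbb N^0}$, i.e. the unique map with $T_{W^k}(\pi_j)\circ\hat\alpha_{W^k,\mathbb N^l}=\hat\alpha_{W^k,\mathbb N^1}\circ F_E(D_{W^k}(\pi_j))$ for $1\le j\le l$; and $\hat\alpha_{A\otimes B,\mathbb N^l}=T_A(\hat\alpha_{B,\mathbb N^l})\circ\hat\alpha_{A,D_B(\mathbb N^l)}$.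
   Formalization: The pullback square expressing universality of the lift in a differential bundle is required to be preserved by all powers T^k of the tangent functor, not only to be a pullback; without this the pullback condition on naturality squares can fail for W⊗W. *)

theory Defs
  imports
    "HOL-Library.Poly_Mapping"
    "HOL-Algebra.Ring"
    "Jordan_Normal_Form.Matrix"
begin

section \<open>Categories\<close>

record ('o, 'a) cat =
  Ob :: "'o set"
  Ar :: "'a set"
  Dom :: "'a \<Rightarrow> 'o"
  Cod :: "'a \<Rightarrow> 'o"
  Idn :: "'o \<Rightarrow> 'a"
  Cmp :: "'a \<Rightarrow> 'a \<Rightarrow> 'a" (infixl "\<cdot>\<index>" 70)

definition Hom :: "('o, 'a, 'x) cat_scheme \<Rightarrow> 'o \<Rightarrow> 'o \<Rightarrow> 'a set" where
  "Hom C x y = {f \<in> Ar C. Dom C f = x \<and> Cod C f = y}"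

definition category :: "('o, 'a, 'x) cat_scheme \<Rightarrow> bool" where
  "category C \<longleftrightarrow>
     (\<forall>f \<in> Ar C. Dom C f \<in> Ob C \<and> Cod C f \<in> Ob C) \<and>
     (\<forall>x \<in> Ob C. Idn C x \<in> Hom C x x) \<and>
     (\<forall>x y z. \<forall>f \<in> Hom C x y. \<forall>g \<in> Hom C y z. g \<cdot>\<^bsub>C\<^esub> f \<in> Hom C x z) \<and>
     (\<forall>x y. \<forall>f \<in> Hom C x y. f \<cdot>\<^bsub>C\<^esub> Idn C x = f \<and> Idn C y \<cdot>\<^bsub>C\<^esub> f = f) \<and>
     (\<forall>w x y z. \<forall>f \<in> Hom C w x. \<forall>g \<in> Hom C x y. \<forall>h \<in> Hom C y z.
        h \<cdot>\<^bsub>C\<^esub> g \<cdot>\<^bsub>C\<^esub> f = h \<cdot>\<^bsub>C\<^esub> (g \<cdot>\<^bsub>C\<^esub> f))"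

definition is_functor ::
  "('o, 'a, 'x) cat_scheme \<Rightarrow> ('p, 'b, 'y) cat_scheme \<Rightarrow> ('o \<Rightarrow> 'p) \<Rightarrow> ('a \<Rightarrow> 'b) \<Rightarrow> bool" where
  "is_functor C D Fo Fa \<longleftrightarrow>
     (\<forall>x \<in> Ob C. Fo x \<in> Ob D \<and> Fa (Idn C x) = Idn D (Fo x)) \<and>
     (\<forall>x y. \<forall>f \<in> Hom C x y. Fa f \<in> Hom D (Fo x) (Fo y)) \<and>
     (\<forall>x y z. \<forall>f \<in> Hom C x y. \<forall>g \<in> Hom C y z. Fa (g \<cdot>\<^bsub>C\<^esub> f) = Fa g \<cdot>\<^bsub>D\<^esub> Fa f)"

definition prod_cat ::
  "('o, 'a, 'x) cat_scheme \<Rightarrow> ('p, 'b, 'y) cat_scheme \<Rightarrow> ('o \<times> 'p, 'a \<times> 'b) cat" where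
  "prod_cat C D = \<lparr>Ob = Ob C \<times> Ob D, Ar = Ar C \<times> Ar D,
     Dom = (\<lambda>(f, g). (Dom C f, Dom D g)), Cod = (\<lambda>(f, g). (Cod C f, Cod D g)),
     Idn = (\<lambda>(x, y). (Idn C x, Idn D y)),
     Cmp = (\<lambda>(f', g') (f, g). (f' \<cdot>\<^bsub>C\<^esub> f, g' \<cdot>\<^bsub>D\<^esub> g))\<rparr>"

definition inverse_arrows :: "('o, 'a, 'x) cat_scheme \<Rightarrow> 'a \<Rightarrow> 'a \<Rightarrow> bool" where
  "inverse_arrows C f g \<longleftrightarrow>
     f \<in> Ar C \<and> g \<in> Hom C (Cod C f) (Dom C f) \<and>
     g \<cdot>\<^bsub>C\<^esub> f = Idn C (Dom C f) \<and> f \<cdot>\<^bsub>C\<^esub> g = Idn C (Cod C f)"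

definition is_iso :: "('o, 'a, 'x) cat_scheme \<Rightarrow> 'a \<Rightarrow> bool" where
  "is_iso C f \<longleftrightarrow> (\<exists>g. inverse_arrows C f g)"

definition inv_arrow :: "('o, 'a, 'x) cat_scheme \<Rightarrow> 'a \<Rightarrow> 'a" where
  "inv_arrow C f = (THE g. inverse_arrows C f g)"

definition is_terminal :: "('o, 'a, 'x) cat_scheme \<Rightarrow> 'o \<Rightarrow> bool" where
  "is_terminal C t \<longleftrightarrow> t \<in> Ob C \<and> (\<forall>x \<in> Ob C. \<exists>!f. f \<in> Hom C x t)"

definition is_product :: "('o, 'a, 'x) cat_scheme \<Rightarrow> 'a \<Rightarrow> 'a \<Rightarrow> bool" where
  "is_product C p q \<longleftrightarrow>
     p \<in> Ar C \<and> q \<in> Ar C \<and> Dom C p = Dom C q \<and>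
     (\<forall>z. \<forall>f \<in> Hom C z (Cod C p). \<forall>g \<in> Hom C z (Cod C q).
        \<exists>!h. h \<in> Hom C z (Dom C p) \<and> p \<cdot>\<^bsub>C\<^esub> h = f \<and> q \<cdot>\<^bsub>C\<^esub> h = g)"

text \<open>Argument order of \<open>is_pullback C top left right bottom\<close>.\<close>

definition is_pullback :: "('o, 'a, 'x) cat_scheme \<Rightarrow> 'a \<Rightarrow> 'a \<Rightarrow> 'a \<Rightarrow> 'a \<Rightarrow> bool" where
  "is_pullback C t l r b \<longleftrightarrow>
     t \<in> Ar C \<and> l \<in> Ar C \<and> r \<in> Ar C \<and> b \<in> Ar C \<and>
     Dom C t = Dom C l \<and> Cod C t = Dom C r \<and> Cod C l = Dom C b \<and> Cod C r = Cod C b \<and>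
     r \<cdot>\<^bsub>C\<^esub> t = b \<cdot>\<^bsub>C\<^esub> l \<and>
     (\<forall>z. \<forall>f \<in> Hom C z (Dom C r). \<forall>g \<in> Hom C z (Dom C b).
        r \<cdot>\<^bsub>C\<^esub> f = b \<cdot>\<^bsub>C\<^esub> g \<longrightarrow>
        (\<exists>!h. h \<in> Hom C z (Dom C t) \<and> t \<cdot>\<^bsub>C\<^esub> h = f \<and> l \<cdot>\<^bsub>C\<^esub> h = g))"

text \<open>
  \<open>u : P \<rightarrow> A\<close> and \<open>\<pi> i : P \<rightarrow> X\<close> (\<open>i < n\<close>) exhibit \<open>P\<close> as the \<open>n\<close>-th pullback power of
  \<open>q : X \<rightarrow> A\<close> over \<open>A\<close>. For \<open>n = 0\<close> this says that \<open>u\<close> is invertible.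
\<close>

definition fibre_power ::
  "('o, 'a, 'x) cat_scheme \<Rightarrow> 'a \<Rightarrow> nat \<Rightarrow> 'a \<Rightarrow> (nat \<Rightarrow> 'a) \<Rightarrow> bool" where
  "fibre_power C q n u \<pi> \<longleftrightarrow>
     q \<in> Ar C \<and> u \<in> Ar C \<and> Cod C u = Cod C q \<and>
     (\<forall>i < n. \<pi> i \<in> Hom C (Dom C u) (Dom C q) \<and> q \<cdot>\<^bsub>C\<^esub> \<pi> i = u) \<and>
     (\<forall>z f. \<forall>v \<in> Hom C z (Cod C q).
        (\<forall>i < n. f i \<in> Hom C z (Dom C q) \<and> q \<cdot>\<^bsub>C\<^esub> f i = v) \<longrightarrow>
        (\<exists>!h. h \<in> Hom C z (Dom C u) \<and> u \<cdot>\<^bsub>C\<^esub> h = v \<and> (\<forall>i < n. \<pi> i \<cdot>\<^bsub>C\<^esub> h = f i)))"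

definition fibre_tuple ::
  "('o, 'a, 'x) cat_scheme \<Rightarrow> nat \<Rightarrow> 'a \<Rightarrow> (nat \<Rightarrow> 'a) \<Rightarrow> 'a \<Rightarrow> (nat \<Rightarrow> 'a) \<Rightarrow> 'a" where
  "fibre_tuple C n u \<pi> v f =
     (THE h. h \<in> Hom C (Dom C v) (Dom C u) \<and> u \<cdot>\<^bsub>C\<^esub> h = v \<and> (\<forall>i < n. \<pi> i \<cdot>\<^bsub>C\<^esub> h = f i))"


section \<open>The category Weil\<close>

text \<open>
  The pair \<open>(n, r)\<close>, with \<open>r\<close> an equivalence relation on \<open>{..<n}\<close>, stands for the semiring
  \<open>\<nat>[x\<^sub>0, \<dots>, x\<^sub>n\<^sub>-\<^sub>1] / \<langle>x\<^sub>i x\<^sub>j | (i, j) \<in> r\<rangle>\<close>, the quotient by the congruence generated by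
  \<open>x\<^sub>i x\<^sub>j \<sim> 0\<close>; its elements are the congruence classes. Monomials are exponent
  vectors.
\<close>

type_synonym monomial = "nat \<Rightarrow>\<^sub>0 nat"
type_synonym npoly = "monomial \<Rightarrow>\<^sub>0 nat"
type_synonym wob = "nat \<times> nat rel"
type_synonym war = "wob \<times> wob \<times> (npoly set \<Rightarrow> npoly set)"

definition mvar :: "nat \<Rightarrow> monomial" where
  "mvar i = Poly_Mapping.single i 1"

definition pmon :: "monomial \<Rightarrow> npoly" where
  "pmon m = Poly_Mapping.single m 1"

definition pvar :: "nat \<Rightarrow> npoly" where
  "pvar i = pmon (mvar i)"

definition npolys :: "nat \<Rightarrow> npoly set" where
  "npolys n = {p. \<forall>m \<in> Poly_Mapping.keys p. Poly_Mapping.keys m \<subseteq> {..<n}}"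

inductive_set wcong :: "wob \<Rightarrow> npoly rel" for A :: wob where
  gen: "(i, j) \<in> snd A \<Longrightarrow> (pvar i * pvar j, 0) \<in> wcong A"
| refl: "p \<in> npolys (fst A) \<Longrightarrow> (p, p) \<in> wcong A"
| sym: "(p, q) \<in> wcong A \<Longrightarrow> (q, p) \<in> wcong A"
| trans: "(p, q) \<in> wcong A \<Longrightarrow> (q, s) \<in> wcong A \<Longrightarrow> (p, s) \<in> wcong A"
| add: "(p, q) \<in> wcong A \<Longrightarrow> (p', q') \<in> wcong A \<Longrightarrow> (p + p', q + q') \<in> wcong A"
| mult: "(p, q) \<in> wcong A \<Longrightarrow> (p', q') \<in> wcong A \<Longrightarrow> (p * p', q * q') \<in> wcong A"

definition wcls :: "wob \<Rightarrow> npoly \<Rightarrow> npoly set" where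
  "wcls A p = wcong A `` {p}"

definition wrep :: "npoly set \<Rightarrow> npoly" where
  "wrep a = (SOME p. p \<in> a)"

definition walg :: "wob \<Rightarrow> npoly set ring" where
  "walg A = \<lparr>carrier = npolys (fst A) // wcong A,
     mult = (\<lambda>a b. wcls A (wrep a * wrep b)), one = wcls A 1,
     zero = wcls A 0, add = (\<lambda>a b. wcls A (wrep a + wrep b))\<rparr>"

text \<open>
  \<^const>\<open>ring_hom\<close> does not ask for preservation of zero, which is not automatic for semirings.
  Additivity and preservation of zero give \<open>\<nat>\<close>-linearity.
\<close>

definition whom :: "wob \<Rightarrow> wob \<Rightarrow> (npoly set \<Rightarrow> npoly set) set" where
  "whom A B = {h \<in> ring_hom (walg A) (walg B).
     h \<zero>\<^bsub>walg A\<^esub> = \<zero>\<^bsub>walg B\<^esub> \<and> h \<in> extensional (carrier (walg A))}"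

definition weil :: "(wob, war) cat" where
  "weil = \<lparr>Ob = {A. equiv {..<fst A} (snd A)},
     Ar = {(A, B, h). equiv {..<fst A} (snd A) \<and> equiv {..<fst B} (snd B) \<and> h \<in> whom A B},
     Dom = (\<lambda>(A, B, h). A), Cod = (\<lambda>(A, B, h). B),
     Idn = (\<lambda>A. (A, A, \<lambda>a \<in> carrier (walg A). a)),
     Cmp = (\<lambda>(B', C, g) (A, B, h). (A, C, compose (carrier (walg A)) g h))\<rparr>"

definition weil_map :: "wob \<Rightarrow> wob \<Rightarrow> (nat \<Rightarrow> npoly) \<Rightarrow> war" where
  \<comment> \<open>the morphism sending the generator \<open>x\<^sub>i\<close> to the class of \<open>g i\<close>\<close>
  "weil_map A B g = (THE f. f \<in> Hom weil A B \<and>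
     (\<forall>i < fst A. snd (snd f) (wcls A (pvar i)) = wcls B (g i)))"

text \<open>
  The coproduct, with the generators of the second factor placed after those of the first.
  With this choice the monoidal structure is strict (\<open>wten_assoc\<close>, \<open>wten_unit_left\<close>,
  \<open>wten_unit_right\<close>), so no associators or unitors of Weil appear below.
\<close>

definition wten :: "wob \<Rightarrow> wob \<Rightarrow> wob" where
  "wten A B = (fst A + fst B, snd A \<union> (\<lambda>(i, j). (fst A + i, fst A + j)) ` snd B)"

definition wunit :: wob where
  "wunit = (0, {})"

lemma wten_assoc: "wten (wten A B) C = wten A (wten B C)"
  unfolding wten_def
  by (simp add: image_Un image_image Un_assoc case_prod_unfold add.assoc)

lemma wten_unit_left: "wten wunit A = A"
  by (simp add: wten_def wunit_def case_prod_unfold)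

lemma wten_unit_right: "wten A wunit = A"
  by (simp add: wten_def wunit_def)

definition winl :: "wob \<Rightarrow> wob \<Rightarrow> war" where
  "winl A B = weil_map A (wten A B) pvar"

definition winr :: "wob \<Rightarrow> wob \<Rightarrow> war" where
  "winr A B = weil_map B (wten A B) (\<lambda>i. pvar (fst A + i))"

definition wtena :: "war \<Rightarrow> war \<Rightarrow> war" where
  "wtena f g = (THE h.
     h \<in> Hom weil (wten (Dom weil f) (Dom weil g)) (wten (Cod weil f) (Cod weil g)) \<and>
     h \<cdot>\<^bsub>weil\<^esub> winl (Dom weil f) (Dom weil g) = winl (Cod weil f) (Cod weil g) \<cdot>\<^bsub>weil\<^esub> f \<and>
     h \<cdot>\<^bsub>weil\<^esub> winr (Dom weil f) (Dom weil g) = winr (Cod weil f) (Cod weil g) \<cdot>\<^bsub>weil\<^esub> g)"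

definition Wpow :: "nat \<Rightarrow> wob" where
  "Wpow n = (n, {..<n} \<times> {..<n})"

abbreviation W1 :: wob where
  "W1 \<equiv> Wpow 1"

definition Wproj :: "nat \<Rightarrow> nat \<Rightarrow> war" where
  "Wproj n i = weil_map (Wpow n) W1 (\<lambda>j. if j = i then pvar 0 else 0)"

text \<open>\<open>waug A\<close> is the unique morphism to the terminal object \<open>\<nat>\<close>, \<open>wini A\<close> the unique one from it.\<close>

definition waug :: "wob \<Rightarrow> war" where
  "waug A = weil_map A wunit (\<lambda>_. 0)"

definition wini :: "wob \<Rightarrow> war" where
  "wini A = weil_map wunit A (\<lambda>_. 0)"

definition w_p :: war where "w_p = waug W1"

definition w_zero :: war where "w_zero = wini W1"

definition w_plus :: war where "w_plus = weil_map (Wpow 2) W1 (\<lambda>_. pvar 0)"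

definition w_l :: war where "w_l = weil_map W1 (wten W1 W1) (\<lambda>_. pvar 0 * pvar 1)"

definition w_nu :: war where
  "w_nu = weil_map (Wpow 2) (wten W1 W1) (\<lambda>i. if i = 0 then pvar 0 * pvar 1 else pvar 1)"

fun Wten :: "nat \<Rightarrow> wob" where
  "Wten 0 = wunit"
| "Wten (Suc n) = wten W1 (Wten n)"


section \<open>Weil-actegories and tangent actegories\<close>

record ('o, 'a) acteg = "('o, 'a) cat" +
  actO :: "wob \<Rightarrow> 'o \<Rightarrow> 'o"
  actA :: "war \<Rightarrow> 'a \<Rightarrow> 'a"
  unitA :: "'o \<Rightarrow> 'a"
  multA :: "wob \<Rightarrow> wob \<Rightarrow> 'o \<Rightarrow> 'a"

abbreviation Tob :: "('o, 'a, 'x) acteg_scheme \<Rightarrow> wob \<Rightarrow> 'o \<Rightarrow> 'o" where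
  "Tob X A x \<equiv> actO X A x"

definition Tar :: "('o, 'a, 'x) acteg_scheme \<Rightarrow> wob \<Rightarrow> 'a \<Rightarrow> 'a" where
  "Tar X A f = actA X (Idn weil A) f"

definition Tnt :: "('o, 'a, 'x) acteg_scheme \<Rightarrow> war \<Rightarrow> 'o \<Rightarrow> 'a" where
  "Tnt X \<theta> x = actA X \<theta> (Idn X x)"

text \<open>\<open>unitA X x : x \<rightarrow> T\<^sub>\<nat> x\<close> and \<open>multA X A B x : T\<^sub>A (T\<^sub>B x) \<rightarrow> T\<^bsub>A \<otimes> B\<^esub> x\<close>.\<close>

definition actegory :: "('o, 'a, 'x) acteg_scheme \<Rightarrow> bool" where
  "actegory X \<longleftrightarrow>
     category X \<and>
     is_functor (prod_cat weil X) X (\<lambda>(A, x). actO X A x) (\<lambda>(\<theta>, f). actA X \<theta> f) \<and>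
     (\<forall>x \<in> Ob X. unitA X x \<in> Hom X x (Tob X wunit x) \<and> is_iso X (unitA X x)) \<and>
     (\<forall>x y. \<forall>f \<in> Hom X x y. Tar X wunit f \<cdot>\<^bsub>X\<^esub> unitA X x = unitA X y \<cdot>\<^bsub>X\<^esub> f) \<and>
     (\<forall>A \<in> Ob weil. \<forall>B \<in> Ob weil. \<forall>x \<in> Ob X.
        multA X A B x \<in> Hom X (Tob X A (Tob X B x)) (Tob X (wten A B) x) \<and>
        is_iso X (multA X A B x)) \<and>
     (\<forall>A A' B B' x y. \<forall>\<theta> \<in> Hom weil A A'. \<forall>\<phi> \<in> Hom weil B B'. \<forall>f \<in> Hom X x y.
        multA X A' B' y \<cdot>\<^bsub>X\<^esub> actA X \<theta> (actA X \<phi> f) =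
        actA X (wtena \<theta> \<phi>) f \<cdot>\<^bsub>X\<^esub> multA X A B x) \<and>
     (\<forall>A \<in> Ob weil. \<forall>B \<in> Ob weil. \<forall>C \<in> Ob weil. \<forall>x \<in> Ob X.
        multA X (wten A B) C x \<cdot>\<^bsub>X\<^esub> multA X A B (Tob X C x) =
        multA X A (wten B C) x \<cdot>\<^bsub>X\<^esub> Tar X A (multA X B C x)) \<and>
     (\<forall>A \<in> Ob weil. \<forall>x \<in> Ob X.
        multA X wunit A x \<cdot>\<^bsub>X\<^esub> unitA X (Tob X A x) = Idn X (Tob X A x) \<and>
        multA X A wunit x \<cdot>\<^bsub>X\<^esub> Tar X A (unitA X x) = Idn X (Tob X A x))"

text \<open>
  In the first family of squares \<open>\<pi>\<^sub>0, \<pi>\<^sub>1\<close> is any product cone that exists in Weil, and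
  \<open>A \<otimes> \<nat>\<close> is \<open>A\<close> itself.
\<close>

definition tangent_actegory :: "('o, 'a, 'x) acteg_scheme \<Rightarrow> bool" where
  "tangent_actegory X \<longleftrightarrow>
     actegory X \<and>
     (\<forall>x \<in> Ob X. \<forall>A \<in> Ob weil. \<forall>\<pi>\<^sub>0 \<pi>\<^sub>1. is_product weil \<pi>\<^sub>0 \<pi>\<^sub>1 \<longrightarrow>
        is_pullback X
          (Tnt X (wtena (Idn weil A) \<pi>\<^sub>0) x)
          (Tnt X (wtena (Idn weil A) \<pi>\<^sub>1) x)
          (Tnt X (wtena (Idn weil A) (waug (Cod weil \<pi>\<^sub>0))) x)
          (Tnt X (wtena (Idn weil A) (waug (Cod weil \<pi>\<^sub>1))) x)) \<and>
     (\<forall>x \<in> Ob X. \<forall>n.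
        is_pullback X
          (Tnt X (wtena (Idn weil (Wten n)) w_nu) x)
          (Tnt X (wtena (Idn weil (Wten n)) (waug (Wpow 2))) x)
          (Tnt X (wtena (Idn weil (Wten n)) (wtena (Idn weil W1) w_p)) x)
          (Tnt X (wtena (Idn weil (Wten n)) w_zero) x))"

text \<open>The structure of the associated tangent category, with \<open>T = T\<^sub>W\<close>.\<close>

abbreviation TO :: "('o, 'a, 'x) acteg_scheme \<Rightarrow> 'o \<Rightarrow> 'o" where
  "TO X x \<equiv> Tob X W1 x"

abbreviation TA :: "('o, 'a, 'x) acteg_scheme \<Rightarrow> 'a \<Rightarrow> 'a" where
  "TA X f \<equiv> Tar X W1 f"

definition tan_p :: "('o, 'a, 'x) acteg_scheme \<Rightarrow> 'o \<Rightarrow> 'a" where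
  "tan_p X x = inv_arrow X (unitA X x) \<cdot>\<^bsub>X\<^esub> Tnt X w_p x"

definition tan_zero :: "('o, 'a, 'x) acteg_scheme \<Rightarrow> 'o \<Rightarrow> 'a" where
  "tan_zero X x = Tnt X w_zero x \<cdot>\<^bsub>X\<^esub> unitA X x"

definition tan_plus :: "('o, 'a, 'x) acteg_scheme \<Rightarrow> 'o \<Rightarrow> 'a" where
  "tan_plus X x = Tnt X w_plus x"

definition tan_l :: "('o, 'a, 'x) acteg_scheme \<Rightarrow> 'o \<Rightarrow> 'a" where
  "tan_l X x = inv_arrow X (multA X W1 W1 x) \<cdot>\<^bsub>X\<^esub> Tnt X w_l x"


section \<open>Additive and differential bundles\<close>

text \<open>
  Additive bundles come with chosen pullback powers \<open>X\<^sub>n\<close>: \<open>bpow n : X\<^sub>n \<rightarrow> A\<close> is the structure map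
  and \<open>bprj n i : X\<^sub>n \<rightarrow> X\<close> (\<open>i < n\<close>) are the projections, normalised so that \<open>X\<^sub>0 = A\<close> and
  \<open>X\<^sub>1 = X\<close>.
\<close>

record ('o, 'a) abun =
  btot :: 'o
  bbase :: 'o
  bproj :: 'a
  bpow :: "nat \<Rightarrow> 'a"
  bprj :: "nat \<Rightarrow> nat \<Rightarrow> 'a"
  bplus :: 'a
  bzero :: 'a

definition bpowO :: "('o, 'a, 'x) cat_scheme \<Rightarrow> ('o, 'a, 'y) abun_scheme \<Rightarrow> nat \<Rightarrow> 'o" where
  "bpowO C b n = Dom C (bpow b n)"

definition bpair ::
  "('o, 'a, 'x) cat_scheme \<Rightarrow> ('o, 'a, 'y) abun_scheme \<Rightarrow> 'a \<Rightarrow> 'a \<Rightarrow> 'a" where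
  "bpair C b f g = fibre_tuple C 2 (bpow b 2) (bprj b 2)
     (bproj b \<cdot>\<^bsub>C\<^esub> f) (\<lambda>i. if i = 0 then f else g)"

definition additive_bundle ::
  "('o, 'a, 'x) cat_scheme \<Rightarrow> ('o, 'a, 'y) abun_scheme \<Rightarrow> bool" where
  "additive_bundle C b \<longleftrightarrow>
     bproj b \<in> Hom C (btot b) (bbase b) \<and>
     (\<forall>n. fibre_power C (bproj b) n (bpow b n) (bprj b n)) \<and>
     bpow b 0 = Idn C (bbase b) \<and> bpow b 1 = bproj b \<and> bprj b 1 0 = Idn C (btot b) \<and>
     bplus b \<in> Hom C (bpowO C b 2) (btot b) \<and> bzero b \<in> Hom C (bbase b) (btot b) \<and>
     bproj b \<cdot>\<^bsub>C\<^esub> bplus b = bproj b \<cdot>\<^bsub>C\<^esub> bprj b 2 0 \<and>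
     bproj b \<cdot>\<^bsub>C\<^esub> bplus b = bproj b \<cdot>\<^bsub>C\<^esub> bprj b 2 1 \<and>
     bproj b \<cdot>\<^bsub>C\<^esub> bzero b = Idn C (bbase b) \<and>
     bplus b \<cdot>\<^bsub>C\<^esub> bpair C b (bplus b \<cdot>\<^bsub>C\<^esub> bpair C b (bprj b 3 0) (bprj b 3 1)) (bprj b 3 2) =
     bplus b \<cdot>\<^bsub>C\<^esub> bpair C b (bprj b 3 0) (bplus b \<cdot>\<^bsub>C\<^esub> bpair C b (bprj b 3 1) (bprj b 3 2)) \<and>
     bplus b \<cdot>\<^bsub>C\<^esub> bpair C b (bprj b 2 1) (bprj b 2 0) = bplus b \<and>
     bplus b \<cdot>\<^bsub>C\<^esub> bpair C b (Idn C (btot b)) (bzero b \<cdot>\<^bsub>C\<^esub> bproj b) = Idn C (btot b)"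

definition additive_bundle_mor ::
  "('o, 'a, 'x) cat_scheme \<Rightarrow> ('o, 'a, 'y) abun_scheme \<Rightarrow> ('o, 'a, 'z) abun_scheme \<Rightarrow>
   'a \<Rightarrow> 'a \<Rightarrow> bool" where
  "additive_bundle_mor C b b' f g \<longleftrightarrow>
     f \<in> Hom C (btot b) (btot b') \<and> g \<in> Hom C (bbase b) (bbase b') \<and>
     bproj b' \<cdot>\<^bsub>C\<^esub> f = g \<cdot>\<^bsub>C\<^esub> bproj b \<and>
     f \<cdot>\<^bsub>C\<^esub> bplus b = bplus b' \<cdot>\<^bsub>C\<^esub> bpair C b' (f \<cdot>\<^bsub>C\<^esub> bprj b 2 0) (f \<cdot>\<^bsub>C\<^esub> bprj b 2 1) \<and>
     f \<cdot>\<^bsub>C\<^esub> bzero b = bzero b' \<cdot>\<^bsub>C\<^esub> g"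

definition Tbundle :: "('o, 'a, 'x) acteg_scheme \<Rightarrow> ('o, 'a, 'y) abun_scheme \<Rightarrow> ('o, 'a) abun" where
  "Tbundle X b = \<lparr>btot = TO X (btot b), bbase = TO X (bbase b), bproj = TA X (bproj b),
     bpow = (\<lambda>n. TA X (bpow b n)), bprj = (\<lambda>n i. TA X (bprj b n i)),
     bplus = TA X (bplus b), bzero = TA X (bzero b)\<rparr>"

definition tangent_bundle :: "('o, 'a, 'x) acteg_scheme \<Rightarrow> 'o \<Rightarrow> ('o, 'a) abun" where
  \<comment> \<open>the pullback powers of \<open>p\<^sub>x\<close> are \<open>T\<^sub>n x = T\<^bsub>W^n\<^esub> x\<close>, except that the \<open>0\<close>-th one is \<open>x\<close> itself
     and not the isomorphic object \<open>T\<^sub>\<nat> x\<close>\<close>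
  "tangent_bundle X x = \<lparr>btot = TO X x, bbase = x, bproj = tan_p X x,
     bpow = (\<lambda>n. if n = 0 then Idn X x
                 else inv_arrow X (unitA X x) \<cdot>\<^bsub>X\<^esub> Tnt X (waug (Wpow n)) x),
     bprj = (\<lambda>n i. Tnt X (Wproj n i) x),
     bplus = tan_plus X x, bzero = tan_zero X x\<rparr>"

record ('o, 'a) dbun = "('o, 'a) abun" +
  blift :: 'a

text \<open>
  \<open>T\<^sup>k\<close>-stability is required both of the pullback powers and of the pullback square expressing the
  universality of the lift; for \<open>k = 0\<close> the last clause is that square itself. In the absence of
  negatives the stability of the square does not follow from the remaining conditions.
\<close>

definition differential_bundle ::
  "('o, 'a, 'x) acteg_scheme \<Rightarrow> ('o, 'a, 'y) dbun_scheme \<Rightarrow> bool" where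
  "differential_bundle X b \<longleftrightarrow>
     additive_bundle X b \<and>
     (\<forall>k n. fibre_power X ((TA X ^^ k) (bproj b)) n ((TA X ^^ k) (bpow b n))
        (\<lambda>i. (TA X ^^ k) (bprj b n i))) \<and>
     additive_bundle_mor X b (Tbundle X b) (blift b) (tan_zero X (bbase b)) \<and>
     additive_bundle_mor X b (tangent_bundle X (btot b)) (blift b) (bzero b) \<and>
     tan_l X (btot b) \<cdot>\<^bsub>X\<^esub> blift b = TA X (blift b) \<cdot>\<^bsub>X\<^esub> blift b \<and>
     (\<forall>k. is_pullback X
        ((TA X ^^ k) (TA X (bplus b) \<cdot>\<^bsub>X\<^esub>
           bpair X (Tbundle X b) (blift b \<cdot>\<^bsub>X\<^esub> bprj b 2 0) (tan_zero X (btot b) \<cdot>\<^bsub>X\<^esub> bprj b 2 1)))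
        ((TA X ^^ k) (bproj b \<cdot>\<^bsub>X\<^esub> bprj b 2 0))
        ((TA X ^^ k) (TA X (bproj b)))
        ((TA X ^^ k) (tan_zero X (bbase b))))"


section \<open>Oplax linear functors and differential functors\<close>

definition oplax_linear_functor ::
  "('o, 'a, 'x) acteg_scheme \<Rightarrow> ('p, 'b, 'y) acteg_scheme \<Rightarrow> ('o \<Rightarrow> 'p) \<Rightarrow> ('a \<Rightarrow> 'b) \<Rightarrow>
   (wob \<Rightarrow> 'o \<Rightarrow> 'b) \<Rightarrow> bool" where
  "oplax_linear_functor X Y Fo Fa \<alpha> \<longleftrightarrow>
     is_functor X Y Fo Fa \<and>
     (\<forall>A \<in> Ob weil. \<forall>x \<in> Ob X. \<alpha> A x \<in> Hom Y (Fo (Tob X A x)) (Tob Y A (Fo x))) \<and>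
     (\<forall>A B x y. \<forall>\<theta> \<in> Hom weil A B. \<forall>f \<in> Hom X x y.
        \<alpha> B y \<cdot>\<^bsub>Y\<^esub> Fa (actA X \<theta> f) = actA Y \<theta> (Fa f) \<cdot>\<^bsub>Y\<^esub> \<alpha> A x) \<and>
     (\<forall>A \<in> Ob weil. \<forall>B \<in> Ob weil. \<forall>x \<in> Ob X.
        \<alpha> (wten A B) x \<cdot>\<^bsub>Y\<^esub> Fa (multA X A B x) =
        multA Y A B (Fo x) \<cdot>\<^bsub>Y\<^esub> Tar Y A (\<alpha> B x) \<cdot>\<^bsub>Y\<^esub> \<alpha> A (Tob X B x)) \<and>
     (\<forall>x \<in> Ob X. \<alpha> wunit x \<cdot>\<^bsub>Y\<^esub> Fa (unitA X x) = unitA Y (Fo x))"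

definition differential_functor ::
  "('o, 'a, 'x) acteg_scheme \<Rightarrow> ('p, 'b, 'y) acteg_scheme \<Rightarrow> ('o \<Rightarrow> 'p) \<Rightarrow> ('a \<Rightarrow> 'b) \<Rightarrow>
   (wob \<Rightarrow> 'o \<Rightarrow> 'b) \<Rightarrow> bool" where
  "differential_functor X Y Fo Fa \<alpha> \<longleftrightarrow>
     oplax_linear_functor X Y Fo Fa \<alpha> \<and>
     (\<exists>s. is_terminal X s) \<and>
     (\<forall>A \<in> Ob weil. \<forall>t l r b. is_pullback X t l r b \<and> is_terminal X (Cod X r) \<longrightarrow>
        is_pullback Y (Tar Y A (Fa t)) (Tar Y A (Fa l)) (Tar Y A (Fa r)) (Tar Y A (Fa b))) \<and>
     (\<forall>A \<in> Ob weil. \<forall>x y. \<forall>f \<in> Hom X x y.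
        is_pullback Y (\<alpha> A x) (Fa (Tar X A f)) (Tar Y A (Fa f)) (\<alpha> A y))"


section \<open>The tangent actegory \<open>\<nat>\<^sup>\<bullet>\<close>\<close>

text \<open>
  The underlying additive monoid of \<open>A\<close> is free on the monomials whose class is not zero, and
  the coefficients of these monomials do not depend on the representative of a class.
  The basis is listed in the lexicographic order of exponent vectors, so \<open>1\<close> comes first and
  \<open>\<nat>\<^sup>k\<close>-valued tuples indexed by \<open>wbasis A\<close> identify \<open>A \<otimes> \<nat>\<^sup>k\<close> with \<open>\<nat>\<^bsup>wdim A * k\<^esup>\<close>:
  coordinate \<open>i * k + j\<close> is the \<open>j\<close>-th coordinate of the \<open>i\<close>-th tuple entry. In particular
  \<open>D\<^sub>W (\<nat>\<^sup>k) = \<nat>\<^sup>k \<times> \<nat>\<^sup>k\<close> with \<open>p = \<pi>\<^sub>0\<close>.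
\<close>

definition wbasis :: "wob \<Rightarrow> monomial list" where
  "wbasis A = sorted_list_of_set
     {m. Poly_Mapping.keys m \<subseteq> {..<fst A} \<and> (pmon m, 0) \<notin> wcong A}"

definition wdim :: "wob \<Rightarrow> nat" where
  "wdim A = length (wbasis A)"

definition wpos :: "wob \<Rightarrow> monomial \<Rightarrow> nat" where
  "wpos A m = (THE i. i < wdim A \<and> wbasis A ! i = m)"

definition wcoeff :: "npoly set \<Rightarrow> monomial \<Rightarrow> nat" where
  "wcoeff a m = Poly_Mapping.lookup (wrep a) m"

definition mshift :: "nat \<Rightarrow> monomial \<Rightarrow> monomial" where
  "mshift n m = (\<Sum>i \<in> Poly_Mapping.keys m. Poly_Mapping.single (n + i) (Poly_Mapping.lookup m i))"

definition nat_actA :: "war \<Rightarrow> nat mat \<Rightarrow> nat mat" where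
  \<comment> \<open>the Kronecker product of the matrix of \<open>\<theta>\<close> with \<open>M\<close>\<close>
  "nat_actA = (\<lambda>(A, B, h) M. mat (wdim B * dim_row M) (wdim A * dim_col M)
     (\<lambda>(i, j). wcoeff (h (wcls A (pmon (wbasis A ! (j div dim_col M))))) (wbasis B ! (i div dim_row M))
        * M $$ (i mod dim_row M, j mod dim_col M)))"

definition nat_mult :: "wob \<Rightarrow> wob \<Rightarrow> nat \<Rightarrow> nat mat" where
  \<comment> \<open>identifies the basis element \<open>a \<otimes> (b \<otimes> e)\<close> with \<open>ab \<otimes> e\<close>\<close>
  "nat_mult A B k = mat (wdim (wten A B) * k) (wdim A * (wdim B * k))
     (\<lambda>(i, j). if wbasis (wten A B) ! (i div k) =
            wbasis A ! (j div (wdim B * k)) + mshift (fst A) (wbasis B ! (j mod (wdim B * k) div k))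
          \<and> i mod k = j mod k then 1 else 0)"

definition Nbul :: "(nat, nat mat) acteg" where
  "Nbul = \<lparr>Ob = UNIV, Ar = UNIV, Dom = dim_col, Cod = dim_row, Idn = (\<lambda>k. 1\<^sub>m k), Cmp = (*),
     actO = (\<lambda>A k. wdim A * k), actA = nat_actA,
     unitA = (\<lambda>k. 1\<^sub>m k), multA = nat_mult\<rparr>"


section \<open>The functor induced by a differential bundle\<close>

text \<open>Addition and zero in the commutative monoid of maps \<open>E\<^sub>m \<rightarrow> E\<close> over \<open>M\<close>.\<close>

definition fib_add :: "('o, 'a, 'x) cat_scheme \<Rightarrow> ('o, 'a, 'y) abun_scheme \<Rightarrow> 'a \<Rightarrow> 'a \<Rightarrow> 'a" where
  "fib_add C b f g = bplus b \<cdot>\<^bsub>C\<^esub> bpair C b f g"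

definition fib_zero :: "('o, 'a, 'x) cat_scheme \<Rightarrow> ('o, 'a, 'y) abun_scheme \<Rightarrow> nat \<Rightarrow> 'a" where
  "fib_zero C b m = bzero b \<cdot>\<^bsub>C\<^esub> bpow b m"

definition fib_mul ::
  "('o, 'a, 'x) cat_scheme \<Rightarrow> ('o, 'a, 'y) abun_scheme \<Rightarrow> nat \<Rightarrow> nat \<Rightarrow> 'a \<Rightarrow> 'a" where
  "fib_mul C b m c f = (fib_add C b f ^^ c) (fib_zero C b m)"

definition ind_ob :: "('o, 'a, 'x) cat_scheme \<Rightarrow> ('o, 'a, 'y) abun_scheme \<Rightarrow> nat \<Rightarrow> 'o" where
  "ind_ob C b k = bpowO C b k"

definition ind_ar :: "('o, 'a, 'x) cat_scheme \<Rightarrow> ('o, 'a, 'y) abun_scheme \<Rightarrow> nat mat \<Rightarrow> 'a" where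
  "ind_ar C b a = (let m = dim_col a; n = dim_row a in
     fibre_tuple C n (bpow b n) (bprj b n) (bpow b m)
       (\<lambda>i. foldr (fib_add C b) (map (\<lambda>j. fib_mul C b m (a $$ (i, j)) (bprj b m j)) [0..<m])
              (fib_zero C b m)))"

text \<open>
  The components \<open>\<alpha>\<^bsub>W,\<nat>\<^sup>1\<^esub>\<close>, \<open>\<alpha>\<^bsub>W^k,\<nat>\<^sup>0\<^esub>\<close>, \<open>\<alpha>\<^bsub>W^k,\<nat>\<^sup>1\<^esub>\<close> and \<open>\<alpha>\<^bsub>W^k,\<nat>\<^sup>l\<^esub>\<close>. The domain of
  \<open>\<alpha>\<^bsub>W^k,\<nat>\<^sup>1\<^esub>\<close> is \<open>E\<^bsub>k+1\<^esub>\<close>, whose projections are indexed by the positions of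
  \<open>1, x\<^sub>0, \<dots>, x\<^bsub>k-1\<^esub>\<close> in the basis of \<open>W^k\<close>.
\<close>

definition alpha_W :: "('o, 'a, 'x) acteg_scheme \<Rightarrow> ('o, 'a, 'y) dbun_scheme \<Rightarrow> 'a" where
  "alpha_W X b = TA X (bplus b) \<cdot>\<^bsub>X\<^esub>
     bpair X (Tbundle X b) (tan_zero X (btot b) \<cdot>\<^bsub>X\<^esub> bprj b 2 0) (blift b \<cdot>\<^bsub>X\<^esub> bprj b 2 1)"

definition alpha_Wk_0 :: "('o, 'a, 'x) acteg_scheme \<Rightarrow> ('o, 'a, 'y) dbun_scheme \<Rightarrow> nat \<Rightarrow> 'a" where
  "alpha_Wk_0 X b k = Tnt X (wini (Wpow k)) (bbase b) \<cdot>\<^bsub>X\<^esub> unitA X (bbase b)"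

definition alpha_Wk_1 :: "('o, 'a, 'x) acteg_scheme \<Rightarrow> ('o, 'a, 'y) dbun_scheme \<Rightarrow> nat \<Rightarrow> 'a" where
  "alpha_Wk_1 X b k = (let \<rho> = (\<lambda>m. bprj b (k + 1) (wpos (Wpow k) m)) in
     THE h. h \<in> Hom X (bpowO X b (k + 1)) (Tob X (Wpow k) (btot b)) \<and>
       inv_arrow X (unitA X (btot b)) \<cdot>\<^bsub>X\<^esub> Tnt X (waug (Wpow k)) (btot b) \<cdot>\<^bsub>X\<^esub> h = \<rho> 0 \<and>
       (\<forall>i < k. Tnt X (Wproj k i) (btot b) \<cdot>\<^bsub>X\<^esub> h =
          alpha_W X b \<cdot>\<^bsub>X\<^esub> bpair X b (\<rho> 0) (\<rho> (mvar i))))"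

definition nat_prj :: "nat \<Rightarrow> nat \<Rightarrow> nat mat" where
  "nat_prj l j = mat 1 l (\<lambda>(_, c). if c = j then 1 else 0)"

definition alpha_Wk ::
  "('o, 'a, 'x) acteg_scheme \<Rightarrow> ('o, 'a, 'y) dbun_scheme \<Rightarrow> nat \<Rightarrow> nat \<Rightarrow> 'a" where
  "alpha_Wk X b k l =
     (THE h. h \<in> Hom X (ind_ob X b (Tob Nbul (Wpow k) l)) (Tob X (Wpow k) (ind_ob X b l)) \<and>
       Tar X (Wpow k) (bpow b l) \<cdot>\<^bsub>X\<^esub> h =
         alpha_Wk_0 X b k \<cdot>\<^bsub>X\<^esub> bpow b (Tob Nbul (Wpow k) l) \<and>
       (\<forall>j < l. Tar X (Wpow k) (bprj b l j) \<cdot>\<^bsub>X\<^esub> h =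
          alpha_Wk_1 X b k \<cdot>\<^bsub>X\<^esub> ind_ar X b (Tar Nbul (Wpow k) (nat_prj l j))))"

text \<open>
  \<open>alpha_word X b [k\<^sub>1, \<dots>, k\<^sub>r] l\<close> is the component at \<open>W^k\<^sub>1 \<otimes> \<dots> \<otimes> W^k\<^sub>r\<close>, obtained by iterating
  \<open>\<alpha>\<^bsub>A \<otimes> B\<^esub> = T\<^sub>A(\<alpha>\<^sub>B) \<circ> \<alpha>\<^sub>A\<close> (with the structure isomorphisms inserted).
\<close>

fun Wword :: "nat list \<Rightarrow> wob" where
  "Wword [] = wunit"
| "Wword (k # ks) = wten (Wpow k) (Wword ks)"

fun alpha_word ::
  "('o, 'a, 'x) acteg_scheme \<Rightarrow> ('o, 'a, 'y) dbun_scheme \<Rightarrow> nat list \<Rightarrow> nat \<Rightarrow> 'a" where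
  "alpha_word X b [] l = unitA X (ind_ob X b l)"
| "alpha_word X b (k # ks) l =
     multA X (Wpow k) (Wword ks) (ind_ob X b l) \<cdot>\<^bsub>X\<^esub>
     Tar X (Wpow k) (alpha_word X b ks l) \<cdot>\<^bsub>X\<^esub>
     alpha_Wk X b k (Tob Nbul (Wword ks) l) \<cdot>\<^bsub>X\<^esub>
     ind_ar X b (inv_arrow Nbul (multA Nbul (Wpow k) (Wword ks) l))"

text \<open>
  An object \<open>(n, r)\<close> whose classes are not consecutive blocks equals some
  \<open>W^k\<^sub>1 \<otimes> \<dots> \<otimes> W^k\<^sub>r\<close> only up to a relabelling of the generators, and \<open>\<alpha>\<close> is transported along
  such an isomorphism. By naturality the result does not depend on its choice; for
  \<open>A = Wword ks\<close> the identity is taken.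
\<close>

definition wdecomp :: "wob \<Rightarrow> nat list \<times> war" where
  "wdecomp A = (SOME (ks, \<phi>). \<phi> \<in> Hom weil A (Wword ks) \<and> is_iso weil \<phi> \<and>
     (A \<in> range Wword \<longrightarrow> \<phi> = Idn weil A))"

definition ind_alpha ::
  "('o, 'a, 'x) acteg_scheme \<Rightarrow> ('o, 'a, 'y) dbun_scheme \<Rightarrow> wob \<Rightarrow> nat \<Rightarrow> 'a" where
  "ind_alpha X b A l = (case wdecomp A of (ks, \<phi>) \<Rightarrow>
     Tnt X (inv_arrow weil \<phi>) (ind_ob X b l) \<cdot>\<^bsub>X\<^esub> alpha_word X b ks l \<cdot>\<^bsub>X\<^esub>
     ind_ar X b (Tnt Nbul \<phi> l))"

end

theory Submission
  imports Defs "HOL-Algebra.FiniteProduct"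
begin

text \<open>
  The proof computes with generalised elements. The lifts to \<open>E\<close> of an arrow \<open>v : z \<rightarrow> M\<close> form a
  commutative monoid, an arrow \<open>z \<rightarrow> E\<^sub>n\<close> over \<open>v\<close> is an \<open>n\<close>-tuple of lifts, and \<open>F\<^sub>E\<close> applied to a
  matrix multiplies such tuples by the matrix (\<open>ind_ar_tup\<close>). A monomial \<open>m\<close> that is nonzero in \<open>A\<close>
  gives a map \<open>lam A m : E \<rightarrow> T\<^sub>A E\<close>: the zero section for \<open>m = 1\<close>, and otherwise the lift \<open>\<lambda>\<close> followed
  by \<open>T\<^sub>\<theta>\<close> for the morphism \<open>\<theta> : W \<rightarrow> A\<close> with \<open>\<theta> x = m\<close>, which exists because \<open>m m = 0\<close>. On elements, the
  component of the natural transformation at \<open>A\<close> is the sum \<open>\<Sum>\<^sub>m lam A m \<cdot> e\<^sub>m\<close> over the monomial basis (\<open>beta\<close>).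

  Naturality in \<open>A\<close> thus amounts to \<open>T\<^sub>\<theta> lam A m = \<Sum> \<theta>\<^bsub>m' m\<^esub> lam A' m'\<close>, where \<open>\<theta>\<^bsub>m' m\<^esub>\<close> are the
  coefficients of \<open>\<theta> m\<close> (\<open>lam_natural\<close>). This is proved for all morphisms at once: nothing cancels over
  the naturals, so the monomials of \<open>\<theta> m\<close> have products zero, \<open>x \<mapsto> \<theta> m\<close> factors through some \<open>W^n\<close>,
  and in \<open>T\<^sub>n E\<close> the claim can be checked componentwise. There it says that \<open>T\<close> of \<open>x \<mapsto> c x\<close> carries
  \<open>\<lambda>\<close> to its \<open>c\<close>-fold sum, which holds because \<open>\<lambda>\<close> is additive for both additions of \<open>T E\<close>
  (\<open>plft_scale\<close>). Compatibility with \<open>\<otimes>\<close> is \<open>T\<^sub>A (lam A' m') \<cdot> lam A m = lam (A \<otimes> A') (m m')\<close>, a form of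
  \<open>\<ell> \<lambda> = T(\<lambda>) \<lambda>\<close> (\<open>lam_mult\<close>).

  The naturality squares are pullbacks because an element of \<open>T\<^sub>A E\<close> over a zero vector of \<open>M\<close> is
  \<open>\<Sum>\<^sub>m lam A m \<cdot> e\<^sub>m\<close> for unique lifts \<open>e\<^sub>m\<close> (\<open>betabij\<close>). For \<open>A = W\<close> this is the universality of the lift,
  for \<open>W^n\<close> it follows by fibre powers, and a tensor product is treated one factor at a time. The last
  step needs the statement inside \<open>T\<^sub>A\<close>, so everything is proved after applying any functor isomorphic
  to some \<open>T\<^sub>C\<close> (\<open>actlike\<close>). The hypotheses give stability under the powers of \<open>T\<close> only; it extends to all
  \<open>T\<^sub>C\<close> since \<open>T\<^sub>B T\<^bsub>W^n\<^esub>\<close> is a fibre power of \<open>T\<^sub>B T\<^sub>W\<close> and limits commute (\<open>wide_pb_stable\<close>).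

  A pullback over the terminal object of the category of matrices is a biproduct, and a functor given
  by matrices preserves the equations that express this (\<open>pullback_Nbul\<close>, \<open>is_pullback_ind_ar\<close>).
  Finally, the sums over monomials have the properties by which the components of the statement
  are defined, hence agree with them (\<open>alpha_Wk_1\<close>, \<open>alpha_Wk\<close>, \<open>alpha_word\<close>, \<open>ind_alpha\<close>).
\<close>

section \<open>Linear combinations in commutative monoids\<close>

definition lincomb :: "('g, 'm) monoid_scheme \<Rightarrow> 'i set \<Rightarrow> ('i \<Rightarrow> nat) \<Rightarrow> ('i \<Rightarrow> 'g) \<Rightarrow> 'g" where
  "lincomb G J c e = finprod G (\<lambda>j. e j [^]\<^bsub>G\<^esub> c j) J"

definition monoid_map :: "('g, 'm) monoid_scheme \<Rightarrow> ('h, 'n) monoid_scheme \<Rightarrow> ('g \<Rightarrow> 'h) \<Rightarrow> bool" where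
  "monoid_map G H \<phi> \<longleftrightarrow> (\<forall>x\<in>carrier G. \<phi> x \<in> carrier H) \<and> \<phi> \<one>\<^bsub>G\<^esub> = \<one>\<^bsub>H\<^esub> \<and>
     (\<forall>x\<in>carrier G. \<forall>y\<in>carrier G. \<phi> (x \<otimes>\<^bsub>G\<^esub> y) = \<phi> x \<otimes>\<^bsub>H\<^esub> \<phi> y)"

lemma monoid_map_finprod:
  assumes G: "comm_monoid G" and H: "comm_monoid H" and \<phi>: "monoid_map G H \<phi>"
    and f: "\<And>i. i \<in> I \<Longrightarrow> f i \<in> carrier G"
  shows "\<phi> (finprod G f I) = finprod H (\<lambda>i. \<phi> (f i)) I"
proof -
  interpret G: comm_monoid G by (rule G)
  interpret H: comm_monoid H by (rule H)
  show ?thesis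
  proof (cases "finite I")
    case True
    then show ?thesis using f
    proof (induction I)
      case (insert a F)
      have "finprod G f F \<in> carrier G" using insert by (intro G.finprod_closed) auto
      then show ?case using insert \<phi> by (simp add: monoid_map_def Pi_iff)
    qed (use \<phi> in \<open>simp add: monoid_map_def\<close>)
  qed (use \<phi> in \<open>simp add: monoid_map_def\<close>)
qed

lemma monoid_map_comp:
  "monoid_map G H \<phi> \<Longrightarrow> monoid_map H K \<psi> \<Longrightarrow> monoid_map G K (\<lambda>x. \<psi> (\<phi> x))"
  by (simp add: monoid_map_def)

lemma monoid_map_cong:
  assumes "comm_monoid G" "monoid_map G H \<phi>" "\<And>x. x \<in> carrier G \<Longrightarrow> \<psi> x = \<phi> x"
  shows "monoid_map G H \<psi>"
proof -
  interpret G: comm_monoid G by fact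
  show ?thesis using assms(2,3) by (simp add: monoid_map_def)
qed

lemma monoid_map_pow:
  assumes G: "comm_monoid G" and \<phi>: "monoid_map G H \<phi>" and x: "x \<in> carrier G"
  shows "\<phi> (x [^]\<^bsub>G\<^esub> (n::nat)) = \<phi> x [^]\<^bsub>H\<^esub> n"
proof -
  interpret G: comm_monoid G by (rule G)
  show ?thesis using \<phi> x by (induction n) (simp_all add: monoid_map_def)
qed

lemma monoid_map_lincomb:
  assumes "comm_monoid G" "comm_monoid H" "monoid_map G H \<phi>"
    and e: "\<And>j. j \<in> J \<Longrightarrow> e j \<in> carrier G"
  shows "\<phi> (lincomb G J c e) = lincomb H J c (\<lambda>j. \<phi> (e j))"
proof -
  interpret G: comm_monoid G by fact
  interpret H: comm_monoid H by fact
  have "\<phi> (lincomb G J c e) = finprod H (\<lambda>j. \<phi> (e j [^]\<^bsub>G\<^esub> c j)) J"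
    unfolding lincomb_def using assms by (intro monoid_map_finprod) auto
  also have "\<dots> = finprod H (\<lambda>j. \<phi> (e j) [^]\<^bsub>H\<^esub> c j) J"
    using assms by (intro H.finprod_cong') (auto simp: monoid_map_pow monoid_map_def)
  finally show ?thesis by (simp add: lincomb_def)
qed

context comm_monoid begin

lemma lincomb_closed [simp, intro]:
  assumes "\<And>j. j \<in> J \<Longrightarrow> e j \<in> carrier G"
  shows "lincomb G J c e \<in> carrier G"
  unfolding lincomb_def using assms by (intro finprod_closed) auto

lemma lincomb_cong:
  assumes "\<And>j. j \<in> J \<Longrightarrow> e j \<in> carrier G" "\<And>j. j \<in> J \<Longrightarrow> e j = e' j" "\<And>j. j \<in> J \<Longrightarrow> c j = c' j"
  shows "lincomb G J c e = lincomb G J c' e'"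
  unfolding lincomb_def using assms by (intro finprod_cong') auto

lemma finprod_pow:
  assumes "\<And>i. i \<in> I \<Longrightarrow> f i \<in> carrier G"
  shows "finprod G f I [^] (n::nat) = finprod G (\<lambda>i. f i [^] n) I"
proof -
  have "monoid_map G G (\<lambda>x. x [^] n)" by (auto simp: monoid_map_def nat_pow_distrib)
  then show ?thesis
    using monoid_map_finprod[OF comm_monoid_axioms comm_monoid_axioms, of "\<lambda>x. x [^] n" I f] assms by simp
qed

lemma finprod_pow_sum:
  assumes "finite I" "x \<in> carrier G"
  shows "finprod G (\<lambda>i. x [^] (c i :: nat)) I = x [^] (\<Sum>i\<in>I. c i)"
  using assms by (induction I) (auto simp: Pi_iff nat_pow_mult)

lemma finprod_swap:
  assumes "finite I" "finite J" "\<And>i j. i \<in> I \<Longrightarrow> j \<in> J \<Longrightarrow> f i j \<in> carrier G"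
  shows "finprod G (\<lambda>i. finprod G (f i) J) I = finprod G (\<lambda>j. finprod G (\<lambda>i. f i j) I) J"
  using assms(1,3)
proof (induction I)
  case (insert a I)
  have "finprod G (\<lambda>i. finprod G (f i) J) (insert a I) =
     finprod G (f a) J \<otimes> finprod G (\<lambda>i. finprod G (f i) J) I"
    using insert by (intro finprod_insert) (auto simp: Pi_iff intro!: finprod_closed)
  also have "\<dots> = finprod G (f a) J \<otimes> finprod G (\<lambda>j. finprod G (\<lambda>i. f i j) I) J"
    using insert by auto
  also have "\<dots> = finprod G (\<lambda>j. f a j \<otimes> finprod G (\<lambda>i. f i j) I) J"
    using insert by (intro finprod_multf[symmetric]) (auto simp: Pi_iff intro!: finprod_closed)
  also have "\<dots> = finprod G (\<lambda>j. finprod G (\<lambda>i. f i j) (insert a I)) J"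
    using insert by (intro finprod_cong') (auto simp: Pi_iff intro!: finprod_closed finprod_insert[symmetric])
  finally show ?case .
qed auto

lemma lincomb_lincomb:
  assumes "finite I" "finite J" "\<And>j. j \<in> J \<Longrightarrow> e j \<in> carrier G"
  shows "lincomb G I b (\<lambda>i. lincomb G J (a i) e) = lincomb G J (\<lambda>j. \<Sum>i\<in>I. b i * a i j) e"
proof -
  have "lincomb G I b (\<lambda>i. lincomb G J (a i) e) =
    finprod G (\<lambda>i. finprod G (\<lambda>j. e j [^] (b i * a i j)) J) I"
    unfolding lincomb_def using assms
    by (intro finprod_cong')
      (auto simp: finprod_pow nat_pow_pow mult.commute Pi_iff intro!: finprod_cong' finprod_closed nat_pow_closed)
  also have "\<dots> = finprod G (\<lambda>j. finprod G (\<lambda>i. e j [^] (b i * a i j)) I) J"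
    using assms by (intro finprod_swap) auto
  also have "\<dots> = lincomb G J (\<lambda>j. \<Sum>i\<in>I. b i * a i j) e"
    unfolding lincomb_def using assms by (intro finprod_cong') (auto simp: finprod_pow_sum)
  finally show ?thesis .
qed

lemma lincomb_delta:
  assumes "finite J" "k \<in> J" "e k \<in> carrier G" "\<And>j. j \<in> J \<Longrightarrow> j \<noteq> k \<Longrightarrow> e j \<in> carrier G"
    and "\<And>j. j \<in> J \<Longrightarrow> c j = (if j = k then 1 else 0)"
  shows "lincomb G J c e = e k"
proof -
  have "lincomb G J c e = finprod G (\<lambda>j. if k = j then e j else \<one>) J"
    unfolding lincomb_def using assms by (intro finprod_cong') auto
  also have "\<dots> = e k" using assms by (intro finprod_singleton) auto
  finally show ?thesis .
qed

text \<open>Division with remainder by \<open>b\<close> makes an index below \<open>a * b\<close> a pair of indices.\<close>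

lemma finprod_lessThan_mult:
  assumes "\<And>i. i < a * b \<Longrightarrow> f i \<in> carrier G"
  shows "finprod G f {..<a * b} = finprod G (\<lambda>p. finprod G (\<lambda>q. f (p * b + q)) {..<b}) {..<(a::nat)}"
  using assms
proof (induction a)
  case (Suc a)
  have *: "p * b + q < Suc a * b" if "p \<le> a" "q < b" for p q
  proof -
    have "p * b + q < p * b + b" using that by simp
    also have "\<dots> \<le> Suc a * b" using mult_le_mono1[OF that(1), of b] by simp
    finally show ?thesis .
  qed
  have s: "{..<Suc a * b} = {..<a * b} \<union> (\<lambda>q. a * b + q) ` {..<b}"
  proof (intro equalityI subsetI)
    fix x assume "x \<in> {..<Suc a * b}"
    then have "x < a * b \<or> (x = a * b + (x - a * b) \<and> x - a * b < b)" by auto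
    then show "x \<in> {..<a * b} \<union> (\<lambda>q. a * b + q) ` {..<b}" by blast
  qed auto
  have "finprod G f {..<Suc a * b} = finprod G f {..<a * b} \<otimes> finprod G f ((\<lambda>q. a * b + q) ` {..<b})"
    unfolding s using Suc.prems by (intro finprod_Un_disjoint) auto
  also have "finprod G f ((\<lambda>q. a * b + q) ` {..<b}) = finprod G (\<lambda>q. f (a * b + q)) {..<b}"
    using Suc.prems by (intro finprod_reindex) (auto simp: inj_on_def)
  also have "finprod G f {..<a * b} = finprod G (\<lambda>p. finprod G (\<lambda>q. f (p * b + q)) {..<b}) {..<a}"
    using Suc by auto
  finally show ?case
    using Suc.prems * by (simp add: lessThan_Suc Pi_iff finprod_closed m_comm)
qed auto

text \<open>Connects the iterated sums by which the functor on matrices is defined with finite products.\<close>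

lemma foldr_finprod:
  assumes "distinct xs" "\<And>x. x \<in> set xs \<Longrightarrow> f x \<in> carrier G"
  shows "foldr (mult G) (map f xs) \<one> = finprod G f (set xs)"
  using assms by (induction xs) (auto simp: Pi_iff)

end

section \<open>Categories\<close>

locale cat =
  fixes C :: "('o, 'a, 'x) cat_scheme" (structure)
  assumes category: "category C"
begin

abbreviation dom :: "'a \<Rightarrow> 'o" where "dom \<equiv> Dom C"
abbreviation arr :: "'a \<Rightarrow> bool" where "arr f \<equiv> f \<in> Ar C"
abbreviation cod :: "'a \<Rightarrow> 'o" where "cod \<equiv> Cod C"

lemma Hom_iff: "f \<in> Hom C x y \<longleftrightarrow> arr f \<and> dom f = x \<and> cod f = y"
  by (simp add: Hom_def)

lemma Dom_Ob [simp]: "arr f \<Longrightarrow> dom f \<in> Ob C"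
  and Cod_Ob [simp]: "arr f \<Longrightarrow> cod f \<in> Ob C"
  using category by (auto simp: category_def)

lemma Idn_Ar [simp]: "x \<in> Ob C \<Longrightarrow> Idn C x \<in> Ar C"
  and Dom_Idn [simp]: "x \<in> Ob C \<Longrightarrow> dom (Idn C x) = x"
  and Cod_Idn [simp]: "x \<in> Ob C \<Longrightarrow> cod (Idn C x) = x"
  using category by (auto simp: category_def Hom_def)

lemma comp_Hom: "f \<in> Hom C x y \<Longrightarrow> g \<in> Hom C y z \<Longrightarrow> g \<cdot> f \<in> Hom C x z"
  using category by (auto simp: category_def)

lemma comp_Ar [simp]: "arr f \<Longrightarrow> arr g \<Longrightarrow> cod f = dom g \<Longrightarrow> g \<cdot> f \<in> Ar C"
  and Dom_comp [simp]: "arr f \<Longrightarrow> arr g \<Longrightarrow> cod f = dom g \<Longrightarrow> dom (g \<cdot> f) = dom f"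
  and Cod_comp [simp]: "arr f \<Longrightarrow> arr g \<Longrightarrow> cod f = dom g \<Longrightarrow> cod (g \<cdot> f) = cod g"
  using comp_Hom[of f _ _ g] by (auto simp: Hom_iff)

lemma comp_Idn [simp]: "arr f \<Longrightarrow> dom f = x \<Longrightarrow> f \<cdot> Idn C x = f"
  and Idn_comp [simp]: "arr f \<Longrightarrow> cod f = x \<Longrightarrow> Idn C x \<cdot> f = f"
  using category by (auto simp: category_def Hom_def)

lemma comp_assoc [simp]:
  "arr f \<Longrightarrow> arr g \<Longrightarrow> arr h \<Longrightarrow> cod f = dom g \<Longrightarrow> cod g = dom h \<Longrightarrow>
   h \<cdot> g \<cdot> f = h \<cdot> (g \<cdot> f)"
  using category unfolding category_def Hom_def by blast

text \<open>
  The simplifier brackets composites to the right, so that an equation \<open>g f = g' f'\<close> can be used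
  inside a longer composite only in this form.
\<close>

lemma comp_extend:
  assumes "g \<cdot> f = g' \<cdot> f'" "arr f" "arr g" "cod f = dom g"
    "arr f'" "arr g'" "cod f' = dom g'" "arr k" "cod k = dom f" "dom f' = dom f"
  shows "g \<cdot> (f \<cdot> k) = g' \<cdot> (f' \<cdot> k)"
  using assms comp_assoc[of k f g] comp_assoc[of k f' g'] by simp

lemma comp_extend1:
  assumes "g \<cdot> f = g'" "arr f" "arr g" "cod f = dom g" "arr k" "cod k = dom f"
  shows "g \<cdot> (f \<cdot> k) = g' \<cdot> k"
  using assms comp_assoc[of k f g] by simp

lemma inverse_arrows_unique: "inverse_arrows C f g \<Longrightarrow> inverse_arrows C f h \<Longrightarrow> g = h"
proof -
  assume "inverse_arrows C f g" "inverse_arrows C f h"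
  then have a: "arr f" "arr g" "arr h" "dom g = cod f" "cod g = dom f" "dom h = cod f"
    "cod h = dom f" "g \<cdot> f = Idn C (dom f)" "f \<cdot> h = Idn C (cod f)"
    by (auto simp: inverse_arrows_def Hom_iff)
  have "g = g \<cdot> (f \<cdot> h)" using a by simp
  also have "\<dots> = (g \<cdot> f) \<cdot> h" using a(1-7) by simp
  also have "\<dots> = h" unfolding a(8) using a(3,7) by simp
  finally show "g = h" .
qed

lemma inv_arrow_eq: "inverse_arrows C f g \<Longrightarrow> inv_arrow C f = g"
  unfolding inv_arrow_def using inverse_arrows_unique by blast

lemma is_iso_inverse: "is_iso C f \<Longrightarrow> inverse_arrows C f (inv_arrow C f)"
  using inv_arrow_eq by (auto simp: is_iso_def)

lemma is_iso_Ar: "is_iso C f \<Longrightarrow> arr f"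
  by (auto simp: is_iso_def inverse_arrows_def)

lemma inv_arrow_simps [simp]:
  assumes "is_iso C f"
  shows "inv_arrow C f \<in> Ar C" "dom (inv_arrow C f) = cod f" "cod (inv_arrow C f) = dom f"
    "inv_arrow C f \<cdot> f = Idn C (dom f)" "f \<cdot> inv_arrow C f = Idn C (cod f)"
  using is_iso_inverse[OF assms] by (auto simp: inverse_arrows_def Hom_iff)

lemma inv_arrow_cancel [simp]:
  assumes "is_iso C f" "arr g"
  shows "cod g = dom f \<Longrightarrow> inv_arrow C f \<cdot> (f \<cdot> g) = g"
    and "cod g = cod f \<Longrightarrow> f \<cdot> (inv_arrow C f \<cdot> g) = g"
proof -
  have f: "arr f" using assms is_iso_Ar by blast
  show "inv_arrow C f \<cdot> (f \<cdot> g) = g" if "cod g = dom f"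
    using comp_extend1[of "inv_arrow C f" f "Idn C (dom f)" g] assms f that by simp
  show "f \<cdot> (inv_arrow C f \<cdot> g) = g" if "cod g = cod f"
    using comp_extend1[of f "inv_arrow C f" "Idn C (cod f)" g] assms f that by simp
qed

lemma iso_mono:
  assumes "is_iso C f" "arr g" "arr h" "cod g = dom f" "cod h = dom f" "f \<cdot> g = f \<cdot> h"
  shows "g = h"
  using inv_arrow_cancel(1)[OF assms(1,2,4)] inv_arrow_cancel(1)[OF assms(1,3,5)] assms(6) by metis

lemma is_isoI:
  assumes "arr f" "arr g" "dom g = cod f" "cod g = dom f"
    "g \<cdot> f = Idn C (dom f)" "f \<cdot> g = Idn C (cod f)"
  shows "is_iso C f"
  using assms by (auto simp: is_iso_def inverse_arrows_def Hom_iff)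

lemma is_iso_inv_arrow: "is_iso C f \<Longrightarrow> is_iso C (inv_arrow C f)"
  by (rule is_isoI[where g = f]) (auto simp: is_iso_Ar)

lemma is_iso_Idn: "x \<in> Ob C \<Longrightarrow> is_iso C (Idn C x)"
  by (rule is_isoI[where g = "Idn C x"]) auto

lemma is_iso_comp:
  assumes "is_iso C f" "is_iso C g" "cod f = dom g"
  shows "is_iso C (g \<cdot> f)"
  using assms is_iso_Ar[OF assms(1)] is_iso_Ar[OF assms(2)]
  by (intro is_isoI[where g = "inv_arrow C f \<cdot> inv_arrow C g"]) auto

end

section \<open>Wide pullbacks\<close>

text \<open>
  Fibre powers and pullback squares are both limits of finitely many arrows \<open>r i\<close> with a common
  codomain, and treating them together saves proving each stability result twice. The legs
  of the limit are \<open>\<pi> i\<close> and \<open>u\<close> is their common composite with the \<open>r i\<close>.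
\<close>

definition wide_pb ::
  "('o, 'a, 'x) cat_scheme \<Rightarrow> nat \<Rightarrow> (nat \<Rightarrow> 'a) \<Rightarrow> 'a \<Rightarrow> (nat \<Rightarrow> 'a) \<Rightarrow> bool" where
  "wide_pb C n r u \<pi> \<longleftrightarrow> u \<in> Ar C \<and>
     (\<forall>i<n. r i \<in> Ar C \<and> \<pi> i \<in> Ar C \<and> Cod C (r i) = Cod C u \<and> Dom C (\<pi> i) = Dom C u \<and>
        Cod C (\<pi> i) = Dom C (r i) \<and> r i \<cdot>\<^bsub>C\<^esub> \<pi> i = u) \<and>
     (\<forall>v\<in>Ar C. \<forall>f. Cod C v = Cod C u \<and>
        (\<forall>i<n. f i \<in> Ar C \<and> Dom C (f i) = Dom C v \<and> Cod C (f i) = Dom C (r i) \<and> r i \<cdot>\<^bsub>C\<^esub> f i = v) \<longrightarrow>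
        (\<exists>!h. h \<in> Ar C \<and> Dom C h = Dom C v \<and> Cod C h = Dom C u \<and> u \<cdot>\<^bsub>C\<^esub> h = v \<and>
           (\<forall>i<n. \<pi> i \<cdot>\<^bsub>C\<^esub> h = f i)))"

context cat begin

lemma wide_pb_Ar: "wide_pb C n r u \<pi> \<Longrightarrow> arr u"
  by (simp add: wide_pb_def)

lemma wide_pbD:
  assumes "wide_pb C n r u \<pi>"
  shows "i < n \<Longrightarrow> r i \<in> Ar C" "i < n \<Longrightarrow> \<pi> i \<in> Ar C" "i < n \<Longrightarrow> cod (r i) = cod u"
    "i < n \<Longrightarrow> dom (\<pi> i) = dom u" "i < n \<Longrightarrow> cod (\<pi> i) = dom (r i)" "i < n \<Longrightarrow> r i \<cdot> \<pi> i = u"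
  using assms by (auto simp: wide_pb_def)

lemma wide_pb_univ:
  assumes pb: "wide_pb C n r u \<pi>" and "arr v" "cod v = cod u"
    "\<And>i. i < n \<Longrightarrow> f i \<in> Ar C \<and> dom (f i) = dom v \<and> cod (f i) = dom (r i) \<and> r i \<cdot> f i = v"
  shows "\<exists>!h. h \<in> Ar C \<and> dom h = dom v \<and> cod h = dom u \<and> u \<cdot> h = v \<and> (\<forall>i<n. \<pi> i \<cdot> h = f i)"
  by (rule pb[unfolded wide_pb_def, THEN conjunct2, THEN conjunct2, THEN bspec, OF assms(2), THEN spec, THEN mp])
    (intro conjI assms(3) allI impI; use assms(4) in simp)

lemma wide_pb_lift:
  assumes pb: "wide_pb C n r u \<pi>" and v: "arr v" "cod v = cod u"
    and f: "\<And>i. i < n \<Longrightarrow> f i \<in> Ar C" "\<And>i. i < n \<Longrightarrow> dom (f i) = dom v"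
    "\<And>i. i < n \<Longrightarrow> cod (f i) = dom (r i)" "\<And>i. i < n \<Longrightarrow> r i \<cdot> f i = v"
  obtains h where "arr h" "dom h = dom v" "cod h = dom u" "u \<cdot> h = v"
    "\<And>i. i < n \<Longrightarrow> \<pi> i \<cdot> h = f i"
proof -
  from ex1_implies_ex[OF wide_pb_univ[OF pb v, of f]] f that show ?thesis by auto
qed

lemma wide_pb_eq:
  assumes pb: "wide_pb C n r u \<pi>" and h: "arr h" "cod h = dom u"
    and h': "arr h'" "cod h' = dom u" and d: "dom h = dom h'"
    and eq: "u \<cdot> h = u \<cdot> h'" "\<And>i. i < n \<Longrightarrow> \<pi> i \<cdot> h = \<pi> i \<cdot> h'"
  shows "h = h'"
proof -
  note D = wide_pbD[OF pb] and u = wide_pb_Ar[OF pb]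
  let ?P = "\<lambda>k. k \<in> Ar C \<and> dom k = dom (u \<cdot> h) \<and> cod k = dom u \<and> u \<cdot> k = u \<cdot> h \<and>
      (\<forall>i<n. \<pi> i \<cdot> k = \<pi> i \<cdot> h)"
  have "r i \<cdot> (\<pi> i \<cdot> h) = u \<cdot> h" if "i < n" for i
    using D[of i] u that h by (intro comp_extend1) auto
  then have "\<exists>!k. ?P k" using D u h by (intro wide_pb_univ[OF pb]) auto
  moreover have "?P h" "?P h'" using h h' d u eq by auto
  ultimately show ?thesis by blast
qed

lemma wide_pbI:
  assumes "arr u"
    and "\<And>i. i < n \<Longrightarrow> r i \<in> Ar C \<and> \<pi> i \<in> Ar C \<and> cod (r i) = cod u \<and> dom (\<pi> i) = dom u \<and>
        cod (\<pi> i) = dom (r i) \<and> r i \<cdot> \<pi> i = u"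
    and ex: "\<And>v f. v \<in> Ar C \<Longrightarrow> cod v = cod u \<Longrightarrow>
        (\<And>i. i < n \<Longrightarrow> f i \<in> Ar C \<and> dom (f i) = dom v \<and> cod (f i) = dom (r i) \<and> r i \<cdot> f i = v) \<Longrightarrow>
        \<exists>h. arr h \<and> dom h = dom v \<and> cod h = dom u \<and> u \<cdot> h = v \<and> (\<forall>i<n. \<pi> i \<cdot> h = f i)"
    and un: "\<And>h h'. h \<in> Ar C \<Longrightarrow> arr h' \<Longrightarrow> cod h = dom u \<Longrightarrow> cod h' = dom u \<Longrightarrow>
        dom h = dom h' \<Longrightarrow> u \<cdot> h = u \<cdot> h' \<Longrightarrow> (\<And>i. i < n \<Longrightarrow> \<pi> i \<cdot> h = \<pi> i \<cdot> h') \<Longrightarrow> h = h'"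
  shows "wide_pb C n r u \<pi>"
  unfolding wide_pb_def
proof (rule conjI[OF assms(1)], rule conjI, use assms(2) in simp, intro ballI allI impI, elim conjE)
  fix v f assume a: "arr v" "cod v = cod u"
    "\<forall>i<n. f i \<in> Ar C \<and> dom (f i) = dom v \<and> cod (f i) = dom (r i) \<and> r i \<cdot> f i = v"
  then obtain h where h: "arr h \<and> dom h = dom v \<and> cod h = dom u \<and> u \<cdot> h = v \<and> (\<forall>i<n. \<pi> i \<cdot> h = f i)"
    using ex[of v f] by blast
  then show "\<exists>!h. h \<in> Ar C \<and> dom h = dom v \<and> cod h = dom u \<and> u \<cdot> h = v \<and> (\<forall>i<n. \<pi> i \<cdot> h = f i)"
  proof (rule ex1I)
    fix k assume k: "arr k \<and> dom k = dom v \<and> cod k = dom u \<and> u \<cdot> k = v \<and> (\<forall>i<n. \<pi> i \<cdot> k = f i)"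
    show "k = h" by (rule un) (use h k in auto)
  qed
qed

lemma fibre_power_iff:
  "fibre_power C q n u \<pi> \<longleftrightarrow> arr q \<and> cod u = cod q \<and> wide_pb C n (\<lambda>_. q) u \<pi>"
proof -
  have "(\<forall>z f. \<forall>v \<in> Hom C z (cod q). P z f v) \<longleftrightarrow> (\<forall>v\<in>Ar C. \<forall>f. cod v = cod q \<longrightarrow> P (dom v) f v)"
    for P :: "'o \<Rightarrow> (nat \<Rightarrow> 'a) \<Rightarrow> 'a \<Rightarrow> bool" by (auto simp: Hom_iff)
  then show ?thesis
    unfolding fibre_power_def wide_pb_def by (auto simp: Hom_iff conj_assoc imp_conjL cong: conj_cong)
qed

lemma is_pullbackI:
  assumes "arr t" "arr l" "arr r" "arr b"
    "dom t = dom l" "cod t = dom r" "cod l = dom b" "cod r = cod b" "r \<cdot> t = b \<cdot> l"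
    and ex: "\<And>f g. f \<in> Ar C \<Longrightarrow> arr g \<Longrightarrow> dom f = dom g \<Longrightarrow> cod f = dom r \<Longrightarrow> cod g = dom b \<Longrightarrow>
        r \<cdot> f = b \<cdot> g \<Longrightarrow> \<exists>h. arr h \<and> dom h = dom g \<and> cod h = dom t \<and> t \<cdot> h = f \<and> l \<cdot> h = g"
    and un: "\<And>h h'. h \<in> Ar C \<Longrightarrow> arr h' \<Longrightarrow> cod h = dom t \<Longrightarrow> cod h' = dom t \<Longrightarrow>
        dom h = dom h' \<Longrightarrow> t \<cdot> h = t \<cdot> h' \<Longrightarrow> l \<cdot> h = l \<cdot> h' \<Longrightarrow> h = h'"
  shows "is_pullback C t l r b"
  unfolding is_pullback_def
proof (intro conjI ballI allI impI assms(1-9))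
  fix z f g assume "f \<in> Hom C z (dom r)" "g \<in> Hom C z (dom b)" "r \<cdot> f = b \<cdot> g"
  then have fg: "arr f" "arr g" "dom f = z" "dom g = z" "cod f = dom r" "cod g = dom b"
    "r \<cdot> f = b \<cdot> g" by (auto simp: Hom_iff)
  then obtain h where "arr h" "dom h = dom g" "cod h = dom t" "t \<cdot> h = f" "l \<cdot> h = g"
    using ex[of f g] by auto
  then show "\<exists>!h. h \<in> Hom C z (dom t) \<and> t \<cdot> h = f \<and> l \<cdot> h = g"
    using fg by (intro ex1I[of _ h]) (auto simp: Hom_iff intro!: un)
qed

text \<open>Brings the square that expresses the universality of the lift into the form of wide pullbacks.\<close>

lemma is_pullback_wide_pb:
  assumes "is_pullback C t l r b"
  shows "wide_pb C 2 (\<lambda>i. if i = 0 then r else b) (r \<cdot> t) (\<lambda>i. if i = 0 then t else l)"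
proof -
  have ty: "arr t" "arr l" "arr r" "arr b" "dom t = dom l" "cod t = dom r"
    "cod l = dom b" "cod r = cod b" and sq: "r \<cdot> t = b \<cdot> l"
    and u: "\<And>z f g. f \<in> Hom C z (dom r) \<Longrightarrow> g \<in> Hom C z (dom b) \<Longrightarrow>
      r \<cdot> f = b \<cdot> g \<Longrightarrow> (\<exists>!h. h \<in> Hom C z (dom t) \<and> t \<cdot> h = f \<and> l \<cdot> h = g)"
    using assms unfolding is_pullback_def by blast+
  show ?thesis
  proof (rule wide_pbI)
    fix v f assume v: "arr v" "cod v = cod (r \<cdot> t)" and
      f: "\<And>i::nat. i < 2 \<Longrightarrow> f i \<in> Ar C \<and> dom (f i) = dom v \<and> cod (f i) = dom (if i = 0 then r else b) \<and>
        (if i = 0 then r else b) \<cdot> f i = v"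
    have f': "f 0 \<in> Hom C (dom v) (dom r)" "f 1 \<in> Hom C (dom v) (dom b)" "r \<cdot> f 0 = b \<cdot> f 1" "r \<cdot> f 0 = v"
      using f[of 0, simplified] f[of 1, simplified] by (simp_all add: Hom_iff)
    obtain h where "h \<in> Hom C (dom v) (dom t)" and h: "t \<cdot> h = f 0" "l \<cdot> h = f 1"
      using u[OF f'(1-3)] by blast
    then have h': "arr h" "dom h = dom v" "cod h = dom t" by (simp_all add: Hom_iff)
    have "(r \<cdot> t) \<cdot> h = r \<cdot> f 0" using h'(1,3) h ty by simp
    then show "\<exists>h. arr h \<and> dom h = dom v \<and> cod h = dom (r \<cdot> t) \<and> (r \<cdot> t) \<cdot> h = v \<and>
        (\<forall>i<2. (if i = 0 then t else l) \<cdot> h = f i)"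
      using h h' ty(1-6) f'(4) by (intro exI[of _ h] conjI) (auto simp: less_2_cases_iff simp del: comp_assoc)
  next
    fix h h' assume h: "arr h" "arr h'" "cod h = dom (r \<cdot> t)" "cod h' = dom (r \<cdot> t)"
        "dom h = dom h'" and eq: "\<And>i::nat. i < 2 \<Longrightarrow> (if i = 0 then t else l) \<cdot> h = (if i = 0 then t else l) \<cdot> h'"
    have "r \<cdot> (t \<cdot> h) = b \<cdot> (l \<cdot> h)" using ty sq h by (intro comp_extend) auto
    then have "\<exists>!k. k \<in> Hom C (dom h) (dom t) \<and> t \<cdot> k = t \<cdot> h \<and> l \<cdot> k = l \<cdot> h"
      using ty h by (intro u) (auto simp: Hom_iff)
    moreover have "h \<in> Hom C (dom h) (dom t)" "h' \<in> Hom C (dom h) (dom t)" "t \<cdot> h = t \<cdot> h'" "l \<cdot> h = l \<cdot> h'"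
      using h ty eq[of 0, simplified] eq[of 1, simplified] by (simp_all add: Hom_iff)
    ultimately show "h = h'" by metis
  qed (use ty sq in \<open>auto simp: less_2_cases_iff\<close>)
qed

text \<open>The cones over isomorphic diagrams correspond to each other by composition with the isomorphisms.\<close>

lemma wide_pb_iso:
  assumes pb: "wide_pb C n r u \<pi>"
    and P: "is_iso C \<phi>P" "dom \<phi>P = dom u" and B: "is_iso C \<phi>B" "dom \<phi>B = cod u"
    and X: "\<And>i. i < n \<Longrightarrow> is_iso C (\<phi>X i)" "\<And>i. i < n \<Longrightarrow> dom (\<phi>X i) = dom (r i)"
    and u': "arr u'" "dom u' = cod \<phi>P" "cod u' = cod \<phi>B" "u' \<cdot> \<phi>P = \<phi>B \<cdot> u"
    and r': "\<And>i. i < n \<Longrightarrow> r' i \<in> Ar C" "\<And>i. i < n \<Longrightarrow> dom (r' i) = cod (\<phi>X i)"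
      "\<And>i. i < n \<Longrightarrow> cod (r' i) = cod \<phi>B" "\<And>i. i < n \<Longrightarrow> r' i \<cdot> \<phi>X i = \<phi>B \<cdot> r i"
    and \<pi>': "\<And>i. i < n \<Longrightarrow> \<pi>' i \<in> Ar C" "\<And>i. i < n \<Longrightarrow> dom (\<pi>' i) = cod \<phi>P"
      "\<And>i. i < n \<Longrightarrow> cod (\<pi>' i) = cod (\<phi>X i)" "\<And>i. i < n \<Longrightarrow> \<pi>' i \<cdot> \<phi>P = \<phi>X i \<cdot> \<pi> i"
  shows "wide_pb C n r' u' \<pi>'"
proof -
  note D = wide_pbD[OF pb] and u = wide_pb_Ar[OF pb]
  note A = is_iso_Ar[OF P(1)] is_iso_Ar[OF B(1)] X(1)[THEN is_iso_Ar]
  show ?thesis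
  proof (rule wide_pbI)
    fix i assume i: "i < n"
    have "(r' i \<cdot> \<pi>' i) \<cdot> \<phi>P = u' \<cdot> \<phi>P"
    proof -
      have "(r' i \<cdot> \<pi>' i) \<cdot> \<phi>P = r' i \<cdot> (\<phi>X i \<cdot> \<pi> i)" using i r' \<pi>' P A by simp
      also have "\<dots> = \<phi>B \<cdot> (r i \<cdot> \<pi> i)" using i r'(4)[OF i] r' D[of i] u A X B by (intro comp_extend) auto
      finally show ?thesis using D[of i] i u' by simp
    qed
    then have "(r' i \<cdot> \<pi>' i) \<cdot> (\<phi>P \<cdot> inv_arrow C \<phi>P) = u' \<cdot> (\<phi>P \<cdot> inv_arrow C \<phi>P)"
      using i r'(1-3) \<pi>'(1-3) P A u'(1-3) by (intro comp_extend) auto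
    then have "r' i \<cdot> \<pi>' i = u'" using i r'(1-3) \<pi>'(1-3) P A u'(1-3) by simp
    then show "r' i \<in> Ar C \<and> \<pi>' i \<in> Ar C \<and> cod (r' i) = cod u' \<and> dom (\<pi>' i) = dom u' \<and>
        cod (\<pi>' i) = dom (r' i) \<and> r' i \<cdot> \<pi>' i = u'" using i r' \<pi>' u' by simp
  next
    fix v f assume v: "arr v" "cod v = cod u'" and
      f: "\<And>i. i < n \<Longrightarrow> f i \<in> Ar C \<and> dom (f i) = dom v \<and> cod (f i) = dom (r' i) \<and> r' i \<cdot> f i = v"
    have "r i \<cdot> (inv_arrow C (\<phi>X i) \<cdot> f i) = inv_arrow C \<phi>B \<cdot> v" if i: "i < n" for i
    proof (rule iso_mono[OF B(1)])
      have "\<phi>B \<cdot> (r i \<cdot> (inv_arrow C (\<phi>X i) \<cdot> f i)) = r' i \<cdot> (\<phi>X i \<cdot> (inv_arrow C (\<phi>X i) \<cdot> f i))"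
        using r'(4)[OF i, symmetric] i X f[OF i] D[of i] u B A r' by (intro comp_extend) auto
      then show "\<phi>B \<cdot> (r i \<cdot> (inv_arrow C (\<phi>X i) \<cdot> f i)) = \<phi>B \<cdot> (inv_arrow C \<phi>B \<cdot> v)"
        using i f[OF i] X r' v B u' by simp
    qed (use i f[OF i] X r' v B u' u D in auto)
    then obtain h where h: "arr h" "dom h = dom (inv_arrow C \<phi>B \<cdot> v)" "cod h = dom u" "u \<cdot> h = inv_arrow C \<phi>B \<cdot> v"
      "\<And>i. i < n \<Longrightarrow> \<pi> i \<cdot> h = inv_arrow C (\<phi>X i) \<cdot> f i"
      using v f B X D u u' r'
      by (elim wide_pb_lift[OF pb, of "inv_arrow C \<phi>B \<cdot> v" "\<lambda>i. inv_arrow C (\<phi>X i) \<cdot> f i", rotated -1]) auto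
    have "u' \<cdot> (\<phi>P \<cdot> h) = \<phi>B \<cdot> (u \<cdot> h)"
      using h(1-3) u' P A B u by (intro comp_extend) auto
    then have "u' \<cdot> (\<phi>P \<cdot> h) = v" unfolding h(4) using B v u'(3) by simp
    moreover have "\<pi>' i \<cdot> (\<phi>P \<cdot> h) = f i" if i: "i < n" for i
      using comp_extend[OF \<pi>'(4)[OF i], of h] h \<pi>'(1-3) P A X D(1-5)[of i] i f[OF i] r'(1-3) by simp
    ultimately show "\<exists>h. arr h \<and> dom h = dom v \<and> cod h = dom u' \<and> u' \<cdot> h = v \<and> (\<forall>i<n. \<pi>' i \<cdot> h = f i)"
      using h P A u' v B by (intro exI[of _ "\<phi>P \<cdot> h"]) auto
  next
    fix h h' assume h: "arr h" "arr h'" "cod h = dom u'" "cod h' = dom u'" "dom h = dom h'"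
      and eq: "u' \<cdot> h = u' \<cdot> h'" "\<And>i. i < n \<Longrightarrow> \<pi>' i \<cdot> h = \<pi>' i \<cdot> h'"
    let ?k = "inv_arrow C \<phi>P \<cdot> h" and ?k' = "inv_arrow C \<phi>P \<cdot> h'"
    have k: "arr ?k" "arr ?k'" "dom ?k = dom h" "dom ?k' = dom h"
      "cod ?k = dom u" "cod ?k' = dom u" using h P u' by auto
    have "?k = ?k'"
    proof (rule wide_pb_eq[OF pb])
      show "u \<cdot> ?k = u \<cdot> ?k'"
      proof (rule iso_mono[OF B(1)])
        have "\<phi>B \<cdot> (u \<cdot> k) = u' \<cdot> (\<phi>P \<cdot> k)" if "arr k" "cod k = dom u" for k
          using u'(4)[symmetric] that A u' P B u by (intro comp_extend) auto
        then show "\<phi>B \<cdot> (u \<cdot> ?k) = \<phi>B \<cdot> (u \<cdot> ?k')" using k eq h P u' by simp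
      qed (use k u B in auto)
    next
      fix i assume i: "i < n"
      show "\<pi> i \<cdot> ?k = \<pi> i \<cdot> ?k'"
      proof (rule iso_mono[OF X(1)[OF i]])
        have "\<phi>X i \<cdot> (\<pi> i \<cdot> k) = \<pi>' i \<cdot> (\<phi>P \<cdot> k)" if "arr k" "cod k = dom u" for k
          using \<pi>'(4)[OF i, symmetric] that A \<pi>' P X D[of i] i by (intro comp_extend) auto
        then show "\<phi>X i \<cdot> (\<pi> i \<cdot> ?k) = \<phi>X i \<cdot> (\<pi> i \<cdot> ?k')" using k eq(2)[OF i] h P u' by simp
      qed (use k D[of i] i X in auto)
    qed (use k in auto)
    moreover have "h = \<phi>P \<cdot> ?k" "h' = \<phi>P \<cdot> ?k'" using h P u' by simp_all
    ultimately show "h = h'" by metis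
  qed (use u' in auto)
qed

end

section \<open>The monoids of lifts of an additive bundle\<close>

definition tup :: "('o, 'a, 'x) cat_scheme \<Rightarrow> ('o, 'a, 'y) abun_scheme \<Rightarrow> nat \<Rightarrow> 'a \<Rightarrow> (nat \<Rightarrow> 'a) \<Rightarrow> 'a" where
  "tup C b n v e = fibre_tuple C n (bpow b n) (bprj b n) v e"

text \<open>
  The generalised elements of the total space over the element \<open>v\<close> of the base. All sums below are
  taken in these monoids.
\<close>

definition fibm :: "('o, 'a, 'x) cat_scheme \<Rightarrow> ('o, 'a, 'y) abun_scheme \<Rightarrow> 'a \<Rightarrow> 'a monoid" where
  "fibm C b v = \<lparr>carrier = {f \<in> Ar C. Dom C f = Dom C v \<and> Cod C f = btot b \<and> bproj b \<cdot>\<^bsub>C\<^esub> f = v},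
     mult = fib_add C b, one = bzero b \<cdot>\<^bsub>C\<^esub> v\<rparr>"

context cat begin

abbreviation is_bundle where "is_bundle b \<equiv> additive_bundle C b"
abbreviation bundle_mor where "bundle_mor b b' f g \<equiv> additive_bundle_mor C b b' f g"
abbreviation fib where "fib b v \<equiv> fibm C b v"
abbreviation lifts where "lifts b v \<equiv> carrier (fibm C b v)"

lemma fibm_simps [simp]: "mult (fib b v) = fib_add C b" "one (fib b v) = bzero b \<cdot> v"
  by (auto simp: fibm_def)

lemma fibm_carrier:
  "f \<in> lifts b v \<longleftrightarrow> arr f \<and> dom f = dom v \<and> cod f = btot b \<and> bproj b \<cdot> f = v"
  by (simp add: fibm_def)

lemma fibmD:
  assumes "f \<in> lifts b v"
  shows "arr f" "dom f = dom v" "cod f = btot b" "bproj b \<cdot> f = v"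
  using assms by (simp_all add: fibm_carrier)

lemma bundleD:
  assumes "is_bundle b"
  shows "bproj b \<in> Ar C" "dom (bproj b) = btot b" "cod (bproj b) = bbase b"
    "bzero b \<in> Ar C" "dom (bzero b) = bbase b" "cod (bzero b) = btot b"
    "bplus b \<in> Ar C" "dom (bplus b) = bpowO C b 2" "cod (bplus b) = btot b"
    "bproj b \<cdot> bzero b = Idn C (bbase b)" "bpow b 0 = Idn C (bbase b)" "bpow b (Suc 0) = bproj b"
    "bprj b (Suc 0) 0 = Idn C (btot b)" "bproj b \<cdot> bplus b = bpow b 2"
    "bpow b n \<in> Ar C" "dom (bpow b n) = bpowO C b n" "cod (bpow b n) = bbase b"
    "i < n \<Longrightarrow> bprj b n i \<in> Ar C" "i < n \<Longrightarrow> dom (bprj b n i) = bpowO C b n"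
    "i < n \<Longrightarrow> cod (bprj b n i) = btot b" "i < n \<Longrightarrow> bproj b \<cdot> bprj b n i = bpow b n"
    "wide_pb C n (\<lambda>_. bproj b) (bpow b n) (bprj b n)"
proof -
  have q: "bproj b \<in> Ar C \<and> dom (bproj b) = btot b \<and> cod (bproj b) = bbase b"
    using assms by (simp add: additive_bundle_def Hom_iff)
  have w: "cod (bpow b n) = cod (bproj b) \<and> wide_pb C n (\<lambda>_. bproj b) (bpow b n) (bprj b n)" for n
    using assms by (simp add: additive_bundle_def fibre_power_iff)
  note D = wide_pbD[OF conjunct2[OF w]]
  have z: "bzero b \<in> Hom C (bbase b) (btot b)" "bplus b \<in> Hom C (bpowO C b 2) (btot b)"
     "bproj b \<cdot> bzero b = Idn C (bbase b)" "bpow b 0 = Idn C (bbase b)" "bpow b 1 = bproj b"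
    "bprj b 1 0 = Idn C (btot b)" "bproj b \<cdot> bplus b = bproj b \<cdot> bprj b 2 0"
    using assms unfolding additive_bundle_def by blast+
  show "bproj b \<in> Ar C" "dom (bproj b) = btot b" "cod (bproj b) = bbase b"
    using q by auto
  show "bzero b \<in> Ar C" "dom (bzero b) = bbase b" "cod (bzero b) = btot b"
    "bplus b \<in> Ar C" "dom (bplus b) = bpowO C b 2" "cod (bplus b) = btot b"
    using z(1,2) by (auto simp: Hom_iff)
  show "bproj b \<cdot> bzero b = Idn C (bbase b)" "bpow b 0 = Idn C (bbase b)" "bpow b (Suc 0) = bproj b"
    "bprj b (Suc 0) 0 = Idn C (btot b)" using z by simp_all
  show "bproj b \<cdot> bplus b = bpow b 2" using z(7) D(6)[of 0 2] by simp
  show "bpow b n \<in> Ar C" "dom (bpow b n) = bpowO C b n" using wide_pb_Ar[OF conjunct2[OF w]] by (simp_all add: bpowO_def)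
  show "cod (bpow b n) = bbase b" using w q by simp
  show "wide_pb C n (\<lambda>_. bproj b) (bpow b n) (bprj b n)" using w by simp
  show "i < n \<Longrightarrow> bprj b n i \<in> Ar C" "i < n \<Longrightarrow> dom (bprj b n i) = bpowO C b n"
    "i < n \<Longrightarrow> cod (bprj b n i) = btot b" "i < n \<Longrightarrow> bproj b \<cdot> bprj b n i = bpow b n"
    using D[of i n] q by (simp_all add: bpowO_def)
qed

lemma fibm_base:
  assumes "is_bundle b" "f \<in> lifts b v"
  shows "arr v" "cod v = bbase b"
  using comp_Ar[of f "bproj b"] Cod_comp[of f "bproj b"] fibmD[OF assms(2)] bundleD[OF assms(1)] by simp_all

lemma bprj_carrier: "is_bundle b \<Longrightarrow> i < n \<Longrightarrow> bprj b n i \<in> lifts b (bpow b n)"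
  by (simp add: bundleD fibm_carrier)

lemma bundle_eqI:
  assumes b: "is_bundle b" and "arr h" "arr h'" "dom h = dom h'"
    "cod h = bpowO C b n" "cod h' = bpowO C b n" "bpow b n \<cdot> h = bpow b n \<cdot> h'"
    "\<And>i. i < n \<Longrightarrow> bprj b n i \<cdot> h = bprj b n i \<cdot> h'"
  shows "h = h'"
  by (rule wide_pb_eq[OF bundleD(22)[OF b]]) (use assms in \<open>auto simp: bundleD[OF b]\<close>)

lemma tup:
  assumes b: "is_bundle b" and v: "arr v" "cod v = bbase b"
    and e: "\<And>i. i < n \<Longrightarrow> e i \<in> lifts b v"
  shows "tup C b n v e \<in> Ar C" "dom (tup C b n v e) = dom v" "cod (tup C b n v e) = bpowO C b n"
    "bpow b n \<cdot> tup C b n v e = v" "i < n \<Longrightarrow> bprj b n i \<cdot> tup C b n v e = e i"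
proof -
  note D = bundleD[OF b]
  have "\<exists>!h. h \<in> Ar C \<and> dom h = dom v \<and> cod h = dom (bpow b n) \<and> bpow b n \<cdot> h = v \<and>
     (\<forall>i<n. bprj b n i \<cdot> h = e i)"
    by (rule wide_pb_univ[OF D(22)]) (use v fibmD[OF e] D in auto)
  then have "\<exists>!h. h \<in> Hom C (dom v) (dom (bpow b n)) \<and> bpow b n \<cdot> h = v \<and>
     (\<forall>i<n. bprj b n i \<cdot> h = e i)" by (simp add: Hom_iff conj_assoc)
  then have "tup C b n v e \<in> Hom C (dom v) (dom (bpow b n)) \<and> bpow b n \<cdot> tup C b n v e = v \<and>
     (\<forall>i<n. bprj b n i \<cdot> tup C b n v e = e i)"
    unfolding tup_def fibre_tuple_def by (rule theI')
  then show "tup C b n v e \<in> Ar C" "dom (tup C b n v e) = dom v" "cod (tup C b n v e) = bpowO C b n"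
    "bpow b n \<cdot> tup C b n v e = v" "i < n \<Longrightarrow> bprj b n i \<cdot> tup C b n v e = e i"
    by (auto simp: Hom_iff D)
qed

lemma tup_unique:
  assumes b: "is_bundle b" and h: "arr h" "cod h = bpowO C b n" "bpow b n \<cdot> h = v"
    and e: "\<And>i. i < n \<Longrightarrow> bprj b n i \<cdot> h = e i"
  shows "h = tup C b n v e"
proof -
  note D = bundleD[OF b]
  have v: "arr v" "cod v = bbase b" "dom v = dom h" using h D by auto
  have e': "e i \<in> lifts b v" if i: "i < n" for i
    using e[OF i, symmetric] comp_extend1[OF D(21)[OF i], of h] h D i v by (simp add: fibm_carrier)
  show ?thesis
    by (rule bundle_eqI[OF b]) (use tup[OF b v(1,2) e'] h v e in auto)
qed

lemma lift_carrier:
  assumes b: "is_bundle b" and h: "arr h" "cod h = bpowO C b n" "bpow b n \<cdot> h = v" and i: "i < n"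
  shows "bprj b n i \<cdot> h \<in> lifts b v"
  using comp_extend1[OF bundleD(21)[OF b i], of h] h i bundleD[OF b] Dom_comp[of h "bpow b n"] by (simp add: fibm_carrier)

lemma tup_cong:
  assumes b: "is_bundle b" and v: "arr v" "cod v = bbase b"
    and e: "\<And>i. i < n \<Longrightarrow> e i \<in> lifts b v" "\<And>i. i < n \<Longrightarrow> e i = e' i"
  shows "tup C b n v e = tup C b n v e'"
  by (rule tup_unique[OF b]) (use tup[OF b v e(1)] e(2) in auto)

lemma carrier_comp:
  assumes b: "is_bundle b" and "f \<in> lifts b v" "arr k" "cod k = dom v"
  shows "f \<cdot> k \<in> lifts b (v \<cdot> k)"
proof -
  have "bproj b \<cdot> (f \<cdot> k) = v \<cdot> k"
    by (rule comp_extend1) (use assms(3,4) fibmD[OF assms(2)] bundleD[OF b] in auto)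
  then show ?thesis using assms(3,4) fibmD[OF assms(2)] fibm_base[OF b assms(2)] by (simp add: fibm_carrier)
qed

lemma tup_comp:
  assumes b: "is_bundle b" and v: "arr v" "cod v = bbase b"
    and e: "\<And>i. i < n \<Longrightarrow> e i \<in> lifts b v" and k: "arr k" "cod k = dom v"
  shows "tup C b n v e \<cdot> k = tup C b n (v \<cdot> k) (\<lambda>i. e i \<cdot> k)"
proof (rule tup_unique[OF b])
  note t = tup[OF b v e] and D = bundleD[OF b]
  show "bpow b n \<cdot> (tup C b n v e \<cdot> k) = v \<cdot> k"
    by (rule comp_extend1) (use t k D in auto)
  show "bprj b n i \<cdot> (tup C b n v e \<cdot> k) = e i \<cdot> k" if "i < n" for i
    by (rule comp_extend1) (use that t k D in auto)
qed (use tup[OF b v e] k in auto)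

lemma bpair_eq_tup:
  assumes "f \<in> lifts b v"
  shows "bpair C b f g = tup C b 2 v (\<lambda>i. if i = 0 then f else g)"
  using fibmD[OF assms] by (simp add: bpair_def tup_def)

lemma bpair:
  assumes b: "is_bundle b" and v: "arr v" "cod v = bbase b"
    and f: "f \<in> lifts b v" and g: "g \<in> lifts b v"
  shows "bpair C b f g \<in> Ar C" "dom (bpair C b f g) = dom v" "cod (bpair C b f g) = bpowO C b 2"
    "bpow b 2 \<cdot> bpair C b f g = v" "bprj b 2 0 \<cdot> bpair C b f g = f" "bprj b 2 (Suc 0) \<cdot> bpair C b f g = g"
proof -
  have e: "(if i = 0 then f else g) \<in> lifts b v" for i :: nat using f g by simp
  note t = tup[OF b v, of 2 "\<lambda>i. if i = 0 then f else g", OF e]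
  show "bpair C b f g \<in> Ar C" "dom (bpair C b f g) = dom v" "cod (bpair C b f g) = bpowO C b 2"
    "bpow b 2 \<cdot> bpair C b f g = v" unfolding bpair_eq_tup[OF f] by (rule t)+
  show "bprj b 2 0 \<cdot> bpair C b f g = f" "bprj b 2 (Suc 0) \<cdot> bpair C b f g = g"
    unfolding bpair_eq_tup[OF f] using t(5)[of 0] t(5)[of 1] by simp_all
qed

lemma bpair_unique:
  assumes b: "is_bundle b" and "arr h" "cod h = bpowO C b 2" "bpow b 2 \<cdot> h = v"
    "bprj b 2 0 \<cdot> h = f" "bprj b 2 (Suc 0) \<cdot> h = g"
  shows "h = bpair C b f g"
proof -
  have f: "f \<in> lifts b v" using lift_carrier[OF assms(1-4), of 0] assms(5) by simp
  show ?thesis unfolding bpair_eq_tup[OF f]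
    by (rule tup_unique[OF b]) (use assms in \<open>auto simp: less_2_cases_iff\<close>)
qed

lemma bpair_comp:
  assumes b: "is_bundle b" and v: "arr v" "cod v = bbase b"
    and f: "f \<in> lifts b v" and g: "g \<in> lifts b v" and k: "arr k" "cod k = dom v"
  shows "bpair C b f g \<cdot> k = bpair C b (f \<cdot> k) (g \<cdot> k)"
proof -
  note t = bpair[OF b v f g] and D = bundleD[OF b]
  show ?thesis
  proof (rule bpair_unique[OF b])
    show "bpow b 2 \<cdot> (bpair C b f g \<cdot> k) = v \<cdot> k"
      by (rule comp_extend1) (use t k D in auto)
    show "bprj b 2 0 \<cdot> (bpair C b f g \<cdot> k) = f \<cdot> k"
      by (rule comp_extend1) (use t k D in auto)
    show "bprj b 2 (Suc 0) \<cdot> (bpair C b f g \<cdot> k) = g \<cdot> k"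
      by (rule comp_extend1) (use t k D in auto)
  qed (use t k in auto)
qed

lemma fib_add:
  assumes b: "is_bundle b" and v: "arr v" "cod v = bbase b"
    and f: "f \<in> lifts b v" and g: "g \<in> lifts b v"
  shows "fib_add C b f g \<in> lifts b v"
proof -
  note t = bpair[OF b v f g] and D = bundleD[OF b]
  have "bproj b \<cdot> (bplus b \<cdot> bpair C b f g) = bpow b 2 \<cdot> bpair C b f g"
    by (rule comp_extend1) (use t D in auto)
  then show ?thesis using t D by (simp add: fib_add_def fibm_carrier)
qed

lemma fib_add_comp:
  assumes b: "is_bundle b" and v: "arr v" "cod v = bbase b"
    and f: "f \<in> lifts b v" and g: "g \<in> lifts b v" and k: "arr k" "cod k = dom v"
  shows "fib_add C b f g \<cdot> k = fib_add C b (f \<cdot> k) (g \<cdot> k)"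
proof -
  note t = bpair[OF b v f g] and D = bundleD[OF b]
  have "fib_add C b f g \<cdot> k = bplus b \<cdot> (bpair C b f g \<cdot> k)"
    unfolding fib_add_def by (rule comp_assoc) (use t k D in auto)
  then show ?thesis unfolding bpair_comp[OF assms] fib_add_def .
qed

lemma bundle_laws:
  assumes "is_bundle b"
  shows "fib_add C b (fib_add C b (bprj b 3 0) (bprj b 3 1)) (bprj b 3 2) =
      fib_add C b (bprj b 3 0) (fib_add C b (bprj b 3 1) (bprj b 3 2))"
    and "fib_add C b (bprj b 2 1) (bprj b 2 0) = bplus b"
    and "fib_add C b (Idn C (btot b)) (bzero b \<cdot> bproj b) = Idn C (btot b)"
  using assms unfolding additive_bundle_def fib_add_def by blast+

text \<open>
  The axioms are about the projections out of the fibre powers, which are the universal elements;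
  composing with a tuple of lifts gives the laws for these lifts.
\<close>

lemma comm_monoid_fibm:
  assumes b: "is_bundle b" and v: "arr v" "cod v = bbase b"
  shows "comm_monoid (fib b v)"
proof -
  note D = bundleD[OF b] and L = bundle_laws[OF b]
  note add = fib_add[OF b v] and comp = fib_add_comp[OF b]
  have z: "bproj b \<cdot> (bzero b \<cdot> v) = Idn C (bbase b) \<cdot> v"
    by (rule comp_extend1[OF D(10)]) (use v D in auto)
  have comm: "fib_add C b g f = fib_add C b f g"
    if f: "f \<in> lifts b v" and g: "g \<in> lifts b v" for f g
  proof -
    note t = bpair[OF b v f g]
    have "fib_add C b (bprj b 2 1) (bprj b 2 0) \<cdot> bpair C b f g =
      fib_add C b (bprj b 2 1 \<cdot> bpair C b f g) (bprj b 2 0 \<cdot> bpair C b f g)"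
      by (rule fib_add_comp[OF b D(15,17) bprj_carrier[OF b] bprj_carrier[OF b]]) (use t D in auto)
    then have "fib_add C b (bprj b 2 1) (bprj b 2 0) \<cdot> bpair C b f g = fib_add C b g f" using t by simp
    then show ?thesis unfolding L(2) by (simp add: fib_add_def)
  qed
  have zero: "fib_add C b f (bzero b \<cdot> v) = f" if f: "f \<in> lifts b v" for f
  proof -
    have i: "Idn C (btot b) \<in> lifts b (bproj b)" "bzero b \<cdot> bproj b \<in> lifts b (bproj b)"
      using D comp_extend1[OF D(10), of "bproj b"] Dom_Ob[OF D(1)] by (simp_all add: fibm_carrier)
    have "(bzero b \<cdot> bproj b) \<cdot> f = bzero b \<cdot> (bproj b \<cdot> f)" by (rule comp_assoc) (use fibmD[OF f] D in auto)
    then have "fib_add C b (Idn C (btot b)) (bzero b \<cdot> bproj b) \<cdot> f = fib_add C b f (bzero b \<cdot> v)"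
      using comp[OF D(1,3) i, of f] fibmD[OF f] D by simp
    then show ?thesis unfolding L(3) using fibmD[OF f] by simp
  qed
  have assoc: "fib_add C b (fib_add C b f g) h = fib_add C b f (fib_add C b g h)"
    if f: "f \<in> lifts b v" and g: "g \<in> lifts b v" and h: "h \<in> lifts b v" for f g h
  proof -
    let ?e = "\<lambda>i::nat. if i = 0 then f else if i = 1 then g else h"
    have e: "?e i \<in> lifts b v" for i using f g h by simp
    note t = tup[OF b v, of 3 ?e, OF e]
    have p: "bprj b 3 i \<in> lifts b (bpow b 3)" if "i < 3" for i using bprj_carrier[OF b that] .
    have c: "fib_add C b x y \<cdot> tup C b 3 v ?e = fib_add C b (x \<cdot> tup C b 3 v ?e) (y \<cdot> tup C b 3 v ?e)"
      if "x \<in> lifts b (bpow b 3)" "y \<in> lifts b (bpow b 3)" for x y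
      by (rule fib_add_comp[OF b D(15,17) that t(1)]) (use t D in auto)
    note q = p[of 0, simplified] p[of 1, simplified] p[of 2, simplified]
    note t' = t(5)[of 0, simplified] t(5)[of 1, simplified] t(5)[of 2, simplified]
    have "fib_add C b (fib_add C b (bprj b 3 0) (bprj b 3 1)) (bprj b 3 2) \<cdot> tup C b 3 v ?e = fib_add C b (fib_add C b f g) h"
      using c[OF fib_add[OF b D(15,17) q(1,2)] q(3)] c[OF q(1,2)] t' by simp
    moreover have "fib_add C b (bprj b 3 0) (fib_add C b (bprj b 3 1) (bprj b 3 2)) \<cdot> tup C b 3 v ?e = fib_add C b f (fib_add C b g h)"
      using c[OF q(1) fib_add[OF b D(15,17) q(2,3)]] c[OF q(2,3)] t' by simp
    ultimately show ?thesis unfolding L(1) by simp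
  qed
  show ?thesis
  proof (rule comm_monoidI)
    show "\<one>\<^bsub>fib b v\<^esub> \<in> lifts b v" using z v D by (simp add: fibm_carrier)
    show "\<one>\<^bsub>fib b v\<^esub> \<otimes>\<^bsub>fib b v\<^esub> x = x" if "x \<in> lifts b v" for x
    proof -
      have "bzero b \<cdot> v \<in> lifts b v" using z v D by (simp add: fibm_carrier)
      from comm[OF that this] zero[OF that] show ?thesis by simp
    qed
  qed (use add comm assoc in simp_all)
qed

lemma comp_right_monoid_map:
  assumes b: "is_bundle b" and v: "arr v" "cod v = bbase b" and k: "arr k" "cod k = dom v"
  shows "monoid_map (fib b v) (fib b (v \<cdot> k)) (\<lambda>f. f \<cdot> k)"
proof -
  have "(bzero b \<cdot> v) \<cdot> k = bzero b \<cdot> (v \<cdot> k)"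
    by (rule comp_assoc) (use v k bundleD[OF b] in auto)
  then show ?thesis
    using carrier_comp[OF b _ k] fib_add_comp[OF b v _ _ k] unfolding monoid_map_def by simp
qed

end

section \<open>Additive bundle morphisms and linear combinations\<close>

context cat begin

lemma bundle_morD:
  assumes "bundle_mor b b' f g"
  shows "arr f" "dom f = btot b" "cod f = btot b'" "arr g" "dom g = bbase b" "cod g = bbase b'"
    "bproj b' \<cdot> f = g \<cdot> bproj b" "f \<cdot> bzero b = bzero b' \<cdot> g"
    "f \<cdot> bplus b = fib_add C b' (f \<cdot> bprj b 2 0) (f \<cdot> bprj b 2 1)"
  using assms by (auto simp: additive_bundle_mor_def Hom_iff fib_add_def)

lemma bundle_mor_carrier:
  assumes b: "is_bundle b" and b': "is_bundle b'" and m: "bundle_mor b b' f g"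
    and x: "x \<in> lifts b v"
  shows "f \<cdot> x \<in> lifts b' (g \<cdot> v)"
proof -
  note D = bundleD[OF b] and D' = bundleD[OF b'] and M = bundle_morD[OF m]
  note v = fibm_base[OF b x] and x = fibmD[OF x]
  have "bproj b' \<cdot> (f \<cdot> x) = g \<cdot> (bproj b \<cdot> x)"
    by (rule comp_extend[OF M(7)]) (use x D D' M in auto)
  then show ?thesis using x M v by (simp add: fibm_carrier)
qed

text \<open>The reason why all maps below may be moved past sums.\<close>

lemma bundle_mor_monoid_map:
  assumes b: "is_bundle b" and b': "is_bundle b'" and m: "bundle_mor b b' f g"
    and v: "arr v" "cod v = bbase b"
  shows "monoid_map (fib b v) (fib b' (g \<cdot> v)) (\<lambda>x. f \<cdot> x)"
proof -
  note D = bundleD[OF b] and D' = bundleD[OF b'] and M = bundle_morD[OF m]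
  note c = bundle_mor_carrier[OF b b' m]
  have z: "f \<cdot> (bzero b \<cdot> v) = bzero b' \<cdot> (g \<cdot> v)"
    by (rule comp_extend[OF M(8)]) (use v D D' M in auto)
  have "f \<cdot> fib_add C b x y = fib_add C b' (f \<cdot> x) (f \<cdot> y)"
    if x: "x \<in> lifts b v" and y: "y \<in> lifts b v" for x y
  proof -
    note t = bpair[OF b v x y]
    note pc = c[OF bprj_carrier[OF b]]
    have "f \<cdot> fib_add C b x y = (f \<cdot> bplus b) \<cdot> bpair C b x y"
      unfolding fib_add_def by (rule comp_assoc[symmetric]) (use t D M in auto)
    also have "\<dots> = fib_add C b' ((f \<cdot> bprj b 2 0) \<cdot> bpair C b x y) ((f \<cdot> bprj b 2 1) \<cdot> bpair C b x y)"
      unfolding M(9) by (rule fib_add_comp[OF b' _ _ pc pc]) (use t D M in auto)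
    also have "(f \<cdot> bprj b 2 0) \<cdot> bpair C b x y = f \<cdot> (bprj b 2 0 \<cdot> bpair C b x y)"
      by (rule comp_assoc) (use t D M in auto)
    also have "(f \<cdot> bprj b 2 1) \<cdot> bpair C b x y = f \<cdot> (bprj b 2 1 \<cdot> bpair C b x y)"
      by (rule comp_assoc) (use t D M in auto)
    finally show ?thesis using t by simp
  qed
  then show ?thesis using z c by (simp add: monoid_map_def)
qed

lemma bundle_morI:
  assumes b: "is_bundle b" and b': "is_bundle b'"
    and "arr f" "dom f = btot b" "cod f = btot b'" "arr g" "dom g = bbase b" "cod g = bbase b'"
    "bproj b' \<cdot> f = g \<cdot> bproj b"
    and mm: "monoid_map (fib b (bpow b 2)) (fib b' (g \<cdot> bpow b 2)) (\<lambda>x. f \<cdot> x)"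
    and z: "f \<cdot> bzero b = bzero b' \<cdot> g"
  shows "bundle_mor b b' f g"
proof -
  note D = bundleD[OF b]
  have "fib_add C b (bprj b 2 0) (bprj b 2 1) = bplus b"
    using comm_monoid.m_comm[OF comm_monoid_fibm[OF b D(15,17)] bprj_carrier[OF b] bprj_carrier[OF b], of 1 2 0]
      bundle_laws(2)[OF b] by simp
  then have "f \<cdot> bplus b = fib_add C b' (f \<cdot> bprj b 2 0) (f \<cdot> bprj b 2 1)"
    using mm[unfolded monoid_map_def, THEN conjunct2, THEN conjunct2, THEN bspec, OF bprj_carrier[OF b, of 0 2],
      THEN bspec, OF _ bprj_carrier[OF b, of 1 2]] by simp
  then show ?thesis using assms by (simp add: additive_bundle_mor_def Hom_iff fib_add_def)
qed

lemma bundle_mor_comp: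
  assumes b: "is_bundle b" and b': "is_bundle b'" and b'': "is_bundle b''"
    and m: "bundle_mor b b' f g" and m': "bundle_mor b' b'' f' g'"
  shows "bundle_mor b b'' (f' \<cdot> f) (g' \<cdot> g)"
proof (rule bundle_morI[OF b b''])
  note D = bundleD[OF b] and D' = bundleD[OF b'] and D'' = bundleD[OF b'']
    and M = bundle_morD[OF m] and M' = bundle_morD[OF m']
  show "bproj b'' \<cdot> (f' \<cdot> f) = (g' \<cdot> g) \<cdot> bproj b"
  proof -
    have "bproj b'' \<cdot> (f' \<cdot> f) = g' \<cdot> (bproj b' \<cdot> f)"
      by (rule comp_extend[OF M'(7)]) (use D D' D'' M M' in auto)
    then show ?thesis using M M' D by simp
  qed
  show "(f' \<cdot> f) \<cdot> bzero b = bzero b'' \<cdot> (g' \<cdot> g)"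
  proof -
    have "f' \<cdot> (bzero b' \<cdot> g) = bzero b'' \<cdot> (g' \<cdot> g)"
      by (rule comp_extend[OF M'(8)]) (use D D' D'' M M' in auto)
    then show ?thesis using M M' D by simp
  qed
  have gb: "g \<cdot> bpow b 2 \<in> Ar C" "cod (g \<cdot> bpow b 2) = bbase b'" using D M by auto
  have "(g' \<cdot> g) \<cdot> bpow b 2 = g' \<cdot> (g \<cdot> bpow b 2)" by (rule comp_assoc) (use D M M' in auto)
  then have *: "monoid_map (fib b (bpow b 2)) (fib b'' ((g' \<cdot> g) \<cdot> bpow b 2)) (\<lambda>x. f' \<cdot> (f \<cdot> x))"
    using monoid_map_comp[OF bundle_mor_monoid_map[OF b b' m D(15,17)[of 2]]
      bundle_mor_monoid_map[OF b' b'' m' gb]] by simp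
  show "monoid_map (fib b (bpow b 2)) (fib b'' ((g' \<cdot> g) \<cdot> bpow b 2)) (\<lambda>x. (f' \<cdot> f) \<cdot> x)"
  proof (rule monoid_map_cong[OF comm_monoid_fibm[OF b D(15,17)] *])
    show "(f' \<cdot> f) \<cdot> x = f' \<cdot> (f \<cdot> x)" if "x \<in> lifts b (bpow b 2)" for x
      by (rule comp_assoc) (use fibmD[OF that] M M' in auto)
  qed
qed (use bundle_morD[OF m] bundle_morD[OF m'] in auto)


lemma lincomb_comp:
  assumes b: "is_bundle b" and v: "arr v" "cod v = bbase b" and k: "arr k" "cod k = dom v"
    and e: "\<And>j. j \<in> J \<Longrightarrow> e j \<in> lifts b v"
  shows "lincomb (fib b v) J c e \<cdot> k = lincomb (fib b (v \<cdot> k)) J c (\<lambda>j. e j \<cdot> k)"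
  by (rule monoid_map_lincomb[OF comm_monoid_fibm[OF b v] comm_monoid_fibm[OF b] comp_right_monoid_map[OF b v k] e])
    (use v k in auto)

lemma finprod_comp:
  assumes b: "is_bundle b" and v: "arr v" "cod v = bbase b" and k: "arr k" "cod k = dom v"
    and e: "\<And>j. j \<in> J \<Longrightarrow> e j \<in> lifts b v"
  shows "finprod (fib b v) e J \<cdot> k = finprod (fib b (v \<cdot> k)) (\<lambda>j. e j \<cdot> k) J"
  by (rule monoid_map_finprod[OF comm_monoid_fibm[OF b v] comm_monoid_fibm[OF b] comp_right_monoid_map[OF b v k] e])
    (use v k in auto)

lemma bundle_mor_lincomb:
  assumes b: "is_bundle b" and b': "is_bundle b'" and m: "bundle_mor b b' f g"
    and v: "arr v" "cod v = bbase b" and e: "\<And>j. j \<in> J \<Longrightarrow> e j \<in> lifts b v"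
  shows "f \<cdot> lincomb (fib b v) J c e = lincomb (fib b' (g \<cdot> v)) J c (\<lambda>j. f \<cdot> e j)"
  by (rule monoid_map_lincomb[OF comm_monoid_fibm[OF b v] comm_monoid_fibm[OF b'] bundle_mor_monoid_map[OF b b' m v] e])
    (use v bundle_morD[OF m] in auto)

lemma bundle_mor_finprod:
  assumes b: "is_bundle b" and b': "is_bundle b'" and m: "bundle_mor b b' f g"
    and v: "arr v" "cod v = bbase b" and e: "\<And>j. j \<in> J \<Longrightarrow> e j \<in> lifts b v"
  shows "f \<cdot> finprod (fib b v) e J = finprod (fib b' (g \<cdot> v)) (\<lambda>j. f \<cdot> e j) J"
  by (rule monoid_map_finprod[OF comm_monoid_fibm[OF b v] comm_monoid_fibm[OF b'] bundle_mor_monoid_map[OF b b' m v] e])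
    (use v bundle_morD[OF m] in auto)

lemma lincomb_fibm:
  assumes b: "is_bundle b" and v: "arr v" "cod v = bbase b"
    and e: "\<And>j. j \<in> J \<Longrightarrow> e j \<in> lifts b v"
  shows "lincomb (fib b v) J c e \<in> lifts b v" "finprod (fib b v) e J \<in> lifts b v"
  using comm_monoid.lincomb_closed[OF comm_monoid_fibm[OF b v], of J e c] e
    comm_monoid.finprod_closed[OF comm_monoid_fibm[OF b v], of e J] by auto

section \<open>Matrices acting on the powers of an additive bundle\<close>

lemma ind_ar_eq_tup:
  assumes b: "is_bundle b"
  shows "ind_ar C b a = tup C b (dim_row a) (bpow b (dim_col a))
    (\<lambda>i. lincomb (fib b (bpow b (dim_col a))) {..<dim_col a} (\<lambda>j. a $$ (i, j)) (bprj b (dim_col a)))"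
proof -
  note D = bundleD[OF b]
  let ?m = "dim_col a" let ?G = "fib b (bpow b ?m)"
  interpret G: comm_monoid ?G by (rule comm_monoid_fibm[OF b D(15,17)])
  have pow: "fib_mul C b ?m c f = f [^]\<^bsub>?G\<^esub> c" if "f \<in> carrier ?G" for c f
    using that
  proof (induction c)
    case (Suc c)
    then have "fib_mul C b ?m (Suc c) f = f \<otimes>\<^bsub>?G\<^esub> f [^]\<^bsub>?G\<^esub> c" by (simp add: fib_mul_def)
    then show ?case using G.nat_pow_Suc2[OF Suc.prems, of c] by simp
  qed (simp add: fib_mul_def fib_zero_def)
  have p: "bprj b ?m j [^]\<^bsub>?G\<^esub> (c::nat) \<in> carrier ?G" if "j < ?m" for j c
    using bprj_carrier[OF b that] by blast
  have "foldr (fib_add C b) (map (\<lambda>j. fib_mul C b ?m (a $$ (i, j)) (bprj b ?m j)) [0..<?m]) (fib_zero C b ?m)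
      = lincomb ?G {..<?m} (\<lambda>j. a $$ (i, j)) (bprj b ?m)" for i
  proof -
    have M: "map (\<lambda>j. fib_mul C b ?m (a $$ (i, j)) (bprj b ?m j)) [0..<?m] =
      map (\<lambda>j. bprj b ?m j [^]\<^bsub>?G\<^esub> a $$ (i, j)) [0..<?m]"
      using bprj_carrier[OF b, of _ ?m] by (auto simp: pow)
    show ?thesis unfolding M
      using G.foldr_finprod[of "[0..<?m]" "\<lambda>j. bprj b ?m j [^]\<^bsub>?G\<^esub> a $$ (i, j)"] p
      by (simp add: lincomb_def fib_zero_def atLeast0LessThan)
  qed
  then show ?thesis by (simp add: ind_ar_def Let_def tup_def)
qed

lemma ind_ar:
  assumes b: "is_bundle b"
  shows "ind_ar C b a \<in> Ar C" "dom (ind_ar C b a) = bpowO C b (dim_col a)" "cod (ind_ar C b a) = bpowO C b (dim_row a)"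
    "bpow b (dim_row a) \<cdot> ind_ar C b a = bpow b (dim_col a)"
    "i < dim_row a \<Longrightarrow> bprj b (dim_row a) i \<cdot> ind_ar C b a =
       lincomb (fib b (bpow b (dim_col a))) {..<dim_col a} (\<lambda>j. a $$ (i, j)) (bprj b (dim_col a))"
proof -
  note D = bundleD[OF b]
  have e: "lincomb (fib b (bpow b (dim_col a))) {..<dim_col a} (\<lambda>j. a $$ (i, j)) (bprj b (dim_col a))
      \<in> lifts b (bpow b (dim_col a))" for i
    by (rule lincomb_fibm(1)[OF b D(15,17)]) (use bprj_carrier[OF b] in auto)
  note t = tup[OF b D(15,17) e, where n="dim_row a"]
  show "ind_ar C b a \<in> Ar C" "dom (ind_ar C b a) = bpowO C b (dim_col a)" "cod (ind_ar C b a) = bpowO C b (dim_row a)"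
    "bpow b (dim_row a) \<cdot> ind_ar C b a = bpow b (dim_col a)"
    "i < dim_row a \<Longrightarrow> bprj b (dim_row a) i \<cdot> ind_ar C b a =
       lincomb (fib b (bpow b (dim_col a))) {..<dim_col a} (\<lambda>j. a $$ (i, j)) (bprj b (dim_col a))"
    unfolding ind_ar_eq_tup[OF b] using D(16) by (auto simp: t)
qed

text \<open>On elements the functor is multiplication of a tuple by a matrix.\<close>

lemma ind_ar_tup:
  assumes b: "is_bundle b" and v: "arr v" "cod v = bbase b"
    and e: "\<And>j. j < dim_col a \<Longrightarrow> e j \<in> lifts b v"
  shows "ind_ar C b a \<cdot> tup C b (dim_col a) v e =
    tup C b (dim_row a) v (\<lambda>i. lincomb (fib b v) {..<dim_col a} (\<lambda>j. a $$ (i, j)) e)"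
proof (rule tup_unique[OF b])
  note D = bundleD[OF b] and I = ind_ar[OF b, where a=a]
  let ?t = "tup C b (dim_col a) v e"
  have t: "arr ?t" "dom ?t = dom v" "cod ?t = bpowO C b (dim_col a)" "bpow b (dim_col a) \<cdot> ?t = v"
    "\<And>j. j < dim_col a \<Longrightarrow> bprj b (dim_col a) j \<cdot> ?t = e j"
    using tup[OF b v, of "dim_col a" e] e by auto
  show "bpow b (dim_row a) \<cdot> (ind_ar C b a \<cdot> ?t) = v"
    using comp_extend1[OF I(4), of ?t] I t D by simp
  fix i assume i: "i < dim_row a"
  have "bprj b (dim_row a) i \<cdot> (ind_ar C b a \<cdot> ?t) =
    lincomb (fib b (bpow b (dim_col a))) {..<dim_col a} (\<lambda>j. a $$ (i, j)) (bprj b (dim_col a)) \<cdot> ?t"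
    by (rule comp_extend1[OF I(5)[OF i]]) (use I t D i in auto)
  also have "\<dots> = lincomb (fib b (bpow b (dim_col a) \<cdot> ?t)) {..<dim_col a} (\<lambda>j. a $$ (i, j)) (\<lambda>j. bprj b (dim_col a) j \<cdot> ?t)"
    by (rule lincomb_comp[OF b D(15,17)]) (use t D bprj_carrier[OF b] in auto)
  also have "\<dots> = lincomb (fib b v) {..<dim_col a} (\<lambda>j. a $$ (i, j)) e"
    unfolding t(4) by (rule comm_monoid.lincomb_cong[OF comm_monoid_fibm[OF b v]]) (use t(5) e in auto)
  finally show "bprj b (dim_row a) i \<cdot> (ind_ar C b a \<cdot> ?t) = lincomb (fib b v) {..<dim_col a} (\<lambda>j. a $$ (i, j)) e" .
qed (use ind_ar[OF b, where a=a] tup[OF b v e] in auto)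

lemma ind_ar_one:
  assumes b: "is_bundle b"
  shows "ind_ar C b (1\<^sub>m k) = Idn C (bpowO C b k)"
proof -
  note D = bundleD[OF b]
  have o: "bpowO C b k \<in> Ob C" using Dom_Ob[OF D(15)] D(16) by metis
  have "Idn C (bpowO C b k) = ind_ar C b (1\<^sub>m k)"
    unfolding ind_ar_eq_tup[OF b]
  proof (rule tup_unique[OF b])
    fix i assume i: "i < dim_row (1\<^sub>m k :: nat mat)"
    have "lincomb (fib b (bpow b k)) {..<k} (\<lambda>j. 1\<^sub>m k $$ (i, j)) (bprj b k) = bprj b k i"
      by (rule comm_monoid.lincomb_delta[OF comm_monoid_fibm[OF b D(15,17)]])
        (use i bprj_carrier[OF b] in auto)
    then show "bprj b (dim_row (1\<^sub>m k :: nat mat)) i \<cdot> Idn C (bpowO C b k) =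
      lincomb (fib b (bpow b (dim_col (1\<^sub>m k :: nat mat)))) {..<dim_col (1\<^sub>m k :: nat mat)}
        (\<lambda>j. 1\<^sub>m k $$ (i, j)) (bprj b (dim_col (1\<^sub>m k :: nat mat)))"
      using D i by simp
  qed (use o D in auto)
  then show ?thesis by simp
qed

lemma ind_ar_mult:
  assumes b: "is_bundle b" and d: "dim_col a = dim_row a'"
  shows "ind_ar C b (a * a') = ind_ar C b a \<cdot> ind_ar C b a'"
proof -
  note D = bundleD[OF b]
  let ?m = "dim_col a'" let ?G = "fib b (bpow b ?m)"
  interpret G: comm_monoid ?G by (rule comm_monoid_fibm[OF b D(15,17)])
  have p: "bprj b ?m j \<in> carrier ?G" if "j < ?m" for j using bprj_carrier[OF b that] .
  have e: "lincomb ?G {..<?m} c (bprj b ?m) \<in> carrier ?G" for c using p by auto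
  have "ind_ar C b a \<cdot> ind_ar C b a' = tup C b (dim_row a) (bpow b ?m)
     (\<lambda>i. lincomb ?G {..<dim_row a'} (\<lambda>j. a $$ (i, j)) (\<lambda>i. lincomb ?G {..<?m} (\<lambda>j. a' $$ (i, j)) (bprj b ?m)))"
    unfolding ind_ar_eq_tup[OF b, of a'] using ind_ar_tup[OF b D(15,17), of a _ ?m, OF e] d by simp
  also have "\<dots> = tup C b (dim_row a) (bpow b ?m) (\<lambda>i. lincomb ?G {..<?m} (\<lambda>j. (a * a') $$ (i, j)) (bprj b ?m))"
  proof (rule tup_cong[OF b D(15,17)])
    fix i assume i: "i < dim_row a"
    have "lincomb ?G {..<dim_row a'} (\<lambda>j. a $$ (i, j)) (\<lambda>i. lincomb ?G {..<?m} (\<lambda>j. a' $$ (i, j)) (bprj b ?m)) =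
      lincomb ?G {..<?m} (\<lambda>k. \<Sum>j<dim_row a'. a $$ (i, j) * a' $$ (j, k)) (bprj b ?m)"
      by (rule G.lincomb_lincomb) (use p in auto)
    also have "\<dots> = lincomb ?G {..<?m} (\<lambda>j. (a * a') $$ (i, j)) (bprj b ?m)"
      by (rule G.lincomb_cong) (use p i d in \<open>auto simp: scalar_prod_def atLeast0LessThan\<close>)
    finally show "lincomb ?G {..<dim_row a'} (\<lambda>j. a $$ (i, j)) (\<lambda>i. lincomb ?G {..<?m} (\<lambda>j. a' $$ (i, j)) (bprj b ?m)) =
      lincomb ?G {..<?m} (\<lambda>j. (a * a') $$ (i, j)) (bprj b ?m)" .
  qed (use e in auto)
  finally show ?thesis unfolding ind_ar_eq_tup[OF b, of "a * a'"] by simp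
qed

end

section \<open>Substitution into polynomials with natural coefficients\<close>

abbreviation lookup :: "('k \<Rightarrow>\<^sub>0 'v::zero) \<Rightarrow> 'k \<Rightarrow> 'v" where "lookup \<equiv> Poly_Mapping.lookup"
abbreviation polys :: "wob \<Rightarrow> npoly set" where "polys A \<equiv> npolys (fst A)"
abbreviation single :: "'k \<Rightarrow> 'v \<Rightarrow> 'k \<Rightarrow>\<^sub>0 'v::zero" where "single \<equiv> Poly_Mapping.single"
abbreviation keys :: "('k \<Rightarrow>\<^sub>0 'v::zero) \<Rightarrow> 'k set" where "keys \<equiv> Poly_Mapping.keys"

lemma pmon_mult: "pmon m * pmon m' = pmon (m + m')"
  by (simp add: pmon_def mult_single)

lemma pmon_zero [simp]: "pmon 0 = 1"
  unfolding pmon_def by (rule single_one)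

lemma lookup_pmon: "lookup (pmon m) m' = (if m = m' then 1 else 0)"
  by (simp add: pmon_def lookup_single when_def)

lemma lookup_mvar: "lookup (mvar i) j = (if i = j then 1 else 0)"
  by (simp add: mvar_def lookup_single when_def)

lemma single_eq_of_nat_pmon: "single m c = of_nat c * pmon m"
proof -
  have "of_nat c * pmon m = single 0 c * single m 1"
    unfolding pmon_def by (simp only: single_of_nat[symmetric] of_nat_id)
  then show ?thesis by (simp add: mult_single)
qed

lemma pmon_single: "pmon (single i c) = pvar i ^ c"
proof (induction c)
  case (Suc c)
  have "single i (Suc c) = mvar i + single i c"
    by (simp add: mvar_def single_add[symmetric])
  then show ?case using Suc by (simp add: pmon_mult[symmetric] pvar_def)
qed simp

lemma update_eq_add: "a \<notin> keys f \<Longrightarrow> Poly_Mapping.update a b f = f + single a b"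
  for f :: "'k \<Rightarrow>\<^sub>0 nat"
  by (rule poly_mapping_eqI) (auto simp: lookup_update lookup_add lookup_single when_def in_keys_iff)

lemma npolys_closed [simp, intro]:
  "0 \<in> npolys n" "1 \<in> npolys n" "i < n \<Longrightarrow> pvar i \<in> npolys n"
  "p \<in> npolys n \<Longrightarrow> q \<in> npolys n \<Longrightarrow> p + q \<in> npolys n"
  "p \<in> npolys n \<Longrightarrow> q \<in> npolys n \<Longrightarrow> p * q \<in> npolys n"
proof -
  show "0 \<in> npolys n" "1 \<in> npolys n" "i < n \<Longrightarrow> pvar i \<in> npolys n"
    by (auto simp: npolys_def pvar_def pmon_def mvar_def keys_one)
  assume a: "p \<in> npolys n" "q \<in> npolys n"
  show "p + q \<in> npolys n" using a keys_add[of p q] unfolding npolys_def by blast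
  show "p * q \<in> npolys n"
    unfolding npolys_def
  proof (intro CollectI ballI)
    fix m assume "m \<in> keys (p * q)"
    then obtain a b where m: "m = a + b" and "a \<in> keys p" "b \<in> keys q"
      using keys_mult[of p q] by blast
    then have "keys a \<subseteq> {..<n}" "keys b \<subseteq> {..<n}"
      using a by (auto simp: npolys_def)
    then show "keys m \<subseteq> {..<n}" using keys_add[of a b] unfolding m by blast
  qed
qed

lemma npolys_of_nat [simp, intro]: "of_nat c \<in> npolys n"
  by (induction c) auto

lemma npolys_pmon: "keys m \<subseteq> {..<n} \<Longrightarrow> pmon m \<in> npolys n"
  by (auto simp: npolys_def pmon_def)

lemma npolys_sum [intro]: "(\<And>i. i \<in> I \<Longrightarrow> f i \<in> npolys n) \<Longrightarrow> sum f I \<in> npolys n"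
  by (induction I rule: infinite_finite_induct) auto

text \<open>The polynomials in \<open>n\<close> variables are generated as a semiring by the variables.\<close>

lemma npolys_induct [consumes 1, case_names zero one pvar add mult]:
  assumes p: "p \<in> npolys n" and z: "P 0" and o: "P 1" and v: "\<And>i. i < n \<Longrightarrow> P (pvar i)"
    and a: "\<And>p q. p \<in> npolys n \<Longrightarrow> q \<in> npolys n \<Longrightarrow> P p \<Longrightarrow> P q \<Longrightarrow> P (p + q)"
    and m: "\<And>p q. p \<in> npolys n \<Longrightarrow> q \<in> npolys n \<Longrightarrow> P p \<Longrightarrow> P q \<Longrightarrow> P (p * q)"
  shows "P p"
proof -
  have pw: "P (pvar i ^ c) \<and> pvar i ^ c \<in> npolys n" if "i < n" for i c
    using that by (induction c) (auto intro: o v m)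
  have mon: "keys k \<subseteq> {..<n} \<Longrightarrow> P (pmon k)" for k
  proof (induction k rule: update_induct)
    case const
    then show ?case by (simp add: o)
  next
    case (update f i c)
    then have "keys f \<subseteq> {..<n}" "i < n" by (auto simp: keys_update split: if_splits)
    then show ?case using update pw[of i c]
      by (auto simp del: power_Suc simp: update_eq_add pmon_mult[symmetric] pmon_single intro!: m npolys_pmon)
  qed
  have nat: "P (of_nat c)" for c by (induction c) (auto intro: z o a)
  show ?thesis using p
  proof (induction p rule: update_induct)
    case (update f k c)
    then have "f \<in> npolys n" "keys k \<subseteq> {..<n}" by (auto simp: npolys_def keys_update split: if_splits)
    then show ?case using update by (auto simp: update_eq_add single_eq_of_nat_pmon intro!: a m nat mon npolys_pmon)
  qed (rule z)
qed

lemma npoly_in_npolys: "\<exists>n. p \<in> npolys n"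
proof -
  have "finite (\<Union> (keys ` keys p))" by simp
  then obtain n where "\<forall>i \<in> \<Union> (keys ` keys p). i < n"
    using finite_nat_set_iff_bounded by metis
  then show ?thesis by (intro exI[of _ n]) (auto simp: npolys_def)
qed

definition meval :: "(nat \<Rightarrow> npoly) \<Rightarrow> monomial \<Rightarrow> npoly" where
  "meval g m = (\<Prod>i\<in>keys m. g i ^ lookup m i)"

definition subst :: "(nat \<Rightarrow> npoly) \<Rightarrow> npoly \<Rightarrow> npoly" where
  "subst g p = (\<Sum>m\<in>keys p. of_nat (lookup p m) * meval g m)"

lemma meval_superset:
  "finite S \<Longrightarrow> keys m \<subseteq> S \<Longrightarrow> meval g m = (\<Prod>i\<in>S. g i ^ lookup m i)"
  unfolding meval_def by (rule prod.mono_neutral_left) (auto simp: in_keys_iff)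

lemma meval_add: "meval g (m + m') = meval g m * meval g m'"
proof -
  let ?S = "keys m \<union> keys m'"
  have "meval g (m + m') = (\<Prod>i\<in>?S. g i ^ lookup (m + m') i)"
    by (rule meval_superset) (use keys_add[of m m'] in auto)
  also have "\<dots> = (\<Prod>i\<in>?S. g i ^ lookup m i) * (\<Prod>i\<in>?S. g i ^ lookup m' i)"
    by (simp add: lookup_add power_add prod.distrib)
  also have "\<dots> = meval g m * meval g m'"
    by (subst (1 2) meval_superset[of ?S]) auto
  finally show ?thesis .
qed

lemma subst_superset:
  "finite S \<Longrightarrow> keys p \<subseteq> S \<Longrightarrow> subst g p = (\<Sum>m\<in>S. of_nat (lookup p m) * meval g m)"
  unfolding subst_def by (rule sum.mono_neutral_left) (auto simp: in_keys_iff)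

lemma subst_add [simp]: "subst g (p + q) = subst g p + subst g q"
proof -
  let ?S = "keys p \<union> keys q"
  have "subst g (p + q) = (\<Sum>m\<in>?S. of_nat (lookup (p + q) m) * meval g m)"
    by (rule subst_superset) (use keys_add[of p q] in auto)
  also have "\<dots> = (\<Sum>m\<in>?S. of_nat (lookup p m) * meval g m) + (\<Sum>m\<in>?S. of_nat (lookup q m) * meval g m)"
    by (simp add: lookup_add distrib_right sum.distrib)
  also have "\<dots> = subst g p + subst g q"
    by (subst (1 2) subst_superset[of ?S]) auto
  finally show ?thesis .
qed

lemma subst_zero [simp]: "subst g 0 = 0"
  by (simp add: subst_def)

lemma subst_single: "subst g (single m c) = of_nat c * meval g m"
  by (cases "c = 0") (simp_all add: subst_def)

lemma subst_one [simp]: "subst g 1 = 1"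
  using subst_single[of g 0 1] unfolding single_one by (simp add: meval_def)

lemma subst_pvar [simp]: "subst g (pvar i) = g i"
  using subst_single[of g "mvar i" 1] by (simp add: pvar_def pmon_def meval_def mvar_def)

lemma npoly_induct:
  assumes "P 0" "\<And>p m c. P p \<Longrightarrow> P (p + single m c)"
  shows "P (p :: npoly)"
  by (induction p rule: update_induct) (simp_all add: assms update_eq_add)

lemma subst_mult [simp]: "subst g (p * q) = subst g p * subst g q"
proof (induction p rule: npoly_induct)
  case (2 p m c)
  have "subst g (single m c * q) = subst g (single m c) * subst g q"
    by (induction q rule: npoly_induct)
      (simp_all add: distrib_left mult_single subst_single meval_add algebra_simps)
  then show ?case using 2 by (simp add: distrib_right)
qed simp

lemma subst_of_nat [simp]: "subst g (of_nat c) = of_nat c"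
  by (induction c) simp_all

lemma subst_sum: "subst g (sum f I) = (\<Sum>i\<in>I. subst g (f i))"
  by (induction I rule: infinite_finite_induct) simp_all

lemma subst_npolys:
  assumes "p \<in> npolys n" "\<And>i. i < n \<Longrightarrow> g i \<in> npolys k"
  shows "subst g p \<in> npolys k"
  using assms by (induction p rule: npolys_induct) auto

lemma subst_id [simp]: "subst pvar p = p"
proof -
  obtain n where "p \<in> npolys n" using npoly_in_npolys by blast
  then show ?thesis by (induction p rule: npolys_induct) auto
qed

lemma subst_subst: "subst h (subst g p) = subst (\<lambda>i. subst h (g i)) p"
proof -
  obtain n where "p \<in> npolys n" using npoly_in_npolys by blast
  then show ?thesis by (induction p rule: npolys_induct) auto
qed

section \<open>The congruence defining a Weil algebra\<close>

definition weil_ob :: "wob \<Rightarrow> bool" where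
  "weil_ob A \<longleftrightarrow> equiv {..<fst A} (snd A)"

lemma Ob_weil [simp]: "A \<in> Ob weil \<longleftrightarrow> weil_ob A"
  by (simp add: weil_def weil_ob_def)

lemma weil_ob_less: "weil_ob A \<Longrightarrow> (i, j) \<in> snd A \<Longrightarrow> i < fst A \<and> j < fst A"
  unfolding weil_ob_def equiv_def refl_on_def by blast

lemma weil_ob_refl: "weil_ob A \<Longrightarrow> i < fst A \<Longrightarrow> (i, i) \<in> snd A"
  unfolding weil_ob_def equiv_def refl_on_def by blast

text \<open>The monomials that vanish in the algebra, namely the multiples of the relators.\<close>

definition dead :: "wob \<Rightarrow> monomial \<Rightarrow> bool" where
  "dead A m \<longleftrightarrow> (\<exists>i j m'. (i, j) \<in> snd A \<and> m = mvar i + mvar j + m')"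

lemma dead_add: "dead A m \<Longrightarrow> dead A (m + m')" "dead A m \<Longrightarrow> dead A (m' + m)"
  unfolding dead_def by (metis add.assoc, metis add.assoc add.commute)

lemma dead_iff:
  "dead A m \<longleftrightarrow> (\<exists>i j. (i, j) \<in> snd A \<and> (if i = j then 2 \<le> lookup m i
      else 1 \<le> lookup m i \<and> 1 \<le> lookup m j))"
proof
  assume "dead A m"
  then obtain i j m' where "(i, j) \<in> snd A" "m = mvar i + mvar j + m'" by (auto simp: dead_def)
  then show "\<exists>i j. (i, j) \<in> snd A \<and> (if i = j then 2 \<le> lookup m i
      else 1 \<le> lookup m i \<and> 1 \<le> lookup m j)"
    by (intro exI[of _ i] exI[of _ j]) (auto simp: lookup_add lookup_mvar)
next
  assume "\<exists>i j. (i, j) \<in> snd A \<and> (if i = j then 2 \<le> lookup m i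
      else 1 \<le> lookup m i \<and> 1 \<le> lookup m j)"
  then obtain i j where ij: "(i, j) \<in> snd A" and "if i = j then 2 \<le> lookup m i
      else 1 \<le> lookup m i \<and> 1 \<le> lookup m j" by blast
  then have "m = mvar i + mvar j + (m - (mvar i + mvar j))"
    by (intro poly_mapping_eqI) (auto simp: lookup_add lookup_mvar minus_poly_mapping.rep_eq split: if_splits)
  then show "dead A m" using ij by (auto simp: dead_def)
qed

definition nz :: "wob \<Rightarrow> monomial set" where
  "nz A = {m. keys m \<subseteq> {..<fst A} \<and> \<not> dead A m}"

lemma wcong_npolys:
  assumes "weil_ob A" "(p, q) \<in> wcong A"
  shows "p \<in> polys A \<and> q \<in> polys A"
  using assms(2)
proof induction
  case (gen i j)
  then show ?case using weil_ob_less[OF assms(1)] by auto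
qed auto

lemma lookup_mult_cong:
  fixes p p' q q' :: npoly
  assumes "\<And>l k. m = l + k \<Longrightarrow> lookup p l = lookup q l"
    and "\<And>l k. m = l + k \<Longrightarrow> lookup p' k = lookup q' k"
  shows "lookup (p * p') m = lookup (q * q') m"
  unfolding lookup_mult
proof (rule Sum_any.cong)
  fix l
  have "(lookup p' k when m = l + k) = (lookup q' k when m = l + k)" for k
    using assms(2)[of l k] by (auto simp: when_def)
  then have i: "(\<Sum>k. lookup p' k when m = l + k) = (\<Sum>k. lookup q' k when m = l + k)"
    by simp
  show "lookup p l * (\<Sum>k. lookup p' k when m = l + k) =
    lookup q l * (\<Sum>k. lookup q' k when m = l + k)"
  proof (cases "\<exists>k. m = l + k")
    case True
    then show ?thesis using assms(1) i by auto
  next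
    case False
    then have "m \<noteq> l + k" for k by blast
    then show ?thesis by simp
  qed
qed

text \<open>
  A coefficient of a product involves only divisors of its monomial, and the divisors of a monomial
  that is not a multiple of a relator are of the same kind; so none of the closure rules changes such a coefficient.
\<close>

lemma wcong_lookup:
  assumes "(p, q) \<in> wcong A" "\<not> dead A m"
  shows "lookup p m = lookup q m"
  using assms
proof (induction arbitrary: m)
  case (gen i j)
  then have "m \<noteq> mvar i + mvar j" unfolding dead_def by (metis add.right_neutral)
  then show ?case by (auto simp: pvar_def pmon_mult lookup_pmon)
next
  case (mult p q p' q')
  then show ?case by (intro lookup_mult_cong) (metis dead_add)+
qed (simp_all add: lookup_add)

lemma wcong_dead:
  assumes A: "weil_ob A" and "keys m \<subseteq> {..<fst A}" "dead A m"
  shows "(pmon m, 0) \<in> wcong A"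
proof -
  obtain i j m' where ij: "(i, j) \<in> snd A" and m: "m = mvar i + mvar j + m'" using assms by (auto simp: dead_def)
  have "keys m' \<subseteq> keys m" unfolding m by (auto simp: in_keys_iff lookup_add)
  then have "pmon m' \<in> polys A" using assms by (intro npolys_pmon) auto
  then have "(pvar i * pvar j * pmon m', 0 * pmon m') \<in> wcong A"
    using ij by (intro wcong.mult wcong.gen wcong.refl)
  then show ?thesis by (simp add: m pvar_def pmon_mult)
qed

lemma wcong_of_nat_mult: "(p, 0) \<in> wcong A \<Longrightarrow> (of_nat c * p, 0) \<in> wcong A"
  using wcong.mult[OF wcong.refl[of "of_nat c" A], of p 0] by auto

text \<open>
  Conversely, all multiples of relators can be deleted from a polynomial. Hence the algebra is
  the free module on the monomials in \<open>nz A\<close>.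
\<close>

lemma wcong_iff:
  assumes A: "weil_ob A"
  shows "(p, q) \<in> wcong A \<longleftrightarrow> p \<in> polys A \<and> q \<in> polys A \<and>
    (\<forall>m\<in>nz A. lookup p m = lookup q m)"
proof
  assume "(p, q) \<in> wcong A"
  then show "p \<in> polys A \<and> q \<in> polys A \<and> (\<forall>m\<in>nz A. lookup p m = lookup q m)"
    using wcong_npolys[OF A] wcong_lookup by (auto simp: nz_def)
next
  \<comment> \<open>The reduction of a polynomial, with all vanishing monomials removed.\<close>
  define red :: "npoly \<Rightarrow> npoly" where "red p = Poly_Mapping.mapp (\<lambda>m c. if dead A m then 0 else c) p" for p
  have lr: "lookup (red p) m = (if dead A m then 0 else lookup p m)" for p m
    by (auto simp: red_def lookup_mapp when_def in_keys_iff)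
  have radd: "red (p + q) = red p + red q" for p q
    by (rule poly_mapping_eqI) (simp add: lr lookup_add)
  have *: "p \<in> polys A \<Longrightarrow> (p, red p) \<in> wcong A" for p
  proof (induction p rule: update_induct)
    case const
    have "red 0 = 0" by (rule poly_mapping_eqI) (simp add: lr)
    then show ?case by (simp add: wcong.refl)
  next
    case (update f m c)
    then have f: "f \<in> polys A" and m: "keys m \<subseteq> {..<fst A}"
      by (auto simp: npolys_def keys_update split: if_splits)
    have "(single m c, red (single m c)) \<in> wcong A"
    proof (cases "dead A m")
      case True
      have "red (single m c) = 0"
        by (rule poly_mapping_eqI) (use True in \<open>auto simp: lr lookup_single when_def\<close>)
      then show ?thesis using wcong_of_nat_mult[OF wcong_dead[OF A m True]] by (simp add: single_eq_of_nat_pmon)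
    next
      case False
      have "red (single m c) = single m c"
        by (rule poly_mapping_eqI) (use False in \<open>auto simp: lr lookup_single when_def\<close>)
      then show ?thesis using m by (auto simp: single_eq_of_nat_pmon intro!: wcong.refl npolys_pmon)
    qed
    then show ?case using update f by (simp add: update_eq_add radd wcong.add)
  qed
  assume a: "p \<in> polys A \<and> q \<in> polys A \<and> (\<forall>m\<in>nz A. lookup p m = lookup q m)"
  have "red p = red q"
  proof (rule poly_mapping_eqI)
    fix m
    have "lookup p m = lookup q m" if "\<not> dead A m"
    proof (cases "keys m \<subseteq> {..<fst A}")
      case False
      then have "m \<notin> keys p" "m \<notin> keys q" using a by (auto simp: npolys_def)
      then show ?thesis by (simp add: in_keys_iff)
    qed (use a that in \<open>auto simp: nz_def\<close>)
    then show "lookup (red p) m = lookup (red q) m" by (simp add: lr)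
  qed
  then show "(p, q) \<in> wcong A" using *[of p] *[of q] a by (metis wcong.sym wcong.trans)
qed

lemma nz_alt: "weil_ob A \<Longrightarrow> nz A = {m. keys m \<subseteq> {..<fst A} \<and> (pmon m, 0) \<notin> wcong A}"
  using wcong_dead[of A] wcong_lookup[of "pmon m" 0 A m for m] by (auto simp: nz_def lookup_pmon)

text \<open>
  Reflexivity of the relation makes all squares of generators zero, so that there are finitely many
  nonzero monomials.
\<close>

lemma nz_le_one: "weil_ob A \<Longrightarrow> m \<in> nz A \<Longrightarrow> lookup m i \<le> 1"
proof (cases "i < fst A")
  case True
  assume "weil_ob A" "m \<in> nz A"
  then show ?thesis using weil_ob_refl[OF _ True] unfolding nz_def dead_iff by fastforce
next
  case False
  assume "m \<in> nz A"
  then have "i \<notin> keys m" using False by (auto simp: nz_def)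
  then show ?thesis by (simp add: in_keys_iff)
qed

lemma finite_nz: assumes A: "weil_ob A" shows "finite (nz A)"
proof (rule inj_on_finite[of keys _ "Pow {..<fst A}"])
  show "inj_on keys (nz A)"
  proof (rule inj_onI, rule poly_mapping_eqI)
    fix m m' i assume m: "m \<in> nz A" "m' \<in> nz A" "keys m = keys m'"
    have "lookup m i = 0 \<longleftrightarrow> lookup m' i = 0" using m(3) by (metis in_keys_iff)
    then show "lookup m i = lookup m' i"
      using nz_le_one[OF A m(1), of i] nz_le_one[OF A m(2), of i] by linarith
  qed
qed (auto simp: nz_def)

lemma zero_nz [simp]: "0 \<in> nz A"
  by (auto simp: nz_def dead_iff)

lemma wbasis:
  assumes "weil_ob A"
  shows "set (wbasis A) = nz A" "distinct (wbasis A)" "wdim A = card (nz A)"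
  using finite_nz[OF assms] by (simp_all add: wbasis_def wdim_def nz_alt[OF assms, symmetric])

lemma wbasis_nth_nz: "weil_ob A \<Longrightarrow> p < wdim A \<Longrightarrow> wbasis A ! p \<in> nz A"
  using wbasis(1)[of A] by (metis nth_mem wdim_def)

lemma wpos_nth: assumes "weil_ob A" "p < wdim A" shows "wpos A (wbasis A ! p) = p"
  unfolding wpos_def using assms wbasis(2)[OF assms(1)] by (auto simp: wdim_def nth_eq_iff_index_eq)

lemma wpos: assumes "weil_ob A" "m \<in> nz A" shows "wpos A m < wdim A" "wbasis A ! wpos A m = m"
proof -
  obtain p where p: "p < wdim A" "wbasis A ! p = m" using assms wbasis(1)[OF assms(1)] by (metis in_set_conv_nth wdim_def)
  show "wpos A m < wdim A" "wbasis A ! wpos A m = m" using wpos_nth[OF assms(1) p(1)] p by auto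
qed

lemma bij_betw_wbasis: assumes "weil_ob A" shows "bij_betw ((!) (wbasis A)) {..<wdim A} (nz A)"
  unfolding wdim_def wbasis(1)[OF assms, symmetric] by (rule bij_betw_nth) (use wbasis[OF assms] in auto)

section \<open>Morphisms of Weil algebras\<close>

lemma equiv_wcong: assumes A: "weil_ob A" shows "equiv (polys A) (wcong A)"
  by (rule equivI) (use wcong_npolys[OF A] in \<open>auto intro!: refl_onI symI transI intro: wcong.refl wcong.sym wcong.trans\<close>)

lemma wcls_eq_iff: "weil_ob A \<Longrightarrow> p \<in> polys A \<Longrightarrow> q \<in> polys A \<Longrightarrow> wcls A p = wcls A q \<longleftrightarrow> (p, q) \<in> wcong A"
  unfolding wcls_def by (rule eq_equiv_class_iff[OF equiv_wcong])

lemma wcls_carrier [simp, intro]: "p \<in> polys A \<Longrightarrow> wcls A p \<in> carrier (walg A)"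
  by (auto simp: walg_def wcls_def intro: quotientI)

lemma wrep:
  assumes A: "weil_ob A" and a: "a \<in> carrier (walg A)"
  shows "wrep a \<in> polys A" "wcls A (wrep a) = a"
proof -
  obtain p where p: "p \<in> polys A" "a = wcls A p" using a by (auto simp: walg_def wcls_def elim: quotientE)
  have "p \<in> a" using p by (simp add: wcls_def wcong.refl)
  then have "wrep a \<in> a" unfolding wrep_def by (rule someI)
  then have "(p, wrep a) \<in> wcong A" by (simp add: p wcls_def)
  then show "wrep a \<in> polys A" "wcls A (wrep a) = a"
    using wcong_npolys[OF A] wcls_eq_iff[OF A, of p "wrep a"] p by auto
qed

lemma wrep_wcls: "weil_ob A \<Longrightarrow> p \<in> polys A \<Longrightarrow> (wrep (wcls A p), p) \<in> wcong A"
  using wrep[of A "wcls A p"] wcls_eq_iff by blast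

lemma wcoeff_wcls: "weil_ob A \<Longrightarrow> p \<in> polys A \<Longrightarrow> m \<in> nz A \<Longrightarrow> wcoeff (wcls A p) m = lookup p m"
  using wcong_lookup[OF wrep_wcls] by (auto simp: wcoeff_def nz_def)

lemma walg_ops:
  assumes A: "weil_ob A"
  shows "\<zero>\<^bsub>walg A\<^esub> = wcls A 0" "\<one>\<^bsub>walg A\<^esub> = wcls A 1"
    "p \<in> polys A \<Longrightarrow> q \<in> polys A \<Longrightarrow> wcls A p \<oplus>\<^bsub>walg A\<^esub> wcls A q = wcls A (p + q)"
    "p \<in> polys A \<Longrightarrow> q \<in> polys A \<Longrightarrow> wcls A p \<otimes>\<^bsub>walg A\<^esub> wcls A q = wcls A (p * q)"
proof -
  show "\<zero>\<^bsub>walg A\<^esub> = wcls A 0" "\<one>\<^bsub>walg A\<^esub> = wcls A 1" by (simp_all add: walg_def)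
  assume pq: "p \<in> polys A" "q \<in> polys A"
  note r = wrep_wcls[OF A pq(1)] wrep_wcls[OF A pq(2)] and n = wcong_npolys[OF A]
  show "wcls A p \<oplus>\<^bsub>walg A\<^esub> wcls A q = wcls A (p + q)"
    using wcong.add[OF r] n[OF wcong.add[OF r]] by (simp add: walg_def wcls_eq_iff[OF A])
  show "wcls A p \<otimes>\<^bsub>walg A\<^esub> wcls A q = wcls A (p * q)"
    using wcong.mult[OF r] n[OF wcong.mult[OF r]] by (simp add: walg_def wcls_eq_iff[OF A])
qed

text \<open>The assignments of polynomials to generators that respect the relations.\<close>

definition wlift :: "wob \<Rightarrow> wob \<Rightarrow> (nat \<Rightarrow> npoly) \<Rightarrow> bool" where
  "wlift A B g \<longleftrightarrow> weil_ob A \<and> weil_ob B \<and> (\<forall>i<fst A. g i \<in> polys B) \<and>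
     (\<forall>i j. (i, j) \<in> snd A \<longrightarrow> (g i * g j, 0) \<in> wcong B)"

lemma wlift_subst:
  assumes g: "wlift A B g"
  shows "p \<in> polys A \<Longrightarrow> subst g p \<in> polys B"
    and "(p, q) \<in> wcong A \<Longrightarrow> (subst g p, subst g q) \<in> wcong B"
proof -
  show n: "p \<in> polys A \<Longrightarrow> subst g p \<in> polys B" for p
    using g by (intro subst_npolys[of p "fst A"]) (auto simp: wlift_def)
  assume "(p, q) \<in> wcong A"
  then show "(subst g p, subst g q) \<in> wcong B"
  proof induction
    case (gen i j)
    then show ?case using g by (simp add: wlift_def)
  qed (auto intro: wcong.refl wcong.sym wcong.trans wcong.add wcong.mult n)
qed

definition wapp :: "war \<Rightarrow> npoly set \<Rightarrow> npoly set" where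
  "wapp f = snd (snd f)"

lemma Hom_weil: "f \<in> Hom weil A B \<longleftrightarrow> weil_ob A \<and> weil_ob B \<and> wapp f \<in> whom A B \<and> f = (A, B, wapp f)"
  by (cases f) (auto simp: Hom_def weil_def weil_ob_def wapp_def)

lemma whomD:
  assumes "h \<in> whom A B" "weil_ob A" "weil_ob B"
  shows "a \<in> carrier (walg A) \<Longrightarrow> h a \<in> carrier (walg B)" "h (wcls A 0) = wcls B 0" "h (wcls A 1) = wcls B 1"
    "p \<in> polys A \<Longrightarrow> q \<in> polys A \<Longrightarrow> h (wcls A (p + q)) = h (wcls A p) \<oplus>\<^bsub>walg B\<^esub> h (wcls A q)"
    "p \<in> polys A \<Longrightarrow> q \<in> polys A \<Longrightarrow> h (wcls A (p * q)) = h (wcls A p) \<otimes>\<^bsub>walg B\<^esub> h (wcls A q)"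
proof -
  have h: "h \<in> ring_hom (walg A) (walg B)" "h \<zero>\<^bsub>walg A\<^esub> = \<zero>\<^bsub>walg B\<^esub>" using assms(1) by (auto simp: whom_def)
  show "a \<in> carrier (walg A) \<Longrightarrow> h a \<in> carrier (walg B)" using ring_hom_closed[OF h(1)] .
  show "h (wcls A 0) = wcls B 0" "h (wcls A 1) = wcls B 1"
    using h ring_hom_one[OF h(1)] by (simp_all add: walg_ops assms)
  assume pq: "p \<in> polys A" "q \<in> polys A"
  show "h (wcls A (p + q)) = h (wcls A p) \<oplus>\<^bsub>walg B\<^esub> h (wcls A q)"
    using ring_hom_add[OF h(1), of "wcls A p" "wcls A q"] pq by (simp add: walg_ops[OF assms(2)])
  show "h (wcls A (p * q)) = h (wcls A p) \<otimes>\<^bsub>walg B\<^esub> h (wcls A q)"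
    using ring_hom_mult[OF h(1), of "wcls A p" "wcls A q"] pq by (simp add: walg_ops[OF assms(2)])
qed

lemma whom_subst:
  assumes h: "h \<in> whom A B" "weil_ob A" "weil_ob B"
    and g: "\<And>i. i < fst A \<Longrightarrow> g i \<in> polys B \<and> h (wcls A (pvar i)) = wcls B (g i)"
    and p: "p \<in> polys A"
  shows "h (wcls A p) = wcls B (subst g p)"
proof -
  note H = whomD[OF h]
  have "subst g p \<in> polys B \<and> h (wcls A p) = wcls B (subst g p)"
    using p by (induction p rule: npolys_induct) (auto simp: H g walg_ops[OF h(3)])
  then show ?thesis by simp
qed

text \<open>The universal property of the presentation: substitution respects the congruence.\<close>

lemma ex_wlift_hom:
  assumes g: "wlift A B g"
  shows "\<exists>f. f \<in> Hom weil A B \<and> (\<forall>p\<in>polys A. wapp f (wcls A p) = wcls B (subst g p))"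
proof -
  have AB: "weil_ob A" "weil_ob B" using g by (auto simp: wlift_def)
  define h where "h = (\<lambda>a \<in> carrier (walg A). wcls B (subst g (wrep a)))"
  have h: "h (wcls A p) = wcls B (subst g p)" if p: "p \<in> polys A" for p
    using wlift_subst[OF g] wrep_wcls[OF AB(1) p] wrep[OF AB(1) wcls_carrier[OF p]] p
    by (simp add: h_def wcls_eq_iff[OF AB(2)])
  have op: "h (wcls A p \<oplus>\<^bsub>walg A\<^esub> wcls A q) = h (wcls A p) \<oplus>\<^bsub>walg B\<^esub> h (wcls A q)"
    "h (wcls A p \<otimes>\<^bsub>walg A\<^esub> wcls A q) = h (wcls A p) \<otimes>\<^bsub>walg B\<^esub> h (wcls A q)"
    if "p \<in> polys A" "q \<in> polys A" for p q
    using that wlift_subst(1)[OF g] by (simp_all add: walg_ops[OF AB(1)] walg_ops[OF AB(2)] h)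
  have "h \<in> ring_hom (walg A) (walg B)"
  proof (rule ring_hom_memI)
    fix a assume a: "a \<in> carrier (walg A)"
    then show "h a \<in> carrier (walg B)" using wlift_subst(1)[OF g] wrep[OF AB(1) a] by (auto simp: h_def)
    fix b assume b: "b \<in> carrier (walg A)"
    show "h (a \<otimes>\<^bsub>walg A\<^esub> b) = h a \<otimes>\<^bsub>walg B\<^esub> h b" "h (a \<oplus>\<^bsub>walg A\<^esub> b) = h a \<oplus>\<^bsub>walg B\<^esub> h b"
      using op[OF wrep(1)[OF AB(1) a] wrep(1)[OF AB(1) b]] wrep(2)[OF AB(1) a] wrep(2)[OF AB(1) b] by simp_all
  qed (simp add: walg_ops[OF AB(1)] walg_ops[OF AB(2)] h)
  then have "h \<in> whom A B" by (simp add: whom_def walg_ops[OF AB(1)] walg_ops[OF AB(2)] h, simp add: h_def)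
  then show ?thesis using h AB by (intro exI[of _ "(A, B, h)"]) (simp add: Hom_weil wapp_def)
qed

lemma hom_weil_eqI:
  assumes f: "f \<in> Hom weil A B" "f' \<in> Hom weil A B"
    and eq: "\<And>i. i < fst A \<Longrightarrow> wapp f (wcls A (pvar i)) = wapp f' (wcls A (pvar i))"
  shows "f = f'"
proof -
  have AB: "weil_ob A" "weil_ob B" and h: "wapp f \<in> whom A B" "wapp f' \<in> whom A B"
    and ff: "f = (A, B, wapp f)" "f' = (A, B, wapp f')" using f by (auto simp: Hom_weil)
  define g where "g i = wrep (wapp f (wcls A (pvar i)))" for i
  have g: "g i \<in> polys B \<and> wapp f (wcls A (pvar i)) = wcls B (g i)" if "i < fst A" for i
    using wrep[OF AB(2), of "wapp f (wcls A (pvar i))"] whomD(1)[OF h(1) AB] that by (simp add: g_def)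
  have g': "g i \<in> polys B \<and> wapp f' (wcls A (pvar i)) = wcls B (g i)" if "i < fst A" for i
    using g[OF that] eq[OF that] by simp
  have "wapp f a = wapp f' a" for a
  proof (cases "a \<in> carrier (walg A)")
    case True
    then show ?thesis
      using whom_subst[OF h(1) AB g wrep(1)[OF AB(1) True]] whom_subst[OF h(2) AB g' wrep(1)[OF AB(1) True]]
        wrep(2)[OF AB(1) True] by simp
  next
    case False
    have "wapp f \<in> extensional (carrier (walg A))" "wapp f' \<in> extensional (carrier (walg A))"
      using h by (simp_all add: whom_def)
    then show ?thesis using False by (simp add: extensional_def)
  qed
  then have "wapp f = wapp f'" by blast
  then show ?thesis using ff by metis
qed

lemma weil_map:
  assumes g: "wlift A B g"
  shows "weil_map A B g \<in> Hom weil A B"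
    and "p \<in> polys A \<Longrightarrow> wapp (weil_map A B g) (wcls A p) = wcls B (subst g p)"
proof -
  have AB: "weil_ob A" "weil_ob B" using g by (auto simp: wlift_def)
  obtain f where f: "f \<in> Hom weil A B" "\<And>p. p\<in>polys A \<Longrightarrow> wapp f (wcls A p) = wcls B (subst g p)"
    using ex_wlift_hom[OF g] by blast
  have "weil_map A B g = f"
    unfolding weil_map_def wapp_def[symmetric]
  proof (rule the_equality)
    show "f \<in> Hom weil A B \<and> (\<forall>i<fst A. wapp f (wcls A (pvar i)) = wcls B (g i))" using f by simp
    fix f' assume f': "f' \<in> Hom weil A B \<and> (\<forall>i<fst A. wapp f' (wcls A (pvar i)) = wcls B (g i))"
    then show "f' = f" using f by (intro hom_weil_eqI[of f' A B f]) auto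
  qed
  then show "weil_map A B g \<in> Hom weil A B"
    and "p \<in> polys A \<Longrightarrow> wapp (weil_map A B g) (wcls A p) = wcls B (subst g p)" using f by auto
qed

text \<open>
  Choosing representatives of the images of the generators turns computations with morphisms into
  substitutions.
\<close>

lemma hom_weilE:
  assumes f: "f \<in> Hom weil A B"
  obtains g where "wlift A B g" "f = weil_map A B g"
proof -
  have AB: "weil_ob A" "weil_ob B" and h: "wapp f \<in> whom A B" using f by (auto simp: Hom_weil)
  define g where "g i = wrep (wapp f (wcls A (pvar i)))" for i
  have g: "g i \<in> polys B \<and> wapp f (wcls A (pvar i)) = wcls B (g i)" if "i < fst A" for i
    using wrep[OF AB(2), of "wapp f (wcls A (pvar i))"] whomD(1)[OF h(1) AB] that by (simp add: g_def)
  have "(g i * g j, 0) \<in> wcong B" if ij: "(i, j) \<in> snd A" for i j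
  proof -
    have l: "i < fst A" "j < fst A" using weil_ob_less[OF AB(1) ij] by auto
    have "wcls A (pvar i * pvar j) = wcls A 0" using wcong.gen[OF ij] l wcls_eq_iff[OF AB(1)] by auto
    then have "wcls B (g i * g j) = wcls B 0"
      using whom_subst[OF h AB g, of "pvar i * pvar j"] whomD(2)[OF h AB] l by simp
    then show ?thesis using wcls_eq_iff[OF AB(2)] g l by auto
  qed
  then have w: "wlift A B g" using AB g by (auto simp: wlift_def)
  moreover have "f = weil_map A B g"
    by (rule hom_weil_eqI[OF f weil_map(1)[OF w]]) (use g weil_map(2)[OF w] in auto)
  ultimately show ?thesis using that by blast
qed

lemma weil_map_cong:
  assumes g: "wlift A B g" "wlift A B h" and eq: "\<And>i. i < fst A \<Longrightarrow> (g i, h i) \<in> wcong B"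
  shows "weil_map A B g = weil_map A B h"
proof (rule hom_weil_eqI[OF weil_map(1)[OF g(1)] weil_map(1)[OF g(2)]])
  fix i assume i: "i < fst A"
  have B: "weil_ob B" using g by (simp add: wlift_def)
  show "wapp (weil_map A B g) (wcls A (pvar i)) = wapp (weil_map A B h) (wcls A (pvar i))"
    using weil_map(2)[OF g(1), of "pvar i"] weil_map(2)[OF g(2), of "pvar i"] i wcong_npolys[OF B eq[OF i]]
      eq[OF i] wcls_eq_iff[OF B] by simp
qed

lemma wlift_cong:
  assumes "wlift A B g" "\<And>i. i < fst A \<Longrightarrow> g i = h i"
  shows "wlift A B h"
  using assms weil_ob_less[of A] unfolding wlift_def by metis

lemma weil_map_cong':
  assumes g: "wlift A B g" and eq: "\<And>i. i < fst A \<Longrightarrow> g i = h i"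
  shows "weil_map A B g = weil_map A B h"
proof (rule weil_map_cong[OF g wlift_cong[OF g eq]])
  show "(g i, h i) \<in> wcong B" if "i < fst A" for i
    unfolding eq[OF that, symmetric] using g that by (auto simp: wlift_def intro: wcong.refl)
qed

lemma wlift_comp:
  assumes "wlift A B g" "wlift B C h"
  shows "wlift A C (\<lambda>i. subst h (g i))"
proof -
  have "(subst h (g i) * subst h (g j), 0) \<in> wcong C" if "(i, j) \<in> snd A" for i j
    using assms(1) that wlift_subst(2)[OF assms(2), of "g i * g j" 0] by (simp add: wlift_def)
  then show ?thesis using assms wlift_subst(1)[OF assms(2)] by (simp add: wlift_def)
qed

section \<open>The category of Weil algebras\<close>

lemma wliftD:
  assumes "wlift A B g"
  shows "weil_ob A" "weil_ob B" "i < fst A \<Longrightarrow> g i \<in> polys B" "(i, j) \<in> snd A \<Longrightarrow> (g i * g j, 0) \<in> wcong B"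
  using assms by (auto simp: wlift_def)

lemma weil_hom_extI:
  assumes F: "F \<in> Hom weil A B" and e: "h \<in> extensional (carrier (walg A))"
    and eq: "\<And>p. p \<in> polys A \<Longrightarrow> h (wcls A p) = wapp F (wcls A p)"
  shows "(A, B, h) = F"
proof -
  have AB: "weil_ob A" and h: "wapp F \<in> whom A B" and ff: "F = (A, B, wapp F)" using F by (auto simp: Hom_weil)
  have "h a = wapp F a" for a
  proof (cases "a \<in> carrier (walg A)")
    case True
    then show ?thesis using eq[OF wrep(1)[OF AB True]] wrep(2)[OF AB True] by simp
  next
    case False
    have "wapp F \<in> extensional (carrier (walg A))" using h by (simp add: whom_def)
    then show ?thesis using e False by (simp add: extensional_def)
  qed
  then have "h = wapp F" by blast
  then show ?thesis using ff by simp
qed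

lemma weil_map_comp:
  assumes g: "wlift A B g" and h: "wlift B C h"
  shows "weil_map B C h \<cdot>\<^bsub>weil\<^esub> weil_map A B g = weil_map A C (\<lambda>i. subst h (g i))"
proof -
  note gh = wlift_comp[OF g h]
  have f: "weil_map A B g = (A, B, wapp (weil_map A B g))" "weil_map B C h = (B, C, wapp (weil_map B C h))"
    using weil_map(1)[OF g] weil_map(1)[OF h] Hom_weil by blast+
  have "weil_map B C h \<cdot>\<^bsub>weil\<^esub> weil_map A B g =
    (A, C, compose (carrier (walg A)) (wapp (weil_map B C h)) (wapp (weil_map A B g)))"
    by (subst f(1), subst f(2)) (simp add: weil_def)
  also have "\<dots> = weil_map A C (\<lambda>i. subst h (g i))"
    by (rule weil_hom_extI[OF weil_map(1)[OF gh]])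
      (use wlift_subst(1)[OF g] in \<open>auto simp: compose_def weil_map(2)[OF g] weil_map(2)[OF h] weil_map(2)[OF gh] subst_subst\<close>)
  finally show ?thesis .
qed

lemma wlift_id: "weil_ob A \<Longrightarrow> wlift A A pvar"
  by (auto simp: wlift_def intro: wcong.gen)

lemma Idn_weil: "weil_ob A \<Longrightarrow> Idn weil A = weil_map A A pvar"
  using weil_hom_extI[OF weil_map(1)[OF wlift_id], of A "\<lambda>a\<in>carrier (walg A). a"] weil_map(2)[OF wlift_id, of A]
  by (simp add: weil_def)

lemma category_weil: "category weil"
  unfolding category_def
proof (intro conjI allI ballI)
  fix f assume "f \<in> Ar weil"
  then show "Dom weil f \<in> Ob weil" "Cod weil f \<in> Ob weil" by (auto simp: weil_def)
next
  fix x assume "x \<in> Ob weil"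
  then show "Idn weil x \<in> Hom weil x x" using weil_map(1)[OF wlift_id] Idn_weil by simp
next
  fix A B C f g assume "f \<in> Hom weil A B" "g \<in> Hom weil B C"
  then show "g \<cdot>\<^bsub>weil\<^esub> f \<in> Hom weil A C"
    by (elim hom_weilE) (simp add: weil_map_comp weil_map(1)[OF wlift_comp])
next
  fix A B f assume "f \<in> Hom weil A B"
  then obtain g where g: "wlift A B g" "f = weil_map A B g" by (elim hom_weilE)
  note AB = wliftD(1,2)[OF g(1)]
  show "f \<cdot>\<^bsub>weil\<^esub> Idn weil A = f" "Idn weil B \<cdot>\<^bsub>weil\<^esub> f = f"
    using g AB by (simp_all add: Idn_weil weil_map_comp[OF wlift_id g(1)] weil_map_comp[OF g(1) wlift_id])
next
  fix A B C D f g h assume "f \<in> Hom weil A B" "g \<in> Hom weil B C" "h \<in> Hom weil C D"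
  then show "h \<cdot>\<^bsub>weil\<^esub> g \<cdot>\<^bsub>weil\<^esub> f = h \<cdot>\<^bsub>weil\<^esub> (g \<cdot>\<^bsub>weil\<^esub> f)"
    by (elim hom_weilE) (simp add: weil_map_comp wlift_comp subst_subst)
qed

interpretation weil: cat weil
  by unfold_locales (rule category_weil)

lemma weil_ob_Dom_Cod [simp]: "\<theta> \<in> Ar weil \<Longrightarrow> weil_ob (Dom weil \<theta>)" "\<theta> \<in> Ar weil \<Longrightarrow> weil_ob (Cod weil \<theta>)"
  using weil.Dom_Ob weil.Cod_Ob Ob_weil by blast+

lemma weil_map_Ar [simp]:
  assumes "wlift A B g"
  shows "weil_map A B g \<in> Ar weil" "Dom weil (weil_map A B g) = A" "Cod weil (weil_map A B g) = B"
  using weil_map(1)[OF assms] by (auto simp: weil.Hom_iff)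

section \<open>The coproduct of Weil algebras\<close>

lemma wten_simps [simp]: "fst (wten A B) = fst A + fst B"
  by (simp add: wten_def)

lemma snd_wten: "(i, j) \<in> snd (wten A B) \<longleftrightarrow> (i, j) \<in> snd A \<or>
   (fst A \<le> i \<and> fst A \<le> j \<and> (i - fst A, j - fst A) \<in> snd B)"
  by (force simp: wten_def image_iff)

lemma ob_wten [simp, intro]:
  assumes A: "weil_ob A" and B: "weil_ob B"
  shows "weil_ob (wten A B)"
  unfolding weil_ob_def
proof (rule equivI)
  note l = weil_ob_less[OF A] weil_ob_less[OF B]
  show "snd (wten A B) \<subseteq> {..<fst (wten A B)} \<times> {..<fst (wten A B)}"
    using l by (fastforce simp: snd_wten)
  show "refl_on {..<fst (wten A B)} (snd (wten A B))"
  proof (rule refl_onI)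
    fix i assume i: "i \<in> {..<fst (wten A B)}"
    show "(i, i) \<in> snd (wten A B)"
      using i weil_ob_refl[OF A, of i] weil_ob_refl[OF B, of "i - fst A"] by (cases "i < fst A") (auto simp: snd_wten)
  qed
  show "sym (snd (wten A B))"
    using A B unfolding weil_ob_def equiv_def sym_def by (auto simp: snd_wten)
  show "trans (snd (wten A B))"
  proof (rule transI)
    fix i j k assume a: "(i, j) \<in> snd (wten A B)" "(j, k) \<in> snd (wten A B)"
    have "trans (snd A)" "trans (snd B)" using A B by (auto simp: weil_ob_def equiv_def)
    then show "(i, k) \<in> snd (wten A B)"
      using a l unfolding snd_wten by (smt (verit, best) linorder_not_less transE)
  qed
qed

lemma ob_wunit [simp, intro]: "weil_ob wunit"
  by (auto simp: weil_ob_def wunit_def equiv_def refl_on_def sym_def trans_def)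

lemma wunit_simps [simp]: "fst wunit = 0" "snd wunit = {}"
  by (simp_all add: wunit_def)

lemma ob_Wpow [simp, intro]: "weil_ob (Wpow n)"
  by (auto simp: weil_ob_def Wpow_def equiv_def refl_on_def sym_def trans_def)

lemma Wpow_simps [simp]: "fst (Wpow n) = n" "(i, j) \<in> snd (Wpow n) \<longleftrightarrow> i < n \<and> j < n"
  by (auto simp: Wpow_def)

lemma Wpow_0: "Wpow 0 = wunit"
  by (simp add: Wpow_def wunit_def)

definition pshift :: "nat \<Rightarrow> npoly \<Rightarrow> npoly" where
  "pshift n = subst (\<lambda>j. pvar (n + j))"

lemma wlift_inl: "weil_ob A \<Longrightarrow> weil_ob B \<Longrightarrow> wlift A (wten A B) pvar"
  by (auto simp: wlift_def snd_wten intro!: wcong.gen)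

lemma wlift_inr: "weil_ob A \<Longrightarrow> weil_ob B \<Longrightarrow> wlift B (wten A B) (\<lambda>j. pvar (fst A + j))"
  by (auto simp: wlift_def snd_wten intro!: wcong.gen)

definition wcotuple :: "wob \<Rightarrow> (nat \<Rightarrow> npoly) \<Rightarrow> (nat \<Rightarrow> npoly) \<Rightarrow> nat \<Rightarrow> npoly" where
  "wcotuple A g h i = (if i < fst A then g i else h (i - fst A))"

lemma wlift_cotuple:
  assumes "wlift A C g" "wlift B C h"
  shows "wlift (wten A B) C (wcotuple A g h)"
  using assms weil_ob_less[OF wliftD(1)[OF assms(1)]]
  by (auto simp: wlift_def snd_wten wcotuple_def)

text \<open>The generators of a coproduct are those of the two factors, and the morphism is determined there.\<close>

lemma wtena_weil_map:
  assumes g: "wlift A A' g" and h: "wlift B B' h"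
  shows "wlift (wten A B) (wten A' B') (wcotuple A g (\<lambda>i. pshift (fst A') (h i)))"
    and "wtena (weil_map A A' g) (weil_map B B' h) =
      weil_map (wten A B) (wten A' B') (wcotuple A g (\<lambda>i. pshift (fst A') (h i)))"
proof -
  note AB = wliftD(1,2)[OF g] wliftD(1,2)[OF h]
  have g': "wlift A (wten A' B') g" using wlift_comp[OF g wlift_inl[OF AB(2,4)]] by simp
  have h': "wlift B (wten A' B') (\<lambda>i. pshift (fst A') (h i))"
    unfolding pshift_def using wlift_comp[OF h wlift_inr[OF AB(2,4)]] .
  let ?t = "wcotuple A g (\<lambda>i. pshift (fst A') (h i))"
  show t: "wlift (wten A B) (wten A' B') ?t" by (rule wlift_cotuple[OF g' h'])
  have L: "winl A' B' \<cdot>\<^bsub>weil\<^esub> weil_map A A' g = weil_map A (wten A' B') g"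
    by (simp add: winl_def weil_map_comp[OF g wlift_inl[OF AB(2,4)]])
  have R: "winr A' B' \<cdot>\<^bsub>weil\<^esub> weil_map B B' h = weil_map B (wten A' B') (\<lambda>i. pshift (fst A') (h i))"
    by (simp add: winr_def weil_map_comp[OF h wlift_inr[OF AB(2,4)]] pshift_def)
  show "wtena (weil_map A A' g) (weil_map B B' h) = weil_map (wten A B) (wten A' B') ?t"
    unfolding wtena_def weil_map_Ar[OF g] weil_map_Ar[OF h] L R
  proof (rule the_equality, intro conjI)
    show "weil_map (wten A B) (wten A' B') ?t \<in> Hom weil (wten A B) (wten A' B')" by (rule weil_map(1)[OF t])
    show "weil_map (wten A B) (wten A' B') ?t \<cdot>\<^bsub>weil\<^esub> winl A B = weil_map A (wten A' B') g"
      unfolding winl_def weil_map_comp[OF wlift_inl[OF AB(1,3)] t]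
      by (rule weil_map_cong'[OF wlift_comp[OF wlift_inl[OF AB(1,3)] t]]) (simp add: wcotuple_def)
    show "weil_map (wten A B) (wten A' B') ?t \<cdot>\<^bsub>weil\<^esub> winr A B = weil_map B (wten A' B') (\<lambda>i. pshift (fst A') (h i))"
      unfolding winr_def weil_map_comp[OF wlift_inr[OF AB(1,3)] t]
      by (rule weil_map_cong'[OF wlift_comp[OF wlift_inr[OF AB(1,3)] t]]) (simp add: wcotuple_def)
  next
    fix k assume k: "k \<in> Hom weil (wten A B) (wten A' B') \<and>
      k \<cdot>\<^bsub>weil\<^esub> winl A B = weil_map A (wten A' B') g \<and>
      k \<cdot>\<^bsub>weil\<^esub> winr A B = weil_map B (wten A' B') (\<lambda>i. pshift (fst A') (h i))"
    then obtain s where s: "wlift (wten A B) (wten A' B') s" "k = weil_map (wten A B) (wten A' B') s"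
      by (auto elim: hom_weilE)
    have sl: "weil_map A (wten A' B') s = weil_map A (wten A' B') g"
      using k weil_map_comp[OF wlift_inl[OF AB(1,3)] s(1)] unfolding s(2) winl_def by simp
    have sr: "weil_map B (wten A' B') (\<lambda>i. s (fst A + i)) = weil_map B (wten A' B') (\<lambda>i. pshift (fst A') (h i))"
      using k weil_map_comp[OF wlift_inr[OF AB(1,3)] s(1)] unfolding s(2) winr_def by simp
    have ls: "wlift A (wten A' B') s" using wlift_comp[OF wlift_inl[OF AB(1,3)] s(1)] by simp
    have rs: "wlift B (wten A' B') (\<lambda>i. s (fst A + i))" using wlift_comp[OF wlift_inr[OF AB(1,3)] s(1)] by simp
    show "k = weil_map (wten A B) (wten A' B') ?t"
      unfolding s(2)
    proof (rule hom_weil_eqI[OF weil_map(1)[OF s(1)] weil_map(1)[OF t]])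
      fix i assume i: "i < fst (wten A B)"
      have "wcls (wten A' B') (s i) = wcls (wten A' B') (?t i)"
      proof (cases "i < fst A")
        case True
        then show ?thesis using weil_map(2)[OF ls, of "pvar i"] weil_map(2)[OF g', of "pvar i"] sl
          by (simp add: wcotuple_def)
      next
        case False
        then have "i - fst A < fst B" using i by auto
        then show ?thesis using weil_map(2)[OF rs, of "pvar (i - fst A)"] weil_map(2)[OF h', of "pvar (i - fst A)"] sr False
          by (simp add: wcotuple_def)
      qed
      then show "wapp (weil_map (wten A B) (wten A' B') s) (wcls (wten A B) (pvar i)) =
        wapp (weil_map (wten A B) (wten A' B') ?t) (wcls (wten A B) (pvar i))"
        using i by (simp add: weil_map(2)[OF s(1)] weil_map(2)[OF t])
    qed
  qed
qed

lemma wtena_Hom: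
  assumes "f \<in> Hom weil A A'" "g \<in> Hom weil B B'"
  shows "wtena f g \<in> Hom weil (wten A B) (wten A' B')"
  using assms by (elim hom_weilE) (simp add: wtena_weil_map weil_map(1)[OF wtena_weil_map(1)])

subsection \<open>Basis monomials of a coproduct\<close>

lemma lookup_mshift: "lookup (mshift n m) k = (if n \<le> k then lookup m (k - n) else 0)"
proof -
  have "lookup (mshift n m) k = (\<Sum>i\<in>keys m. if i = k - n \<and> n \<le> k then lookup m i else 0)"
    unfolding mshift_def lookup_sum by (rule sum.cong) (auto simp: lookup_single when_def)
  also have "\<dots> = (if n \<le> k then lookup m (k - n) else 0)"
    by (auto simp: sum.delta in_keys_iff)
  finally show ?thesis .
qed

lemma lookup_add_mshift:
  assumes "keys m \<subseteq> {..<n}"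
  shows "lookup (m + mshift n m') k =
    (if k < n then lookup m k else lookup m' (k - n))"
proof -
  have "lookup m k = 0" if "n \<le> k" using assms that by (force simp: in_keys_iff)
  then show ?thesis by (simp add: lookup_add lookup_mshift)
qed

lemma dead_wten:
  assumes A: "weil_ob A" and B: "weil_ob B" and m: "keys m \<subseteq> {..<fst A}"
  shows "dead (wten A B) (m + mshift (fst A) m') \<longleftrightarrow> dead A m \<or> dead B m'"
proof
  assume "dead (wten A B) (m + mshift (fst A) m')"
  then obtain i j where ij: "(i, j) \<in> snd (wten A B)"
    and l: "if i = j then 2 \<le> lookup (m + mshift (fst A) m') i
      else 1 \<le> lookup (m + mshift (fst A) m') i \<and> 1 \<le> lookup (m + mshift (fst A) m') j"
    unfolding dead_iff by blast
  from ij show "dead A m \<or> dead B m'" unfolding snd_wten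
  proof
    assume ij: "(i, j) \<in> snd A"
    then have "dead A m" unfolding dead_iff
      using l weil_ob_less[OF A ij] by (intro exI[of _ i] exI[of _ j]) (auto simp: lookup_add_mshift[OF m] split: if_splits)
    then show ?thesis ..
  next
    assume ij: "fst A \<le> i \<and> fst A \<le> j \<and> (i - fst A, j - fst A) \<in> snd B"
    then have "dead B m'" unfolding dead_iff
      using l by (intro exI[of _ "i - fst A"] exI[of _ "j - fst A"])
        (auto simp: lookup_add_mshift[OF m] split: if_splits)
    then show ?thesis ..
  qed
next
  assume "dead A m \<or> dead B m'"
  then show "dead (wten A B) (m + mshift (fst A) m')"
  proof
    assume "dead A m"
    then obtain i j where "(i, j) \<in> snd A"
      "if i = j then 2 \<le> lookup m i else 1 \<le> lookup m i \<and> 1 \<le> lookup m j"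
      unfolding dead_iff by blast
    then show ?thesis unfolding dead_iff using weil_ob_less[OF A, of i j]
      by (intro exI[of _ i] exI[of _ j]) (cases "i = j"; simp add: lookup_add_mshift[OF m] snd_wten)
  next
    assume "dead B m'"
    then obtain i j where "(i, j) \<in> snd B"
      "if i = j then 2 \<le> lookup m' i else 1 \<le> lookup m' i \<and> 1 \<le> lookup m' j"
      unfolding dead_iff by blast
    then show ?thesis unfolding dead_iff
      by (intro exI[of _ "fst A + i"] exI[of _ "fst A + j"]) (cases "i = j"; simp add: lookup_add_mshift[OF m] snd_wten)
  qed
qed

abbreviation mten :: "wob \<Rightarrow> monomial \<Rightarrow> monomial \<Rightarrow> monomial" where
  "mten A m m' \<equiv> m + mshift (fst A) m'"

text \<open>
  A relator of the coproduct involves generators of one factor only, so that a monomial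
  vanishes exactly if one of its two parts does.
\<close>

lemma nz_wten:
  assumes A: "weil_ob A" and B: "weil_ob B"
  shows "bij_betw (\<lambda>(m, m'). m + mshift (fst A) m') (nz A \<times> nz B) (nz (wten A B))"
  unfolding bij_betw_def
proof
  show "inj_on (\<lambda>(m, m'). m + mshift (fst A) m') (nz A \<times> nz B)"
  proof (rule inj_onI, clarify)
    fix m m' k k' assume a: "m \<in> nz A" "m' \<in> nz B" "k \<in> nz A" "k' \<in> nz B"
      and eq: "m + mshift (fst A) m' = k + mshift (fst A) k'"
    have ks: "keys m \<subseteq> {..<fst A}" "keys k \<subseteq> {..<fst A}" using a by (auto simp: nz_def)
    have l: "(if i < fst A then lookup m i else lookup m' (i - fst A)) =
       (if i < fst A then lookup k i else lookup k' (i - fst A))" for i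
      using eq lookup_add_mshift[OF ks(1)] lookup_add_mshift[OF ks(2)] by metis
    have "lookup m i = lookup k i" for i
    proof (cases "i < fst A")
      case False
      then have "i \<notin> keys m" "i \<notin> keys k" using ks by auto
      then show ?thesis by (simp add: in_keys_iff)
    qed (use l[of i] in simp)
    moreover have "lookup m' i = lookup k' i" for i using l[of "fst A + i"] by simp
    ultimately show "m = k \<and> m' = k'" by (blast intro: poly_mapping_eqI)
  qed
  show "(\<lambda>(m, m'). m + mshift (fst A) m') ` (nz A \<times> nz B) = nz (wten A B)"
  proof (intro equalityI subsetI)
    fix x assume "x \<in> (\<lambda>(m, m'). m + mshift (fst A) m') ` (nz A \<times> nz B)"
    then obtain m m' where x: "x = m + mshift (fst A) m'" and m: "m \<in> nz A" "m' \<in> nz B" by auto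
    have "keys x \<subseteq> {..<fst A + fst B}"
    proof
      fix i assume "i \<in> keys x"
      moreover have "keys m \<subseteq> {..<fst A}" using m by (simp add: nz_def)
      ultimately have "i < fst A \<or> i - fst A \<in> keys m'"
        unfolding x in_keys_iff by (auto simp: lookup_add_mshift split: if_splits)
      then show "i \<in> {..<fst A + fst B}" using m by (auto simp: nz_def)
    qed
    then show "x \<in> nz (wten A B)" using m dead_wten[OF A B, of m m'] by (simp add: nz_def x)
  next
    fix x assume x: "x \<in> nz (wten A B)"
    define m where "m = Poly_Mapping.mapp (\<lambda>i c. if i < fst A then c else 0) x"
    define m' where "m' = Poly_Mapping.map_key (\<lambda>i. fst A + i) x"
    have lm: "lookup m i = (if i < fst A then lookup x i else 0)" for i
      by (auto simp: m_def lookup_mapp when_def in_keys_iff)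
    have lm': "lookup m' i = lookup x (fst A + i)" for i
      by (simp add: m'_def map_key.rep_eq)
    have km: "keys m \<subseteq> {..<fst A}" by (auto simp: in_keys_iff lm split: if_splits)
    have km': "keys m' \<subseteq> {..<fst B}"
    proof
      fix i assume "i \<in> keys m'"
      then have "fst A + i \<in> keys x" by (simp add: in_keys_iff lm')
      then show "i \<in> {..<fst B}" using x by (auto simp: nz_def)
    qed
    have eq: "x = m + mshift (fst A) m'"
      by (rule poly_mapping_eqI) (simp add: lookup_add_mshift[OF km] lm lm')
    have "m \<in> nz A" "m' \<in> nz B" using x km km' dead_wten[OF A B km, of m'] eq by (auto simp: nz_def)
    then show "x \<in> (\<lambda>(m, m'). m + mshift (fst A) m') ` (nz A \<times> nz B)" using eq by auto
  qed
qed

lemma pshift_pmon: "pshift n (pmon m) = pmon (mshift n m)"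
proof (induction m rule: update_induct)
  case const
  have "mshift n 0 = 0" by (simp add: mshift_def)
  then show ?case by (simp add: pshift_def)
next
  case (update f i c)
  have "mshift n (f + single i c) = mshift n f + single (n + i) c"
    by (rule poly_mapping_eqI) (auto simp: lookup_mshift lookup_add lookup_single when_def)
  moreover have "subst g (pvar i ^ k) = g i ^ k" for g k by (induction k) auto
  ultimately show ?case using update by (simp add: update_eq_add pmon_mult[symmetric] pmon_single pshift_def)
qed

section \<open>Square-zero elements and the algebras W^n\<close>

lemma wcong_zero_iff:
  assumes "weil_ob A"
  shows "(p, 0) \<in> wcong A \<longleftrightarrow> p \<in> polys A \<and> (\<forall>m\<in>keys p. dead A m)"
proof -
  have "(\<forall>m\<in>nz A. lookup p m = lookup 0 m) \<longleftrightarrow> (\<forall>m\<in>keys p. dead A m)"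
    if "p \<in> polys A"
  proof -
    have "keys m \<subseteq> {..<fst A}" if "m \<in> keys p" for m
      using \<open>p \<in> polys A\<close> that by (auto simp: npolys_def)
    note k = this
    show ?thesis
    proof (intro iffI ballI)
      fix m assume a: "\<forall>m\<in>nz A. lookup p m = lookup 0 m" and m: "m \<in> keys p"
      show "dead A m"
      proof (rule ccontr)
        assume "\<not> dead A m"
        then have "m \<in> nz A" using k[OF m] by (simp add: nz_def)
        then show False using a m by (simp add: in_keys_iff)
      qed
    next
      fix m assume "\<forall>m\<in>keys p. dead A m" "m \<in> nz A"
      then have "m \<notin> keys p" by (auto simp: nz_def)
      then show "lookup p m = lookup 0 m" by (simp add: in_keys_iff)
    qed
  qed
  then show ?thesis unfolding wcong_iff[OF assms] by blast
qed

text \<open>This fails over the integers, where terms can cancel.\<close>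

lemma keys_times:
  fixes p q :: npoly
  assumes "a \<in> keys p" "b \<in> keys q"
  shows "a + b \<in> keys (p * q)"
proof -
  \<comment> \<open>Splitting off one monomial of each factor leaves a remainder with coefficients at least \<open>0\<close>.\<close>
  define p' where "p' = p - single a (lookup p a)"
  define q' where "q' = q - single b (lookup q b)"
  have p: "p = single a (lookup p a) + p'"
    by (rule poly_mapping_eqI) (simp add: p'_def lookup_add minus_poly_mapping.rep_eq lookup_single when_def)
  have q: "q = single b (lookup q b) + q'"
    by (rule poly_mapping_eqI) (simp add: q'_def lookup_add minus_poly_mapping.rep_eq lookup_single when_def)
  have "p * q = (single a (lookup p a) + p') * (single b (lookup q b) + q')"
    by (rule arg_cong2[OF p q])
  also have "\<dots> = single (a + b) (lookup p a * lookup q b) +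
     (single a (lookup p a) * q' + p' * (single b (lookup q b) + q'))"
    by (simp add: algebra_simps mult_single)
  finally have "lookup (p * q) (a + b) \<ge> lookup p a * lookup q b"
    by (simp add: lookup_add)
  moreover have "0 < lookup p a * lookup q b" using assms by (simp add: in_keys_iff)
  ultimately have "lookup (p * q) (a + b) \<noteq> 0" by linarith
  then show ?thesis by (simp add: in_keys_iff)
qed

lemma add_eq_zero_monomial: "m + m' = 0 \<longleftrightarrow> m = 0 \<and> m' = (0 :: monomial)"
proof
  assume "m + m' = 0"
  then have "lookup m i + lookup m' i = 0" for i by (metis lookup_add lookup_zero)
  then show "m = 0 \<and> m' = 0" by (auto intro: poly_mapping_eqI)
qed simp

lemma dead_square: assumes A: "weil_ob A" and m: "keys m \<subseteq> {..<fst A}" "m \<noteq> 0" shows "dead A (m + m)"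
proof -
  have "keys m \<noteq> {}" using m(2) by (metis all_not_in_conv in_keys_iff lookup_zero poly_mapping_eqI)
  then obtain i where i: "i \<in> keys m" by blast
  then have "(i, i) \<in> snd A" using m weil_ob_refl[OF A] by auto
  then show ?thesis unfolding dead_iff using i by (intro exI[of _ i]) (auto simp: lookup_add in_keys_iff)
qed

text \<open>
  A nonconstant monomial has square zero, hence so has its image; as nothing cancels, all products of
  two monomials of the image vanish.
\<close>

lemma wlift_keys_dead:
  assumes g: "wlift A B g" and m: "m \<in> nz A" "m \<noteq> 0"
    and ab: "a \<in> keys (subst g (pmon m))" "b \<in> keys (subst g (pmon m))"
  shows "dead B (a + b)"
proof -
  note AB = wliftD(1,2)[OF g]
  have k: "keys m \<subseteq> {..<fst A}" using m by (simp add: nz_def)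
  then have "keys (m + m) \<subseteq> {..<fst A}" using keys_add[of m m] by blast
  then have "(pmon (m + m), 0) \<in> wcong A" by (rule wcong_dead[OF AB(1) _ dead_square[OF AB(1) k m(2)]])
  then have "(subst g (pmon m) * subst g (pmon m), 0) \<in> wcong B"
    using wlift_subst(2)[OF g] by (fastforce simp: pmon_mult[symmetric])
  then show ?thesis using keys_times[OF ab] wcong_zero_iff[OF AB(2)] by blast
qed

lemma not_dead_zero: "\<not> dead A 0"
  by (auto simp: dead_iff)

lemma wlift_no_constant:
  assumes g: "wlift A B g" and m: "m \<in> nz A" "m \<noteq> 0"
  shows "0 \<notin> keys (subst g (pmon m))"
  using wlift_keys_dead[OF g m, of 0 0] not_dead_zero by auto

lemma mvar_nz: assumes "weil_ob A" "i < fst A" shows "mvar i \<in> nz A" "mvar i \<noteq> 0"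
proof -
  show "mvar i \<noteq> 0" by (metis lookup_mvar lookup_zero zero_neq_one)
  show "mvar i \<in> nz A" using assms by (auto simp: nz_def mvar_def dead_iff lookup_single when_def split: if_splits)
qed

lemma wlift_gen_no_constant:
  assumes g: "wlift A B g" and i: "i < fst A"
  shows "0 \<notin> keys (g i)"
  using wlift_no_constant[OF g mvar_nz[OF wliftD(1)[OF g] i]] by (simp add: pvar_def[symmetric])

lemma dead_Wpow:
  assumes "keys m \<subseteq> {..<n}" "keys m' \<subseteq> {..<n}" "m \<noteq> 0" "m' \<noteq> 0"
  shows "dead (Wpow n) (m + m')"
proof -
  have "keys m \<noteq> {}" "keys m' \<noteq> {}"
    using assms by (metis all_not_in_conv in_keys_iff lookup_zero poly_mapping_eqI)+
  then obtain i j where i: "i \<in> keys m" "j \<in> keys m'" by blast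
  moreover have "i < n" "j < n" using i assms by auto
  ultimately have "i < n" "j < n" "0 < lookup m i" "0 < lookup m' j"
    by (auto simp: in_keys_iff)
  then show ?thesis unfolding dead_iff
    by (intro exI[of _ i] exI[of _ j]) (cases "i = j"; simp add: lookup_add)
qed

lemma nz_Wpow: "nz (Wpow n) = insert 0 (mvar ` {..<n})"
proof (intro equalityI subsetI)
  fix m assume m: "m \<in> nz (Wpow n)"
  show "m \<in> insert 0 (mvar ` {..<n})"
  proof (cases "m = 0")
    case False
    then obtain i where i: "i \<in> keys m" by (metis all_not_in_conv in_keys_iff lookup_zero poly_mapping_eqI)
    then have n: "i < n" using m by (auto simp: nz_def)
    have "lookup m j = lookup (mvar i) j" for j
    proof (cases "j = i")
      case True
      then show ?thesis using nz_le_one[OF ob_Wpow m, of i] i by (simp add: lookup_mvar in_keys_iff)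
    next
      case False
      have "lookup m j = 0"
      proof (rule ccontr)
        assume "lookup m j \<noteq> 0"
        then have j: "j \<in> keys m" by (simp add: in_keys_iff)
        then have "j < n" using m by (auto simp: nz_def)
        then have "dead (Wpow n) m" unfolding dead_iff using i j n False
          by (intro exI[of _ i] exI[of _ j]) (simp add: in_keys_iff)
        then show False using m by (simp add: nz_def)
      qed
      then show ?thesis using False by (simp add: lookup_mvar)
    qed
    then have "m = mvar i" by (rule poly_mapping_eqI)
    then show ?thesis using n by simp
  qed simp
qed (use mvar_nz(1)[of "Wpow n"] in auto)

lemma inj_mvar: "inj mvar"
  by (rule injI) (metis lookup_mvar zero_neq_one)

lemma nz_wunit: "nz wunit = {0}"
  using nz_Wpow[of 0] by (simp add: Wpow_0)

lemma wlift_Wpow: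
  assumes "weil_ob A" "\<And>i. i < fst A \<Longrightarrow> g i \<in> npolys n" "\<And>i. i < fst A \<Longrightarrow> 0 \<notin> keys (g i)"
  shows "wlift A (Wpow n) g"
proof -
  have "(g i * g j, 0) \<in> wcong (Wpow n)" if ij: "(i, j) \<in> snd A" for i j
  proof -
    have l: "i < fst A" "j < fst A" using weil_ob_less[OF assms(1) ij] by auto
    have "dead (Wpow n) m" if m: "m \<in> keys (g i * g j)" for m
    proof -
      obtain a b where ab: "m = a + b" "a \<in> keys (g i)" "b \<in> keys (g j)"
        using keys_mult[of "g i" "g j"] m by blast
      then show ?thesis using assms(2,3)[OF l(1)] assms(2,3)[OF l(2)]
        by (auto simp: npolys_def intro!: dead_Wpow)
    qed
    then show ?thesis using assms(2) l by (simp add: wcong_zero_iff)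
  qed
  then show ?thesis using assms by (simp add: wlift_def)
qed

lemma zero_notin_keys_pvar [simp]: "0 \<notin> keys (pvar i)"
  using mvar_nz(2)[of "Wpow (Suc i)" i] by (auto simp: pvar_def pmon_def)

lemma zero_notin_keys_add: "0 \<notin> keys p \<Longrightarrow> 0 \<notin> keys q \<Longrightarrow> 0 \<notin> keys (p + q :: npoly)"
  by (simp add: in_keys_iff lookup_add)

lemma zero_notin_keys_of_nat: "0 \<notin> keys p \<Longrightarrow> 0 \<notin> keys (of_nat c * p :: npoly)"
  by (induction c) (auto simp: distrib_right zero_notin_keys_add)

lemma wlift_wunit: "weil_ob A \<Longrightarrow> wlift wunit A g"
  by (simp add: wlift_def)

lemma wlift_zero: "weil_ob A \<Longrightarrow> weil_ob B \<Longrightarrow> wlift A B (\<lambda>_. 0)"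
  by (auto simp: wlift_def intro: wcong.refl)

lemma weil_map_wunit: "weil_ob A \<Longrightarrow> weil_map wunit A g = weil_map wunit A h"
  by (rule weil_map_cong') (auto intro: wlift_wunit)

lemma weil_map_to_wunit:
  assumes g: "wlift A wunit g"
  shows "weil_map A wunit g = waug A"
  unfolding waug_def
proof (rule weil_map_cong[OF g wlift_zero])
  fix i assume i: "i < fst A"
  show "(g i, 0) \<in> wcong wunit"
    using wlift_gen_no_constant[OF g i] wliftD(3)[OF g i] by (auto simp: wcong_iff nz_wunit in_keys_iff)
qed (use wliftD(1)[OF g] in auto)

subsection \<open>Morphisms into W^n are families of vectors\<close>

text \<open>An element of \<open>W^n\<close> without constant term.\<close>

definition lin :: "nat \<Rightarrow> (nat \<Rightarrow> nat) \<Rightarrow> npoly" where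
  "lin n c = (\<Sum>j<n. of_nat (c j) * pvar j)"

lemma lookup_lin: "lookup (lin n c) (mvar k) = (if k < n then c k else 0)"
  "lookup (lin n c) 0 = 0"
proof -
  have m: "mvar j = mvar k \<longleftrightarrow> j = k" for j using inj_mvar by (auto dest: injD)
  have "lookup (lin n c) (mvar k) = (\<Sum>j<n. if j = k then c j else 0)"
    unfolding lin_def lookup_sum pvar_def single_eq_of_nat_pmon[symmetric]
    by (rule sum.cong) (auto simp: lookup_single when_def m)
  then show "lookup (lin n c) (mvar k) = (if k < n then c k else 0)" by simp
  have "mvar j \<noteq> 0" for j using mvar_nz(2)[of "Wpow (Suc j)" j] by simp
  then show "lookup (lin n c) 0 = 0"
    unfolding lin_def lookup_sum pvar_def single_eq_of_nat_pmon[symmetric] by (simp add: lookup_single when_def)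
qed

lemma lin_npolys [simp]: "lin n c \<in> npolys n"
  by (auto simp: lin_def)

lemma wlift_lin: "weil_ob Z \<Longrightarrow> wlift Z (Wpow n) (\<lambda>i. lin n (c i))"
  by (rule wlift_Wpow) (auto simp: in_keys_iff lookup_lin)

text \<open>The image of a generator squares to zero, so it has no constant term and is a vector of coefficients.\<close>

lemma hom_WpowE:
  assumes f: "f \<in> Hom weil Z (Wpow n)"
  obtains c where "f = weil_map Z (Wpow n) (\<lambda>i. lin n (c i))"
proof -
  obtain a where a: "wlift Z (Wpow n) a" "f = weil_map Z (Wpow n) a" using f by (elim hom_weilE)
  have "f = weil_map Z (Wpow n) (\<lambda>i. lin n (\<lambda>j. lookup (a i) (mvar j)))"
    unfolding a(2)
  proof (rule weil_map_cong[OF a(1) wlift_lin[OF wliftD(1)[OF a(1)]]])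
    fix i assume i: "i < fst Z"
    show "(a i, lin n (\<lambda>j. lookup (a i) (mvar j))) \<in> wcong (Wpow n)"
      using wlift_gen_no_constant[OF a(1) i] wliftD(3)[OF a(1) i]
      by (auto simp: wcong_iff nz_Wpow lookup_lin in_keys_iff)
  qed
  then show ?thesis by (rule that)
qed

lemma weil_map_lin_eq:
  assumes Z: "weil_ob Z" and eq: "weil_map Z (Wpow n) (\<lambda>i. lin n (c i)) = weil_map Z (Wpow n) (\<lambda>i. lin n (d i))"
    and "i < fst Z" "j < n"
  shows "c i j = d i j"
proof -
  have "wcls (Wpow n) (lin n (c i)) = wcls (Wpow n) (lin n (d i))"
    using weil_map(2)[OF wlift_lin[OF Z, of n c], of "pvar i"] weil_map(2)[OF wlift_lin[OF Z, of n d], of "pvar i"] eq assms(3)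
    by simp
  then have "(lin n (c i), lin n (d i)) \<in> wcong (Wpow n)" by (simp add: wcls_eq_iff)
  then have "lookup (lin n (c i)) (mvar j) = lookup (lin n (d i)) (mvar j)"
    using assms(4) by (simp add: wcong_iff nz_Wpow)
  then show ?thesis using assms(4) by (simp add: lookup_lin)
qed

lemma subst_lin: "subst g (lin n c) = (\<Sum>j<n. of_nat (c j) * g j)"
  by (simp add: lin_def subst_sum)

text \<open>
  A morphism to \<open>W^n\<close> is a family of vectors, and vectors of length \<open>n + 1\<close> are pairs.
\<close>

lemma Wpow_product:
  "is_product weil (weil_map (Wpow (Suc n)) (Wpow n) (\<lambda>i. if i < n then pvar i else 0)) (Wproj (Suc n) n)"
proof -
  let ?l = "\<lambda>i. if i < n then pvar i else 0" let ?r = "\<lambda>i. if i = n then pvar 0 else 0"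
  have l: "wlift (Wpow (Suc n)) (Wpow n) ?l" by (rule wlift_Wpow) auto
  have r: "wlift (Wpow (Suc n)) W1 ?r" by (rule wlift_Wpow) auto
  let ?L = "weil_map (Wpow (Suc n)) (Wpow n) ?l" and ?R = "weil_map (Wpow (Suc n)) W1 ?r"
  have L: "?L \<cdot>\<^bsub>weil\<^esub> weil_map Z (Wpow (Suc n)) (\<lambda>i. lin (Suc n) (c i)) = weil_map Z (Wpow n) (\<lambda>i. lin n (c i))"
    if "weil_ob Z" for Z c
    using weil_map_comp[OF wlift_lin[OF that] l] by (simp add: subst_lin) (simp add: lin_def)
  have R: "?R \<cdot>\<^bsub>weil\<^esub> weil_map Z (Wpow (Suc n)) (\<lambda>i. lin (Suc n) (c i)) = weil_map Z W1 (\<lambda>i. lin 1 (\<lambda>_. c i n))"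
    if "weil_ob Z" for Z c
    using weil_map_comp[OF wlift_lin[OF that] r] by (simp add: subst_lin) (simp add: lin_def)
  have "\<exists>!h. h \<in> Hom weil Z (Wpow (Suc n)) \<and> ?L \<cdot>\<^bsub>weil\<^esub> h = f \<and> ?R \<cdot>\<^bsub>weil\<^esub> h = g"
    if fg: "f \<in> Hom weil Z (Wpow n)" "g \<in> Hom weil Z W1" for Z f g
  proof -
    have Z: "weil_ob Z" using fg by (simp add: Hom_weil)
    obtain a where a: "f = weil_map Z (Wpow n) (\<lambda>i. lin n (a i))" using fg(1) by (rule hom_WpowE)
    obtain b where b: "g = weil_map Z W1 (\<lambda>i. lin 1 (b i))" using fg(2) by (rule hom_WpowE)
    define c where "c i j = (if j < n then a i j else b i 0)" for i j
    have "lin n (c i) = lin n (a i)" "lin 1 (\<lambda>_. c i n) = lin 1 (b i)" for i by (simp_all add: lin_def c_def)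
    then have Lc: "?L \<cdot>\<^bsub>weil\<^esub> weil_map Z (Wpow (Suc n)) (\<lambda>i. lin (Suc n) (c i)) = f"
      and Rc: "?R \<cdot>\<^bsub>weil\<^esub> weil_map Z (Wpow (Suc n)) (\<lambda>i. lin (Suc n) (c i)) = g"
      unfolding a b L[OF Z] R[OF Z] by simp_all
    show ?thesis
    proof (rule ex1I[of _ "weil_map Z (Wpow (Suc n)) (\<lambda>i. lin (Suc n) (c i))"])
      fix h assume h: "h \<in> Hom weil Z (Wpow (Suc n)) \<and> ?L \<cdot>\<^bsub>weil\<^esub> h = f \<and> ?R \<cdot>\<^bsub>weil\<^esub> h = g"
      then obtain d where d: "h = weil_map Z (Wpow (Suc n)) (\<lambda>i. lin (Suc n) (d i))" using hom_WpowE by blast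
      have "d i j = c i j" if "i < fst Z" "j < Suc n" for i j
      proof (cases "j < n")
        case True
        then show ?thesis using weil_map_lin_eq[OF Z, of n d c i j] that h Lc unfolding d L[OF Z] by simp
      next
        case False
        then show ?thesis using weil_map_lin_eq[OF Z, of 1 "\<lambda>i _. d i n" "\<lambda>i _. c i n" i 0] that h Rc unfolding d R[OF Z]
          by (simp add: less_Suc_eq)
      qed
      then have "lin (Suc n) (d i) = lin (Suc n) (c i)" if "i < fst Z" for i using that unfolding lin_def by simp
      then show "h = weil_map Z (Wpow (Suc n)) (\<lambda>i. lin (Suc n) (c i))"
        unfolding d by (intro weil_map_cong'[OF wlift_lin[OF Z]])
    qed (use weil_map(1)[OF wlift_lin[OF Z]] Lc Rc in auto)
  qed
  then show ?thesis
    unfolding is_product_def Wproj_def using l r by simp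
qed

section \<open>Every Weil algebra is a coproduct of algebras W^k\<close>

lemma ob_Wword [simp, intro]: "weil_ob (Wword ks)"
  by (induction ks) auto

text \<open>
  Each equivalence class of \<open>r\<close> contributes one factor; the induction splits off the class of one element.
\<close>

lemma Wword_relabel:
  fixes S :: "nat set"
  assumes "finite S" "equiv S r"
  shows "\<exists>ks g. bij_betw g {..<fst (Wword ks)} S \<and>
    (\<forall>i<fst (Wword ks). \<forall>j<fst (Wword ks). (i, j) \<in> snd (Wword ks) \<longleftrightarrow> (g i, g j) \<in> r)"
  using assms
proof (induction "card S" arbitrary: S r rule: less_induct)
  case less
  show ?case
  proof (cases "S = {}")
    case True
    then show ?thesis by (intro exI[of _ "[]"] exI[of _ id]) (simp add: bij_betw_def)
  next
    case False
    then obtain a where a: "a \<in> S" by blast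
    let ?C = "r `` {a}"
    have rs: "r \<subseteq> S \<times> S" "sym r" "trans r" "refl_on S r" using less(3) by (auto simp: equiv_def)
    have aC: "a \<in> ?C" and CS: "?C \<subseteq> S" using a rs by (auto simp: refl_on_def)
    let ?S = "S - ?C" let ?r = "r \<inter> ?S \<times> ?S"
    have "card ?S < card S" using aC a less(2) by (intro psubset_card_mono) auto
    moreover have "equiv ?S ?r"
      using rs unfolding equiv_def refl_on_def sym_def trans_def by blast
    ultimately obtain ks g where g: "bij_betw g {..<fst (Wword ks)} ?S"
      "\<forall>i<fst (Wword ks). \<forall>j<fst (Wword ks). (i, j) \<in> snd (Wword ks) \<longleftrightarrow> (g i, g j) \<in> ?r"
      using less(1)[of ?S ?r] less(2) by auto
    have fC: "finite ?C" using CS less(2) finite_subset by blast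
    obtain h where h: "bij_betw h {..<card ?C} ?C"
      using ex_bij_betw_nat_finite[OF fC] by (auto simp: atLeast0LessThan)
    let ?k = "card ?C"
    let ?f = "\<lambda>i. if i < ?k then h i else g (i - ?k)"
    have hC: "h i \<in> ?C" if "i < ?k" for i using h that by (auto simp: bij_betw_def)
    have gS: "g i \<in> ?S" if "i < fst (Wword ks)" for i using g(1) that by (auto simp: bij_betw_def)
    have "bij_betw ?f ({..<?k} \<union> {?k..<?k + fst (Wword ks)}) (?C \<union> ?S)"
    proof (rule bij_betw_combine)
      show "bij_betw ?f {..<?k} ?C" using h by (rule bij_betw_cong[THEN iffD1, rotated]) simp
      have "bij_betw (\<lambda>i. i - ?k) {?k..<?k + fst (Wword ks)} {..<fst (Wword ks)}"
        by (rule bij_betw_byWitness[where f' = "\<lambda>i. i + ?k"]) auto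
      then have "bij_betw (g \<circ> (\<lambda>i. i - ?k)) {?k..<?k + fst (Wword ks)} ?S" using g(1) by (rule bij_betw_trans)
      then show "bij_betw ?f {?k..<?k + fst (Wword ks)} ?S"
        by (rule bij_betw_cong[THEN iffD1, rotated]) simp
    qed auto
    moreover have "{..<?k} \<union> {?k..<?k + fst (Wword ks)} = {..<fst (Wword (?k # ks))}" by auto
    moreover have "?C \<union> ?S = S" using CS by auto
    ultimately have "bij_betw ?f {..<fst (Wword (?k # ks))} S" by simp
    moreover have "(i, j) \<in> snd (Wword (?k # ks)) \<longleftrightarrow> (?f i, ?f j) \<in> r"
      if ij: "i < fst (Wword (?k # ks))" "j < fst (Wword (?k # ks))" for i j
    proof (cases "i < ?k"; cases "j < ?k")
      assume "i < ?k" "j < ?k"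
      then have "(h i, h j) \<in> r" using hC[of i] hC[of j] rs(2,3) by (meson Image_singleton_iff symD transD)
      then show ?thesis using \<open>i < ?k\<close> \<open>j < ?k\<close> by (simp add: snd_wten)
    next
      assume l: "i < ?k" "\<not> j < ?k"
      then have "j - ?k < fst (Wword ks)" using ij by auto
      then have "(h i, g (j - ?k)) \<notin> r" using hC[of i] gS[of "j - ?k"] l(1) rs(3) by (meson DiffD2 Image_singleton_iff transD)
      then show ?thesis using l by (simp add: snd_wten)
    next
      assume l: "\<not> i < ?k" "j < ?k"
      then have "i - ?k < fst (Wword ks)" using ij by auto
      then have "(g (i - ?k), h j) \<notin> r" using hC[of j] gS[of "i - ?k"] l(2) rs(2,3)
        by (meson DiffD2 Image_singleton_iff symD transD)
      then show ?thesis using l by (simp add: snd_wten)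
    next
      assume l: "\<not> i < ?k" "\<not> j < ?k"
      then have "i - ?k < fst (Wword ks)" "j - ?k < fst (Wword ks)" using ij by auto
      then show ?thesis using gS[of "j - ?k"] gS[of "i - ?k"] g(2) l by (auto simp: snd_wten)
    qed
    ultimately show ?thesis by blast
  qed
qed

lemma iso_Wword:
  assumes A: "weil_ob A"
  shows "\<exists>ks \<phi>. \<phi> \<in> Hom weil A (Wword ks) \<and> is_iso weil \<phi>"
proof -
  obtain ks g where g: "bij_betw g {..<fst (Wword ks)} {..<fst A}"
    and r: "\<And>i j. i<fst (Wword ks) \<Longrightarrow> j<fst (Wword ks) \<Longrightarrow> (i, j) \<in> snd (Wword ks) \<longleftrightarrow> (g i, g j) \<in> snd A"
    using Wword_relabel[OF _ A[unfolded weil_ob_def]] by auto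
  define h where "h = inv_into {..<fst (Wword ks)} g"
  have h: "h i < fst (Wword ks)" "g (h i) = i" if "i < fst A" for i
    using bij_betw_inv_into[OF g] bij_betw_inv_into_right[OF g] that by (auto simp: h_def bij_betw_def)
  have g': "g i < fst A" "h (g i) = i" if "i < fst (Wword ks)" for i
    using g bij_betw_inv_into_left[OF g] that by (auto simp: h_def bij_betw_def)
  have rh: "(h i, h j) \<in> snd (Wword ks)" if "(i, j) \<in> snd A" for i j
    using r[of "h i" "h j"] h[of i] h[of j] weil_ob_less[OF A that] that by simp
  have rg: "(g i, g j) \<in> snd A" if "(i, j) \<in> snd (Wword ks)" for i j
    using r[of i j] weil_ob_less[OF ob_Wword that] that by simp
  have w: "wlift A (Wword ks) (\<lambda>i. pvar (h i))"
    unfolding wlift_def using A h(1) rh wcong.gen by simp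
  have w': "wlift (Wword ks) A (\<lambda>i. pvar (g i))"
    unfolding wlift_def using A g'(1) rg wcong.gen by simp
  have "is_iso weil (weil_map A (Wword ks) (\<lambda>i. pvar (h i)))"
  proof (rule weil.is_isoI[where g = "weil_map (Wword ks) A (\<lambda>i. pvar (g i))"])
    show "weil_map (Wword ks) A (\<lambda>i. pvar (g i)) \<cdot>\<^bsub>weil\<^esub> weil_map A (Wword ks) (\<lambda>i. pvar (h i)) =
      Idn weil (Dom weil (weil_map A (Wword ks) (\<lambda>i. pvar (h i))))"
      using weil_map_cong'[OF wlift_comp[OF w w'], of pvar] h w A by (simp add: weil_map_comp[OF w w'] Idn_weil)
    show "weil_map A (Wword ks) (\<lambda>i. pvar (h i)) \<cdot>\<^bsub>weil\<^esub> weil_map (Wword ks) A (\<lambda>i. pvar (g i)) =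
      Idn weil (Cod weil (weil_map A (Wword ks) (\<lambda>i. pvar (h i))))"
      using weil_map_cong'[OF wlift_comp[OF w' w], of pvar] g' w by (simp add: weil_map_comp[OF w' w] Idn_weil)
  qed (use w w' in simp_all)
  then show ?thesis using weil_map(1)[OF w] by blast
qed

lemma wdecomp:
  assumes A: "weil_ob A" and w: "wdecomp A = (ks, \<phi>)"
  shows "\<phi> \<in> Hom weil A (Wword ks)" "is_iso weil \<phi>"
proof -
  let ?P = "\<lambda>(ks, \<phi>). \<phi> \<in> Hom weil A (Wword ks) \<and> is_iso weil \<phi> \<and> (A \<in> range Wword \<longrightarrow> \<phi> = Idn weil A)"
  have "\<exists>x. ?P x"
  proof (cases "A \<in> range Wword")
    case True
    then obtain ks where ks: "A = Wword ks" by blast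
    have "?P (ks, Idn weil A)" using ks weil_map(1)[OF wlift_id[OF A]] weil.is_iso_Idn[of A] A by (simp add: Idn_weil)
    then show ?thesis by blast
  next
    case False
    then show ?thesis using iso_Wword[OF A] by auto
  qed
  then have "?P (wdecomp A)" unfolding wdecomp_def by (rule someI_ex)
  then show "\<phi> \<in> Hom weil A (Wword ks)" "is_iso weil \<phi>" using w by auto
qed

section \<open>Endofunctors and natural transformations\<close>

text \<open>Functors are given by their action on arrows only; the one on objects is recovered from the identities.\<close>

definition fo :: "('o, 'a, 'x) cat_scheme \<Rightarrow> ('a \<Rightarrow> 'a) \<Rightarrow> 'o \<Rightarrow> 'o" where
  "fo C F x = Dom C (F (Idn C x))"

definition endo :: "('o, 'a, 'x) cat_scheme \<Rightarrow> ('a \<Rightarrow> 'a) \<Rightarrow> bool" where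
  "endo C F \<longleftrightarrow> is_functor C C (fo C F) F"

definition nt :: "('o, 'a, 'x) cat_scheme \<Rightarrow> ('a \<Rightarrow> 'a) \<Rightarrow> ('a \<Rightarrow> 'a) \<Rightarrow> ('o \<Rightarrow> 'a) \<Rightarrow> bool" where
  "nt C F G \<phi> \<longleftrightarrow> endo C F \<and> endo C G \<and>
     (\<forall>x\<in>Ob C. \<phi> x \<in> Hom C (fo C F x) (fo C G x)) \<and>
     (\<forall>f\<in>Ar C. \<phi> (Cod C f) \<cdot>\<^bsub>C\<^esub> F f = G f \<cdot>\<^bsub>C\<^esub> \<phi> (Dom C f))"

definition niso :: "('o, 'a, 'x) cat_scheme \<Rightarrow> ('a \<Rightarrow> 'a) \<Rightarrow> ('a \<Rightarrow> 'a) \<Rightarrow> bool" where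
  "niso C F G \<longleftrightarrow> (\<exists>\<phi>. nt C F G \<phi> \<and> (\<forall>x\<in>Ob C. is_iso C (\<phi> x)))"

text \<open>Cones that need not be limits. Their images under a functor may be limits all the same.\<close>

definition cone :: "('o, 'a, 'x) cat_scheme \<Rightarrow> nat \<Rightarrow> (nat \<Rightarrow> 'a) \<Rightarrow> 'a \<Rightarrow> (nat \<Rightarrow> 'a) \<Rightarrow> bool" where
  "cone C n r u \<pi> \<longleftrightarrow> u \<in> Ar C \<and>
     (\<forall>i<n. r i \<in> Ar C \<and> \<pi> i \<in> Ar C \<and> Cod C (r i) = Cod C u \<and> Dom C (\<pi> i) = Dom C u \<and>
        Cod C (\<pi> i) = Dom C (r i) \<and> r i \<cdot>\<^bsub>C\<^esub> \<pi> i = u)"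

context cat begin

lemma endo_simps:
  assumes "endo C F"
  shows "arr f \<Longrightarrow> F f \<in> Ar C" "arr f \<Longrightarrow> dom (F f) = fo C F (dom f)"
    "arr f \<Longrightarrow> cod (F f) = fo C F (cod f)"
    "arr f \<Longrightarrow> arr g \<Longrightarrow> cod f = dom g \<Longrightarrow> F (g \<cdot> f) = F g \<cdot> F f"
    "x \<in> Ob C \<Longrightarrow> F (Idn C x) = Idn C (fo C F x)" "x \<in> Ob C \<Longrightarrow> fo C F x \<in> Ob C"
  using assms unfolding endo_def is_functor_def by (auto simp: Hom_iff)

lemma endoI:
  assumes "\<And>f. f \<in> Ar C \<Longrightarrow> F f \<in> Ar C" "\<And>f. f \<in> Ar C \<Longrightarrow> dom (F f) = fo C F (dom f)"
    "\<And>f. f \<in> Ar C \<Longrightarrow> cod (F f) = fo C F (cod f)"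
    "\<And>f g. f \<in> Ar C \<Longrightarrow> arr g \<Longrightarrow> cod f = dom g \<Longrightarrow> F (g \<cdot> f) = F g \<cdot> F f"
    "\<And>x. x \<in> Ob C \<Longrightarrow> F (Idn C x) = Idn C (fo C F x)"
  shows "endo C F"
proof -
  have "fo C F x \<in> Ob C" if "x \<in> Ob C" for x
    unfolding fo_def using assms(1) that by (intro Dom_Ob) auto
  then show ?thesis using assms unfolding endo_def is_functor_def by (auto simp: Hom_iff)
qed

lemma fo_id: "x \<in> Ob C \<Longrightarrow> fo C id x = x"
  by (simp add: fo_def)

lemma endo_id: "endo C id"
  by (rule endoI) (auto simp: fo_id)

lemma fo_comp: "endo C F \<Longrightarrow> endo C G \<Longrightarrow> x \<in> Ob C \<Longrightarrow> fo C (F \<circ> G) x = fo C F (fo C G x)"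
  unfolding fo_def[of C G] fo_def[of C "F \<circ> G"] comp_apply by (rule endo_simps(2)) (auto intro: endo_simps(1))

lemma endo_comp: "endo C F \<Longrightarrow> endo C G \<Longrightarrow> endo C (F \<circ> G)"
  by (rule endoI) (auto simp: endo_simps fo_comp)

lemma ntD:
  assumes "nt C F G \<phi>"
  shows "endo C F" "endo C G" "x \<in> Ob C \<Longrightarrow> \<phi> x \<in> Ar C" "x \<in> Ob C \<Longrightarrow> dom (\<phi> x) = fo C F x"
    "x \<in> Ob C \<Longrightarrow> cod (\<phi> x) = fo C G x" "arr f \<Longrightarrow> \<phi> (cod f) \<cdot> F f = G f \<cdot> \<phi> (dom f)"
  using assms by (auto simp: nt_def Hom_iff)

lemma ntI:
  assumes "endo C F" "endo C G" "\<And>x. x \<in> Ob C \<Longrightarrow> \<phi> x \<in> Ar C" "\<And>x. x \<in> Ob C \<Longrightarrow> dom (\<phi> x) = fo C F x"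
    "\<And>x. x \<in> Ob C \<Longrightarrow> cod (\<phi> x) = fo C G x" "\<And>f. f \<in> Ar C \<Longrightarrow> \<phi> (cod f) \<cdot> F f = G f \<cdot> \<phi> (dom f)"
  shows "nt C F G \<phi>"
  using assms by (auto simp: nt_def Hom_iff)

lemma nt_left: assumes n: "nt C F G \<phi>" and K: "endo C K" shows "nt C (K \<circ> F) (K \<circ> G) (\<lambda>x. K (\<phi> x))"
proof -
  note N = ntD[OF n] and E = endo_simps[OF K] endo_simps[OF ntD(1)[OF n]] endo_simps[OF ntD(2)[OF n]]
  show ?thesis
  proof (rule ntI[OF endo_comp[OF K N(1)] endo_comp[OF K N(2)]])
    fix f assume f: "arr f"
    have "K (\<phi> (cod f) \<cdot> F f) = K (G f \<cdot> \<phi> (dom f))" using N(6)[OF f] by (rule arg_cong)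
    moreover have "K (\<phi> (cod f) \<cdot> F f) = K (\<phi> (cod f)) \<cdot> K (F f)" "K (G f \<cdot> \<phi> (dom f)) = K (G f) \<cdot> K (\<phi> (dom f))"
      by (rule E(4); use f N(3-5) E in auto)+
    ultimately show "K (\<phi> (cod f)) \<cdot> (K \<circ> F) f = (K \<circ> G) f \<cdot> K (\<phi> (dom f))" by (metis comp_apply)
  qed (use N(3-5) E fo_comp[OF K N(1)] fo_comp[OF K N(2)] in auto)
qed

lemma nt_right: assumes n: "nt C F G \<phi>" and K: "endo C K" shows "nt C (F \<circ> K) (G \<circ> K) (\<lambda>x. \<phi> (fo C K x))"
proof -
  note N = ntD[OF n] and E = endo_simps[OF K]
  show ?thesis
    by (rule ntI[OF endo_comp[OF N(1) K] endo_comp[OF N(2) K]])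
      (use N(3-5) N(6)[OF E(1)] E fo_comp[OF N(1) K] fo_comp[OF N(2) K] in auto)
qed

lemma nt_comp: assumes n: "nt C F G \<phi>" and m: "nt C G H \<psi>" shows "nt C F H (\<lambda>x. \<psi> x \<cdot> \<phi> x)"
proof -
  note N = ntD[OF n] and M = ntD[OF m] and E = endo_simps[OF ntD(1)[OF n]] endo_simps[OF ntD(2)[OF n]] endo_simps[OF ntD(2)[OF m]]
  show ?thesis
  proof (rule ntI[OF N(1) M(2)])
    fix f assume f: "arr f"
    have "(\<psi> (cod f) \<cdot> \<phi> (cod f)) \<cdot> F f = \<psi> (cod f) \<cdot> (G f \<cdot> \<phi> (dom f))"
      using f N M(3-5) E by simp
    also have "\<dots> = H f \<cdot> (\<psi> (dom f) \<cdot> \<phi> (dom f))"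
      by (rule comp_extend[OF M(6)[OF f]]) (use f N(3-5) M(3-5) E in auto)
    finally show "(\<psi> (cod f) \<cdot> \<phi> (cod f)) \<cdot> F f = H f \<cdot> (\<psi> (dom f) \<cdot> \<phi> (dom f))" .
  qed (use N(3-5) M(3-5) in auto)
qed

lemma nisoI: "nt C F G \<phi> \<Longrightarrow> (\<And>x. x \<in> Ob C \<Longrightarrow> is_iso C (\<phi> x)) \<Longrightarrow> niso C F G"
  by (auto simp: niso_def)

lemma endo_iso: assumes K: "endo C K" and f: "is_iso C f" shows "is_iso C (K f)"
proof -
  note E = endo_simps[OF K] and A = is_iso_Ar[OF f]
  show ?thesis
  proof (rule is_isoI[where g = "K (inv_arrow C f)"])
    have "K (inv_arrow C f) \<cdot> K f = K (inv_arrow C f \<cdot> f)" using f A E(4)[of f "inv_arrow C f"] by simp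
    then show "K (inv_arrow C f) \<cdot> K f = Idn C (dom (K f))" using f A E by simp
    have "K f \<cdot> K (inv_arrow C f) = K (f \<cdot> inv_arrow C f)" using f A E(4)[of "inv_arrow C f" f] by simp
    then show "K f \<cdot> K (inv_arrow C f) = Idn C (cod (K f))" using f A E by simp
  qed (use f A E in auto)
qed

lemma niso_endo: "niso C F G \<Longrightarrow> endo C F" "niso C F G \<Longrightarrow> endo C G"
  by (auto simp: niso_def dest: ntD)

lemma niso_left: "niso C F G \<Longrightarrow> endo C K \<Longrightarrow> niso C (K \<circ> F) (K \<circ> G)"
  unfolding niso_def using nt_left endo_iso by blast

lemma niso_right: "niso C F G \<Longrightarrow> endo C K \<Longrightarrow> niso C (F \<circ> K) (G \<circ> K)"
  unfolding niso_def using nt_right endo_simps(6) by fast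

lemma niso_trans: assumes "niso C F G" "niso C G H" shows "niso C F H"
proof -
  obtain \<phi> \<psi> where n: "nt C F G \<phi>" "nt C G H \<psi>" and i: "\<And>x. x \<in> Ob C \<Longrightarrow> is_iso C (\<phi> x)" "\<And>x. x \<in> Ob C \<Longrightarrow> is_iso C (\<psi> x)"
    using assms by (auto simp: niso_def)
  show ?thesis
    by (rule nisoI[OF nt_comp[OF n]]) (use i ntD(3-5)[OF n(1)] ntD(3-5)[OF n(2)] is_iso_comp in auto)
qed

lemma niso_sym: assumes "niso C F G" shows "niso C G F"
proof -
  obtain \<phi> where n: "nt C F G \<phi>" and i: "\<And>x. x \<in> Ob C \<Longrightarrow> is_iso C (\<phi> x)" using assms by (auto simp: niso_def)
  note N = ntD[OF n] and E = endo_simps[OF ntD(1)[OF n]] endo_simps[OF ntD(2)[OF n]]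
  have "nt C G F (\<lambda>x. inv_arrow C (\<phi> x))"
  proof (rule ntI[OF N(2,1)])
    fix f assume f: "arr f"
    let ?i = "\<lambda>x. inv_arrow C (\<phi> x)"
    have if': "is_iso C (\<phi> (cod f))" "is_iso C (\<phi> (dom f))" using i f by simp_all
    have "G f = (G f \<cdot> \<phi> (dom f)) \<cdot> ?i (dom f)" using f if' N(3-5) E by simp
    also have "\<dots> = \<phi> (cod f) \<cdot> (F f \<cdot> ?i (dom f))" unfolding N(6)[OF f, symmetric] using f if' N(3-5) E by simp
    finally have "?i (cod f) \<cdot> G f = ?i (cod f) \<cdot> (\<phi> (cod f) \<cdot> (F f \<cdot> ?i (dom f)))" by simp
    then show "?i (cod f) \<cdot> G f = F f \<cdot> ?i (dom f)"
      using inv_arrow_cancel(1)[OF if'(1), of "F f \<cdot> ?i (dom f)"] f if' N(3-5) E by simp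
  qed (use i N(3-5) in auto)
  then show ?thesis using i by (intro nisoI) (auto intro: is_iso_inv_arrow)
qed

lemma niso_refl: assumes F: "endo C F" shows "niso C F F"
proof (rule nisoI)
  show "nt C F F (\<lambda>x. Idn C (fo C F x))" by (rule ntI[OF F F]) (use endo_simps[OF F] in auto)
  show "is_iso C (Idn C (fo C F x))" if "x \<in> Ob C" for x using endo_simps(6)[OF F that] by (rule is_iso_Idn)
qed

lemma wide_pb_cone: "wide_pb C n r u \<pi> \<Longrightarrow> cone C n r u \<pi>"
  unfolding cone_def using wide_pbD wide_pb_Ar by simp

lemma coneD:
  assumes "cone C n r u \<pi>"
  shows "arr u" "\<And>i. i < n \<Longrightarrow> r i \<in> Ar C" "\<And>i. i < n \<Longrightarrow> \<pi> i \<in> Ar C" "\<And>i. i < n \<Longrightarrow> cod (r i) = cod u"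
    "\<And>i. i < n \<Longrightarrow> dom (\<pi> i) = dom u" "\<And>i. i < n \<Longrightarrow> cod (\<pi> i) = dom (r i)" "\<And>i. i < n \<Longrightarrow> r i \<cdot> \<pi> i = u"
  using assms by (auto simp: cone_def)

lemma wide_pb_niso:
  assumes n: "niso C F G" and S: "cone C n r u \<pi>" and pb: "wide_pb C n (\<lambda>i. F (r i)) (F u) (\<lambda>i. F (\<pi> i))"
  shows "wide_pb C n (\<lambda>i. G (r i)) (G u) (\<lambda>i. G (\<pi> i))"
proof -
  obtain \<phi> where nn: "nt C F G \<phi>" and i: "\<And>x. x \<in> Ob C \<Longrightarrow> is_iso C (\<phi> x)" using n by (auto simp: niso_def)
  note N = ntD[OF nn] and E = endo_simps[OF ntD(1)[OF nn]] endo_simps[OF ntD(2)[OF nn]] and D = coneD[OF S]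
  have nat: "G f \<cdot> \<phi> x = \<phi> y \<cdot> F f" if "arr f" "dom f = x" "cod f = y" for f x y using N(6) that by metis
  show ?thesis
    by (rule wide_pb_iso[OF pb, where \<phi>P = "\<phi> (dom u)" and \<phi>B = "\<phi> (cod u)" and \<phi>X = "\<lambda>i. \<phi> (dom (r i))"])
      (use D N(3-5) E i in \<open>auto intro: nat\<close>)
qed

text \<open>
  Limits commute with limits: if \<open>Kn\<close> is pointwise a fibre power of \<open>K1\<close> over \<open>K0\<close>, it preserves the
  limits that \<open>K0\<close> and \<open>K1\<close> preserve.
\<close>

lemma wide_pb_interchange:
  assumes u: "nt C Kn K0 U" and p: "nt C K1 K0 P" and pr: "\<And>j. j < m \<Longrightarrow> nt C Kn K1 (Pr j)"
    and pw: "\<And>x. x \<in> Ob C \<Longrightarrow> wide_pb C m (\<lambda>_. P x) (U x) (\<lambda>j. Pr j x)"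
    and S: "cone C n r v \<pi>"
    and pb0: "wide_pb C n (\<lambda>i. K0 (r i)) (K0 v) (\<lambda>i. K0 (\<pi> i))"
    and pb1: "wide_pb C n (\<lambda>i. K1 (r i)) (K1 v) (\<lambda>i. K1 (\<pi> i))"
  shows "wide_pb C n (\<lambda>i. Kn (r i)) (Kn v) (\<lambda>i. Kn (\<pi> i))"
proof -
  note NU = ntD[OF u] and NP = ntD[OF p] and NPr = ntD[OF pr]
  note E0 = endo_simps[OF ntD(2)[OF u]] and En = endo_simps[OF ntD(1)[OF u]] and E1 = endo_simps[OF ntD(1)[OF p]]
  note D = coneD[OF S]
  have eqn: "h = h'"
    if "arr h" "arr h'" "dom h = dom h'" "cod h = fo C Kn x" "cod h' = fo C Kn x" "x \<in> Ob C"
      "U x \<cdot> h = U x \<cdot> h'" "\<And>j. j < m \<Longrightarrow> Pr j x \<cdot> h = Pr j x \<cdot> h'" for x h h'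
    by (rule wide_pb_eq[OF pw]) (use that NU(3-5) in auto)
  have natU: "U y \<cdot> (Kn f \<cdot> k) = K0 f \<cdot> (U x \<cdot> k)"
    if "arr f" "dom f = x" "cod f = y" "arr k" "cod k = fo C Kn x" for f x y k
    by (rule comp_extend) (use that NU E0 En NU(6)[OF that(1)] in auto)
  have natPr: "Pr j y \<cdot> (Kn f \<cdot> k) = K1 f \<cdot> (Pr j x \<cdot> k)"
    if "j < m" "arr f" "dom f = x" "cod f = y" "arr k" "cod k = fo C Kn x" for f x y k j
    by (rule comp_extend) (use that NPr(3-5) E1 En NPr(6)[OF that(1,2)] in auto)
  have natP: "P y \<cdot> (K1 f \<cdot> k) = K0 f \<cdot> (P x \<cdot> k)"
    if "arr f" "dom f = x" "cod f = y" "arr k" "cod k = fo C K1 x" for f x y k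
    by (rule comp_extend) (use that NP E1 E0 NP(6)[OF that(1)] in auto)
  have PPr: "P x \<cdot> (Pr j x \<cdot> k) = U x \<cdot> k" if "j < m" "x \<in> Ob C" "arr k" "cod k = fo C Kn x" for j x k
    by (rule comp_extend1[OF wide_pbD(6)[OF pw]]) (use that NPr(3-5) NP(3-5) in auto)
  let ?Q = "dom v" and ?B = "cod v" and ?Y = "\<lambda>i. dom (r i)"
  have ob: "?Q \<in> Ob C" "?B \<in> Ob C" "\<And>i. i < n \<Longrightarrow> ?Y i \<in> Ob C" using D by auto
  show ?thesis
  proof (rule wide_pbI)
    fix i assume i: "i < n"
    have "Kn (r i) \<cdot> Kn (\<pi> i) = Kn (r i \<cdot> \<pi> i)" using En(4)[OF D(3)[OF i] D(2)[OF i] D(6)[OF i]] by simp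
    then show "Kn (r i) \<in> Ar C \<and> Kn (\<pi> i) \<in> Ar C \<and> cod (Kn (r i)) = cod (Kn v) \<and> dom (Kn (\<pi> i)) = dom (Kn v) \<and>
        cod (Kn (\<pi> i)) = dom (Kn (r i)) \<and> Kn (r i) \<cdot> Kn (\<pi> i) = Kn v"
      using D i En by simp
  next
    fix w f assume w: "arr w" "cod w = cod (Kn v)"
      and f: "\<And>i. i < n \<Longrightarrow> f i \<in> Ar C \<and> dom (f i) = dom w \<and> cod (f i) = dom (Kn (r i)) \<and> Kn (r i) \<cdot> f i = w"
    have w': "cod w = fo C Kn ?B" using w D En by simp
    have f': "f i \<in> Ar C" "dom (f i) = dom w" "cod (f i) = fo C Kn (?Y i)" "Kn (r i) \<cdot> f i = w" if "i < n" for i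
      using f[OF that] D(2)[OF that] En by auto
    have "\<exists>h. arr h \<and> dom h = dom w \<and> cod h = fo C K1 ?Q \<and> K1 v \<cdot> h = Pr j ?B \<cdot> w \<and>
        (\<forall>i<n. K1 (\<pi> i) \<cdot> h = Pr j (?Y i) \<cdot> f i)" if j: "j < m" for j
    proof -
      have "K1 (r i) \<cdot> (Pr j (?Y i) \<cdot> f i) = Pr j ?B \<cdot> w" if i: "i < n" for i
        using natPr[OF j D(2)[OF i] HOL.refl D(4)[OF i], of "f i"] f'[OF i] by simp
      then have "\<exists>!h. h \<in> Ar C \<and> dom h = dom (Pr j ?B \<cdot> w) \<and> cod h = dom (K1 v) \<and> K1 v \<cdot> h = Pr j ?B \<cdot> w \<and>
        (\<forall>i<n. K1 (\<pi> i) \<cdot> h = Pr j (?Y i) \<cdot> f i)"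
        by (intro wide_pb_univ[OF pb1]) (use w w' f' NPr(3-5)[OF j] ob D E1 in auto)
      then show ?thesis using w w' NPr(3-5)[OF j] ob D E1 by auto
    qed
    then obtain h where h: "\<And>j. j < m \<Longrightarrow> h j \<in> Ar C \<and> dom (h j) = dom w \<and> cod (h j) = fo C K1 ?Q \<and> K1 v \<cdot> h j = Pr j ?B \<cdot> w \<and>
        (\<forall>i<n. K1 (\<pi> i) \<cdot> h j = Pr j (?Y i) \<cdot> f i)" by metis
    have "K0 (r i) \<cdot> (U (?Y i) \<cdot> f i) = U ?B \<cdot> w" if i: "i < n" for i
      using natU[OF D(2)[OF i] HOL.refl D(4)[OF i], of "f i"] f'[OF i] by simp
    then have "\<exists>!h. h \<in> Ar C \<and> dom h = dom (U ?B \<cdot> w) \<and> cod h = dom (K0 v) \<and> K0 v \<cdot> h = U ?B \<cdot> w \<and>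
        (\<forall>i<n. K0 (\<pi> i) \<cdot> h = U (?Y i) \<cdot> f i)"
      by (intro wide_pb_univ[OF pb0]) (use w w' f' NU(3-5) ob D E0 in auto)
    then obtain g where g: "arr g" "dom g = dom w" "cod g = fo C K0 ?Q" "K0 v \<cdot> g = U ?B \<cdot> w"
      "\<And>i. i < n \<Longrightarrow> K0 (\<pi> i) \<cdot> g = U (?Y i) \<cdot> f i" using w w' NU(3-5) ob D E0 by auto
    have hg: "P ?Q \<cdot> h j = g" if j: "j < m" for j
    proof (rule wide_pb_eq[OF pb0])
      show "K0 v \<cdot> (P ?Q \<cdot> h j) = K0 v \<cdot> g"
        using natP[OF D(1) HOL.refl HOL.refl, of "h j"] h[OF j] PPr[OF j ob(2) w(1) w'] g(4) by simp
      show "K0 (\<pi> i) \<cdot> (P ?Q \<cdot> h j) = K0 (\<pi> i) \<cdot> g" if i: "i < n" for i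
        using natP[OF D(3)[OF i] D(5)[OF i] D(6)[OF i], of "h j"] h[OF j] i PPr[OF j ob(3)[OF i] f'(1)[OF i] f'(3)[OF i]] g(5)[OF i]
        by simp
    qed (use h[OF j] g ob NP(3-5) D E0 in auto)
    have "\<exists>!k. k \<in> Ar C \<and> dom k = dom g \<and> cod k = dom (U ?Q) \<and> U ?Q \<cdot> k = g \<and> (\<forall>j<m. Pr j ?Q \<cdot> k = h j)"
      by (rule wide_pb_univ[OF pw[OF ob(1)]]) (use h g hg ob NP(3-5) NU(3-5) in auto)
    then obtain k where k: "arr k" "dom k = dom w" "cod k = fo C Kn ?Q" "U ?Q \<cdot> k = g"
      "\<And>j. j < m \<Longrightarrow> Pr j ?Q \<cdot> k = h j" using g NU(3-5) ob by auto
    have kv: "Kn v \<cdot> k = w"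
    proof (rule eqn[OF _ w(1) _ _ w' ob(2)])
      show "U ?B \<cdot> (Kn v \<cdot> k) = U ?B \<cdot> w" using natU[OF D(1) HOL.refl HOL.refl k(1,3)] k(4) g(4) by simp
      show "Pr j ?B \<cdot> (Kn v \<cdot> k) = Pr j ?B \<cdot> w" if "j < m" for j
        using natPr[OF that D(1) HOL.refl HOL.refl k(1,3)] k(5)[OF that] h[OF that] by simp
    qed (use k D En in auto)
    have kf: "Kn (\<pi> i) \<cdot> k = f i" if i: "i < n" for i
    proof (rule eqn[OF _ f'(1)[OF i] _ _ f'(3)[OF i] ob(3)[OF i]])
      show "U (?Y i) \<cdot> (Kn (\<pi> i) \<cdot> k) = U (?Y i) \<cdot> f i"
        using natU[OF D(3)[OF i] D(5)[OF i] D(6)[OF i] k(1,3)] k(4) g(5)[OF i] by simp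
      show "Pr j (?Y i) \<cdot> (Kn (\<pi> i) \<cdot> k) = Pr j (?Y i) \<cdot> f i" if "j < m" for j
        using natPr[OF that D(3)[OF i] D(5)[OF i] D(6)[OF i] k(1,3)] k(5)[OF that] h[OF that] i by simp
    qed (use k D i En f' in auto)
    show "\<exists>h. arr h \<and> dom h = dom w \<and> cod h = dom (Kn v) \<and> Kn v \<cdot> h = w \<and> (\<forall>i<n. Kn (\<pi> i) \<cdot> h = f i)"
      using k kv kf D En by (intro exI[of _ k]) simp
  next
    fix h h' assume h: "arr h" "arr h'" "cod h = dom (Kn v)" "cod h' = dom (Kn v)" "dom h = dom h'"
      and eq: "Kn v \<cdot> h = Kn v \<cdot> h'" "\<And>i. i < n \<Longrightarrow> Kn (\<pi> i) \<cdot> h = Kn (\<pi> i) \<cdot> h'"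
    have h': "cod h = fo C Kn ?Q" "cod h' = fo C Kn ?Q" using h D En by auto
    show "h = h'"
    proof (rule eqn[OF h(1,2,5) h' ob(1)])
      show "U ?Q \<cdot> h = U ?Q \<cdot> h'"
      proof (rule wide_pb_eq[OF pb0])
        show "K0 v \<cdot> (U ?Q \<cdot> h) = K0 v \<cdot> (U ?Q \<cdot> h')"
          using natU[OF D(1) HOL.refl HOL.refl h(1) h'(1)] natU[OF D(1) HOL.refl HOL.refl h(2) h'(2)] eq(1) by simp
        show "K0 (\<pi> i) \<cdot> (U ?Q \<cdot> h) = K0 (\<pi> i) \<cdot> (U ?Q \<cdot> h')" if i: "i < n" for i
          using natU[OF D(3)[OF i] D(5)[OF i] D(6)[OF i] h(1) h'(1)] natU[OF D(3)[OF i] D(5)[OF i] D(6)[OF i] h(2) h'(2)] eq(2)[OF i] by simp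
      qed (use h h' NU(3-5) ob D E0 in auto)
      show "Pr j ?Q \<cdot> h = Pr j ?Q \<cdot> h'" if j: "j < m" for j
      proof (rule wide_pb_eq[OF pb1])
        show "K1 v \<cdot> (Pr j ?Q \<cdot> h) = K1 v \<cdot> (Pr j ?Q \<cdot> h')"
          using natPr[OF j D(1) HOL.refl HOL.refl h(1) h'(1)] natPr[OF j D(1) HOL.refl HOL.refl h(2) h'(2)] eq(1) by simp
        show "K1 (\<pi> i) \<cdot> (Pr j ?Q \<cdot> h) = K1 (\<pi> i) \<cdot> (Pr j ?Q \<cdot> h')" if i: "i < n" for i
          using natPr[OF j D(3)[OF i] D(5)[OF i] D(6)[OF i] h(1) h'(1)] natPr[OF j D(3)[OF i] D(5)[OF i] D(6)[OF i] h(2) h'(2)] eq(2)[OF i] by simp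
      qed (use h h' NPr(3-5)[OF j] ob D E1 in auto)
    qed
  qed (use D En in auto)
qed

lemma wide_pb_0: assumes u: "is_iso C u" shows "wide_pb C 0 r u \<pi>"
proof (rule wide_pbI)
  fix v assume v: "arr v" "cod v = cod u"
  then show "\<exists>h. arr h \<and> dom h = dom v \<and> cod h = dom u \<and> u \<cdot> h = v \<and> (\<forall>i<0. \<pi> i \<cdot> h = f i)" for f
    using u is_iso_Ar[OF u] by (intro exI[of _ "inv_arrow C u \<cdot> v"]) auto
qed (use is_iso_Ar[OF u] iso_mono[OF u] in auto)

lemma wide_pb_Suc:
  assumes n: "wide_pb C n (\<lambda>_. q) u \<pi>" and q: "arr q"
    and pb: "wide_pb C 2 (\<lambda>i. if i = 0 then u else q) w (\<lambda>i. if i = 0 then t else l)"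
    and \<rho>: "\<And>i. i < n \<Longrightarrow> \<rho> i = \<pi> i \<cdot> t" "\<rho> n = l"
  shows "wide_pb C (Suc n) (\<lambda>_. q) w \<rho>"
proof -
  note D = wide_pbD[OF n] and u = wide_pb_Ar[OF n] and W = wide_pb_Ar[OF pb]
  note P = wide_pbD[OF pb, of 0, simplified] wide_pbD[OF pb, of 1, simplified]
  have qpt: "q \<cdot> (\<pi> i \<cdot> t) = w" if "i < n" for i
    using comp_extend1[OF D(6)[OF that], of t] D[OF that] P q u by simp
  show ?thesis
  proof (rule wide_pbI)
    show "arr q \<and> \<rho> i \<in> Ar C \<and> cod q = cod w \<and> dom (\<rho> i) = dom w \<and> cod (\<rho> i) = dom q \<and> q \<cdot> \<rho> i = w"
      if "i < Suc n" for i
      using that \<rho> P q u D[of i] qpt[of i] by (cases "i = n") auto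
  next
    fix v f assume v: "arr v" "cod v = cod w"
      and f: "\<And>i. i < Suc n \<Longrightarrow> f i \<in> Ar C \<and> dom (f i) = dom v \<and> cod (f i) = dom q \<and> q \<cdot> f i = v"
    obtain h where h: "arr h" "dom h = dom v" "cod h = dom u" "u \<cdot> h = v" "\<And>i. i < n \<Longrightarrow> \<pi> i \<cdot> h = f i"
      by (rule wide_pb_lift[OF n v(1), of f]) (use f v P in auto)
    obtain k where k: "arr k" "dom k = dom v" "cod k = dom w" "w \<cdot> k = v"
      "\<And>i::nat. i < 2 \<Longrightarrow> (if i = 0 then t else l) \<cdot> k = (if i = 0 then h else f n)"
      by (rule wide_pb_lift[OF pb v(1), of "\<lambda>i. if i = 0 then h else f n"]) (use f[of n] h v P in auto)
    have k': "t \<cdot> k = h" "l \<cdot> k = f n" using k(5)[of 0] k(5)[of 1] by simp_all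
    have "\<rho> i \<cdot> k = f i" if i: "i < Suc n" for i
    proof (cases "i = n")
      case False
      then have "\<rho> i \<cdot> k = \<pi> i \<cdot> (t \<cdot> k)" using i \<rho> D[of i] P k(1-3) by simp
      then show ?thesis using k' h(5)[of i] i False by simp
    qed (use k' \<rho> in simp)
    then show "\<exists>h. arr h \<and> dom h = dom v \<and> cod h = dom w \<and> w \<cdot> h = v \<and> (\<forall>i<Suc n. \<rho> i \<cdot> h = f i)"
      using k by blast
  next
    fix h h' assume h: "arr h" "arr h'" "cod h = dom w" "cod h' = dom w" "dom h = dom h'"
      and eq: "w \<cdot> h = w \<cdot> h'" "\<And>i. i < Suc n \<Longrightarrow> \<rho> i \<cdot> h = \<rho> i \<cdot> h'"
    have ut: "u \<cdot> (t \<cdot> k) = w \<cdot> k" if "arr k" "cod k = dom w" for k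
      using comp_extend1[OF P(6), of k] that P u by simp
    have pt: "\<pi> i \<cdot> (t \<cdot> k) = \<rho> i \<cdot> k" if "i < n" "arr k" "cod k = dom w" for i k
      using that \<rho> D[of i] P by simp
    have t: "t \<cdot> h = t \<cdot> h'"
      by (rule wide_pb_eq[OF n]) (use h ut pt eq P in auto)
    show "h = h'"
    proof (rule wide_pb_eq[OF pb])
      show "(if i = 0 then t else l) \<cdot> h = (if i = 0 then t else l) \<cdot> h'" if "i < 2" for i :: nat
        using t eq(2)[of n] \<rho>(2) by simp
    qed (use h eq in auto)
  qed (rule W)
qed

end

section \<open>Actegories\<close>

locale tan_acteg =
  fixes X :: "('o, 'a) acteg" (structure)
  assumes tangent: "tangent_actegory X"
begin

lemma acteg: "actegory X"
  using tangent by (simp add: tangent_actegory_def)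

sublocale cat X
  using acteg by unfold_locales (simp add: actegory_def)

abbreviation Tn :: "war \<Rightarrow> 'o \<Rightarrow> 'a" where "Tn \<equiv> Tnt X"
abbreviation T :: "wob \<Rightarrow> 'a \<Rightarrow> 'a" where "T \<equiv> Tar X"

lemma action_functor: "is_functor (prod_cat weil X) X (\<lambda>(A, x). actO X A x) (\<lambda>(\<theta>, f). actA X \<theta> f)"
  using acteg by (simp add: actegory_def)

lemma Hom_prod: "(\<theta>, f) \<in> Hom (prod_cat weil X) (A, x) (B, y) \<longleftrightarrow> \<theta> \<in> Hom weil A B \<and> f \<in> Hom X x y"
  by (auto simp: Hom_def prod_cat_def)

lemma actO_Ob [simp]: "weil_ob A \<Longrightarrow> x \<in> Ob X \<Longrightarrow> actO X A x \<in> Ob X"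
  using action_functor by (auto simp: is_functor_def prod_cat_def)

lemma actA_simps [simp]:
  assumes "\<theta> \<in> Ar weil" "arr f"
  shows "actA X \<theta> f \<in> Ar X" "dom (actA X \<theta> f) = actO X (Dom weil \<theta>) (dom f)"
    "cod (actA X \<theta> f) = actO X (Cod weil \<theta>) (cod f)"
proof -
  have "(\<theta>, f) \<in> Hom (prod_cat weil X) (Dom weil \<theta>, dom f) (Cod weil \<theta>, cod f)"
    using assms by (simp add: Hom_prod weil.Hom_iff Hom_iff)
  then have "actA X \<theta> f \<in> Hom X (actO X (Dom weil \<theta>) (dom f)) (actO X (Cod weil \<theta>) (cod f))"
    using action_functor[unfolded is_functor_def, THEN conjunct2, THEN conjunct1, THEN spec, THEN spec, THEN bspec] by fastforce
  then show "actA X \<theta> f \<in> Ar X" "dom (actA X \<theta> f) = actO X (Dom weil \<theta>) (dom f)"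
    "cod (actA X \<theta> f) = actO X (Cod weil \<theta>) (cod f)" by (auto simp: Hom_iff)
qed

lemma actA_comp:
  assumes "\<theta> \<in> Ar weil" "arr f" "\<theta>' \<in> Ar weil" "arr f'" "Cod weil \<theta> = Dom weil \<theta>'" "cod f = dom f'"
  shows "actA X (\<theta>' \<cdot>\<^bsub>weil\<^esub> \<theta>) (f' \<cdot> f) = actA X \<theta>' f' \<cdot> actA X \<theta> f"
proof -
  have h: "(\<theta>, f) \<in> Hom (prod_cat weil X) (Dom weil \<theta>, dom f) (Cod weil \<theta>, cod f)"
    "(\<theta>', f') \<in> Hom (prod_cat weil X) (Cod weil \<theta>, cod f) (Cod weil \<theta>', cod f')"
    using assms by (simp_all add: Hom_prod weil.Hom_iff Hom_iff)
  have "(case (\<theta>', f') \<cdot>\<^bsub>prod_cat weil X\<^esub> (\<theta>, f) of (\<theta>, f) \<Rightarrow> actA X \<theta> f) = actA X \<theta>' f' \<cdot> actA X \<theta> f"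
    using action_functor[unfolded is_functor_def, THEN conjunct2, THEN conjunct2, THEN spec, THEN spec, THEN spec,
      THEN bspec, OF h(1), THEN bspec, OF h(2)] by simp
  then show ?thesis by (simp add: prod_cat_def)
qed

lemma actA_Idn: "weil_ob A \<Longrightarrow> x \<in> Ob X \<Longrightarrow> actA X (Idn weil A) (Idn X x) = Idn X (actO X A x)"
  using action_functor by (auto simp: is_functor_def prod_cat_def)

lemma Tar_simps [simp]:
  assumes "weil_ob A" "arr f"
  shows "T A f \<in> Ar X" "dom (T A f) = actO X A (dom f)" "cod (T A f) = actO X A (cod f)"
  using assms by (simp_all add: Tar_def)

lemma Tar_comp: "weil_ob A \<Longrightarrow> arr f \<Longrightarrow> arr g \<Longrightarrow> cod f = dom g \<Longrightarrow> T A (g \<cdot> f) = T A g \<cdot> T A f"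
  using actA_comp[of "Idn weil A" f "Idn weil A" g] by (simp add: Tar_def)

lemma Tar_Idn: "weil_ob A \<Longrightarrow> x \<in> Ob X \<Longrightarrow> T A (Idn X x) = Idn X (actO X A x)"
  by (simp add: Tar_def actA_Idn)

lemma fo_Tar [simp]: "weil_ob A \<Longrightarrow> x \<in> Ob X \<Longrightarrow> fo X (T A) x = actO X A x"
  by (simp add: fo_def)

lemma endo_Tar: "weil_ob A \<Longrightarrow> endo X (T A)"
  by (rule endoI) (auto simp: Tar_comp Tar_Idn)

lemma Tnt_simps [simp]:
  assumes "\<theta> \<in> Ar weil" "x \<in> Ob X"
  shows "Tn \<theta> x \<in> Ar X" "dom (Tn \<theta> x) = actO X (Dom weil \<theta>) x" "cod (Tn \<theta> x) = actO X (Cod weil \<theta>) x"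
  using assms by (simp_all add: Tnt_def)

lemma Tnt_comp: "\<theta> \<in> Ar weil \<Longrightarrow> \<theta>' \<in> Ar weil \<Longrightarrow> Cod weil \<theta> = Dom weil \<theta>' \<Longrightarrow> x \<in> Ob X \<Longrightarrow>
   Tn (\<theta>' \<cdot>\<^bsub>weil\<^esub> \<theta>) x = Tn \<theta>' x \<cdot> Tn \<theta> x"
  using actA_comp[of \<theta> "Idn X x" \<theta>' "Idn X x"] by (simp add: Tnt_def)

lemma Tnt_Idn: "weil_ob A \<Longrightarrow> x \<in> Ob X \<Longrightarrow> Tn (Idn weil A) x = Idn X (actO X A x)"
  by (simp add: Tnt_def actA_Idn)

lemma actA_split:
  assumes "\<theta> \<in> Ar weil" "arr f"
  shows "actA X \<theta> f = Tn \<theta> (cod f) \<cdot> T (Dom weil \<theta>) f" "actA X \<theta> f = T (Cod weil \<theta>) f \<cdot> Tn \<theta> (dom f)"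
proof -
  have o: "weil_ob (Dom weil \<theta>)" "weil_ob (Cod weil \<theta>)" using assms weil.Dom_Ob weil.Cod_Ob Ob_weil by blast+
  show "actA X \<theta> f = Tn \<theta> (cod f) \<cdot> T (Dom weil \<theta>) f"
    using actA_comp[of "Idn weil (Dom weil \<theta>)" f \<theta> "Idn X (cod f)"] assms o by (simp add: Tnt_def Tar_def)
  show "actA X \<theta> f = T (Cod weil \<theta>) f \<cdot> Tn \<theta> (dom f)"
    using actA_comp[of \<theta> "Idn X (dom f)" "Idn weil (Cod weil \<theta>)" f] assms o by (simp add: Tnt_def Tar_def)
qed

lemma nt_Tnt:
  assumes "\<theta> \<in> Hom weil A B"
  shows "nt X (T A) (T B) (Tn \<theta>)"
proof -
  have \<theta>: "\<theta> \<in> Ar weil" "Dom weil \<theta> = A" "Cod weil \<theta> = B" "weil_ob A" "weil_ob B"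
    using assms by (auto simp: weil.Hom_iff Hom_weil)
  show ?thesis
    by (rule ntI) (use \<theta> actA_split[OF \<theta>(1)] in \<open>auto simp: endo_Tar\<close>)
qed

lemma niso_Tnt:
  assumes "\<theta> \<in> Hom weil A B" "is_iso weil \<theta>"
  shows "niso X (T A) (T B)"
proof (rule nisoI[OF nt_Tnt[OF assms(1)]])
  fix x assume x: "x \<in> Ob X"
  have \<theta>: "\<theta> \<in> Ar weil" "Dom weil \<theta> = A" "Cod weil \<theta> = B" "weil_ob A" "weil_ob B"
    using assms by (auto simp: weil.Hom_iff Hom_weil)
  show "is_iso X (Tn \<theta> x)"
    by (rule is_isoI[where g = "Tn (inv_arrow weil \<theta>) x"])
      (use \<theta> x assms(2) in \<open>auto simp: Tnt_comp[symmetric] Tnt_Idn\<close>)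
qed

lemma unitA: assumes "x \<in> Ob X"
  shows "unitA X x \<in> Ar X" "dom (unitA X x) = x" "cod (unitA X x) = actO X wunit x" "is_iso X (unitA X x)"
  using acteg assms by (auto simp: actegory_def Hom_iff)

lemma nt_unit: "nt X id (T wunit) (unitA X)"
  by (rule ntI) (use acteg in \<open>auto simp: unitA endo_id endo_Tar fo_id actegory_def Hom_iff\<close>)

lemma multA: assumes "weil_ob A" "weil_ob B" "x \<in> Ob X"
  shows "multA X A B x \<in> Ar X" "dom (multA X A B x) = actO X A (actO X B x)"
    "cod (multA X A B x) = actO X (wten A B) x" "is_iso X (multA X A B x)"
  using acteg assms by (auto simp: actegory_def Hom_iff)

lemma multA_natural:
  assumes "\<theta> \<in> Hom weil A A'" "\<phi> \<in> Hom weil B B'" "f \<in> Hom X x y"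
  shows "multA X A' B' y \<cdot> actA X \<theta> (actA X \<phi> f) = actA X (wtena \<theta> \<phi>) f \<cdot> multA X A B x"
  using acteg assms unfolding actegory_def by blast

lemma wtena_Idn: assumes "weil_ob A" "weil_ob B" shows "wtena (Idn weil A) (Idn weil B) = Idn weil (wten A B)"
proof -
  note w = wtena_weil_map[OF wlift_id[OF assms(1)] wlift_id[OF assms(2)]]
  show ?thesis
    unfolding Idn_weil[OF assms(1)] Idn_weil[OF assms(2)] Idn_weil[OF ob_wten[OF assms]] w(2)
    by (rule weil_map_cong'[OF w(1)]) (simp add: wcotuple_def pshift_def)
qed

lemma nt_mult:
  assumes "weil_ob A" "weil_ob B"
  shows "nt X (T A \<circ> T B) (T (wten A B)) (multA X A B)"
proof (rule ntI)
  fix f assume f: "arr f"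
  have "Idn weil A \<in> Hom weil A A" "Idn weil B \<in> Hom weil B B" "f \<in> Hom X (dom f) (cod f)"
    using assms f by (auto simp: weil.Hom_iff Hom_iff)
  from multA_natural[OF this] show "multA X A B (cod f) \<cdot> (T A \<circ> T B) f = T (wten A B) f \<cdot> multA X A B (dom f)"
    by (simp add: Tar_def wtena_Idn assms)
qed (use assms in \<open>auto simp: endo_Tar endo_comp multA fo_comp\<close>)

lemma niso_mult: "weil_ob A \<Longrightarrow> weil_ob B \<Longrightarrow> niso X (T A \<circ> T B) (T (wten A B))"
  by (rule nisoI[OF nt_mult]) (auto simp: multA)

lemma niso_unit: "niso X id (T wunit)"
  by (rule nisoI[OF nt_unit]) (auto simp: unitA)

section \<open>Limits preserved by the whole action\<close>

lemma wlift_proj: "wlift (Wpow n) W1 (\<lambda>j. if j = i then pvar 0 else 0)"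
  by (rule wlift_Wpow) auto

lemma Wproj_Hom: "Wproj n i \<in> Hom weil (Wpow n) W1"
  unfolding Wproj_def by (rule weil_map(1)[OF wlift_proj])

lemma waug_Hom: "weil_ob A \<Longrightarrow> waug A \<in> Hom weil A wunit"
  unfolding waug_def by (rule weil_map(1)[OF wlift_zero]) auto

text \<open>
  The product \<open>W^n \<times> W\<close> is sent to a pullback, which adds one factor to the fibre power.
\<close>

lemma wide_pb_Wpow:
  assumes A: "weil_ob A" and x: "x \<in> Ob X"
  shows "wide_pb X n (\<lambda>_. T A (Tn w_p x)) (T A (Tn (waug (Wpow n)) x)) (\<lambda>i. T A (Tn (Wproj n i) x))"
proof (induction n)
  case 0
  have "waug wunit = Idn weil wunit" unfolding waug_def by (simp add: Idn_weil weil_map_wunit)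
  then have "T A (Tn (waug (Wpow 0)) x) = Idn X (actO X A (actO X wunit x))"
    using A x by (simp add: Wpow_0 Tnt_Idn Tar_Idn)
  then show ?case using A x by (auto intro!: wide_pb_0 is_iso_Idn)
next
  case (Suc n)
  let ?l = "\<lambda>i. if i < n then pvar i else 0"
  let ?L = "weil_map (Wpow (Suc n)) (Wpow n) ?l"
  have l: "wlift (Wpow (Suc n)) (Wpow n) ?l" by (rule wlift_Wpow) auto
  note L = weil_map(1)[OF l] and R = Wproj_Hom[of "Suc n" n]
  have "\<forall>x \<in> Ob X. \<forall>A \<in> Ob weil. \<forall>\<pi>\<^sub>0 \<pi>\<^sub>1. is_product weil \<pi>\<^sub>0 \<pi>\<^sub>1 \<longrightarrow>
        is_pullback X (Tn (wtena (Idn weil A) \<pi>\<^sub>0) x) (Tn (wtena (Idn weil A) \<pi>\<^sub>1) x)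
          (Tn (wtena (Idn weil A) (waug (Cod weil \<pi>\<^sub>0))) x) (Tn (wtena (Idn weil A) (waug (Cod weil \<pi>\<^sub>1))) x)"
    using tangent unfolding tangent_actegory_def by blast
  from this[THEN bspec, OF x, THEN bspec, of A, THEN spec, THEN spec, THEN mp, OF _ Wpow_product[of n]]
  have P: "is_pullback X
          (Tn (wtena (Idn weil A) ?L) x) (Tn (wtena (Idn weil A) (Wproj (Suc n) n)) x)
          (Tn (wtena (Idn weil A) (waug (Wpow n))) x) (Tn (wtena (Idn weil A) (waug W1)) x)"
    using A L R by (simp add: weil.Hom_iff)
  have IA: "Idn weil A \<in> Hom weil A A" using A by (simp add: weil.Hom_iff)
  have m: "multA X A B' x \<cdot> T A (Tn \<theta> x) = Tn (wtena (Idn weil A) \<theta>) x \<cdot> multA X A B x"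
    if "\<theta> \<in> Hom weil B B'" for \<theta> B B'
    using multA_natural[OF IA that, of "Idn X x" x x] x by (simp add: Tar_def Tnt_def Hom_iff)
  have inv: "T A (Tn \<theta> x) \<cdot> inv_arrow X (multA X A B x) = inv_arrow X (multA X A B' x) \<cdot> Tn (wtena (Idn weil A) \<theta>) x"
    if \<theta>: "\<theta> \<in> Hom weil B B'" for \<theta> B B'
  proof -
    have B: "weil_ob B" "weil_ob B'" "\<theta> \<in> Ar weil" "Dom weil \<theta> = B" "Cod weil \<theta> = B'" using \<theta> by (auto simp: Hom_weil[of \<theta>] weil.Hom_iff)
    have w: "wtena (Idn weil A) \<theta> \<in> Ar weil" "Dom weil (wtena (Idn weil A) \<theta>) = wten A B" "Cod weil (wtena (Idn weil A) \<theta>) = wten A B'"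
      using wtena_Hom[OF IA \<theta>] by (auto simp: weil.Hom_iff)
    have "multA X A B' x \<cdot> (T A (Tn \<theta> x) \<cdot> inv_arrow X (multA X A B x)) =
      Tn (wtena (Idn weil A) \<theta>) x \<cdot> (multA X A B x \<cdot> inv_arrow X (multA X A B x))"
      by (rule comp_extend[OF m[OF \<theta>]]) (use A x B w multA[OF A B(1) x] multA[OF A B(2) x] in auto)
    also have "\<dots> = multA X A B' x \<cdot> (inv_arrow X (multA X A B' x) \<cdot> Tn (wtena (Idn weil A) \<theta>) x)"
      using A x B w multA[OF A B(1) x] multA[OF A B(2) x] by simp
    finally show ?thesis
      by (rule iso_mono[OF multA(4)[OF A B(2) x], rotated -1]) (use A x B w multA[OF A B(1) x] multA[OF A B(2) x] in auto)
  qed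
  have wt: "wtena (Idn weil A) \<theta> \<in> Ar weil" "Dom weil (wtena (Idn weil A) \<theta>) = wten A B" "Cod weil (wtena (Idn weil A) \<theta>) = wten A B'"
    if "\<theta> \<in> Hom weil B B'" for \<theta> B B'
    using wtena_Hom[OF IA that] by (auto simp: weil.Hom_iff)
  let ?u = "T A (Tn (waug (Wpow n)) x)" and ?q = "T A (Tn w_p x)"
  let ?t = "T A (Tn ?L x)" and ?r = "T A (Tn (Wproj (Suc n) n) x)"
  let ?w = "T A (Tn (waug (Wpow (Suc n))) x)"
  have H: "waug (Wpow n) \<in> Hom weil (Wpow n) wunit" "waug W1 \<in> Hom weil W1 wunit" "waug (Wpow (Suc n)) \<in> Hom weil (Wpow (Suc n)) wunit"
    by (auto intro: waug_Hom)
  have c1: "waug (Wpow n) \<cdot>\<^bsub>weil\<^esub> ?L = waug (Wpow (Suc n))"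
    unfolding waug_def using weil_map_comp[OF l wlift_zero] weil_map_to_wunit[OF wlift_comp[OF l wlift_zero]] by (simp add: waug_def)
  have c2: "Wproj n i \<cdot>\<^bsub>weil\<^esub> ?L = Wproj (Suc n) i" if "i < n" for i
    unfolding Wproj_def weil_map_comp[OF l wlift_proj]
    by (rule weil_map_cong'[OF wlift_comp[OF l wlift_proj]]) (use that in auto)
  have ar: "\<theta> \<in> Ar weil" "Dom weil \<theta> = B" "Cod weil \<theta> = B'" "weil_ob B" "weil_ob B'" if "\<theta> \<in> Hom weil B B'" for \<theta> B B'
    using that by (auto simp: weil.Hom_iff Hom_weil)
  have ut: "?u \<cdot> ?t = ?w" unfolding c1[symmetric]
    using ar[OF L] ar[OF H(1)] A x Tar_comp[of A "Tn ?L x" "Tn (waug (Wpow n)) x"] by (simp add: Tnt_comp)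
  have W: "wtena (Idn weil A) (waug (Wpow n)) \<cdot>\<^bsub>weil\<^esub> wtena (Idn weil A) ?L = wtena (Idn weil A) (waug (Wpow (Suc n)))"
  proof -
    note I = wlift_id[OF A] and z = wlift_zero[OF ob_Wpow ob_wunit, of n] and z' = wlift_zero[OF ob_Wpow ob_wunit, of "Suc n"]
    note w = wtena_weil_map[OF I l] wtena_weil_map[OF I z] wtena_weil_map[OF I z']
    show ?thesis
      unfolding waug_def Idn_weil[OF A] w(2,4,6) weil_map_comp[OF w(1) w(3)]
      by (rule weil_map_cong'[OF wlift_comp[OF w(1,3)]]) (auto simp: wcotuple_def pshift_def)
  qed
  have pb: "wide_pb X 2 (\<lambda>i. if i = 0 then ?u else ?q) ?w (\<lambda>i. if i = 0 then ?t else ?r)"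
  proof (rule wide_pb_iso[OF is_pullback_wide_pb[OF P],
      where \<phi>P = "inv_arrow X (multA X A (Wpow (Suc n)) x)" and \<phi>B = "inv_arrow X (multA X A wunit x)"
        and \<phi>X = "\<lambda>i. if i = 0 then inv_arrow X (multA X A (Wpow n) x) else inv_arrow X (multA X A W1 x)"])
    show "?w \<cdot> inv_arrow X (multA X A (Wpow (Suc n)) x) =
      inv_arrow X (multA X A wunit x) \<cdot> (Tn (wtena (Idn weil A) (waug (Wpow n))) x \<cdot> Tn (wtena (Idn weil A) ?L) x)"
      unfolding inv[OF H(3)] W[symmetric] using wt[OF L] wt[OF H(1)] x by (simp add: Tnt_comp)
    show "(if i = 0 then ?u else ?q) \<cdot> (if i = 0 then inv_arrow X (multA X A (Wpow n) x) else inv_arrow X (multA X A W1 x)) =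
      inv_arrow X (multA X A wunit x) \<cdot> (if i = 0 then Tn (wtena (Idn weil A) (waug (Wpow n))) x else Tn (wtena (Idn weil A) (waug W1)) x)"
      for i :: nat using inv[OF H(1)] inv[OF H(2)] by (simp add: w_p_def)
    show "(if i = 0 then ?t else ?r) \<cdot> inv_arrow X (multA X A (Wpow (Suc n)) x) =
      (if i = 0 then inv_arrow X (multA X A (Wpow n) x) else inv_arrow X (multA X A W1 x)) \<cdot>
      (if i = 0 then Tn (wtena (Idn weil A) ?L) x else Tn (wtena (Idn weil A) (Wproj (Suc n) n)) x)"
      for i :: nat using inv[OF L] inv[OF R] by simp
  qed (use A x wt[OF L] wt[OF R] wt[OF H(1)] wt[OF H(2)] ar[OF L] ar[OF R] ar[OF H(1)] ar[OF H(2)] ar[OF H(3)] is_iso_inv_arrow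
       in \<open>auto simp: multA w_p_def\<close>)
  show ?case
  proof (rule wide_pb_Suc[OF Suc _ pb])
    show "T A (Tn (Wproj (Suc n) i) x) = T A (Tn (Wproj n i) x) \<cdot> ?t" if "i < n" for i
      unfolding c2[OF that, symmetric]
      using ar[OF L] ar[OF Wproj_Hom[of n i]] A x Tar_comp[of A "Tn ?L x" "Tn (Wproj n i) x"] by (simp add: Tnt_comp)
  qed (use A x ar[OF H(2)] in \<open>auto simp: w_p_def\<close>)
qed

end

context tan_acteg begin

lemma weil_Idn_Hom: "weil_ob A \<Longrightarrow> Idn weil A \<in> Hom weil A A"
  by (simp add: weil.Hom_iff)

lemma hom_weilD:
  assumes "\<theta> \<in> Hom weil A B"
  shows "\<theta> \<in> Ar weil" "Dom weil \<theta> = A" "Cod weil \<theta> = B" "weil_ob A" "weil_ob B"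
  using assms by (auto simp: weil.Hom_iff)

lemma ob_Wten [simp, intro]: "weil_ob (Wten k)"
  by (induction k) auto

lemma Wten_snoc: "wten (Wten k) W1 = Wten (Suc k)"
proof (induction k)
  case 0
  show ?case by (simp add: wten_unit_left wten_unit_right)
next
  case (Suc k)
  have "wten (Wten (Suc k)) W1 = wten W1 (wten (Wten k) W1)" by (simp add: wten_assoc)
  then show ?case using Suc by simp
qed

lemma endo_iter: "endo X (T W1 ^^ k)"
proof (induction k)
  case 0
  show ?case unfolding funpow.simps(1) by (rule endo_id)
next
  case (Suc k)
  show ?case unfolding funpow.simps(2) by (rule endo_comp[OF endo_Tar Suc]) simp
qed

lemma niso_iter: "niso X (T W1 ^^ k) (T (Wten k))"
proof (induction k)
  case 0
  then show ?case using niso_unit by (simp add: id_def)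
next
  case (Suc k)
  have "niso X (T W1 \<circ> (T W1 ^^ k)) (T W1 \<circ> T (Wten k))"
    by (rule niso_left[OF Suc endo_Tar]) simp
  then show ?case unfolding funpow.simps(2) Wten.simps(2) by (rule niso_trans[OF _ niso_mult]) auto
qed

text \<open>
  \<open>T\<^sub>A T\<^bsub>W^n\<^esub>\<close> is a fibre power of \<open>T\<^sub>A T\<^sub>W\<close>, so it inherits the limits preserved by the latter.
\<close>

lemma wide_pb_Wpow_step:
  assumes A: "weil_ob A" and S: "cone X m r v \<pi>"
    and pb0: "wide_pb X m (\<lambda>i. T A (r i)) (T A v) (\<lambda>i. T A (\<pi> i))"
    and pb1: "wide_pb X m (\<lambda>i. T A (T W1 (r i))) (T A (T W1 v)) (\<lambda>i. T A (T W1 (\<pi> i)))"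
  shows "wide_pb X m (\<lambda>i. T A (T (Wpow n) (r i))) (T A (T (Wpow n) v)) (\<lambda>i. T A (T (Wpow n) (\<pi> i)))"
proof -
  have e: "endo X (T A)" using A by (rule endo_Tar)
  have "niso X (T A \<circ> id) (T A \<circ> T wunit)" by (rule niso_left[OF niso_unit e])
  then have pb0': "wide_pb X m (\<lambda>i. (T A \<circ> T wunit) (r i)) ((T A \<circ> T wunit) v) (\<lambda>i. (T A \<circ> T wunit) (\<pi> i))"
    using wide_pb_niso[OF _ S, of "T A" "T A \<circ> T wunit"] pb0 by simp
  have "wide_pb X m (\<lambda>i. (T A \<circ> T (Wpow n)) (r i)) ((T A \<circ> T (Wpow n)) v) (\<lambda>i. (T A \<circ> T (Wpow n)) (\<pi> i))"
  proof (rule wide_pb_interchange[OF _ _ _ _ S pb0', where ?K1.0 = "T A \<circ> T W1" and m = n])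
    show "nt X (T A \<circ> T (Wpow n)) (T A \<circ> T wunit) (\<lambda>x. T A (Tn (waug (Wpow n)) x))"
      by (rule nt_left[OF nt_Tnt[OF waug_Hom] e]) simp
    show "nt X (T A \<circ> T W1) (T A \<circ> T wunit) (\<lambda>x. T A (Tn w_p x))"
      unfolding w_p_def by (rule nt_left[OF nt_Tnt[OF waug_Hom] e]) simp
    show "nt X (T A \<circ> T (Wpow n)) (T A \<circ> T W1) (\<lambda>x. T A (Tn (Wproj n j) x))" for j
      by (rule nt_left[OF nt_Tnt[OF Wproj_Hom] e])
  qed (use pb1 wide_pb_Wpow[OF A] in auto)
  then show ?thesis by simp
qed

lemma wide_pb_stable_word:
  assumes S: "cone X n r u \<pi>"
    and st: "\<And>k. wide_pb X n (\<lambda>i. (T W1 ^^ k) (r i)) ((T W1 ^^ k) u) (\<lambda>i. (T W1 ^^ k) (\<pi> i))"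
  shows "wide_pb X n (\<lambda>i. T (Wten k) (T (Wword ks) (r i))) (T (Wten k) (T (Wword ks) u))
    (\<lambda>i. T (Wten k) (T (Wword ks) (\<pi> i)))"
proof (induction ks arbitrary: k)
  case Nil
  have "niso X (T (Wten k) \<circ> id) (T (Wten k) \<circ> T wunit)" by (rule niso_left[OF niso_unit endo_Tar]) simp
  from niso_trans[OF niso_iter this[simplified]]
  show ?case using wide_pb_niso[OF _ S st, of _ "T (Wten k) \<circ> T wunit"] by simp
next
  case (Cons m ks)
  let ?F = "T (Wword ks)"
  have E: "endo X ?F" by (rule endo_Tar) simp
  have S': "cone X n (\<lambda>i. ?F (r i)) (?F u) (\<lambda>i. ?F (\<pi> i))"
  proof -
    have "?F (r i) \<cdot> ?F (\<pi> i) = ?F u" if "i < n" for i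
      using endo_simps(4)[OF E, of "\<pi> i" "r i"] coneD[OF S] that by simp
    then show ?thesis using coneD[OF S] by (simp add: cone_def)
  qed
  have n1: "niso X (T (Wten (Suc k))) (T (Wten k) \<circ> T W1)"
    using niso_sym[OF niso_mult[of "Wten k" W1]] unfolding Wten_snoc by simp
  have "wide_pb X n (\<lambda>i. T (Wten k) (T W1 (?F (r i)))) (T (Wten k) (T W1 (?F u))) (\<lambda>i. T (Wten k) (T W1 (?F (\<pi> i))))"
    using wide_pb_niso[OF n1 S' Cons[of "Suc k"]] by simp
  then have "wide_pb X n (\<lambda>i. T (Wten k) (T (Wpow m) (?F (r i)))) (T (Wten k) (T (Wpow m) (?F u)))
      (\<lambda>i. T (Wten k) (T (Wpow m) (?F (\<pi> i))))"
    by (rule wide_pb_Wpow_step[OF _ S' Cons[of k], rotated]) simp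
  moreover have "niso X (T (Wten k) \<circ> (T (Wpow m) \<circ> ?F)) (T (Wten k) \<circ> T (wten (Wpow m) (Wword ks)))"
    by (rule niso_left[OF niso_mult endo_Tar]) auto
  ultimately show ?case using wide_pb_niso[OF _ S, of "T (Wten k) \<circ> (T (Wpow m) \<circ> ?F)"
    "T (Wten k) \<circ> T (wten (Wpow m) (Wword ks))"] by simp
qed

text \<open>
  The isomorphism makes this class of functors contain the identity and composites of actions, which
  agree with the action of \<open>\<nat>\<close> and of a tensor product only up to isomorphism.
\<close>

definition actlike :: "('a \<Rightarrow> 'a) \<Rightarrow> bool" where
  "actlike K \<longleftrightarrow> (\<exists>A. weil_ob A \<and> niso X (T A) K)"

lemma actlike_endo: "actlike K \<Longrightarrow> endo X K"
  by (auto simp: actlike_def dest: niso_endo)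

lemma actlike_Tar: "weil_ob A \<Longrightarrow> actlike (T A)"
  unfolding actlike_def using niso_refl endo_Tar by blast

lemma actlike_id: "actlike id"
  unfolding actlike_def using niso_sym[OF niso_unit] by blast

lemma actlike_comp: assumes "actlike K" "weil_ob B" shows "actlike (K \<circ> T B)"
proof -
  obtain A where A: "weil_ob A" "niso X (T A) K" using assms by (auto simp: actlike_def)
  have "niso X (T (wten A B)) (K \<circ> T B)"
    by (rule niso_trans[OF niso_sym[OF niso_mult[OF A(1) assms(2)]] niso_right[OF A(2) endo_Tar[OF assms(2)]]])
  then show ?thesis using A assms unfolding actlike_def by blast
qed

text \<open>
  An algebra is isomorphic to a tensor product of algebras \<open>W^k\<close>, and each factor \<open>W^k\<close> can be replaced by
  \<open>W\<close> at the cost of a fibre power.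
\<close>

lemma wide_pb_stable:
  assumes S: "cone X n r u \<pi>"
    and st: "\<And>k. wide_pb X n (\<lambda>i. (T W1 ^^ k) (r i)) ((T W1 ^^ k) u) (\<lambda>i. (T W1 ^^ k) (\<pi> i))"
    and K: "actlike K"
  shows "wide_pb X n (\<lambda>i. K (r i)) (K u) (\<lambda>i. K (\<pi> i))"
proof -
  obtain A where A: "weil_ob A" "niso X (T A) K" using K by (auto simp: actlike_def)
  obtain ks \<phi> where \<phi>: "\<phi> \<in> Hom weil A (Wword ks)" "is_iso weil \<phi>" using iso_Wword[OF A(1)] by blast
  have "niso X (T (Wten 0) \<circ> T (Wword ks)) (T (Wword ks))"
    using niso_mult[of "Wten 0" "Wword ks"] by (simp add: wten_unit_left)
  from niso_trans[OF niso_trans[OF this niso_sym[OF niso_Tnt[OF \<phi>]]] A(2)]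
  show ?thesis using wide_pb_niso[OF _ S, of "T (Wten 0) \<circ> T (Wword ks)" K] wide_pb_stable_word[OF S st, of 0 ks] by simp
qed

lemma wide_pb_actlike_Wpow:
  assumes K: "actlike K" and x: "x \<in> Ob X"
  shows "wide_pb X n (\<lambda>_. K (Tn w_p x)) (K (Tn (waug (Wpow n)) x)) (\<lambda>i. K (Tn (Wproj n i) x))"
proof -
  obtain A where A: "weil_ob A" "niso X (T A) K" using K by (auto simp: actlike_def)
  have "niso X (T wunit) id" by (rule niso_sym[OF niso_unit])
  have S: "cone X n (\<lambda>_. Tn w_p x) (Tn (waug (Wpow n)) x) (\<lambda>i. Tn (Wproj n i) x)"
  proof -
    have "w_p \<cdot>\<^bsub>weil\<^esub> Wproj n i = waug (Wpow n)" for i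
      unfolding w_p_def Wproj_def waug_def[of W1] weil_map_comp[OF wlift_proj wlift_zero[OF ob_Wpow ob_wunit]]
      by (rule weil_map_to_wunit[OF wlift_comp[OF wlift_proj wlift_zero]]) auto
    then have "Tn w_p x \<cdot> Tn (Wproj n i) x = Tn (waug (Wpow n)) x" for i
      using Tnt_comp[of "Wproj n i" w_p x] hom_weilD[OF Wproj_Hom[of n i]] hom_weilD[OF waug_Hom[of W1]] x by (simp add: w_p_def)
    then show ?thesis
      using hom_weilD[OF Wproj_Hom[of n]] hom_weilD[OF waug_Hom[of W1]] hom_weilD[OF waug_Hom[of "Wpow n"]] x
      by (simp add: cone_def w_p_def)
  qed
  show ?thesis by (rule wide_pb_niso[OF A(2) S wide_pb_Wpow[OF A(1) x]])
qed

end

section \<open>Additive bundles under endofunctors\<close>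

text \<open>
  The image of a bundle under a functor. It is an additive bundle if the functor preserves the fibre powers.
\<close>

definition bmap :: "('o, 'a, 'x) cat_scheme \<Rightarrow> ('a \<Rightarrow> 'a) \<Rightarrow> ('o, 'a, 'y) abun_scheme \<Rightarrow> ('o, 'a) abun" where
  "bmap C K b = \<lparr>btot = fo C K (btot b), bbase = fo C K (bbase b), bproj = K (bproj b),
     bpow = (\<lambda>n. K (bpow b n)), bprj = (\<lambda>n i. K (bprj b n i)), bplus = K (bplus b), bzero = K (bzero b)\<rparr>"

lemma bmap_simps [simp]:
  "btot (bmap C K b) = fo C K (btot b)" "bbase (bmap C K b) = fo C K (bbase b)" "bproj (bmap C K b) = K (bproj b)"
  "bpow (bmap C K b) n = K (bpow b n)" "bprj (bmap C K b) n i = K (bprj b n i)"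
  "bplus (bmap C K b) = K (bplus b)" "bzero (bmap C K b) = K (bzero b)"
  by (simp_all add: bmap_def)

context cat begin

lemma bpowO_bmap: "is_bundle b \<Longrightarrow> endo C K \<Longrightarrow> bpowO C (bmap C K b) n = fo C K (bpowO C b n)"
  unfolding bpowO_def bmap_simps by (rule endo_simps(2)) (auto simp: bundleD)

lemma fibre_tuple:
  assumes pb: "wide_pb C n (\<lambda>_. q) u \<pi>" and v: "arr v" "cod v = cod u"
    and f: "\<And>i. i < n \<Longrightarrow> f i \<in> Ar C \<and> dom (f i) = dom v \<and> cod (f i) = dom q \<and> q \<cdot> f i = v"
  shows "fibre_tuple C n u \<pi> v f \<in> Ar C" "dom (fibre_tuple C n u \<pi> v f) = dom v"
    "cod (fibre_tuple C n u \<pi> v f) = dom u" "u \<cdot> fibre_tuple C n u \<pi> v f = v"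
    "i < n \<Longrightarrow> \<pi> i \<cdot> fibre_tuple C n u \<pi> v f = f i"
proof -
  have "\<exists>!h. h \<in> Ar C \<and> dom h = dom v \<and> cod h = dom u \<and> u \<cdot> h = v \<and> (\<forall>i<n. \<pi> i \<cdot> h = f i)"
    by (rule wide_pb_univ[OF pb v f])
  then have "\<exists>!h. h \<in> Hom C (dom v) (dom u) \<and> u \<cdot> h = v \<and> (\<forall>i<n. \<pi> i \<cdot> h = f i)"
    by (simp add: Hom_iff conj_assoc)
  from theI'[OF this] show "fibre_tuple C n u \<pi> v f \<in> Ar C" "dom (fibre_tuple C n u \<pi> v f) = dom v"
    "cod (fibre_tuple C n u \<pi> v f) = dom u" "u \<cdot> fibre_tuple C n u \<pi> v f = v"
    "i < n \<Longrightarrow> \<pi> i \<cdot> fibre_tuple C n u \<pi> v f = f i"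
    unfolding fibre_tuple_def by (auto simp: Hom_iff)
qed

lemma fibre_tuple_eqI:
  assumes pb: "wide_pb C n (\<lambda>_. q) u \<pi>" and h: "arr h" "cod h = dom u" "u \<cdot> h = v" "dom v = dom h"
    "\<And>i. i < n \<Longrightarrow> \<pi> i \<cdot> h = f i"
  shows "fibre_tuple C n u \<pi> v f = h"
  unfolding fibre_tuple_def
proof (rule the_equality)
  show "h \<in> Hom C (dom v) (dom u) \<and> u \<cdot> h = v \<and> (\<forall>i<n. \<pi> i \<cdot> h = f i)" using h by (simp add: Hom_iff)
  fix k assume k: "k \<in> Hom C (dom v) (dom u) \<and> u \<cdot> k = v \<and> (\<forall>i<n. \<pi> i \<cdot> k = f i)"
  show "k = h" by (rule wide_pb_eq[OF pb]) (use h k in \<open>auto simp: Hom_iff\<close>)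
qed

lemma bmap_fib_add:
  assumes b: "is_bundle b" and K: "endo C K"
    and pb: "wide_pb C 2 (\<lambda>_. K (bproj b)) (K (bpow b 2)) (\<lambda>i. K (bprj b 2 i))"
    and f: "f \<in> lifts b v" and g: "g \<in> lifts b v"
  shows "K (fib_add C b f g) = fib_add C (bmap C K b) (K f) (K g)"
proof -
  note D = bundleD[OF b] and E = endo_simps[OF K] and v = fibm_base[OF b f]
  note t = bpair[OF b v f g] and F = fibmD[OF f] and G = fibmD[OF g]
  have qf: "K (bproj b) \<cdot> K f = K v" using E(4)[OF F(1) D(1)] F D by simp
  have "bpair C (bmap C K b) (K f) (K g) =
    fibre_tuple C 2 (K (bpow b 2)) (\<lambda>i. K (bprj b 2 i)) (K v) (\<lambda>i. if i = 0 then K f else K g)"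
    by (simp add: bpair_def qf bmap_def)
  also have "\<dots> = K (bpair C b f g)"
  proof (rule fibre_tuple_eqI[OF pb])
    show "K (bpow b 2) \<cdot> K (bpair C b f g) = K v"
      using E(4)[of "bpair C b f g" "bpow b 2"] t D by simp
    show "K (bprj b 2 i) \<cdot> K (bpair C b f g) = (if i = 0 then K f else K g)" if "i < 2" for i
      using E(4)[of "bpair C b f g" "bprj b 2 i"] t D that by (auto simp: less_2_cases_iff)
  qed (use t E D v in auto)
  finally have "bpair C (bmap C K b) (K f) (K g) = K (bpair C b f g)" .
  then show ?thesis using E(4)[of "bpair C b f g" "bplus b"] t D by (simp add: fib_add_def)
qed

lemma bundle_bmap:
  assumes b: "is_bundle b" and K: "endo C K"
    and pb: "\<And>n. wide_pb C n (\<lambda>_. K (bproj b)) (K (bpow b n)) (\<lambda>i. K (bprj b n i))"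
  shows "is_bundle (bmap C K b)"
proof -
  note D = bundleD[OF b] and E = endo_simps[OF K] and L = bundle_laws[OF b]
  note add = bmap_fib_add[OF b K pb]
  have ob: "btot b \<in> Ob C" "bbase b \<in> Ob C" using Dom_Ob[OF D(1)] Cod_Ob[OF D(1)] D by simp_all
  have p: "bprj b n i \<in> lifts b (bpow b n)" if "i < n" for i n by (rule bprj_carrier[OF b that])
  have i: "Idn C (btot b) \<in> lifts b (bproj b)" "bzero b \<cdot> bproj b \<in> lifts b (bproj b)"
    using D comp_extend1[OF D(10), of "bproj b"] Dom_Ob[OF D(1)] by (simp_all add: fibm_carrier)
  have a3: "fib_add C b (bprj b 3 i) (bprj b 3 j) \<in> lifts b (bpow b 3)" if "i < 3" "j < 3" for i j
    by (rule fib_add[OF b D(15,17) p[OF that(1)] p[OF that(2)]])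
  have 1: "fib_add C (bmap C K b) (fib_add C (bmap C K b) (K (bprj b 3 0)) (K (bprj b 3 1))) (K (bprj b 3 2)) =
    fib_add C (bmap C K b) (K (bprj b 3 0)) (fib_add C (bmap C K b) (K (bprj b 3 1)) (K (bprj b 3 2)))"
    using arg_cong[OF L(1), of K] add[OF a3[of 0 1] p[of 2 3]] add[OF p[of 0 3] p[of 1 3]]
      add[OF p[of 0 3] a3[of 1 2]] add[OF p[of 1 3] p[of 2 3]] by simp
  have 2: "fib_add C (bmap C K b) (K (bprj b 2 1)) (K (bprj b 2 0)) = K (bplus b)"
    using arg_cong[OF L(2), of K] add[OF p[of 1 2] p[of 0 2]] by simp
  have 3: "fib_add C (bmap C K b) (Idn C (fo C K (btot b))) (K (bzero b) \<cdot> K (bproj b)) = Idn C (fo C K (btot b))"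
    using arg_cong[OF L(3), of K] add[OF i] E(4)[of "bproj b" "bzero b"] D ob by (simp add: E(5))
  have pl: "K (bproj b) \<cdot> K (bplus b) = K (bpow b 2)" "K (bproj b) \<cdot> K (bprj b 2 0) = K (bpow b 2)" "K (bproj b) \<cdot> K (bprj b 2 1) = K (bpow b 2)"
    using E(4)[of "bplus b" "bproj b"] E(4)[of "bprj b 2 0" "bproj b"] E(4)[of "bprj b 2 1" "bproj b"] D(14) D by simp_all
  have z: "K (bproj b) \<cdot> K (bzero b) = Idn C (fo C K (bbase b))" using E(4)[of "bzero b" "bproj b"] D ob by (simp add: E(5))
  have fp: "fibre_power C (K (bproj b)) n (K (bpow b n)) (\<lambda>i. K (bprj b n i))" for n
    unfolding fibre_power_iff using pb D E by simp
  have po: "bpowO C (bmap C K b) 2 = fo C K (bpowO C b 2)" by (rule bpowO_bmap[OF b K])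
  show ?thesis
    unfolding additive_bundle_def
  proof (intro conjI allI)
    show "fibre_power C (bproj (bmap C K b)) n (bpow (bmap C K b) n) (bprj (bmap C K b) n)" for n
      using fp by (simp add: bmap_def)
  qed (use 1 2 3 pl z po D E ob in \<open>auto simp: Hom_iff fib_add_def\<close>)
qed

lemma bmap_monoid_map:
  assumes b: "is_bundle b" and K: "endo C K" and b': "is_bundle (bmap C K b)"
    and v: "arr v" "cod v = bbase b"
  shows "monoid_map (fib b v) (fib (bmap C K b) (K v)) K"
proof -
  note D = bundleD[OF b] and E = endo_simps[OF K]
  have c: "K f \<in> lifts (bmap C K b) (K v)" if "f \<in> lifts b v" for f
    using fibmD[OF that] E(4)[of f "bproj b"] D E v by (simp add: fibm_carrier)
  have pb: "wide_pb C 2 (\<lambda>_. K (bproj b)) (K (bpow b 2)) (\<lambda>i. K (bprj b 2 i))"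
    using bundleD(22)[OF b', of 2] by (simp add: bmap_def)
  show ?thesis
    unfolding monoid_map_def using c bmap_fib_add[OF b K pb] E(4)[of v "bzero b"] v D by simp
qed

lemma bmap_carrier:
  assumes b: "is_bundle b" and K: "endo C K" and b': "is_bundle (bmap C K b)" and f: "f \<in> lifts b v"
  shows "K f \<in> lifts (bmap C K b) (K v)"
  using bmap_monoid_map[OF b K b' fibm_base[OF b f]] f by (simp add: monoid_map_def)

lemma bmap_tup:
  assumes b: "is_bundle b" and K: "endo C K" and b': "is_bundle (bmap C K b)"
    and v: "arr v" "cod v = bbase b" and e: "\<And>i. i < n \<Longrightarrow> e i \<in> lifts b v"
  shows "K (tup C b n v e) = tup C (bmap C K b) n (K v) (\<lambda>i. K (e i))"
proof (rule tup_unique[OF b'])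
  note D = bundleD[OF b] and E = endo_simps[OF K]
  have t: "tup C b n v e \<in> Ar C" "cod (tup C b n v e) = bpowO C b n" "bpow b n \<cdot> tup C b n v e = v"
    "\<And>i. i < n \<Longrightarrow> bprj b n i \<cdot> tup C b n v e = e i" using tup[OF b v, of n e] e by auto
  show "K (tup C b n v e) \<in> Ar C" "cod (K (tup C b n v e)) = bpowO C (bmap C K b) n"
    using t E by (simp_all add: bpowO_bmap[OF b K])
  show "bpow (bmap C K b) n \<cdot> K (tup C b n v e) = K v" using E(4)[of "tup C b n v e" "bpow b n"] t D by simp
  show "bprj (bmap C K b) n i \<cdot> K (tup C b n v e) = K (e i)" if "i < n" for i
    using E(4)[of "tup C b n v e" "bprj b n i"] t D that by simp
qed

lemma bmap_ind_ar:
  assumes b: "is_bundle b" and K: "endo C K" and b': "is_bundle (bmap C K b)"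
  shows "K (ind_ar C b a) = ind_ar C (bmap C K b) a"
proof -
  note D = bundleD[OF b]
  let ?v = "bpow b (dim_col a)" let ?G = "fib b ?v" let ?H = "fib (bmap C K b) (K ?v)"
  have p: "bprj b (dim_col a) j \<in> carrier ?G" if "j < dim_col a" for j by (rule bprj_carrier[OF b that])
  have l: "K (lincomb ?G {..<dim_col a} c (bprj b (dim_col a))) = lincomb ?H {..<dim_col a} c (\<lambda>j. K (bprj b (dim_col a) j))" for c
    by (rule monoid_map_lincomb[OF comm_monoid_fibm[OF b D(15,17)] comm_monoid_fibm[OF b'] bmap_monoid_map[OF b K b' D(15,17)]])
      (use p D endo_simps[OF K] in auto)
  have "K (ind_ar C b a) = tup C (bmap C K b) (dim_row a) (K ?v) (\<lambda>i. K (lincomb ?G {..<dim_col a} (\<lambda>j. a $$ (i, j)) (bprj b (dim_col a))))"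
    unfolding ind_ar_eq_tup[OF b] by (rule bmap_tup[OF b K b' D(15,17)]) (rule lincomb_fibm(1)[OF b D(15,17)], use p in auto)
  also have "\<dots> = ind_ar C (bmap C K b) a" unfolding l ind_ar_eq_tup[OF b'] by (simp add: bmap_def)
  finally show ?thesis .
qed

text \<open>The operations of a bundle are arrows, so naturality with respect to them is additivity.\<close>

lemma nt_bundle_mor:
  assumes n: "nt C F G \<phi>" and b: "is_bundle b" and F: "is_bundle (bmap C F b)" and G: "is_bundle (bmap C G b)"
  shows "bundle_mor (bmap C F b) (bmap C G b) (\<phi> (btot b)) (\<phi> (bbase b))"
proof -
  note N = ntD[OF n] and D = bundleD[OF b] and E = endo_simps[OF ntD(1)[OF n]] endo_simps[OF ntD(2)[OF n]]
  have ob: "btot b \<in> Ob C" "bbase b \<in> Ob C" "bpowO C b 2 \<in> Ob C"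
    using Dom_Ob[OF D(1)] Cod_Ob[OF D(1)] Dom_Ob[OF D(15)[of 2]] D by simp_all
  have nat: "\<phi> y \<cdot> F f = G f \<cdot> \<phi> x" if "arr f" "dom f = x" "cod f = y" for f x y using N(6) that by metis
  have "\<phi> (bpowO C b 2) = bpair C (bmap C G b) (\<phi> (btot b) \<cdot> F (bprj b 2 0)) (\<phi> (btot b) \<cdot> F (bprj b 2 1))"
  proof (rule bpair_unique[OF G])
    show "bprj (bmap C G b) 2 0 \<cdot> \<phi> (bpowO C b 2) = \<phi> (btot b) \<cdot> F (bprj b 2 0)"
      using nat[of "bprj b 2 0" "bpowO C b 2" "btot b"] D by simp
    show "bprj (bmap C G b) 2 (Suc 0) \<cdot> \<phi> (bpowO C b 2) = \<phi> (btot b) \<cdot> F (bprj b 2 1)"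
      using nat[of "bprj b 2 1" "bpowO C b 2" "btot b"] D by simp
  qed (use N(3-5) ob bpowO_bmap[OF b N(2)] in auto)
  then have "\<phi> (btot b) \<cdot> F (bplus b) = G (bplus b) \<cdot> bpair C (bmap C G b) (\<phi> (btot b) \<cdot> F (bprj b 2 0)) (\<phi> (btot b) \<cdot> F (bprj b 2 1))"
    using nat[of "bplus b" "bpowO C b 2" "btot b"] D by simp
  then show ?thesis
    unfolding additive_bundle_mor_def
    using nat[of "bproj b" "btot b" "bbase b"] nat[of "bzero b" "bbase b" "btot b"] D N(3-5) ob by (simp add: Hom_iff)
qed

lemma bmap_bundle_mor:
  assumes b: "is_bundle b" and b': "is_bundle b'" and K: "endo C K"
    and Kb: "is_bundle (bmap C K b)" and Kb': "is_bundle (bmap C K b')"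
    and m: "bundle_mor b b' f g"
  shows "bundle_mor (bmap C K b) (bmap C K b') (K f) (K g)"
proof -
  note D = bundleD[OF b] and D' = bundleD[OF b'] and M = bundle_morD[OF m] and E = endo_simps[OF K]
  have pc: "f \<cdot> bprj b 2 i \<in> lifts b' (g \<cdot> bpow b 2)" if "i < 2" for i
    by (rule bundle_mor_carrier[OF b b' m bprj_carrier[OF b that]])
  have pb: "wide_pb C 2 (\<lambda>_. K (bproj b')) (K (bpow b' 2)) (\<lambda>i. K (bprj b' 2 i))"
    using bundleD(22)[OF Kb', of 2] by (simp add: bmap_def)
  have "K (f \<cdot> bplus b) = fib_add C (bmap C K b') (K (f \<cdot> bprj b 2 0)) (K (f \<cdot> bprj b 2 1))"
    unfolding M(9) by (rule bmap_fib_add[OF b' K pb pc pc]) auto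
  then have a: "K f \<cdot> K (bplus b) = fib_add C (bmap C K b') (K f \<cdot> K (bprj b 2 0)) (K f \<cdot> K (bprj b 2 1))"
    using E(4)[of "bplus b" f] E(4)[of "bprj b 2 0" f] E(4)[of "bprj b 2 1" f] M D by simp
  have 1: "K (bproj b') \<cdot> K f = K g \<cdot> K (bproj b)"
    using arg_cong[OF M(7), of K] E(4)[of f "bproj b'"] E(4)[of "bproj b" g] M D D' by simp
  have 2: "K f \<cdot> K (bzero b) = K (bzero b') \<cdot> K g"
    using arg_cong[OF M(8), of K] E(4)[of "bzero b" f] E(4)[of g "bzero b'"] M D D' by simp
  show ?thesis unfolding additive_bundle_mor_def using a 1 2 M E by (simp add: Hom_iff fib_add_def)
qed

lemma bmap_bmap:
  assumes "is_bundle b" "endo C K" "endo C K'"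
  shows "bmap C K (bmap C K' b) = bmap C (K \<circ> K') b"
  using assms Dom_Ob[of "bproj b"] Cod_Ob[of "bproj b"] bundleD(1-3)[OF assms(1)] by (simp add: bmap_def fo_comp)

end

context comm_monoid begin

lemma lincomb_reindex_support:
  assumes h: "bij_betw h {..<n} S" and S: "S \<subseteq> T" "finite T" and c: "\<And>t. t \<in> T \<Longrightarrow> t \<notin> S \<Longrightarrow> c t = 0"
    and e: "\<And>t. t \<in> T \<Longrightarrow> e t \<in> carrier G"
  shows "lincomb G {..<n} (\<lambda>i. c (h i)) (\<lambda>i. e (h i)) = lincomb G T c e"
proof -
  have "lincomb G {..<n} (\<lambda>i. c (h i)) (\<lambda>i. e (h i)) = finprod G (\<lambda>t. e t [^] c t) (h ` {..<n})"
    unfolding lincomb_def using h S e by (intro finprod_reindex[symmetric]) (auto simp: bij_betw_def)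
  also have "h ` {..<n} = S" using h by (simp add: bij_betw_def)
  also have "finprod G (\<lambda>t. e t [^] c t) S = finprod G (\<lambda>t. e t [^] c t) T"
    by (rule finprod_mono_neutral_cong_left) (use S c e in auto)
  finally show ?thesis by (simp add: lincomb_def)
qed

end

section \<open>The lift along square-zero elements\<close>

locale dbundle = tan_acteg X for X :: "('o, 'a) acteg" (structure) +
  fixes E :: "('o, 'a) dbun"
  assumes db: "differential_bundle X E"
begin

abbreviation "tE \<equiv> btot E"
abbreviation "M \<equiv> bbase E"
abbreviation "q \<equiv> bproj E"
abbreviation "B K \<equiv> bmap X K E"

abbreviation FE :: "nat mat \<Rightarrow> 'a" where "FE \<equiv> ind_ar X E"

lemma abE: "is_bundle E"
  using db by (simp add: differential_bundle_def)

lemmas DE = bundleD[OF abE]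

lemma obE [simp]: "tE \<in> Ob X" "M \<in> Ob X"
  using Dom_Ob[OF DE(1)] Cod_Ob[OF DE(1)] DE by simp_all

lemma abB: assumes K: "actlike K" shows "is_bundle (B K)"
proof (rule bundle_bmap[OF abE actlike_endo[OF K]])
  fix n
  show "wide_pb X n (\<lambda>_. K q) (K (bpow E n)) (\<lambda>i. K (bprj E n i))"
  proof (rule wide_pb_stable[OF wide_pb_cone[OF DE(22)] _ K])
    fix k
    have "fibre_power X ((TA X ^^ k) q) n ((TA X ^^ k) (bpow E n)) (\<lambda>i. (TA X ^^ k) (bprj E n i))"
      using db unfolding differential_bundle_def by blast
    then show "wide_pb X n (\<lambda>_. (TA X ^^ k) q) ((TA X ^^ k) (bpow E n)) (\<lambda>i. (TA X ^^ k) (bprj E n i))"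
      by (simp add: fibre_power_iff)
  qed
qed

lemma fib_add_bmap_id: "fib_add X (B id) = fib_add X E"
  by (intro ext) (simp add: fib_add_def bpair_def bmap_def)

lemma fibm_bmap_id [simp]: "fib (B id) v = fib E v"
  by (simp add: fibm_def fib_add_bmap_id) (simp add: fo_id)

lemma bundle_mor_id [simp]: "bundle_mor (B id) b f g = bundle_mor E b f g"
  by (simp add: additive_bundle_mor_def fo_id)

lemma bmap_bmap_E: "endo X K \<Longrightarrow> endo X K' \<Longrightarrow> bmap X K (B K') = B (K \<circ> K')"
  by (rule bmap_bmap[OF abE])

text \<open>
  The zero section of the action of \<open>A\<close>; for \<open>A = W\<close> it is the zero of the tangent structure.
\<close>

definition zsec :: "wob \<Rightarrow> 'o \<Rightarrow> 'a" where
  "zsec A x = Tn (wini A) x \<cdot> unitA X x"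

lemma wini_Hom: "weil_ob A \<Longrightarrow> wini A \<in> Hom weil wunit A"
  unfolding wini_def by (rule weil_map(1)[OF wlift_wunit])

lemma wini_unique: "\<theta> \<in> Hom weil wunit A \<Longrightarrow> \<theta> = wini A"
  unfolding wini_def by (elim hom_weilE) (simp add: weil_map_wunit hom_weilD weil_map_wunit[OF wliftD(2)])

lemma comp_wini: "\<theta> \<in> Hom weil A A' \<Longrightarrow> \<theta> \<cdot>\<^bsub>weil\<^esub> wini A = wini A'"
  by (rule wini_unique, rule weil.comp_Hom[OF wini_Hom]) (auto dest: hom_weilD)

lemma zsec [simp]: assumes "weil_ob A" "x \<in> Ob X"
  shows "zsec A x \<in> Ar X" "dom (zsec A x) = x" "cod (zsec A x) = actO X A x"
  using hom_weilD[OF wini_Hom[OF assms(1)]] unitA[OF assms(2)] assms(2) by (simp_all add: zsec_def)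

lemma nt_zsec: "weil_ob A \<Longrightarrow> nt X id (T A) (zsec A)"
  unfolding zsec_def by (rule nt_comp[OF nt_unit nt_Tnt[OF wini_Hom]])

lemma zsec_natural: "weil_ob A \<Longrightarrow> arr f \<Longrightarrow> zsec A (cod f) \<cdot> f = T A f \<cdot> zsec A (dom f)"
  using ntD(6)[OF nt_zsec] by simp

lemma Tnt_zsec: assumes "\<theta> \<in> Hom weil A A'" "x \<in> Ob X" shows "Tn \<theta> x \<cdot> zsec A x = zsec A' x"
proof -
  note H = hom_weilD[OF assms(1)] and I = hom_weilD[OF wini_Hom[OF hom_weilD(4)[OF assms(1)]]]
  have "Tn \<theta> x \<cdot> zsec A x = (Tn \<theta> x \<cdot> Tn (wini A) x) \<cdot> unitA X x"
    unfolding zsec_def by (rule comp_assoc[symmetric]) (use H I unitA[OF assms(2)] assms(2) in auto)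
  also have "Tn \<theta> x \<cdot> Tn (wini A) x = Tn (wini A') x"
    using Tnt_comp[OF I(1) H(1)] H I assms comp_wini[OF assms(1)] by simp
  finally show ?thesis by (simp add: zsec_def)
qed

lemma zsec_wunit: assumes "x \<in> Ob X" shows "zsec wunit x = unitA X x"
proof -
  have "wini wunit = Idn weil wunit" by (rule wini_unique[symmetric, OF weil_Idn_Hom]) simp
  then show ?thesis using unitA[OF assms] assms by (simp add: zsec_def Tnt_Idn)
qed

lemma Tnt_mor: assumes "\<theta> \<in> Hom weil A A'"
  shows "bundle_mor (B (T A)) (B (T A')) (Tn \<theta> tE) (Tn \<theta> M)"
  using nt_bundle_mor[OF nt_Tnt[OF assms] abE] abB[OF actlike_Tar] hom_weilD[OF assms] by simp

abbreviation "lft \<equiv> blift E"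

lemma Tbundle_eq: "Tbundle X E = B (T W1)"
  by (simp add: Tbundle_def bmap_def)

lemma tan_zero_eq: "tan_zero X x = zsec W1 x"
  by (simp add: tan_zero_def w_zero_def zsec_def)

lemma lift_mor: "bundle_mor E (B (T W1)) lft (zsec W1 M)"
  using db by (simp add: differential_bundle_def Tbundle_eq tan_zero_eq)

lemmas DL = bundle_morD[OF lift_mor]

lemma lft [simp]: "arr lft" "dom lft = tE" "cod lft = actO X W1 tE"
  using DL by simp_all

lemma lift_tangent: "bundle_mor E (tangent_bundle X tE) lft (bzero E)"
  using db by (simp add: differential_bundle_def)

lemma tan_p_lift: "Tn w_p tE \<cdot> lft = unitA X tE \<cdot> (bzero E \<cdot> q)"
proof -
  note U = unitA[OF obE(1)] and P = hom_weilD[OF waug_Hom[OF ob_Wpow, of 1], folded w_p_def]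
  have "(inv_arrow X (unitA X tE) \<cdot> Tn w_p tE) \<cdot> lft = bzero E \<cdot> q"
    using bundle_morD(7)[OF lift_tangent] by (simp add: tangent_bundle_def tan_p_def)
  then have "inv_arrow X (unitA X tE) \<cdot> (Tn w_p tE \<cdot> lft) = bzero E \<cdot> q" using U P by simp
  then have "unitA X tE \<cdot> (inv_arrow X (unitA X tE) \<cdot> (Tn w_p tE \<cdot> lft)) = unitA X tE \<cdot> (bzero E \<cdot> q)" by simp
  then show ?thesis using U P by simp
qed

text \<open>
  The axiom \<open>\<ell> \<lambda> = T(\<lambda>) \<lambda>\<close> without the inverse of the structure isomorphism.
\<close>

lemma lift_lift: "Tn w_l tE \<cdot> lft = multA X W1 W1 tE \<cdot> (T W1 lft \<cdot> lft)"
proof -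
  have wl: "wlift W1 (wten W1 W1) (\<lambda>_. pvar 0 * pvar 1)"
  proof -
    have "(pvar 0 * pvar 1 * (pvar 0 * pvar 1), 0) \<in> wcong (wten W1 W1)"
    proof -
      have "(pvar 0 * pvar 0 * (pvar 1 * pvar 1), 0 * (pvar 1 * pvar 1)) \<in> wcong (wten W1 W1)"
        by (intro wcong.mult wcong.gen wcong.refl) (auto simp: snd_wten)
      then show ?thesis by (simp add: ac_simps)
    qed
    then show ?thesis by (auto simp: wlift_def)
  qed
  note L = hom_weilD[OF weil_map(1)[OF wl], folded w_l_def] and m = multA[OF ob_Wpow ob_Wpow obE(1), of 1 1]
  have "(inv_arrow X (multA X W1 W1 tE) \<cdot> Tn w_l tE) \<cdot> lft = T W1 lft \<cdot> lft"
    using db by (simp add: differential_bundle_def tan_l_def)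
  then have "inv_arrow X (multA X W1 W1 tE) \<cdot> (Tn w_l tE \<cdot> lft) = T W1 lft \<cdot> lft" using L m by simp
  then have "multA X W1 W1 tE \<cdot> (inv_arrow X (multA X W1 W1 tE) \<cdot> (Tn w_l tE \<cdot> lft)) = multA X W1 W1 tE \<cdot> (T W1 lft \<cdot> lft)" by simp
  then show ?thesis using L m by simp
qed

subsection \<open>Square-zero elements act on the bundle\<close>

text \<open>
  Elements \<open>p\<close> with \<open>p p = 0\<close>, in the form of morphisms \<open>W \<rightarrow> A\<close> with \<open>x \<mapsto> p\<close>.
\<close>

definition sqz :: "wob \<Rightarrow> npoly \<Rightarrow> bool" where
  "sqz A p \<longleftrightarrow> wlift W1 A (\<lambda>_. p)"

lemma sqzI: "weil_ob A \<Longrightarrow> p \<in> polys A \<Longrightarrow> (p * p, 0) \<in> wcong A \<Longrightarrow> sqz A p"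
  by (simp add: sqz_def wlift_def)

text \<open>
  The lift \<open>\<lambda>\<close> with the generator \<open>x\<close> of \<open>W\<close> replaced by \<open>p\<close>.
\<close>

definition plft :: "wob \<Rightarrow> npoly \<Rightarrow> 'a" where
  "plft A p = Tn (weil_map W1 A (\<lambda>_. p)) tE \<cdot> lft"

abbreviation "pbase A \<equiv> zsec A M \<cdot> q"

lemma pbase [simp]: "weil_ob A \<Longrightarrow> pbase A \<in> Ar X" "weil_ob A \<Longrightarrow> dom (pbase A) = tE" "weil_ob A \<Longrightarrow> cod (pbase A) = actO X A M"
  using DE by simp_all

lemma sqz_Hom: "sqz A p \<Longrightarrow> weil_map W1 A (\<lambda>_. p) \<in> Hom weil W1 A"
  unfolding sqz_def by (rule weil_map(1))

lemma sqz_ob: "sqz A p \<Longrightarrow> weil_ob A"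
  unfolding sqz_def by (rule wliftD(2))

lemma plft_mor: assumes p: "sqz A p" shows "bundle_mor E (B (T A)) (plft A p) (zsec A M)"
proof -
  note H = sqz_Hom[OF p] and A = sqz_ob[OF p]
  show ?thesis
    using bundle_mor_comp[OF abE abB[OF actlike_Tar] abB[OF actlike_Tar] lift_mor Tnt_mor[OF H]] A Tnt_zsec[OF H obE(2)]
    by (simp add: plft_def)
qed

lemma mor_carrier:
  assumes "bundle_mor E (B (T A)) f (zsec A M)"
  shows "f \<in> lifts (B (T A)) (pbase A)"
  using bundle_morD[OF assms] DE Dom_comp[of q "zsec A M"] by (simp add: fibm_carrier)

lemma Tnt_plft: assumes p: "sqz A p" and g: "wlift A A' g"
  shows "Tn (weil_map A A' g) tE \<cdot> plft A p = plft A' (subst g p)" "sqz A' (subst g p)"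
proof -
  note H = hom_weilD[OF sqz_Hom[OF p]] and G = hom_weilD[OF weil_map(1)[OF g]]
  have "Tn (weil_map A A' g) tE \<cdot> plft A p = (Tn (weil_map A A' g) tE \<cdot> Tn (weil_map W1 A (\<lambda>_. p)) tE) \<cdot> lft"
    unfolding plft_def by (rule comp_assoc[symmetric]) (use H G in auto)
  then show "Tn (weil_map A A' g) tE \<cdot> plft A p = plft A' (subst g p)"
    using Tnt_comp[OF H(1) G(1)] H G weil_map_comp[OF p[unfolded sqz_def] g] by (simp add: plft_def)
  show "sqz A' (subst g p)" using wlift_comp[OF p[unfolded sqz_def] g] by (simp add: sqz_def)
qed

lemma plft_cong: assumes "sqz A p" "(p, p') \<in> wcong A" shows "plft A p = plft A p'" "sqz A p'"
proof -
  note A = sqz_ob[OF assms(1)]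
  have "(p' * p', 0) \<in> wcong A"
    using wliftD(4)[OF assms(1)[unfolded sqz_def], of 0 0] wcong.mult[OF assms(2) assms(2)] by (auto intro: wcong.sym wcong.trans)
  then show s: "sqz A p'" using wcong_npolys[OF A assms(2)] A by (auto intro: sqzI)
  show "plft A p = plft A p'"
    unfolding plft_def using weil_map_cong[OF assms(1)[unfolded sqz_def] s[unfolded sqz_def]] assms(2) by simp
qed

text \<open>
  The morphism \<open>x \<mapsto> 0\<close> factors through \<open>p : W \<rightarrow> \<nat>\<close>, and \<open>p \<lambda> = \<zeta> q\<close>.
\<close>

lemma plft_zero: assumes A: "weil_ob A" shows "plft A 0 = \<one>\<^bsub>fib (B (T A)) (pbase A)\<^esub>"
proof -
  note I = hom_weilD[OF wini_Hom[OF A]] and P = hom_weilD[OF waug_Hom[OF ob_Wpow, of 1], folded w_p_def] and U = unitA[OF obE(1)]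
  have c: "wini A \<cdot>\<^bsub>weil\<^esub> w_p = weil_map W1 A (\<lambda>_. 0)"
    unfolding wini_def w_p_def waug_def using A weil_map_comp[OF wlift_zero wlift_wunit, of W1 A "\<lambda>_. 0"] by simp
  have "plft A 0 = (Tn (wini A) tE \<cdot> Tn w_p tE) \<cdot> lft"
    unfolding plft_def c[symmetric] using Tnt_comp[OF P(1) I(1)] P I by simp
  also have "\<dots> = Tn (wini A) tE \<cdot> (Tn w_p tE \<cdot> lft)"
    by (rule comp_assoc) (use I P in auto)
  also have "\<dots> = zsec A tE \<cdot> (bzero E \<cdot> q)" unfolding tan_p_lift zsec_def using I U DE by simp
  also have "\<dots> = T A (bzero E) \<cdot> (zsec A M \<cdot> q)"
    by (rule comp_extend) (use zsec_natural[OF A DE(4)] A DE in auto)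
  finally show ?thesis by simp
qed

lemma plft_pvar: "plft W1 (pvar 0) = lft"
proof -
  have "weil_map W1 W1 (\<lambda>_. pvar 0) = Idn weil W1"
    using weil_map_cong'[OF wlift_id, of W1 "\<lambda>_. pvar 0"] by (simp add: Idn_weil)
  then show ?thesis by (simp add: plft_def Tnt_Idn)
qed

text \<open>
  Additivity of \<open>\<lambda>\<close> for the bundle \<open>T E \<rightarrow> T M\<close> turns the right side into \<open>\<lambda>\<close> of a \<open>c\<close>-fold sum in \<open>E\<close>.
  Additivity for the bundle \<open>T E \<rightarrow> E\<close>, whose addition is \<open>T\<close> of \<open>x\<^sub>1, x\<^sub>2 \<mapsto> x\<close>, turns this into the
  left side. So the argument of Eckmann and Hilton makes the two additions agree on \<open>\<lambda>\<close>.
\<close>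

lemma plft_scale: "plft W1 (of_nat c * pvar 0) = lft [^]\<^bsub>fib (B (T W1)) (pbase W1)\<^esub> c"
proof (induction c)
  case 0
  show ?case using plft_zero[of W1] by (simp del: fibm_simps)
next
  case (Suc c)
  let ?G = "fib E q" let ?H = "fib (B (T W1)) (pbase W1)" let ?i = "Idn X tE"
  have bW: "is_bundle (B (T W1))" by (rule abB[OF actlike_Tar]) simp
  interpret G: comm_monoid ?G by (rule comm_monoid_fibm[OF abE DE(1,3)])
  have i: "?i \<in> carrier ?G" using DE by (simp add: fibm_carrier)
  have mm: "monoid_map ?G ?H (\<lambda>x. lft \<cdot> x)" by (rule bundle_mor_monoid_map[OF abE bW lift_mor DE(1,3)])
  have lp: "lft \<cdot> (?i [^]\<^bsub>?G\<^esub> n) = lft [^]\<^bsub>?H\<^esub> n" for n :: nat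
    using monoid_map_pow[OF G.comm_monoid_axioms mm i, of n] by simp
  \<comment> \<open>The universal element of \<open>E\<close> is the identity; \<open>?f\<close> is its \<open>c\<close>-fold sum.\<close>
  let ?f = "?i [^]\<^bsub>?G\<^esub> c"
  have f: "?f \<in> carrier ?G" using i by blast
  note F = fibmD[OF f] and I = fibmD[OF i] and t = bpair[OF abE DE(1,3) f i]
  let ?Tb = "tangent_bundle X tE"
  have P: "w_p \<in> Ar weil" "Dom weil w_p = W1" "Cod weil w_p = wunit"
    using hom_weilD[OF waug_Hom[OF ob_Wpow, of 1]] by (simp_all add: w_p_def)
  have Au: "waug (Wpow 2) \<in> Ar weil" "Dom weil (waug (Wpow 2)) = Wpow 2" "Cod weil (waug (Wpow 2)) = wunit"
    using hom_weilD[OF waug_Hom[OF ob_Wpow, of 2]] by simp_all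
  have Wp: "Wproj 2 i \<in> Ar weil" "Dom weil (Wproj 2 i) = Wpow 2" "Cod weil (Wproj 2 i) = W1" for i
    using hom_weilD[OF Wproj_Hom[of 2 i]] by simp_all
  have pl: "w_plus \<in> Ar weil" "Dom weil w_plus = Wpow 2" "Cod weil w_plus = W1" and pw: "wlift (Wpow 2) W1 (\<lambda>_. pvar 0)"
  proof -
    show w: "wlift (Wpow 2) W1 (\<lambda>_. pvar 0)" by (rule wlift_Wpow) auto
    then show "w_plus \<in> Ar weil" "Dom weil w_plus = Wpow 2" "Cod weil w_plus = W1" by (simp_all add: w_plus_def)
  qed
  note U = unitA[OF obE(1)]
  have pb: "wide_pb X 2 (\<lambda>_. tan_p X tE) (bpow ?Tb 2) (bprj ?Tb 2)"
    by (rule wide_pb_iso[OF wide_pb_actlike_Wpow[OF actlike_id obE(1), of 2], where \<phi>P = "Idn X (actO X (Wpow 2) tE)"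
         and \<phi>B = "inv_arrow X (unitA X tE)" and \<phi>X = "\<lambda>_. Idn X (actO X W1 tE)"])
      (use P Au Wp U in \<open>auto simp: tangent_bundle_def tan_p_def intro: is_iso_Idn is_iso_inv_arrow\<close>)
  have pp: "tan_p X tE \<cdot> (lft \<cdot> x) = bzero E \<cdot> (q \<cdot> x)" if "arr x" "cod x = tE" for x
    by (rule comp_extend[OF bundle_morD(7)[OF lift_tangent, unfolded tangent_bundle_def, simplified]])
      (use that P U DE in \<open>auto simp: tan_p_def\<close>)
  have ub: "cod (bpow ?Tb 2) = tE" "dom (bpow ?Tb 2) = actO X (Wpow 2) tE" "bpow ?Tb 2 \<in> Ar X"
    "bprj ?Tb 2 i \<in> Ar X" "dom (bprj ?Tb 2 i) = actO X (Wpow 2) tE" "cod (bprj ?Tb 2 i) = actO X W1 tE" for i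
    using U Au Wp by (simp_all add: tangent_bundle_def)
  let ?b = "bpair X ?Tb (lft \<cdot> bprj E 2 0) (lft \<cdot> bprj E 2 1)"
  have b: "arr ?b" "dom ?b = bpowO X E 2" "cod ?b = actO X (Wpow 2) tE" "bpow ?Tb 2 \<cdot> ?b = bzero E \<cdot> bpow E 2"
    "bprj ?Tb 2 0 \<cdot> ?b = lft \<cdot> bprj E 2 0" "bprj ?Tb 2 1 \<cdot> ?b = lft \<cdot> bprj E 2 1"
  proof -
    have v: "bproj ?Tb \<cdot> (lft \<cdot> bprj E 2 0) = bzero E \<cdot> bpow E 2"
      using pp[of "bprj E 2 0"] DE by (simp add: tangent_bundle_def)
    have ft: "?b = fibre_tuple X 2 (bpow ?Tb 2) (bprj ?Tb 2) (bzero E \<cdot> bpow E 2) (\<lambda>i. if i = 0 then lft \<cdot> bprj E 2 0 else lft \<cdot> bprj E 2 1)"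
      unfolding bpair_def v ..
    have h: "(if i = 0 then lft \<cdot> bprj E 2 0 else lft \<cdot> bprj E 2 1) \<in> Ar X \<and>
        dom (if i = 0 then lft \<cdot> bprj E 2 0 else lft \<cdot> bprj E 2 1) = dom (bzero E \<cdot> bpow E 2) \<and>
        cod (if i = 0 then lft \<cdot> bprj E 2 0 else lft \<cdot> bprj E 2 1) = dom (tan_p X tE) \<and>
        tan_p X tE \<cdot> (if i = 0 then lft \<cdot> bprj E 2 0 else lft \<cdot> bprj E 2 1) = bzero E \<cdot> bpow E 2" for i :: nat
      using pp[of "bprj E 2 0"] pp[of "bprj E 2 1"] DE P U by (simp add: tan_p_def)
    have zv: "bzero E \<cdot> bpow E 2 \<in> Ar X" "dom (bzero E \<cdot> bpow E 2) = bpowO X E 2" "cod (bzero E \<cdot> bpow E 2) = tE"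
      using DE by simp_all
    note T = fibre_tuple[OF pb zv(1), of "\<lambda>i. if i = 0 then lft \<cdot> bprj E 2 0 else lft \<cdot> bprj E 2 1", OF _ h, folded ft, unfolded zv ub]
    show "arr ?b" "dom ?b = bpowO X E 2" "cod ?b = actO X (Wpow 2) tE" "bpow ?Tb 2 \<cdot> ?b = bzero E \<cdot> bpow E 2"
      using T(1-4) by simp_all
    show "bprj ?Tb 2 0 \<cdot> ?b = lft \<cdot> bprj E 2 0" "bprj ?Tb 2 1 \<cdot> ?b = lft \<cdot> bprj E 2 1"
      using T(5)[of 0] T(5)[of 1] by simp_all
  qed
  let ?c = "of_nat c * pvar 0 + pvar 1 :: npoly"
  have cs: "sqz (Wpow 2) ?c"
    unfolding sqz_def by (rule wlift_Wpow) (simp_all add: zero_notin_keys_add zero_notin_keys_of_nat npolys_closed)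
  note CH = hom_weilD[OF sqz_Hom[OF cs]]
  have cl: "plft (Wpow 2) ?c \<in> Ar X" "dom (plft (Wpow 2) ?c) = tE" "cod (plft (Wpow 2) ?c) = actO X (Wpow 2) tE"
    using CH by (simp_all add: plft_def)
  \<comment> \<open>The pair \<open>(\<lambda> (c e), \<lambda> e)\<close> in \<open>T\<^sub>2 E\<close> is the vector along \<open>c x\<^sub>1 + x\<^sub>2\<close>.\<close>
  have key: "?b \<cdot> bpair X E ?f ?i = plft (Wpow 2) ?c"
  proof (rule wide_pb_eq[OF pb])
    have "bpow ?Tb 2 \<cdot> (?b \<cdot> bpair X E ?f ?i) = (bzero E \<cdot> bpow E 2) \<cdot> bpair X E ?f ?i"
      by (rule comp_extend1[OF b(4)]) (use b(1-3) t ub DE in auto)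
    also have "\<dots> = bzero E \<cdot> q" using t DE by simp
    also have "\<dots> = bpow ?Tb 2 \<cdot> plft (Wpow 2) ?c"
    proof -
      have "Tn (waug (Wpow 2)) tE \<cdot> plft (Wpow 2) ?c = unitA X tE \<cdot> (bzero E \<cdot> q)"
      proof -
        have "Tn (waug (Wpow 2)) tE \<cdot> plft (Wpow 2) ?c = plft wunit 0"
          using Tnt_plft(1)[OF cs wlift_zero[OF ob_Wpow ob_wunit]] by (simp add: waug_def)
        also have "\<dots> = unitA X tE \<cdot> (bzero E \<cdot> q)"
          unfolding plft_def waug_def[of W1, symmetric] w_p_def[symmetric] by (rule tan_p_lift)
        finally show ?thesis .
      qed
      then show ?thesis using U Au cl DE by (simp add: tangent_bundle_def)
    qed
    finally show "bpow ?Tb 2 \<cdot> (?b \<cdot> bpair X E ?f ?i) = bpow ?Tb 2 \<cdot> plft (Wpow 2) ?c" .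
    fix i :: nat assume "i < 2"
    then have "i = 0 \<or> i = 1" by auto
    then show "bprj ?Tb 2 i \<cdot> (?b \<cdot> bpair X E ?f ?i) = bprj ?Tb 2 i \<cdot> plft (Wpow 2) ?c"
    proof
      assume i0: "i = 0"
      have "bprj ?Tb 2 0 \<cdot> (?b \<cdot> bpair X E ?f ?i) = (lft \<cdot> bprj E 2 0) \<cdot> bpair X E ?f ?i"
        by (rule comp_extend1[OF b(5)]) (use b(1-3) t ub DE in auto)
      also have "\<dots> = lft \<cdot> ?f" using t DE by simp
      also have "\<dots> = plft W1 (of_nat c * pvar 0)" unfolding lp Suc ..
      also have "\<dots> = bprj ?Tb 2 0 \<cdot> plft (Wpow 2) ?c"
        using Tnt_plft(1)[OF cs wlift_proj[of 2 0]] by (simp add: tangent_bundle_def Wproj_def)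
      finally show ?thesis unfolding i0 .
    next
      assume i1: "i = 1"
      have "bprj ?Tb 2 1 \<cdot> (?b \<cdot> bpair X E ?f ?i) = (lft \<cdot> bprj E 2 1) \<cdot> bpair X E ?f ?i"
        by (rule comp_extend1[OF b(6)]) (use b(1-3) t ub DE in auto)
      also have "\<dots> = lft" using t DE by simp
      also have "\<dots> = bprj ?Tb 2 1 \<cdot> plft (Wpow 2) ?c"
        using Tnt_plft(1)[OF cs wlift_proj[of 2 1]] plft_pvar by (simp add: tangent_bundle_def Wproj_def)
      finally show ?thesis unfolding i1 .
    qed
  qed (use b(1-3) t cl ub DE(1-3) in auto)
  have "lft [^]\<^bsub>?H\<^esub> Suc c = lft \<cdot> (?f \<otimes>\<^bsub>?G\<^esub> ?i)" unfolding lp[symmetric] by simp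
  also have "\<dots> = lft \<cdot> (bplus E \<cdot> bpair X E ?f ?i)" by (simp add: fib_add_def)
  also have "\<dots> = (bplus ?Tb \<cdot> ?b) \<cdot> bpair X E ?f ?i"
    by (rule comp_extend1[OF bundle_morD(9)[OF lift_tangent, unfolded fib_add_def]]) (use t DE in auto)
  also have "\<dots> = tan_plus X tE \<cdot> (?b \<cdot> bpair X E ?f ?i)"
    using b(1-3) t pl by (simp add: tangent_bundle_def tan_plus_def)
  also have "\<dots> = plft W1 (of_nat (Suc c) * pvar 0)"
    unfolding key tan_plus_def w_plus_def Tnt_plft(1)[OF cs pw] by (simp add: distrib_right add.commute)
  finally show ?case ..
qed

end

lemma (in comm_monoid) lincomb_one:
  assumes "\<And>j. j \<in> J \<Longrightarrow> e j = \<one>"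
  shows "lincomb G J c e = \<one>"
  unfolding lincomb_def using assms by (intro finprod_one_eqI) auto

lemma (in comm_monoid) lincomb_only:
  assumes "finite J" "k \<in> J" "e k \<in> carrier G" "\<And>j. j \<in> J \<Longrightarrow> j \<noteq> k \<Longrightarrow> e j = \<one>"
  shows "lincomb G J c e = e k [^] c k"
proof -
  have e: "e j \<in> carrier G" if "j \<in> J" for j using assms that by (cases "j = k") auto
  have "lincomb G J c e = finprod G (\<lambda>j. if k = j then e j [^] c j else \<one>) J"
    unfolding lincomb_def by (rule finprod_cong') (use assms(4) e in auto)
  also have "\<dots> = e k [^] c k" using assms(1,2) e by (intro finprod_singleton) auto
  finally show ?thesis .
qed

context dbundle begin

lemma abT: "weil_ob A \<Longrightarrow> is_bundle (B (T A))"
  by (rule abB[OF actlike_Tar])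

lemma cmT: "weil_ob A \<Longrightarrow> comm_monoid (fib (B (T A)) (pbase A))"
  by (rule comm_monoid_fibm[OF abT]) auto

lemma plft_carrier: "sqz A p \<Longrightarrow> plft A p \<in> lifts (B (T A)) (pbase A)"
  by (rule mor_carrier[OF plft_mor])

lemma Tnt_pbase:
  assumes "\<theta> \<in> Hom weil A A'"
  shows "Tn \<theta> M \<cdot> pbase A = pbase A'"
  by (rule comp_extend1[OF Tnt_zsec[OF assms obE(2)]]) (use hom_weilD[OF assms] DE in auto)

lemma Tnt_lincomb:
  assumes g: "wlift A A' g" and e: "\<And>j. j \<in> J \<Longrightarrow> e j \<in> lifts (B (T A)) (pbase A)"
  shows "Tn (weil_map A A' g) tE \<cdot> lincomb (fib (B (T A)) (pbase A)) J c e =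
    lincomb (fib (B (T A')) (pbase A')) J c (\<lambda>j. Tn (weil_map A A' g) tE \<cdot> e j)"
proof -
  note H = weil_map(1)[OF g] and AA = wliftD(1,2)[OF g]
  show ?thesis
    using bundle_mor_lincomb[OF abT[OF AA(1)] abT[OF AA(2)] Tnt_mor[OF H] _ _ e, where J=J and c=c] AA Tnt_pbase[OF H] by simp
qed

lemma sqz_pvar: "i < n \<Longrightarrow> sqz (Wpow n) (pvar i)"
  unfolding sqz_def by (rule wlift_Wpow) auto

lemma sqz_lin: "sqz (Wpow n) (lin n c)"
  unfolding sqz_def by (rule wlift_Wpow) (auto simp: in_keys_iff lookup_lin)

text \<open>
  Both sides are elements of \<open>T\<^sub>n E\<close>, so it suffices to compare their components; these are instances of
  \<open>plft_scale\<close>.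
\<close>

lemma plft_lin:
  "plft (Wpow n) (lin n c) = lincomb (fib (B (T (Wpow n))) (pbase (Wpow n))) {..<n} c (\<lambda>i. plft (Wpow n) (pvar i))"
    (is "?l = lincomb ?G _ _ _")
proof (rule wide_pb_eq[OF wide_pb_actlike_Wpow[OF actlike_id obE(1), of n]])
  have p: "plft (Wpow n) (pvar i) \<in> carrier ?G" if "i \<in> {..<n}" for i using plft_carrier[OF sqz_pvar] that by simp
  let ?r = "lincomb ?G {..<n} c (\<lambda>i. plft (Wpow n) (pvar i))"
  have "?r \<in> carrier ?G" by (rule comm_monoid.lincomb_closed[OF cmT[OF ob_Wpow] p])
  note rc = fibmD[OF this]
  note lc = fibmD[OF plft_carrier[OF sqz_lin]]
  note AH = hom_weilD[OF waug_Hom[OF ob_Wpow, of n]]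
  show "arr ?l" "arr ?r" "dom ?l = dom ?r" using lc rc by simp_all
  show "cod ?l = dom (id (Tn (waug (Wpow n)) tE))" "cod ?r = dom (id (Tn (waug (Wpow n)) tE))"
    using lc rc AH by simp_all
  have T: "Tn (weil_map (Wpow n) A' g) tE \<cdot> ?l = plft A' (\<Sum>j<n. of_nat (c j) * g j)"
     "Tn (weil_map (Wpow n) A' g) tE \<cdot> ?r = lincomb (fib (B (T A')) (pbase A')) {..<n} c (\<lambda>i. plft A' (g i))"
     if g: "wlift (Wpow n) A' g" for A' g
  proof -
    show "Tn (weil_map (Wpow n) A' g) tE \<cdot> ?l = plft A' (\<Sum>j<n. of_nat (c j) * g j)"
      unfolding Tnt_plft(1)[OF sqz_lin g] subst_lin ..
    have "Tn (weil_map (Wpow n) A' g) tE \<cdot> ?r = lincomb (fib (B (T A')) (pbase A')) {..<n} c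
      (\<lambda>j. Tn (weil_map (Wpow n) A' g) tE \<cdot> plft (Wpow n) (pvar j))" by (rule Tnt_lincomb[OF g p])
    also have "\<dots> = lincomb (fib (B (T A')) (pbase A')) {..<n} c (\<lambda>i. plft A' (g i))"
    proof (rule comm_monoid.lincomb_cong[OF cmT[OF wliftD(2)[OF g]]])
      fix j assume j: "j \<in> {..<n}"
      show eq: "Tn (weil_map (Wpow n) A' g) tE \<cdot> plft (Wpow n) (pvar j) = plft A' (g j)"
        using Tnt_plft(1)[OF sqz_pvar g, of j] j by simp
      show "Tn (weil_map (Wpow n) A' g) tE \<cdot> plft (Wpow n) (pvar j) \<in> lifts (B (T A')) (pbase A')"
        unfolding eq using plft_carrier[OF Tnt_plft(2)[OF sqz_pvar g, of j]] j by simp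
    qed simp
    finally show "Tn (weil_map (Wpow n) A' g) tE \<cdot> ?r =
      lincomb (fib (B (T A')) (pbase A')) {..<n} c (\<lambda>i. plft A' (g i))" .
  qed
  show "id (Tn (waug (Wpow n)) tE) \<cdot> ?l = id (Tn (waug (Wpow n)) tE) \<cdot> ?r"
    using T[OF wlift_zero[OF ob_Wpow ob_wunit]]
      comm_monoid.lincomb_one[OF cmT[OF ob_wunit], of "{..<n}" "\<lambda>_. plft wunit 0" c] plft_zero[OF ob_wunit]
    by (simp add: waug_def del: fibm_simps)
  fix j assume j: "j < n"
  let ?H = "fib (B (T W1)) (pbase W1)"
  have z: "plft W1 0 = \<one>\<^bsub>?H\<^esub>" by (rule plft_zero) simp
  have s: "(\<Sum>i<n. of_nat (c i) * (if i = j then pvar 0 else 0)) = of_nat (c j) * (pvar 0 :: npoly)"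
    using j by (simp add: if_distrib[of "\<lambda>x. of_nat _ * x"] cong: if_cong)
  have lc1: "lft \<in> carrier ?H" using plft_carrier[OF sqz_pvar, of 0 1] by (simp add: plft_pvar[simplified])
  have "lincomb ?H {..<n} c (\<lambda>i. plft W1 (if i = j then pvar 0 else 0)) = plft W1 (if j = j then pvar 0 else 0) [^]\<^bsub>?H\<^esub> c j"
    by (rule comm_monoid.lincomb_only[OF cmT]) (use j z lc1 plft_pvar in \<open>auto simp del: fibm_simps\<close>)
  then show "id (Tn (Wproj n j) tE) \<cdot> ?l = id (Tn (Wproj n j) tE) \<cdot> ?r"
    using T[OF wlift_proj[of n j]] s plft_scale[of "c j"] plft_pvar by (simp add: Wproj_def)
qed

section \<open>The maps attached to basis monomials\<close>

text \<open>The constant monomial contributes the zero section and is exceptional because its square is not zero.\<close>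

definition lam :: "wob \<Rightarrow> monomial \<Rightarrow> 'a" where
  "lam A m = (if m = 0 then zsec A tE else plft A (pmon m))"

lemma sqz_pmon: assumes "weil_ob A" "m \<in> nz A" "m \<noteq> 0" shows "sqz A (pmon m)"
proof -
  have k: "keys m \<subseteq> {..<fst A}" using assms by (simp add: nz_def)
  then have "keys (m + m) \<subseteq> {..<fst A}" using keys_add[of m m] by blast
  then have "(pmon m * pmon m, 0) \<in> wcong A"
    unfolding pmon_mult by (rule wcong_dead[OF assms(1) _ dead_square[OF assms(1) k assms(3)]])
  then show ?thesis using k assms(1) by (intro sqzI npolys_pmon)
qed

lemma lam_mor: assumes "weil_ob A" "m \<in> nz A" shows "bundle_mor E (B (T A)) (lam A m) (zsec A M)"
proof (cases "m = 0")
  case True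
  have "bundle_mor (B id) (B (T A)) (zsec A tE) (zsec A M)"
    by (rule nt_bundle_mor[OF nt_zsec[OF assms(1)] abE abB[OF actlike_id] abT[OF assms(1)]])
  then show ?thesis using True by (simp add: lam_def)
next
  case False
  then show ?thesis using plft_mor[OF sqz_pmon[OF assms]] by (simp add: lam_def)
qed

lemma lam_carrier: "weil_ob A \<Longrightarrow> m \<in> nz A \<Longrightarrow> lam A m \<in> lifts (B (T A)) (pbase A)"
  by (rule mor_carrier[OF lam_mor])

lemma lam [simp]: assumes "weil_ob A" "m \<in> nz A"
  shows "lam A m \<in> Ar X" "dom (lam A m) = tE" "cod (lam A m) = actO X A tE"
  using bundle_morD(1-3)[OF lam_mor[OF assms]] assms by simp_all

text \<open>
  If \<open>\<Sum> c\<^sub>i m\<^sub>i\<close> is the image of the monomial, all products \<open>m\<^sub>i m\<^sub>j\<close> vanish. So the morphism from \<open>W\<close>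
  with this value factors through \<open>x \<mapsto> \<Sum> c\<^sub>i x\<^sub>i\<close>, a morphism to \<open>W^n\<close>, and \<open>plft_lin\<close> applies.
\<close>

lemma lam_natural:
  assumes g: "wlift A A' g" and m: "m \<in> nz A"
  shows "Tn (weil_map A A' g) tE \<cdot> lam A m =
    lincomb (fib (B (T A')) (pbase A')) (nz A') (\<lambda>m'. lookup (subst g (pmon m)) m') (lam A')"
proof -
  note AA = wliftD(1,2)[OF g] and H = weil_map(1)[OF g]
  let ?G = "fib (B (T A')) (pbase A')"
  interpret G: comm_monoid ?G by (rule cmT[OF AA(2)])
  have lc: "\<And>m'. m' \<in> nz A' \<Longrightarrow> lam A' m' \<in> carrier ?G" using AA by (intro lam_carrier)
  show ?thesis
  proof (cases "m = 0")
    case True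
    have "lincomb ?G (nz A') (\<lambda>m'. lookup (subst g (pmon m)) m') (lam A') = lam A' 0"
      by (rule G.lincomb_delta) (use lc True finite_nz[OF AA(2)] in \<open>auto simp: lookup_one when_def\<close>)
    then show ?thesis using True Tnt_zsec[OF H obE(1)] by (simp add: lam_def)
  next
    case False
    let ?b = "subst g (pmon m)"
    \<comment> \<open>The monomials that occur in the image, enumerated by \<open>h\<close>, are the variables of the intermediate \<open>W^n\<close>.\<close>
    define S where "S = {m' \<in> nz A'. lookup ?b m' \<noteq> 0}"
    have sp: "sqz A (pmon m)" by (rule sqz_pmon[OF AA(1) m False])
    have S0: "0 \<notin> S" using wlift_no_constant[OF g m False] by (simp add: S_def in_keys_iff)
    have S: "S \<subseteq> nz A'" "finite S" using finite_nz[OF AA(2)] by (auto simp: S_def)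
    obtain h where h: "bij_betw h {..<card S} S" using ex_bij_betw_nat_finite[OF S(2)] by (auto simp: atLeast0LessThan)
    have hS: "h i \<in> S" if "i < card S" for i using h that by (auto simp: bij_betw_def)
    let ?n = "card S" and ?c = "\<lambda>i. lookup ?b (h i)" and ?h = "\<lambda>i. pmon (h i)"
    have hk: "keys (h i) \<subseteq> {..<fst A'}" if "i < ?n" for i using hS[OF that] by (auto simp: S_def nz_def)
    have w: "wlift (Wpow ?n) A' ?h"
      unfolding wlift_def
    proof (intro conjI allI impI ob_Wpow AA(2))
      show "pmon (h i) \<in> polys A'" if "i < fst (Wpow ?n)" for i using hk that by (simp add: npolys_pmon)
      fix i j assume "(i, j) \<in> snd (Wpow ?n)"
      then have ij: "i < ?n" "j < ?n" by auto
      have "dead A' (h i + h j)"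
        by (rule wlift_keys_dead[OF g m False]) (use hS[OF ij(1)] hS[OF ij(2)] in \<open>auto simp: S_def in_keys_iff\<close>)
      then show "(pmon (h i) * pmon (h j), 0) \<in> wcong A'"
        unfolding pmon_mult using hk[OF ij(1)] hk[OF ij(2)] keys_add[of "h i" "h j"] by (intro wcong_dead[OF AA(2)]) blast
    qed
    have bn: "?b \<in> polys A'" using wlift_subst(1)[OF g] m by (auto simp: nz_def npolys_pmon)
    have eqv: "(subst ?h (lin ?n ?c), ?b) \<in> wcong A'"
      unfolding wcong_iff[OF AA(2)]
    proof (intro conjI ballI bn)
      show "subst ?h (lin ?n ?c) \<in> polys A'" using wlift_subst(1)[OF w] by simp
      fix m' assume m': "m' \<in> nz A'"
      have "lookup (subst ?h (lin ?n ?c)) m' = (\<Sum>j<?n. if h j = m' then lookup ?b (h j) else 0)"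
        unfolding subst_lin lookup_sum single_eq_of_nat_pmon[symmetric]
        by (rule sum.cong) (auto simp: lookup_single when_def)
      also have "\<dots> = (\<Sum>s\<in>S. if s = m' then lookup ?b s else 0)"
        using h by (intro sum.reindex_bij_betw)
      also have "\<dots> = lookup ?b m'" using S m' by (auto simp: S_def)
      finally show "lookup (subst ?h (lin ?n ?c)) m' = lookup ?b m'" .
    qed
    have "Tn (weil_map A A' g) tE \<cdot> lam A m = plft A' ?b" using False Tnt_plft(1)[OF sp g] by (simp add: lam_def)
    also have "\<dots> = plft A' (subst ?h (lin ?n ?c))"
      by (rule plft_cong(1)[symmetric, OF Tnt_plft(2)[OF sqz_lin w] eqv])
    also have "\<dots> = Tn (weil_map (Wpow ?n) A' ?h) tE \<cdot> plft (Wpow ?n) (lin ?n ?c)" by (rule Tnt_plft(1)[symmetric, OF sqz_lin w])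
    also have "\<dots> = lincomb ?G {..<?n} ?c (\<lambda>i. Tn (weil_map (Wpow ?n) A' ?h) tE \<cdot> plft (Wpow ?n) (pvar i))"
      unfolding plft_lin by (rule Tnt_lincomb[OF w plft_carrier[OF sqz_pvar]]) simp
    also have "\<dots> = lincomb ?G {..<?n} ?c (\<lambda>i. lam A' (h i))"
    proof (rule G.lincomb_cong)
      fix i assume i: "i \<in> {..<?n}"
      have "h i \<noteq> 0" using hS[of i] S0 i by auto
      then show eq: "Tn (weil_map (Wpow ?n) A' ?h) tE \<cdot> plft (Wpow ?n) (pvar i) = lam A' (h i)"
        using Tnt_plft(1)[OF sqz_pvar w, of i] i by (simp add: lam_def)
      show "Tn (weil_map (Wpow ?n) A' ?h) tE \<cdot> plft (Wpow ?n) (pvar i) \<in> carrier ?G"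
        unfolding eq using hS[of i] S i lc by auto
    qed simp
    also have "\<dots> = lincomb ?G (nz A') (\<lambda>m'. lookup ?b m') (lam A')"
      by (rule G.lincomb_reindex_support[OF h S(1) finite_nz[OF AA(2)]]) (use lc in \<open>auto simp: S_def\<close>)
    finally show ?thesis .
  qed
qed

subsection \<open>Compatibility with the tensor product\<close>

text \<open>
  Moves two morphisms of Weil algebras out of a composite of two vector-valued maps, by naturality of
  the structure isomorphism.
\<close>

lemma wtena_square:
  assumes \<theta>: "\<theta> \<in> Hom weil S A" and \<phi>: "\<phi> \<in> Hom weil S' A'"
    and \<mu>: "arr \<mu>" "dom \<mu> = x" "cod \<mu> = actO X S y" and \<mu>': "arr \<mu>'" "dom \<mu>' = y" "cod \<mu>' = actO X S' z"
    and z: "z \<in> Ob X"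
  shows "multA X A A' z \<cdot> (T A (Tn \<phi> z \<cdot> \<mu>') \<cdot> (Tn \<theta> y \<cdot> \<mu>)) =
    Tn (wtena \<theta> \<phi>) z \<cdot> (multA X S S' z \<cdot> (T S \<mu>' \<cdot> \<mu>))"
proof -
  note T = hom_weilD[OF \<theta>] and P = hom_weilD[OF \<phi>] and W = hom_weilD[OF wtena_Hom[OF \<theta> \<phi>]]
  have y: "y \<in> Ob X" using \<mu>' by auto
  have zz: "actO X S' z \<in> Ob X" "actO X A' z \<in> Ob X" using z P by auto
  note mA = multA[OF T(5) P(5) z] and mS = multA[OF T(4) P(4) z]
  have a: "T A (Tn \<phi> z \<cdot> \<mu>') = T A (Tn \<phi> z) \<cdot> T A \<mu>'"
    by (rule Tar_comp) (use T P \<mu>' z in auto)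
  have n1: "T A \<mu>' \<cdot> (Tn \<theta> y \<cdot> \<mu>) = Tn \<theta> (actO X S' z) \<cdot> (T S \<mu>' \<cdot> \<mu>)"
    by (rule comp_extend) (use actA_split[OF T(1) \<mu>'(1)] T P \<mu> \<mu>' y z zz in auto)
  have n2: "T A (Tn \<phi> z) \<cdot> Tn \<theta> (actO X S' z) = actA X \<theta> (Tn \<phi> z)"
    using actA_split(2)[OF T(1), of "Tn \<phi> z"] T P z by simp
  have n3: "multA X A A' z \<cdot> actA X \<theta> (Tn \<phi> z) = Tn (wtena \<theta> \<phi>) z \<cdot> multA X S S' z"
    unfolding Tnt_def by (rule multA_natural[OF \<theta> \<phi>]) (use z in \<open>simp add: Hom_iff\<close>)
  have "T A (Tn \<phi> z \<cdot> \<mu>') \<cdot> (Tn \<theta> y \<cdot> \<mu>) = T A (Tn \<phi> z) \<cdot> (Tn \<theta> (actO X S' z) \<cdot> (T S \<mu>' \<cdot> \<mu>))"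
    unfolding a n1[symmetric] by (rule comp_assoc) (use T P \<mu> \<mu>' y z zz in auto)
  also have "\<dots> = actA X \<theta> (Tn \<phi> z) \<cdot> (T S \<mu>' \<cdot> \<mu>)"
    by (rule comp_extend1[OF n2]) (use T P \<mu> \<mu>' y z zz in auto)
  finally have "T A (Tn \<phi> z \<cdot> \<mu>') \<cdot> (Tn \<theta> y \<cdot> \<mu>) = actA X \<theta> (Tn \<phi> z) \<cdot> (T S \<mu>' \<cdot> \<mu>)" .
  moreover have "multA X A A' z \<cdot> (actA X \<theta> (Tn \<phi> z) \<cdot> (T S \<mu>' \<cdot> \<mu>)) = Tn (wtena \<theta> \<phi>) z \<cdot> (multA X S S' z \<cdot> (T S \<mu>' \<cdot> \<mu>))"
    by (rule comp_extend[OF n3]) (use T P W \<mu> \<mu>' y z zz mA mS in auto)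
  ultimately show ?thesis by simp
qed

lemma multA_unit: assumes "weil_ob A" "x \<in> Ob X"
  shows "multA X wunit A x \<cdot> unitA X (actO X A x) = Idn X (actO X A x)"
    "multA X A wunit x \<cdot> T A (unitA X x) = Idn X (actO X A x)"
  using acteg assms by (auto simp: actegory_def)

lemma unit_left: assumes \<mu>': "arr \<mu>'" "dom \<mu>' = y" "cod \<mu>' = actO X S' z" and S': "weil_ob S'" and z: "z \<in> Ob X"
  shows "multA X wunit S' z \<cdot> (T wunit \<mu>' \<cdot> unitA X y) = \<mu>'"
proof -
  have y: "y \<in> Ob X" using \<mu>' by auto
  have zz: "actO X S' z \<in> Ob X" using S' z by simp
  note m = multA[OF ob_wunit S' z]
  have "T wunit \<mu>' \<cdot> unitA X y = unitA X (actO X S' z) \<cdot> \<mu>'" using ntD(6)[OF nt_unit \<mu>'(1)] \<mu>' by simp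
  moreover have "multA X wunit S' z \<cdot> (unitA X (actO X S' z) \<cdot> \<mu>') = Idn X (actO X S' z) \<cdot> \<mu>'"
    by (rule comp_extend1[OF multA_unit(1)[OF S' z]]) (use m unitA[OF zz] \<mu>' wten_unit_left in auto)
  ultimately show ?thesis using \<mu>' by simp
qed

lemma zsec_mult: assumes "weil_ob A" "weil_ob A'" "x \<in> Ob X"
  shows "multA X A A' x \<cdot> (T A (zsec A' x) \<cdot> zsec A x) = zsec (wten A A') x"
proof -
  note U = unitA[OF assms(3)]
  have "multA X A A' x \<cdot> (T A (zsec A' x) \<cdot> zsec A x) =
    Tn (wtena (wini A) (wini A')) x \<cdot> (multA X wunit wunit x \<cdot> (T wunit (unitA X x) \<cdot> unitA X x))"
    unfolding zsec_def by (rule wtena_square[OF wini_Hom[OF assms(1)] wini_Hom[OF assms(2)]]) (use U assms in auto)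
  also have "\<dots> = Tn (wtena (wini A) (wini A')) x \<cdot> unitA X x"
    using unit_left[OF U(1-3) ob_wunit assms(3)] by simp
  also have "wtena (wini A) (wini A') = wini (wten A A')"
    by (rule wini_unique) (use wtena_Hom[OF wini_Hom[OF assms(1)] wini_Hom[OF assms(2)]] in \<open>simp add: wten_unit_left\<close>)
  finally show ?thesis by (simp add: zsec_def)
qed

lemma mshift_zero [simp]: "mshift n 0 = 0"
  by (simp add: mshift_def)

lemma mshift_eq_zero: "mshift n m = 0 \<longleftrightarrow> m = 0"
proof
  assume "mshift n m = 0"
  then have "lookup m i = 0" for i using lookup_mshift[of n m "n + i"] by simp
  then show "m = 0" by (auto intro: poly_mapping_eqI)
qed simp

text \<open>
  Each of the two monomials may be constant, which gives four cases. If neither is, \<open>\<ell> \<lambda> = T(\<lambda>) \<lambda>\<close> replaces two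
  applications of the lift by one, along \<open>x \<mapsto> m m'\<close>; the other cases are the unit laws.
\<close>

lemma lam_mult:
  assumes A: "weil_ob A" and A': "weil_ob A'" and m: "m \<in> nz A" and m': "m' \<in> nz A'"
  shows "multA X A A' tE \<cdot> (T A (lam A' m') \<cdot> lam A m) = lam (wten A A') (mten A m m')"
proof -
  note U = unitA[OF obE(1)]
  consider "m = 0" "m' = 0" | "m = 0" "m' \<noteq> 0" | "m \<noteq> 0" "m' = 0" | "m \<noteq> 0" "m' \<noteq> 0" by blast
  then show ?thesis
  proof cases
    case 1
    then show ?thesis using zsec_mult[OF A A' obE(1)] by (simp add: lam_def)
  next
    case 2
    note s = sqz_pmon[OF A' m' 2(2)]
    note w = wtena_weil_map[OF wlift_wunit[OF A, of "\<lambda>_. 0"] s[unfolded sqz_def]]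
    have t: "wtena (wini A) (weil_map W1 A' (\<lambda>_. pmon m')) = weil_map W1 (wten A A') (\<lambda>_. pmon (mshift (fst A) m'))"
      unfolding wini_def w(2) wten_unit_left
      by (rule weil_map_cong'[OF w(1)[unfolded wten_unit_left]]) (simp add: wcotuple_def pshift_pmon)
    have "multA X A A' tE \<cdot> (T A (lam A' m') \<cdot> lam A m) =
      Tn (wtena (wini A) (weil_map W1 A' (\<lambda>_. pmon m'))) tE \<cdot> (multA X wunit W1 tE \<cdot> (T wunit lft \<cdot> unitA X tE))"
      using wtena_square[OF wini_Hom[OF A] sqz_Hom[OF s] U(1-3) lft obE(1)] 2 by (simp add: lam_def plft_def zsec_def)
    also have "\<dots> = lam (wten A A') (mten A m m')"
      unfolding t using unit_left[OF lft ob_Wpow obE(1)] 2 by (simp add: lam_def plft_def mshift_eq_zero)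
    finally show ?thesis .
  next
    case 3
    note s = sqz_pmon[OF A m 3(1)]
    note w = wtena_weil_map[OF s[unfolded sqz_def] wlift_wunit[OF A', of "\<lambda>_. 0"]]
    have t: "wtena (weil_map W1 A (\<lambda>_. pmon m)) (wini A') = weil_map W1 (wten A A') (\<lambda>_. pmon m)"
      unfolding wini_def w(2) wten_unit_right
      by (rule weil_map_cong'[OF w(1)[unfolded wten_unit_right]]) (simp add: wcotuple_def)
    have "multA X A A' tE \<cdot> (T A (lam A' m') \<cdot> lam A m) =
      Tn (wtena (weil_map W1 A (\<lambda>_. pmon m)) (wini A')) tE \<cdot> (multA X W1 wunit tE \<cdot> (T W1 (unitA X tE) \<cdot> lft))"
      using wtena_square[OF sqz_Hom[OF s] wini_Hom[OF A'] lft U(1-3) obE(1)] 3 by (simp add: lam_def plft_def zsec_def)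
    also have "multA X W1 wunit tE \<cdot> (T W1 (unitA X tE) \<cdot> lft) = Idn X (actO X W1 tE) \<cdot> lft"
      by (rule comp_extend1[OF multA_unit(2)]) (use U multA[OF ob_Wpow ob_wunit obE(1), of 1] wten_unit_right in auto)
    also have "Tn (wtena (weil_map W1 A (\<lambda>_. pmon m)) (wini A')) tE \<cdot> \<dots> = lam (wten A A') (mten A m m')"
      unfolding t using 3 by (simp add: lam_def plft_def)
    finally show ?thesis .
  next
    case 4
    note s = sqz_pmon[OF A m 4(1)] and s' = sqz_pmon[OF A' m' 4(2)]
    note w = wtena_weil_map[OF s[unfolded sqz_def] s'[unfolded sqz_def]]
    have wl: "wlift W1 (wten W1 W1) (\<lambda>_. pvar 0 * pvar 1)"
    proof -
      have "(pvar 0 * pvar 0 * (pvar 1 * pvar 1), 0 * (pvar 1 * pvar 1)) \<in> wcong (wten W1 W1)"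
        by (intro wcong.mult wcong.gen wcong.refl) (auto simp: snd_wten)
      then have "(pvar 0 * pvar 1 * (pvar 0 * pvar 1), 0) \<in> wcong (wten W1 W1)" by (simp add: ac_simps)
      then show ?thesis by (auto simp: wlift_def)
    qed
    let ?t = "wtena (weil_map W1 A (\<lambda>_. pmon m)) (weil_map W1 A' (\<lambda>_. pmon m'))"
    have t: "?t \<cdot>\<^bsub>weil\<^esub> w_l = weil_map W1 (wten A A') (\<lambda>_. pmon (mten A m m'))"
      unfolding w(2) w_l_def weil_map_comp[OF wl w(1)]
      by (rule weil_map_cong'[OF wlift_comp[OF wl w(1)]]) (simp add: wcotuple_def pshift_pmon pmon_mult)
    note T = hom_weilD[OF wtena_Hom[OF sqz_Hom[OF s] sqz_Hom[OF s']]] and L = hom_weilD[OF weil_map(1)[OF wl], folded w_l_def]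
    have "multA X A A' tE \<cdot> (T A (lam A' m') \<cdot> lam A m) = Tn ?t tE \<cdot> (multA X W1 W1 tE \<cdot> (T W1 lft \<cdot> lft))"
      using wtena_square[OF sqz_Hom[OF s] sqz_Hom[OF s'] lft lft obE(1)] 4 by (simp add: lam_def plft_def)
    also have "\<dots> = Tn ?t tE \<cdot> (Tn w_l tE \<cdot> lft)" unfolding lift_lift ..
    also have "\<dots> = Tn (?t \<cdot>\<^bsub>weil\<^esub> w_l) tE \<cdot> lft" using T L Tnt_comp[OF L(1) T(1)] by simp
    also have "\<dots> = lam (wten A A') (mten A m m')"
      unfolding t using 4 by (simp add: lam_def plft_def add_eq_zero_monomial)
    finally show ?thesis .
  qed
qed

end

context comm_monoid begin

lemma finprod_lincomb_swap:
  assumes "finite I" "finite J" "\<And>i j. i \<in> I \<Longrightarrow> j \<in> J \<Longrightarrow> f i j \<in> carrier G"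
  shows "finprod G (\<lambda>i. lincomb G J (c i) (f i)) I = finprod G (\<lambda>j. lincomb G I (\<lambda>i. c i j) (\<lambda>i. f i j)) J"
  unfolding lincomb_def by (rule finprod_swap) (use assms in auto)

lemma lincomb_finprod:
  assumes "finite I" "finite J" "\<And>i j. i \<in> I \<Longrightarrow> j \<in> J \<Longrightarrow> f i j \<in> carrier G"
  shows "lincomb G J c (\<lambda>j. finprod G (\<lambda>i. f i j) I) = finprod G (\<lambda>i. lincomb G J c (f i)) I"
proof -
  have "lincomb G J c (\<lambda>j. finprod G (\<lambda>i. f i j) I) = finprod G (\<lambda>j. finprod G (\<lambda>i. f i j [^] c j) I) J"
    unfolding lincomb_def by (rule finprod_cong') (use assms in \<open>auto simp: finprod_pow intro!: finprod_closed\<close>)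
  also have "\<dots> = finprod G (\<lambda>i. lincomb G J c (f i)) I"
    unfolding lincomb_def by (rule finprod_swap) (use assms in auto)
  finally show ?thesis .
qed

end

lemma nz_wten_add: "weil_ob A \<Longrightarrow> weil_ob A' \<Longrightarrow> m \<in> nz A \<Longrightarrow> m' \<in> nz A' \<Longrightarrow> mten A m m' \<in> nz (wten A A')"
  using nz_wten[of A A'] unfolding bij_betw_def by force

context dbundle begin

section \<open>Sums over the monomial basis\<close>

text \<open>
  The vector of \<open>K T\<^sub>A E\<close> with coordinates \<open>e m\<close>, where \<open>K\<close> is a functor isomorphic to an action. The
  functor \<open>K\<close> makes it possible to iterate the construction.
\<close>

definition beta :: "('a \<Rightarrow> 'a) \<Rightarrow> wob \<Rightarrow> 'a \<Rightarrow> (monomial \<Rightarrow> 'a) \<Rightarrow> 'a" where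
  "beta K A w e = finprod (fib (B (K \<circ> T A)) (K (zsec A M) \<cdot> w)) (\<lambda>m. K (lam A m) \<cdot> e m) (nz A)"

definition over :: "('a \<Rightarrow> 'a) \<Rightarrow> 'a \<Rightarrow> bool" where
  "over K w \<longleftrightarrow> actlike K \<and> arr w \<and> cod w = fo X K M"

lemma overD:
  assumes "over K w"
  shows "actlike K" "endo X K" "arr w" "cod w = fo X K M" "cod w = bbase (B K)" "is_bundle (B K)"
  using assms actlike_endo abB by (auto simp: over_def)

lemma overI: "actlike K \<Longrightarrow> arr w \<Longrightarrow> cod w = fo X K M \<Longrightarrow> over K w"
  by (simp add: over_def)

lemma over_comp: assumes "over K w" "arr k" "cod k = dom w" shows "over K (w \<cdot> k)"
  using assms by (auto simp: over_def)

lemma over_zsec: assumes w: "over K w" and A: "weil_ob A" shows "over (K \<circ> T A) (K (zsec A M) \<cdot> w)"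
  "dom (K (zsec A M) \<cdot> w) = dom w"
proof -
  note O = overD[OF w] and E = endo_simps[OF overD(2)[OF w]]
  show "over (K \<circ> T A) (K (zsec A M) \<cdot> w)"
    by (rule overI[OF actlike_comp[OF O(1) A]]) (use O E A fo_comp[OF O(2) endo_Tar[OF A] obE(2)] in auto)
  show "dom (K (zsec A M) \<cdot> w) = dom w" using O E A by simp
qed

lemma cm_over: "over K w \<Longrightarrow> comm_monoid (fib (B K) w)"
  using overD[of K w] by (intro comm_monoid_fibm)

lemma K_mor:
  assumes K: "actlike K" and A: "weil_ob A" and m: "m \<in> nz A"
  shows "bundle_mor (B K) (B (K \<circ> T A)) (K (lam A m)) (K (zsec A M))"
  using bmap_bundle_mor[OF abE abT[OF A] actlike_endo[OF K] abB[OF K] _ lam_mor[OF A m]]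
    bmap_bmap_E[OF actlike_endo[OF K] endo_Tar[OF A]] abB[OF actlike_comp[OF K A]] by simp

lemma beta_term:
  assumes w: "over K w" and A: "weil_ob A" and m: "m \<in> nz A" and e: "x \<in> lifts (B K) w"
  shows "K (lam A m) \<cdot> x \<in> lifts (B (K \<circ> T A)) (K (zsec A M) \<cdot> w)"
  using bundle_mor_carrier[OF overD(6)[OF w] abB[OF actlike_comp[OF overD(1)[OF w] A]] K_mor[OF overD(1)[OF w] A m] e] .

lemma beta_carrier:
  assumes w: "over K w" and A: "weil_ob A" and e: "\<And>m. m \<in> nz A \<Longrightarrow> e m \<in> lifts (B K) w"
  shows "beta K A w e \<in> lifts (B (K \<circ> T A)) (K (zsec A M) \<cdot> w)"
  unfolding beta_def by (rule comm_monoid.finprod_closed[OF cm_over[OF over_zsec(1)[OF w A]]]) (use beta_term[OF w A] e in auto)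

lemma beta_cong:
  assumes w: "over K w" and A: "weil_ob A" and e: "\<And>m. m \<in> nz A \<Longrightarrow> e m \<in> lifts (B K) w"
    and eq: "\<And>m. m \<in> nz A \<Longrightarrow> e m = e' m"
  shows "beta K A w e = beta K A w e'"
  unfolding beta_def by (rule comm_monoid.finprod_cong'[OF cm_over[OF over_zsec(1)[OF w A]]]) (use beta_term[OF w A] e eq in auto)

lemma beta_comp:
  assumes w: "over K w" and A: "weil_ob A" and e: "\<And>m. m \<in> nz A \<Longrightarrow> e m \<in> lifts (B K) w"
    and k: "arr k" "cod k = dom w"
  shows "beta K A w e \<cdot> k = beta K A (w \<cdot> k) (\<lambda>m. e m \<cdot> k)"
proof -
  note z = over_zsec[OF w A] and O = overD[OF w] and E = endo_simps[OF overD(2)[OF w]]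
  have a: "(K (lam A m) \<cdot> e m) \<cdot> k = K (lam A m) \<cdot> (e m \<cdot> k)" if "m \<in> nz A" for m
    by (rule comp_assoc) (use fibmD[OF e[OF that]] k E A that in auto)
  have b: "(K (zsec A M) \<cdot> w) \<cdot> k = K (zsec A M) \<cdot> (w \<cdot> k)"
    by (rule comp_assoc) (use O k E A in auto)
  have c: "e m \<cdot> k \<in> lifts (B K) (w \<cdot> k)" if "m \<in> nz A" for m
    by (rule carrier_comp[OF O(6) e[OF that] k])
  have "beta K A w e \<cdot> k = finprod (fib (B (K \<circ> T A)) (K (zsec A M) \<cdot> (w \<cdot> k))) (\<lambda>m. (K (lam A m) \<cdot> e m) \<cdot> k) (nz A)"
    unfolding beta_def b[symmetric]
    by (rule finprod_comp[OF overD(6,3,5)[OF z(1)]]) (use beta_term[OF w A] e k z in auto)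
  also have "\<dots> = beta K A (w \<cdot> k) (\<lambda>m. e m \<cdot> k)"
    unfolding beta_def
    by (rule comm_monoid.finprod_cong'[OF cm_over[OF over_zsec(1)[OF over_comp[OF w k] A]]])
      (use beta_term[OF over_comp[OF w k] A] c a in auto)
  finally show ?thesis .
qed

lemma beta_lincomb:
  assumes w: "over K w" and A: "weil_ob A" and J: "finite J"
    and e: "\<And>m j. m \<in> nz A \<Longrightarrow> j \<in> J \<Longrightarrow> e m j \<in> lifts (B K) w"
  shows "beta K A w (\<lambda>m. lincomb (fib (B K) w) J c (e m)) =
    lincomb (fib (B (K \<circ> T A)) (K (zsec A M) \<cdot> w)) J c (\<lambda>j. beta K A w (\<lambda>m. e m j))"
proof -
  note z = over_zsec[OF w A] and O = overD[OF w]
  let ?H = "fib (B (K \<circ> T A)) (K (zsec A M) \<cdot> w)"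
  interpret H: comm_monoid ?H by (rule cm_over[OF z(1)])
  have t: "K (lam A m) \<cdot> lincomb (fib (B K) w) J c (e m) = lincomb ?H J c (\<lambda>j. K (lam A m) \<cdot> e m j)" if m: "m \<in> nz A" for m
    by (rule bundle_mor_lincomb[OF O(6) overD(6)[OF z(1)] K_mor[OF O(1) A m] O(3,5)]) (use e m in auto)
  have tc: "K (lam A m) \<cdot> e m j \<in> carrier ?H" if "m \<in> nz A" "j \<in> J" for m j by (rule beta_term[OF w A that(1) e[OF that]])
  have "beta K A w (\<lambda>m. lincomb (fib (B K) w) J c (e m)) = finprod ?H (\<lambda>m. lincomb ?H J c (\<lambda>j. K (lam A m) \<cdot> e m j)) (nz A)"
    unfolding beta_def by (rule H.finprod_cong') (use t tc in auto)
  also have "\<dots> = lincomb ?H J c (\<lambda>j. beta K A w (\<lambda>m. e m j))"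
    unfolding beta_def by (rule H.lincomb_finprod[symmetric]) (use tc J finite_nz[OF A] in auto)
  finally show ?thesis .
qed

lemma K_Tnt_mor:
  assumes K: "actlike K" and \<theta>: "\<theta> \<in> Hom weil A A'"
  shows "bundle_mor (B (K \<circ> T A)) (B (K \<circ> T A')) (K (Tn \<theta> tE)) (K (Tn \<theta> M))"
  using nt_bundle_mor[OF nt_left[OF nt_Tnt[OF \<theta>] actlike_endo[OF K]] abE] abB[OF actlike_comp[OF K]] hom_weilD[OF \<theta>]
  by simp

text \<open>
  The matrix entries of the morphism are supplied by \<open>lam_natural\<close>; then the two sums are exchanged.
\<close>

lemma beta_natural:
  assumes w: "over K w" and g: "wlift A A' g" and e: "\<And>m. m \<in> nz A \<Longrightarrow> e m \<in> lifts (B K) w"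
  shows "K (Tn (weil_map A A' g) tE) \<cdot> beta K A w e =
    beta K A' w (\<lambda>m'. lincomb (fib (B K) w) (nz A) (\<lambda>m. lookup (subst g (pmon m)) m') e)"
proof -
  note AA = wliftD(1,2)[OF g] and H = weil_map(1)[OF g]
  note O = overD[OF w] and E = endo_simps[OF overD(2)[OF w]] and z = over_zsec[OF w AA(1)] and z' = over_zsec[OF w AA(2)]
  note HD = hom_weilD[OF H]
  let ?\<theta> = "weil_map A A' g" let ?c = "\<lambda>m m'. lookup (subst g (pmon m)) m'"
  let ?H = "fib (B (K \<circ> T A')) (K (zsec A' M) \<cdot> w)"
  interpret H: comm_monoid ?H by (rule cm_over[OF z'(1)])
  have base: "K (Tn ?\<theta> M) \<cdot> (K (zsec A M) \<cdot> w) = K (zsec A' M) \<cdot> w"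
  proof (rule comp_extend1)
    show "K (Tn ?\<theta> M) \<cdot> K (zsec A M) = K (zsec A' M)"
      using E(4)[of "zsec A M" "Tn ?\<theta> M"] Tnt_zsec[OF H obE(2)] HD AA by simp
  qed (use E HD AA O in auto)
  have tc: "K (lam A' m') \<cdot> e m \<in> carrier ?H" if "m \<in> nz A" "m' \<in> nz A'" for m m' by (rule beta_term[OF w AA(2) that(2) e[OF that(1)]])
  have t: "K (Tn ?\<theta> tE) \<cdot> (K (lam A m) \<cdot> e m) = lincomb ?H (nz A') (?c m) (\<lambda>m'. K (lam A' m') \<cdot> e m)" if m: "m \<in> nz A" for m
  proof -
    note em = fibmD[OF e[OF m]]
    let ?G = "fib (B (T A')) (pbase A')" let ?G' = "fib (bmap X K (B (T A'))) (K (pbase A'))"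
    have bb: "bmap X K (B (T A')) = B (K \<circ> T A')" by (rule bmap_bmap_E[OF O(2) endo_Tar[OF AA(2)]])
    have ab: "is_bundle (bmap X K (B (T A')))" unfolding bb by (rule abB[OF actlike_comp[OF O(1) AA(2)]])
    have pb: "pbase A' \<in> Ar X" "cod (pbase A') = bbase (B (T A'))" using AA by simp_all
    have Kp: "K (pbase A') \<in> Ar X" "cod (K (pbase A')) = bbase (bmap X K (B (T A')))" "dom (K (pbase A')) = fo X K tE"
      using E AA pb by simp_all
    have lc: "\<And>m'. m' \<in> nz A' \<Longrightarrow> lam A' m' \<in> carrier ?G" using AA by (intro lam_carrier)
    have Klc: "K (lam A' m') \<in> carrier ?G'" if "m' \<in> nz A'" for m'
      by (rule bmap_carrier[OF abT[OF AA(2)] O(2) ab lc[OF that]])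
    have "K (Tn ?\<theta> tE) \<cdot> (K (lam A m) \<cdot> e m) = K (Tn ?\<theta> tE \<cdot> lam A m) \<cdot> e m"
      using E(4)[of "lam A m" "Tn ?\<theta> tE"] HD AA m em E by simp
    also have "Tn ?\<theta> tE \<cdot> lam A m = lincomb ?G (nz A') (?c m) (lam A')" by (rule lam_natural[OF g m])
    also have "K \<dots> = lincomb ?G' (nz A') (?c m) (\<lambda>m'. K (lam A' m'))"
      by (rule monoid_map_lincomb[OF cmT[OF AA(2)] comm_monoid_fibm[OF ab Kp(1,2)] bmap_monoid_map[OF abT[OF AA(2)] O(2) ab pb] lc])
    also have "\<dots> \<cdot> e m = lincomb (fib (bmap X K (B (T A'))) (K (pbase A') \<cdot> e m)) (nz A') (?c m) (\<lambda>m'. K (lam A' m') \<cdot> e m)"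
      by (rule lincomb_comp[OF ab Kp(1,2)]) (use em Kp Klc in auto)
    also have "K (pbase A') \<cdot> e m = K (zsec A' M) \<cdot> w"
    proof -
      have "K (pbase A') = K (zsec A' M) \<cdot> K q" using E(4)[of q "zsec A' M"] DE AA by simp
      then show ?thesis using em E DE AA by simp
    qed
    finally show ?thesis unfolding bb .
  qed
  have "K (Tn ?\<theta> tE) \<cdot> beta K A w e = finprod ?H (\<lambda>m. K (Tn ?\<theta> tE) \<cdot> (K (lam A m) \<cdot> e m)) (nz A)"
    unfolding beta_def base[symmetric]
    by (rule bundle_mor_finprod[OF overD(6)[OF z(1)] overD(6)[OF z'(1)] K_Tnt_mor[OF O(1) H] overD(3,5)[OF z(1)]])
      (use beta_term[OF w AA(1)] e in auto)
  also have "\<dots> = finprod ?H (\<lambda>m. lincomb ?H (nz A') (?c m) (\<lambda>m'. K (lam A' m') \<cdot> e m)) (nz A)"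
    by (rule H.finprod_cong') (use t tc in auto)
  also have "\<dots> = finprod ?H (\<lambda>m'. lincomb ?H (nz A) (\<lambda>m. ?c m m') (\<lambda>m. K (lam A' m') \<cdot> e m)) (nz A')"
    by (rule H.finprod_lincomb_swap) (use tc finite_nz AA in auto)
  also have "\<dots> = beta K A' w (\<lambda>m'. lincomb (fib (B K) w) (nz A) (\<lambda>m. ?c m m') e)"
    unfolding beta_def
  proof (rule H.finprod_cong')
    fix m' assume m': "m' \<in> nz A'"
    show "lincomb ?H (nz A) (\<lambda>m. ?c m m') (\<lambda>m. K (lam A' m') \<cdot> e m) = K (lam A' m') \<cdot> lincomb (fib (B K) w) (nz A) (\<lambda>m. ?c m m') e"
      by (rule bundle_mor_lincomb[symmetric, OF O(6) overD(6)[OF z'(1)] K_mor[OF O(1) AA(2) m'] O(3,5) e])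
  next
    show "(\<lambda>m'. K (lam A' m') \<cdot> lincomb (fib (B K) w) (nz A) (\<lambda>m. ?c m m') e) \<in> nz A' \<rightarrow> carrier ?H"
      by (intro Pi_I beta_term[OF w AA(2)] comm_monoid.lincomb_closed[OF cm_over[OF w] e])
  qed simp
  finally show ?thesis .
qed

text \<open>
  Coordinates for a tensor product are coordinates of coordinates. The inner sums are moved through the
  additive map of the outer monomial, where \<open>lam_mult\<close> combines the two monomials.
\<close>

lemma beta_tensor:
  assumes w: "over K w" and A: "weil_ob A" and A': "weil_ob A'"
    and e: "\<And>m. m \<in> nz (wten A A') \<Longrightarrow> e m \<in> lifts (B K) w"
  shows "K (multA X A A' tE) \<cdot> beta (K \<circ> T A) A' (K (zsec A M) \<cdot> w) (\<lambda>m'. beta K A w (\<lambda>m. e (mten A m m'))) =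
    beta K (wten A A') w e"
proof -
  note O = overD[OF w] and E = endo_simps[OF overD(2)[OF w]] and z = over_zsec[OF w A]
  note zz = over_zsec[OF z(1) A'] and zt = over_zsec[OF w ob_wten[OF A A']]
  let ?AA = "wten A A'" let ?K = "K \<circ> T A" let ?w = "K (zsec A M) \<cdot> w"
  let ?H = "fib (B (K \<circ> T ?AA)) (K (zsec ?AA M) \<cdot> w)"
  interpret H: comm_monoid ?H by (rule cm_over[OF zt(1)])
  note m\<mu> = multA[OF A A']
  have nt: "nt X (?K \<circ> T A') (K \<circ> T ?AA) (\<lambda>x. K (multA X A A' x))"
    using nt_left[OF nt_mult[OF A A'] O(2)] by (simp add: o_assoc)
  have mor: "bundle_mor (B (?K \<circ> T A')) (B (K \<circ> T ?AA)) (K (multA X A A' tE)) (K (multA X A A' M))"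
    by (rule nt_bundle_mor[OF nt abE overD(6)[OF zz(1)] overD(6)[OF zt(1)]])
  have base: "K (multA X A A' M) \<cdot> (?K (zsec A' M) \<cdot> ?w) = K (zsec ?AA M) \<cdot> w"
  proof -
    have "K (multA X A A' M \<cdot> (T A (zsec A' M) \<cdot> zsec A M)) = K (multA X A A' M) \<cdot> (K (T A (zsec A' M)) \<cdot> K (zsec A M))"
      using E(4)[of "zsec A M" "T A (zsec A' M)"] E(4)[of "T A (zsec A' M) \<cdot> zsec A M" "multA X A A' M"] A A' m\<mu>[OF obE(2)] by simp
    then have "K (zsec ?AA M) \<cdot> w = (K (multA X A A' M) \<cdot> (K (T A (zsec A' M)) \<cdot> K (zsec A M))) \<cdot> w"
      using zsec_mult[OF A A' obE(2)] by simp
    also have "\<dots> = K (multA X A A' M) \<cdot> (?K (zsec A' M) \<cdot> ?w)"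
      using E A A' m\<mu>[OF obE(2)] O by simp
    finally show ?thesis ..
  qed
  have ec: "e (mten A m m') \<in> lifts (B K) w" if "m \<in> nz A" "m' \<in> nz A'" for m m'
    by (rule e[OF nz_wten_add[OF A A' that]])
  have bc: "beta K A w (\<lambda>m. e (mten A m m')) \<in> lifts (B ?K) ?w" if "m' \<in> nz A'" for m'
    by (rule beta_carrier[OF w A ec[OF _ that]])
  have t: "K (multA X A A' tE) \<cdot> (?K (lam A' m') \<cdot> (K (lam A m) \<cdot> e (mten A m m'))) =
     K (lam ?AA (mten A m m')) \<cdot> e (mten A m m')"
    if m: "m \<in> nz A" "m' \<in> nz A'" for m m'
  proof -
    note em = fibmD[OF ec[OF m]]
    have "K (multA X A A' tE \<cdot> (T A (lam A' m') \<cdot> lam A m)) = K (multA X A A' tE) \<cdot> (K (T A (lam A' m')) \<cdot> K (lam A m))"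
      using E(4)[of "lam A m" "T A (lam A' m')"] E(4)[of "T A (lam A' m') \<cdot> lam A m" "multA X A A' tE"] A A' m m\<mu>[OF obE(1)] by simp
    then have "K (lam ?AA (mten A m m')) \<cdot> e (mten A m m') =
       (K (multA X A A' tE) \<cdot> (K (T A (lam A' m')) \<cdot> K (lam A m))) \<cdot> e (mten A m m')"
      using lam_mult[OF A A' m] by simp
    also have "\<dots> = K (multA X A A' tE) \<cdot> (?K (lam A' m') \<cdot> (K (lam A m) \<cdot> e (mten A m m')))"
      using E A A' m m\<mu>[OF obE(1)] em by simp
    finally show ?thesis ..
  qed
  have tc: "K (lam ?AA (mten A m m')) \<cdot> e (mten A m m') \<in> carrier ?H" if "m \<in> nz A" "m' \<in> nz A'" for m m'
    by (rule beta_term[OF w ob_wten[OF A A'] nz_wten_add[OF A A' that] ec[OF that]])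
  have inner: "K (multA X A A' tE) \<cdot> (?K (lam A' m') \<cdot> beta K A w (\<lambda>m. e (mten A m m'))) =
     finprod ?H (\<lambda>m. K (lam ?AA (mten A m m')) \<cdot> e (mten A m m')) (nz A)" if m': "m' \<in> nz A'" for m'
  proof -
    have "?K (lam A' m') \<cdot> beta K A w (\<lambda>m. e (mten A m m')) =
      finprod (fib (B (?K \<circ> T A')) (?K (zsec A' M) \<cdot> ?w)) (\<lambda>m. ?K (lam A' m') \<cdot> (K (lam A m) \<cdot> e (mten A m m'))) (nz A)"
      unfolding beta_def
      by (rule bundle_mor_finprod[OF overD(6)[OF z(1)] overD(6)[OF zz(1)] K_mor[OF overD(1)[OF z(1)] A' m'] overD(3,5)[OF z(1)]])
        (use beta_term[OF w A] ec m' in auto)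
    then have "K (multA X A A' tE) \<cdot> (?K (lam A' m') \<cdot> beta K A w (\<lambda>m. e (mten A m m'))) =
      K (multA X A A' tE) \<cdot> finprod (fib (B (?K \<circ> T A')) (?K (zsec A' M) \<cdot> ?w)) (\<lambda>m. ?K (lam A' m') \<cdot> (K (lam A m) \<cdot> e (mten A m m'))) (nz A)"
      by simp
    also have "\<dots> = finprod ?H (\<lambda>m. K (multA X A A' tE) \<cdot> (?K (lam A' m') \<cdot> (K (lam A m) \<cdot> e (mten A m m')))) (nz A)"
      unfolding base[symmetric]
      by (rule bundle_mor_finprod[OF overD(6)[OF zz(1)] overD(6)[OF zt(1)] mor overD(3,5)[OF zz(1)]])
        (rule beta_term[OF z(1) A' m' beta_term[OF w A _ ec[OF _ m']]])
    also have "\<dots> = finprod ?H (\<lambda>m. K (lam ?AA (mten A m m')) \<cdot> e (mten A m m')) (nz A)"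
      by (rule H.finprod_cong') (use t tc m' in auto)
    finally show ?thesis .
  qed
  have ic: "finprod ?H (\<lambda>m. K (lam ?AA (mten A m m')) \<cdot> e (mten A m m')) (nz A) \<in> carrier ?H" if "m' \<in> nz A'" for m'
    by (rule H.finprod_closed) (use tc that in auto)
  have "K (multA X A A' tE) \<cdot> beta ?K A' ?w (\<lambda>m'. beta K A w (\<lambda>m. e (mten A m m'))) =
    finprod ?H (\<lambda>m'. K (multA X A A' tE) \<cdot> (?K (lam A' m') \<cdot> beta K A w (\<lambda>m. e (mten A m m')))) (nz A')"
    unfolding beta_def[of ?K] base[symmetric]
    by (rule bundle_mor_finprod[OF overD(6)[OF zz(1)] overD(6)[OF zt(1)] mor overD(3,5)[OF zz(1)]])
      (rule beta_term[OF z(1) A' _ bc])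
  also have "\<dots> = finprod ?H (\<lambda>m'. finprod ?H (\<lambda>m. K (lam ?AA (mten A m m')) \<cdot> e (mten A m m')) (nz A)) (nz A')"
    by (rule H.finprod_cong') (use inner ic in auto)
  also have "\<dots> = finprod ?H (\<lambda>m. finprod ?H (\<lambda>m'. K (lam ?AA (mten A m m')) \<cdot> e (mten A m m')) (nz A')) (nz A)"
    by (rule H.finprod_swap) (use tc finite_nz A A' in auto)
  also have "\<dots> = finprod ?H (\<lambda>x. K (lam ?AA x) \<cdot> e x) (\<Union>m\<in>nz A. (\<lambda>m'. mten A m m') ` nz A')"
  proof -
    have inj: "inj_on (\<lambda>(m, m'). mten A m m') (nz A \<times> nz A')" using nz_wten[OF A A'] by (simp add: bij_betw_def)
    have "finprod ?H (\<lambda>x. K (lam ?AA x) \<cdot> e x) (\<Union>m\<in>nz A. (\<lambda>m'. mten A m m') ` nz A') =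
      finprod ?H (\<lambda>m. finprod ?H (\<lambda>x. K (lam ?AA x) \<cdot> e x) ((\<lambda>m'. mten A m m') ` nz A')) (nz A)"
    proof (rule H.finprod_UN_disjoint)
      show "pairwise (\<lambda>m n. disjnt ((\<lambda>m'. mten A m m') ` nz A') ((\<lambda>m'. n + mshift (fst A) m') ` nz A')) (nz A)"
      proof (rule pairwiseI, unfold disjnt_iff, intro allI notI, elim conjE imageE)
        fix m n x a b assume "m \<in> nz A" "n \<in> nz A" "m \<noteq> n" "a \<in> nz A'" "b \<in> nz A'"
          "x = m + mshift (fst A) a" "x = n + mshift (fst A) b"
        then show False using inj_onD[OF inj, of "(m, a)" "(n, b)"] by auto
      qed
    qed (use finite_nz[OF A] finite_nz[OF A'] tc in auto)
    also have "\<dots> = finprod ?H (\<lambda>m. finprod ?H (\<lambda>m'. K (lam ?AA (mten A m m')) \<cdot> e (mten A m m')) (nz A')) (nz A)"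
    proof (rule H.finprod_cong')
      fix m assume m: "m \<in> nz A"
      have "inj_on (\<lambda>m'. mten A m m') (nz A')"
        by (rule inj_onI) (use inj_onD[OF inj, of "(m, a)" "(m, b)" for a b] m in auto)
      then show "finprod ?H (\<lambda>x. K (lam ?AA x) \<cdot> e x) ((\<lambda>m'. mten A m m') ` nz A') =
        finprod ?H (\<lambda>m'. K (lam ?AA (mten A m m')) \<cdot> e (mten A m m')) (nz A')"
        by (rule H.finprod_reindex[rotated]) (use tc m in auto)
    next
      show "(\<lambda>m. finprod ?H (\<lambda>m'. K (lam ?AA (mten A m m')) \<cdot> e (mten A m m')) (nz A')) \<in> nz A \<rightarrow> carrier ?H"
        by (intro Pi_I H.finprod_closed) (use tc in auto)
    qed simp
    finally show ?thesis ..
  qed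
  also have "(\<Union>m\<in>nz A. (\<lambda>m'. mten A m m') ` nz A') = nz ?AA"
  proof -
    have img: "(\<lambda>(m, m'). mten A m m') ` (nz A \<times> nz A') = nz ?AA"
      using nz_wten[OF A A'] by (simp add: bij_betw_def)
    show ?thesis unfolding img[symmetric] by force
  qed
  finally show ?thesis unfolding beta_def[of K ?AA] .
qed

end

lemma lookup_of_nat_mult: "lookup (of_nat c * p) m = c * lookup (p :: npoly) m"
  by (induction c) (simp_all add: distrib_right lookup_add)

text \<open>Morphisms compose like their matrices.\<close>

lemma lookup_subst_eq_sum:
  assumes h: "wlift A A' h" and p: "p \<in> polys A" and m: "m \<in> nz A'"
  shows "lookup (subst h p) m =
    (\<Sum>k\<in>nz A. lookup p k * lookup (subst h (pmon k)) m)"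
proof -
  note AA = wliftD(1,2)[OF h]
  let ?p = "\<Sum>k\<in>nz A. of_nat (lookup p k) * pmon k"
  have "(p, ?p) \<in> wcong A"
    unfolding wcong_iff[OF AA(1)]
  proof (intro conjI ballI p)
    show "?p \<in> polys A" by (intro npolys_sum npolys_closed(5) npolys_of_nat npolys_pmon) (auto simp: nz_def)
    fix k assume "k \<in> nz A"
    then show "lookup p k = lookup ?p k"
      using finite_nz[OF AA(1)] by (simp add: lookup_sum lookup_of_nat_mult lookup_pmon if_distrib cong: if_cong)
  qed
  then have "lookup (subst h p) m = lookup (subst h ?p) m"
    using wcong_lookup[OF wlift_subst(2)[OF h]] m by (simp add: nz_def)
  then show ?thesis by (simp add: subst_sum lookup_sum lookup_of_nat_mult)
qed

context cat begin

lemma bundle_mor_iso_carrier: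
  assumes b: "is_bundle b" and b': "is_bundle b'" and m: "bundle_mor b b' f g"
    and f: "is_iso C f" and g: "is_iso C g" and v: "arr v" "cod v = bbase b"
    and y: "y \<in> lifts b' (g \<cdot> v)"
  shows "inv_arrow C f \<cdot> y \<in> lifts b v" "f \<cdot> (inv_arrow C f \<cdot> y) = y"
proof -
  note D = bundleD[OF b] and D' = bundleD[OF b'] and M = bundle_morD[OF m] and Y = fibmD[OF y]
  show fy: "f \<cdot> (inv_arrow C f \<cdot> y) = y" using f Y M by simp
  have "g \<cdot> (bproj b \<cdot> (inv_arrow C f \<cdot> y)) = bproj b' \<cdot> (f \<cdot> (inv_arrow C f \<cdot> y))"
    by (rule comp_extend[OF M(7)[symmetric]]) (use f Y M D D' in auto)
  then have "g \<cdot> (bproj b \<cdot> (inv_arrow C f \<cdot> y)) = g \<cdot> v" unfolding fy Y(4) .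
  then have "bproj b \<cdot> (inv_arrow C f \<cdot> y) = v"
    by (rule iso_mono[OF g, rotated -1]) (use f Y M D v in auto)
  then show "inv_arrow C f \<cdot> y \<in> lifts b v" using f Y M v by (simp add: fibm_carrier)
qed

end

context dbundle begin

section \<open>Vertical vectors are tuples\<close>

text \<open>Every vector over the zero vector at \<open>w\<close> has unique coordinates.\<close>

definition betabij :: "('a \<Rightarrow> 'a) \<Rightarrow> wob \<Rightarrow> bool" where
  "betabij K A \<longleftrightarrow> (\<forall>w. over K w \<longrightarrow>
     (\<forall>y \<in> lifts (B (K \<circ> T A)) (K (zsec A M) \<cdot> w).
        \<exists>e. (\<forall>m\<in>nz A. e m \<in> lifts (B K) w) \<and> beta K A w e = y) \<and>
     (\<forall>e e'. (\<forall>m\<in>nz A. e m \<in> lifts (B K) w) \<and> (\<forall>m\<in>nz A. e' m \<in> lifts (B K) w) \<and>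
        beta K A w e = beta K A w e' \<longrightarrow> (\<forall>m\<in>nz A. e m = e' m)))"

lemma betabijI:
  assumes "\<And>w y. over K w \<Longrightarrow> y \<in> lifts (B (K \<circ> T A)) (K (zsec A M) \<cdot> w) \<Longrightarrow>
      \<exists>e. (\<forall>m\<in>nz A. e m \<in> lifts (B K) w) \<and> beta K A w e = y"
    and "\<And>w e e' m. over K w \<Longrightarrow> (\<And>m. m \<in> nz A \<Longrightarrow> e m \<in> lifts (B K) w) \<Longrightarrow>
      (\<And>m. m \<in> nz A \<Longrightarrow> e' m \<in> lifts (B K) w) \<Longrightarrow> beta K A w e = beta K A w e' \<Longrightarrow> m \<in> nz A \<Longrightarrow> e m = e' m"
  shows "betabij K A"
  unfolding betabij_def using assms by simp

lemma betabij_ex: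
  assumes "betabij K A" "over K w" "y \<in> lifts (B (K \<circ> T A)) (K (zsec A M) \<cdot> w)"
  obtains e where "\<And>m. m \<in> nz A \<Longrightarrow> e m \<in> lifts (B K) w" "beta K A w e = y"
  using assms unfolding betabij_def by metis

lemma betabij_unique:
  assumes "betabij K A" "over K w" "\<And>m. m \<in> nz A \<Longrightarrow> e m \<in> lifts (B K) w"
    "\<And>m. m \<in> nz A \<Longrightarrow> e' m \<in> lifts (B K) w" "beta K A w e = beta K A w e'" "m \<in> nz A"
  shows "e m = e' m"
  using assms unfolding betabij_def by simp

lemma beta_wunit:
  assumes w: "over K w" and e: "e 0 \<in> lifts (B K) w"
  shows "beta K wunit w e = K (unitA X tE) \<cdot> e 0"
proof -
  have t: "K (lam wunit 0) \<cdot> e 0 \<in> lifts (B (K \<circ> T wunit)) (K (zsec wunit M) \<cdot> w)"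
    by (rule beta_term[OF w ob_wunit _ e]) (simp add: nz_wunit)
  interpret H: comm_monoid "fib (B (K \<circ> T wunit)) (K (zsec wunit M) \<cdot> w)"
    by (rule cm_over[OF over_zsec(1)[OF w ob_wunit]])
  have "beta K wunit w e = K (lam wunit 0) \<cdot> e 0"
    unfolding beta_def nz_wunit using t H.finprod_insert[of "{}" 0 "\<lambda>m. K (lam wunit m) \<cdot> e m"] H.r_one[OF t] by (simp del: fibm_simps)
  then show ?thesis by (simp add: lam_def zsec_wunit)
qed

lemma K_unit_mor:
  assumes K: "actlike K"
  shows "bundle_mor (B K) (B (K \<circ> T wunit)) (K (unitA X tE)) (K (unitA X M))"
    "is_iso X (K (unitA X tE))" "is_iso X (K (unitA X M))"
  using nt_bundle_mor[OF nt_left[OF nt_unit actlike_endo[OF K]] abE] abB[OF K] abB[OF actlike_comp[OF K ob_wunit]]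
    endo_iso[OF actlike_endo[OF K]] unitA(4)[OF obE(1)] unitA(4)[OF obE(2)] by simp_all

lemma betabij_wunit: assumes K: "actlike K" shows "betabij K wunit"
proof (rule betabijI)
  note m = K_unit_mor[OF K] and bu = abB[OF actlike_comp[OF K ob_wunit]]
  fix w y assume w: "over K w" and y: "y \<in> lifts (B (K \<circ> T wunit)) (K (zsec wunit M) \<cdot> w)"
  note O = overD[OF w]
  note i = bundle_mor_iso_carrier[OF O(6) bu m O(3,5), of y]
  have y': "y \<in> lifts (B (K \<circ> T wunit)) (K (unitA X M) \<cdot> w)" using y by (simp add: zsec_wunit)
  show "\<exists>e. (\<forall>m\<in>nz wunit. e m \<in> lifts (B K) w) \<and> beta K wunit w e = y"
    using i[OF y'] beta_wunit[OF w, of "\<lambda>_. inv_arrow X (K (unitA X tE)) \<cdot> y"] by (intro exI[of _ "\<lambda>_. inv_arrow X (K (unitA X tE)) \<cdot> y"]) simp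
next
  note m = K_unit_mor[OF K]
  fix w e e' m assume w: "over K w" and e: "\<And>m. m \<in> nz wunit \<Longrightarrow> e m \<in> lifts (B K) w"
    "\<And>m. m \<in> nz wunit \<Longrightarrow> e' m \<in> lifts (B K) w" and eq: "beta K wunit w e = beta K wunit w e'" and mm: "m \<in> nz wunit"
  have e0: "e 0 \<in> lifts (B K) w" "e' 0 \<in> lifts (B K) w" using e by simp_all
  have "K (unitA X tE) \<cdot> e 0 = K (unitA X tE) \<cdot> e' 0" using eq beta_wunit[OF w, of e] beta_wunit[OF w, of e'] e0 by simp
  then have "e 0 = e' 0"
    by (rule iso_mono[OF m(2), rotated -1]) (use fibmD[OF e0(1)] fibmD[OF e0(2)] bundle_morD(2)[OF m(1)] in auto)
  then show "e m = e' m" using mm by (simp add: nz_wunit)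
qed

subsection \<open>The case of W: universality of the lift\<close>

text \<open>The top side of the pullback square that expresses the universality of the lift.\<close>

definition vlift :: "'a" where
  "vlift = fib_add X (B (T W1)) (lft \<cdot> bprj E 2 0) (zsec W1 tE \<cdot> bprj E 2 1)"

lemma nz_W1: "nz W1 = {0, mvar 0}" "nz (Wpow (Suc 0)) = {0, mvar 0}"
  unfolding nz_Wpow by auto

lemma mvar_neq_0 [simp]: "mvar i \<noteq> 0"
  using mvar_nz(2)[of "Wpow (Suc i)" i] by simp

lemma lam_W1: "lam W1 0 = zsec W1 tE" "lam W1 (mvar 0) = lft" "lam (Wpow (Suc 0)) 0 = zsec (Wpow (Suc 0)) tE" "lam (Wpow (Suc 0)) (mvar 0) = lft"
  using plft_pvar by (simp_all add: lam_def pvar_def)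

lemma beta_W1:
  assumes w: "over K w" and e: "e 0 \<in> lifts (B K) w" "e (mvar 0) \<in> lifts (B K) w"
  shows "beta K W1 w e = fib_add X (B (K \<circ> T W1)) (K lft \<cdot> e (mvar 0)) (K (zsec W1 tE) \<cdot> e 0)"
proof -
  let ?H = "fib (B (K \<circ> T W1)) (K (zsec W1 M) \<cdot> w)"
  interpret H: comm_monoid ?H by (rule cm_over[OF over_zsec(1)[OF w ob_Wpow]])
  have t: "K (lam W1 0) \<cdot> e 0 \<in> carrier ?H" "K (lam W1 (mvar 0)) \<cdot> e (mvar 0) \<in> carrier ?H"
    by (rule beta_term[OF w ob_Wpow]; simp add: nz_W1 e)+
  have "beta K W1 w e = (K (lam W1 0) \<cdot> e 0) \<otimes>\<^bsub>?H\<^esub> finprod ?H (\<lambda>m. K (lam W1 m) \<cdot> e m) {mvar 0}"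
    unfolding beta_def nz_W1(1) by (rule H.finprod_insert) (use t mvar_neq_0[of 0, symmetric] in \<open>auto simp del: fibm_simps One_nat_def\<close>)
  also have "finprod ?H (\<lambda>m. K (lam W1 m) \<cdot> e m) {mvar 0} = (K (lam W1 (mvar 0)) \<cdot> e (mvar 0)) \<otimes>\<^bsub>?H\<^esub> finprod ?H (\<lambda>m. K (lam W1 m) \<cdot> e m) {}"
    by (rule H.finprod_insert) (use t in \<open>auto simp del: fibm_simps One_nat_def\<close>)
  also have "\<dots> = K (lam W1 (mvar 0)) \<cdot> e (mvar 0)" unfolding H.finprod_empty by (rule H.r_one[OF t(2)])
  also have "(K (lam W1 0) \<cdot> e 0) \<otimes>\<^bsub>?H\<^esub> (K (lam W1 (mvar 0)) \<cdot> e (mvar 0)) = (K (lam W1 (mvar 0)) \<cdot> e (mvar 0)) \<otimes>\<^bsub>?H\<^esub> (K (lam W1 0) \<cdot> e 0)"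
    by (rule H.m_comm[OF t])
  finally show ?thesis by (simp add: lam_W1)
qed

lemma vlift_terms: "lft \<cdot> bprj E 2 0 \<in> lifts (B (T W1)) (zsec W1 M \<cdot> bpow E 2)"
  "zsec W1 tE \<cdot> bprj E 2 1 \<in> lifts (B (T W1)) (zsec W1 M \<cdot> bpow E 2)"
  using bundle_mor_carrier[OF abE abT[OF ob_Wpow] lift_mor bprj_carrier[OF abE], of 0 2]
    bundle_mor_carrier[OF abE abT[OF ob_Wpow] lam_mor[OF ob_Wpow, of 0 1] bprj_carrier[OF abE], of 1 2]
  by (simp_all add: lam_W1)

lemma vlift: "arr vlift" "dom vlift = bpowO X E 2" "cod vlift = actO X W1 tE" "T W1 q \<cdot> vlift = zsec W1 M \<cdot> bpow E 2"
proof -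
  have "vlift \<in> lifts (B (T W1)) (zsec W1 M \<cdot> bpow E 2)"
    unfolding vlift_def by (rule fib_add[OF abT _ _ vlift_terms]) (use DE in auto)
  from fibmD[OF this] show "arr vlift" "dom vlift = bpowO X E 2" "cod vlift = actO X W1 tE" "T W1 q \<cdot> vlift = zsec W1 M \<cdot> bpow E 2"
    using DE by simp_all
qed

text \<open>Evaluates the top side of that square at a pair of elements.\<close>

lemma K_vlift:
  assumes w: "over K w" and h: "arr h" "cod h = bpowO X (B K) 2" "bpow (B K) 2 \<cdot> h = w"
  shows "K vlift \<cdot> h = beta K W1 w (\<lambda>m. if m = 0 then K (bprj E 2 1) \<cdot> h else K (bprj E 2 0) \<cdot> h)"
proof -
  note O = overD[OF w] and E = endo_simps[OF overD(2)[OF w]]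
  have W: "weil_ob W1" by simp
  let ?b = "bmap X K (B (T W1))"
  have bb: "?b = B (K \<circ> T W1)" by (rule bmap_bmap_E[OF O(2) endo_Tar[OF W]])
  have ab: "is_bundle ?b" unfolding bb by (rule abB[OF actlike_comp[OF O(1) W]])
  let ?v = "zsec W1 M \<cdot> bpow E 2"
  have v: "arr ?v" "cod ?v = bbase (B (T W1))" "dom ?v = bpowO X E 2" using DE by simp_all
  have Kv: "K ?v \<in> Ar X" "cod (K ?v) = bbase ?b" "dom (K ?v) = fo X K (bpowO X E 2)" using E v by simp_all
  have hc: "cod h = fo X K (bpowO X E 2)" using h(2) bpowO_bmap[OF abE O(2)] by simp
  have mm: "monoid_map (fib (B (T W1)) ?v) (fib ?b (K ?v)) K" by (rule bmap_monoid_map[OF abT[OF W] O(2) ab v(1,2)])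
  have c: "K (lft \<cdot> bprj E 2 0) \<in> lifts ?b (K ?v)" "K (zsec W1 tE \<cdot> bprj E 2 1) \<in> lifts ?b (K ?v)"
    using mm vlift_terms unfolding monoid_map_def by blast+
  have p: "K (bprj E 2 i) \<cdot> h \<in> lifts (B K) w" if "i < 2" for i
    using lift_carrier[OF O(6) h that] by simp
  have "K vlift = fib_add X ?b (K (lft \<cdot> bprj E 2 0)) (K (zsec W1 tE \<cdot> bprj E 2 1))"
    unfolding vlift_def using mm vlift_terms unfolding monoid_map_def by simp
  then have "K vlift \<cdot> h = fib_add X ?b (K (lft \<cdot> bprj E 2 0) \<cdot> h) (K (zsec W1 tE \<cdot> bprj E 2 1) \<cdot> h)"
    using fib_add_comp[OF ab Kv(1,2) c h(1)] Kv(3) hc by simp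
  also have "K (lft \<cdot> bprj E 2 0) \<cdot> h = K lft \<cdot> (K (bprj E 2 0) \<cdot> h)"
    using E(4)[of "bprj E 2 0" lft] E DE h(1) hc by simp
  also have "K (zsec W1 tE \<cdot> bprj E 2 1) \<cdot> h = K (zsec W1 tE) \<cdot> (K (bprj E 2 1) \<cdot> h)"
    using E(4)[of "bprj E 2 1" "zsec W1 tE"] E DE h(1) hc by simp
  finally show ?thesis
    unfolding bb using beta_W1[OF w, of "\<lambda>m. if m = 0 then K (bprj E 2 1) \<cdot> h else K (bprj E 2 0) \<cdot> h"] p[of 0] p[of 1] by simp
qed

lemma wide_pb_vlift:
  assumes K: "actlike K"
  shows "wide_pb X 2 (\<lambda>i. K (if i = 0 then T W1 q else zsec W1 M)) (K (T W1 q \<cdot> vlift)) (\<lambda>i. K (if i = 0 then vlift else q \<cdot> bprj E 2 0))"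
proof -
  have vl: "T W1 (bplus E) \<cdot> bpair X (Tbundle X E) (lft \<cdot> bprj E 2 0) (zsec W1 tE \<cdot> bprj E 2 1) = vlift"
    by (simp add: vlift_def fib_add_def Tbundle_eq tan_zero_eq)
  have st: "wide_pb X 2 (\<lambda>i. (T W1 ^^ k) (if i = 0 then T W1 q else zsec W1 M)) ((T W1 ^^ k) (T W1 q \<cdot> vlift))
     (\<lambda>i. (T W1 ^^ k) (if i = 0 then vlift else q \<cdot> bprj E 2 0))" for k
  proof -
    have "is_pullback X ((T W1 ^^ k) vlift) ((T W1 ^^ k) (q \<cdot> bprj E 2 0)) ((T W1 ^^ k) (T W1 q)) ((T W1 ^^ k) (zsec W1 M))"
      using db unfolding differential_bundle_def tan_zero_eq vl by blast
    note pb = is_pullback_wide_pb[OF this]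
    have u: "(T W1 ^^ k) (T W1 q \<cdot> vlift) = (T W1 ^^ k) (T W1 q) \<cdot> (T W1 ^^ k) vlift"
      by (rule endo_simps(4)[OF endo_iter]) (use vlift DE in auto)
    have ff: "(\<lambda>i::nat. (T W1 ^^ k) (if i = 0 then a else b)) = (\<lambda>i. if i = 0 then (T W1 ^^ k) a else (T W1 ^^ k) b)" for a b
      by (rule ext) simp
    show ?thesis unfolding u ff by (rule pb)
  qed
  have c: "cone X 2 (\<lambda>i. if i = 0 then T W1 q else zsec W1 M) (T W1 q \<cdot> vlift) (\<lambda>i. if i = 0 then vlift else q \<cdot> bprj E 2 0)"
    using wide_pb_cone[OF st[of 0]] by (simp only: funpow_0)
  show ?thesis by (rule wide_pb_stable[OF c st K])
qed

text \<open>
  This is the universality of the lift: the components of the arrow into the pullback \<open>E\<^sub>2\<close> are the two coordinates.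
\<close>

lemma betabij_W1: assumes K: "actlike K" shows "betabij K W1"
proof (rule betabijI)
  note pb = wide_pb_vlift[OF K] and E = endo_simps[OF actlike_endo[OF K]]
  have W: "weil_ob W1" by simp
  have po: "bpowO X (B K) 2 = fo X K (bpowO X E 2)" by (rule bpowO_bmap[OF abE actlike_endo[OF K]])
  fix w y assume w: "over K w" and y: "y \<in> lifts (B (K \<circ> T W1)) (K (zsec W1 M) \<cdot> w)"
  note O = overD[OF w] and Y = fibmD[OF y] and z = over_zsec[OF w W]
  have Yc: "cod y = fo X K (actO X W1 tE)" using Y fo_comp[OF O(2) endo_Tar[OF W] obE(1)] by simp
  let ?v = "K (zsec W1 M) \<cdot> w"
  have Dom': "dom (K (T W1 q \<cdot> vlift)) = fo X K (bpowO X E 2)" "cod (K (T W1 q \<cdot> vlift)) = fo X K (actO X W1 M)"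
    using E vlift(1-3) DE by simp_all
  obtain h where h: "arr h" "dom h = dom ?v" "cod h = dom (K (T W1 q \<cdot> vlift))"
    "\<And>i::nat. i < 2 \<Longrightarrow> K (if i = 0 then vlift else q \<cdot> bprj E 2 0) \<cdot> h = (if i = 0 then y else w)"
  proof (rule wide_pb_lift[OF pb overD(3)[OF z(1)], of "\<lambda>i. if i = 0 then y else w"])
    show "cod ?v = cod (K (T W1 q \<cdot> vlift))" using E O Dom' by simp
    fix i :: nat assume "i < 2"
    show "(if i = 0 then y else w) \<in> Ar X" "dom (if i = 0 then y else w) = dom ?v"
      "cod (if i = 0 then y else w) = dom (K (if i = 0 then T W1 q else zsec W1 M))"
      "K (if i = 0 then T W1 q else zsec W1 M) \<cdot> (if i = 0 then y else w) = ?v"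
      using Y Yc O E DE z by simp_all
  qed blast
  have hh: "K vlift \<cdot> h = y" "K (q \<cdot> bprj E 2 0) \<cdot> h = w" using h(4)[of 0] h(4)[of 1] by simp_all
  have hw: "bpow (B K) 2 \<cdot> h = w" using hh(2) DE(21)[of 0 2] by simp
  have hc: "cod h = bpowO X (B K) 2" using h(3) po Dom' by simp
  have p: "K (bprj E 2 i) \<cdot> h \<in> lifts (B K) w" if "i < 2" for i
    using lift_carrier[OF O(6) h(1) hc hw that] by simp
  show "\<exists>e. (\<forall>m\<in>nz W1. e m \<in> lifts (B K) w) \<and> beta K W1 w e = y"
    using K_vlift[OF w h(1) hc hw] hh(1) p[of 0] p[of 1]
    by (intro exI[of _ "\<lambda>m. if m = 0 then K (bprj E 2 1) \<cdot> h else K (bprj E 2 0) \<cdot> h"]) (simp add: nz_W1)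
next
  note pb = wide_pb_vlift[OF K] and E = endo_simps[OF actlike_endo[OF K]]
  fix w e e' m assume w: "over K w" and e: "\<And>m. m \<in> nz W1 \<Longrightarrow> e m \<in> lifts (B K) w"
    "\<And>m. m \<in> nz W1 \<Longrightarrow> e' m \<in> lifts (B K) w" and eq: "beta K W1 w e = beta K W1 w e'" and m: "m \<in> nz W1"
  note O = overD[OF w]
  have po: "bpowO X (B K) 2 = fo X K (bpowO X E 2)" by (rule bpowO_bmap[OF abE O(2)])
  have Dom': "dom (K (T W1 q \<cdot> vlift)) = fo X K (bpowO X E 2)" using E vlift(1-3) DE by simp
  have n: "0 \<in> nz W1" "mvar 0 \<in> nz W1" by (simp_all add: nz_W1)
  let ?h = "\<lambda>e. bpair X (B K) (e (mvar 0)) (e 0)"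
  have H: "?h e \<in> Ar X" "dom (?h e) = dom w" "cod (?h e) = bpowO X (B K) 2" "bpow (B K) 2 \<cdot> ?h e = w"
    "K (bprj E 2 0) \<cdot> ?h e = e (mvar 0)" "K (bprj E 2 1) \<cdot> ?h e = e 0" "K vlift \<cdot> ?h e = beta K W1 w e" "K (q \<cdot> bprj E 2 0) \<cdot> ?h e = w"
    if eb: "\<forall>m\<in>nz W1. e m \<in> lifts (B K) w" for e
  proof -
    note e = bspec[OF eb]
    note t = bpair[OF O(6) O(3,5) e[OF n(2)] e[OF n(1)]]
    show "?h e \<in> Ar X" "dom (?h e) = dom w" "cod (?h e) = bpowO X (B K) 2" "bpow (B K) 2 \<cdot> ?h e = w" by (rule t)+
    show p: "K (bprj E 2 0) \<cdot> ?h e = e (mvar 0)" "K (bprj E 2 1) \<cdot> ?h e = e 0" using t by simp_all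
    show "K (q \<cdot> bprj E 2 0) \<cdot> ?h e = w" using t(4) DE(21)[of 0 2] by simp
    have "K vlift \<cdot> ?h e = beta K W1 w (\<lambda>m. if m = 0 then e 0 else e (mvar 0))"
      using K_vlift[OF w t(1,3,4)] unfolding p .
    also have "\<dots> = beta K W1 w e"
      by (rule beta_cong[OF w ob_Wpow]) (use e n in \<open>auto simp: nz_W1\<close>)
    finally show "K vlift \<cdot> ?h e = beta K W1 w e" .
  qed
  have eb: "\<forall>m\<in>nz W1. e m \<in> lifts (B K) w" "\<forall>m\<in>nz W1. e' m \<in> lifts (B K) w" using e by blast+
  note He = H[OF eb(1)] and He' = H[OF eb(2)]
  have "?h e = ?h e'"
  proof (rule wide_pb_eq[OF pb])
    have q0: "K (T W1 q \<cdot> vlift) \<cdot> k = K (T W1 q) \<cdot> (K vlift \<cdot> k)" if "arr k" "cod k = bpowO X (B K) 2" for k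
      using E(4)[of vlift "T W1 q"] E vlift(1-3) DE that po by simp
    show "K (T W1 q \<cdot> vlift) \<cdot> ?h e = K (T W1 q \<cdot> vlift) \<cdot> ?h e'"
      using q0[OF He(1,3)] q0[OF He'(1,3)] He(7) He'(7) eq by simp
    show "K (if i = 0 then vlift else q \<cdot> bprj E 2 0) \<cdot> ?h e = K (if i = 0 then vlift else q \<cdot> bprj E 2 0) \<cdot> ?h e'" for i :: nat
      using He(7,8) He'(7,8) eq by simp
  qed (use He(1-3) He'(1-3) Dom' po in auto)
  then have "e 0 = e' 0" "e (mvar 0) = e' (mvar 0)" using He(5,6) He'(5,6) by auto
  then show "e m = e' m" using m by (auto simp: nz_W1)
qed

subsection \<open>Fibre powers and tensor products\<close>

lemma K_Tnt_carrier:
  assumes w: "over K w" and \<theta>: "\<theta> \<in> Hom weil A A'" and y: "y \<in> lifts (B (K \<circ> T A)) (K (zsec A M) \<cdot> w)"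
  shows "K (Tn \<theta> tE) \<cdot> y \<in> lifts (B (K \<circ> T A')) (K (zsec A' M) \<cdot> w)"
proof -
  note O = overD[OF w] and E = endo_simps[OF overD(2)[OF w]] and HD = hom_weilD[OF \<theta>]
  have base: "K (Tn \<theta> M) \<cdot> (K (zsec A M) \<cdot> w) = K (zsec A' M) \<cdot> w"
  proof (rule comp_extend1)
    show "K (Tn \<theta> M) \<cdot> K (zsec A M) = K (zsec A' M)"
      using E(4)[of "zsec A M" "Tn \<theta> M"] Tnt_zsec[OF \<theta> obE(2)] HD by simp
  qed (use E HD O in auto)
  show ?thesis
    using bundle_mor_carrier[OF abB[OF actlike_comp[OF O(1) HD(4)]] abB[OF actlike_comp[OF O(1) HD(5)]] K_Tnt_mor[OF O(1) \<theta>] y]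
    unfolding base .
qed

lemma beta_waug:
  assumes w: "over K w" and A: "weil_ob A" and e: "\<And>m. m \<in> nz A \<Longrightarrow> e m \<in> lifts (B K) w"
  shows "K (Tn (waug A) tE) \<cdot> beta K A w e = beta K wunit w (\<lambda>_. e 0)"
proof -
  note G = wlift_zero[OF A ob_wunit]
  interpret G: comm_monoid "fib (B K) w" by (rule cm_over[OF w])
  have s: "subst (\<lambda>_. 0) (pmon m) = (if m = 0 then 1 else 0)" for m
  proof (cases "m = 0")
    case False
    then obtain i where i: "i \<in> keys m" by (metis keys_eq_empty ex_in_conv)
    then have "lookup m i \<noteq> 0" by (simp add: in_keys_iff)
    then have "(\<Prod>i\<in>keys m. (0::npoly) ^ lookup m i) = 0" using i by (intro prod_zero bexI[of _ i]) (auto simp: power_0_left)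
    then show ?thesis using False unfolding pmon_def subst_single meval_def by simp
  qed simp
  have z: "(0::monomial) \<in> nz A" by simp
  have "lincomb (fib (B K) w) (nz A) (\<lambda>m. lookup (subst (\<lambda>_. 0) (pmon m)) 0) e = e 0"
    by (rule G.lincomb_delta) (use e z finite_nz[OF A] s in \<open>auto simp: lookup_one when_def\<close>)
  then show ?thesis
    using e[OF z] beta_natural[OF w G, of e] e unfolding waug_def
    by (auto simp: nz_wunit intro!: beta_cong[OF w ob_wunit])
qed

lemma beta_Wproj:
  assumes w: "over K w" and j: "j < n" and e: "\<And>m. m \<in> nz (Wpow n) \<Longrightarrow> e m \<in> lifts (B K) w"
  shows "K (Tn (Wproj n j) tE) \<cdot> beta K (Wpow n) w e = beta K W1 w (\<lambda>m. if m = 0 then e 0 else e (mvar j))"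
proof -
  let ?g = "\<lambda>i. if i = j then pvar 0 else 0"
  interpret G: comm_monoid "fib (B K) w" by (rule cm_over[OF w])
  have e0: "e 0 \<in> lifts (B K) w" using e by simp
  have ej: "e (mvar j) \<in> lifts (B K) w" using e j by (simp add: nz_Wpow)
  have jn: "mvar j \<in> nz (Wpow n)" using j by (simp add: nz_Wpow)
  have s: "subst ?g (pmon (mvar i)) = (if i = j then pvar 0 else 0)" for i by (simp add: pvar_def[symmetric])
  have l0: "lincomb (fib (B K) w) (nz (Wpow n)) (\<lambda>m. lookup (subst ?g (pmon m)) 0) e = e 0"
  proof (rule G.lincomb_delta)
    fix m assume "m \<in> nz (Wpow n)"
    then consider "m = 0" | i where "m = mvar i" by (auto simp: nz_Wpow)
    then show "lookup (subst ?g (pmon m)) 0 = (if m = 0 then 1 else 0)"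
      by cases (simp_all add: s pvar_def lookup_pmon lookup_one)
  qed (use e finite_nz[OF ob_Wpow] in auto)
  have lj: "lincomb (fib (B K) w) (nz (Wpow n)) (\<lambda>m. lookup (subst ?g (pmon m)) (mvar 0)) e = e (mvar j)"
  proof (rule G.lincomb_delta)
    fix m assume "m \<in> nz (Wpow n)"
    then consider "m = 0" | i where "m = mvar i" by (auto simp: nz_Wpow)
    then show "lookup (subst ?g (pmon m)) (mvar 0) = (if m = mvar j then 1 else 0)"
    proof cases
      case 1
      then show ?thesis using mvar_neq_0[of j, symmetric] by (simp add: lookup_one)
    next
      case (2 i)
      have "mvar i = mvar j \<longleftrightarrow> i = j" using inj_mvar by (auto dest: injD)
      then show ?thesis using 2 by (simp add: s pvar_def lookup_pmon)
    qed
  qed (use e jn finite_nz[OF ob_Wpow] in auto)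
  have "K (Tn (Wproj n j) tE) \<cdot> beta K (Wpow n) w e =
      beta K W1 w (\<lambda>m'. lincomb (fib (B K) w) (nz (Wpow n)) (\<lambda>m. lookup (subst ?g (pmon m)) m') e)"
    unfolding Wproj_def by (rule beta_natural[OF w wlift_proj]) (rule e)
  also have "\<dots> = beta K W1 w (\<lambda>m. if m = 0 then e 0 else e (mvar j))"
  proof (rule beta_cong[OF w ob_Wpow])
    fix m assume "m \<in> nz W1"
    then show "lincomb (fib (B K) w) (nz (Wpow n)) (\<lambda>k. lookup (subst ?g (pmon k)) m) e = (if m = 0 then e 0 else e (mvar j))"
      using l0 lj by (auto simp: nz_W1)
    show "lincomb (fib (B K) w) (nz (Wpow n)) (\<lambda>k. lookup (subst ?g (pmon k)) m) e \<in> lifts (B K) w"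
      by (rule G.lincomb_closed[OF e])
  qed
  finally show ?thesis .
qed

text \<open>
  The components in \<open>T\<^sub>W\<close> of a vector in \<open>T\<close> at \<open>W^n\<close> have coordinates by the case of \<open>W\<close>, and their
  constant coordinates agree because they all come from the image under \<open>W^n \<rightarrow> \<nat>\<close>.
\<close>

lemma betabij_Wpow: assumes K: "actlike K" shows "betabij K (Wpow n)"
proof (rule betabijI)
  note pw = wide_pb_actlike_Wpow[OF K obE(1), of n]
  note AU = waug_Hom[OF ob_Wpow, of n] and WP = Wproj_Hom[of n]
  fix w y assume w: "over K w" and y: "y \<in> lifts (B (K \<circ> T (Wpow n))) (K (zsec (Wpow n) M) \<cdot> w)"
  note O = overD[OF w] and E = endo_simps[OF overD(2)[OF w]]
  obtain e0 where e0: "\<And>m. m \<in> nz wunit \<Longrightarrow> e0 m \<in> lifts (B K) w" "beta K wunit w e0 = K (Tn (waug (Wpow n)) tE) \<cdot> y"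
    using betabij_ex[OF betabij_wunit[OF K] w K_Tnt_carrier[OF w AU y]] by blast
  have "\<forall>j. \<exists>e. (\<forall>m\<in>nz W1. e m \<in> lifts (B K) w) \<and> beta K W1 w e = K (Tn (Wproj n j) tE) \<cdot> y"
    using betabij_ex[OF betabij_W1[OF K] w K_Tnt_carrier[OF w WP y]] by metis
  then obtain f where f: "\<And>j m. m \<in> nz W1 \<Longrightarrow> f j m \<in> lifts (B K) w"
    "\<And>j. beta K W1 w (f j) = K (Tn (Wproj n j) tE) \<cdot> y" by metis
  have e0c: "e0 0 \<in> lifts (B K) w" using e0(1) by simp
  have eq0: "f j 0 = e0 0" for j
  proof (rule betabij_unique[OF betabij_wunit[OF K] w, of "\<lambda>_. f j 0" "\<lambda>_. e0 0" 0])
    have "beta K wunit w (\<lambda>_. f j 0) = K (Tn (waug W1) tE) \<cdot> (K (Tn (Wproj n j) tE) \<cdot> y)"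
      unfolding f(2)[symmetric] by (rule beta_waug[OF w ob_Wpow, symmetric]) (rule f(1))
    also have "\<dots> = K (Tn (waug (Wpow n)) tE) \<cdot> y"
    proof (rule comp_extend1)
      have c: "waug W1 \<cdot>\<^bsub>weil\<^esub> Wproj n j = waug (Wpow n)"
        unfolding Wproj_def waug_def[of W1] weil_map_comp[OF wlift_proj wlift_zero[OF ob_Wpow ob_wunit]]
        by (rule weil_map_to_wunit[OF wlift_comp[OF wlift_proj wlift_zero]]) auto
      have "Tn (waug (Wpow n)) tE = Tn (waug W1) tE \<cdot> Tn (Wproj n j) tE"
        unfolding c[symmetric] by (rule Tnt_comp) (use hom_weilD[OF WP[of j]] hom_weilD[OF waug_Hom[of W1]] in auto)
      then show "K (Tn (waug W1) tE) \<cdot> K (Tn (Wproj n j) tE) = K (Tn (waug (Wpow n)) tE)"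
        using E(4)[of "Tn (Wproj n j) tE" "Tn (waug W1) tE"] hom_weilD[OF WP[of j]] hom_weilD[OF waug_Hom[of W1]] by simp
    qed (use E hom_weilD[OF WP[of j]] hom_weilD[OF waug_Hom[of W1]] fibmD[OF y] fo_comp[OF O(2) endo_Tar obE(1), of "Wpow n"] in auto)
    also have "\<dots> = beta K wunit w (\<lambda>_. e0 0)" unfolding e0(2)[symmetric]
      by (rule beta_cong[OF w ob_wunit e0(1)]) (simp_all add: nz_wunit)
    finally show "beta K wunit w (\<lambda>_. f j 0) = beta K wunit w (\<lambda>_. e0 0)" .
  qed (use f(1)[of 0 j] e0c in \<open>auto simp: nz_W1\<close>)
  \<comment> \<open>The coordinates of the components, glued along the common constant one.\<close>
  define e where "e m = (if m = 0 then e0 0 else f (inv_into UNIV mvar m) (mvar 0))" for m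
  have im: "inv_into UNIV mvar (mvar j) = j" for j by (rule inv_f_f[OF inj_mvar])
  have ec: "e m \<in> lifts (B K) w" if "m \<in> nz (Wpow n)" for m
    using e0c f(1)[of "mvar 0"] by (auto simp: e_def nz_W1)
  have bc: "beta K (Wpow n) w e \<in> lifts (B (K \<circ> T (Wpow n))) (K (zsec (Wpow n) M) \<cdot> w)"
    by (rule beta_carrier[OF w ob_Wpow ec])
  have "beta K (Wpow n) w e = y"
  proof (rule wide_pb_eq[OF pw])
    have "beta K wunit w (\<lambda>_. e 0) = beta K wunit w e0"
      by (rule beta_cong[OF w ob_wunit]) (use e0(1) in \<open>auto simp: nz_wunit e_def\<close>)
    then show "K (Tn (waug (Wpow n)) tE) \<cdot> beta K (Wpow n) w e = K (Tn (waug (Wpow n)) tE) \<cdot> y"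
      using beta_waug[OF w ob_Wpow, of n e] ec e0(2) by simp
    fix j assume j: "j < n"
    have "beta K W1 w (\<lambda>m. if m = 0 then e 0 else e (mvar j)) = beta K W1 w (f j)"
      by (rule beta_cong[OF w ob_Wpow]) (use f(1)[of _ j] eq0[of j] e0c in \<open>auto simp: nz_W1 e_def im\<close>)
    then show "K (Tn (Wproj n j) tE) \<cdot> beta K (Wpow n) w e = K (Tn (Wproj n j) tE) \<cdot> y"
      using beta_Wproj[OF w j, of e] ec f(2) by (simp only:)
  qed (use fibmD[OF bc] fibmD[OF y] hom_weilD[OF AU] E fo_comp[OF O(2) endo_Tar obE(1), of "Wpow n"] in auto)
  then show "\<exists>e. (\<forall>m\<in>nz (Wpow n). e m \<in> lifts (B K) w) \<and> beta K (Wpow n) w e = y" using ec by blast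
next
  fix w e e' m assume w: "over K w" and e: "\<And>m. m \<in> nz (Wpow n) \<Longrightarrow> e m \<in> lifts (B K) w"
    "\<And>m. m \<in> nz (Wpow n) \<Longrightarrow> e' m \<in> lifts (B K) w" and eq: "beta K (Wpow n) w e = beta K (Wpow n) w e'"
    and m: "m \<in> nz (Wpow n)"
  have c0: "e 0 \<in> lifts (B K) w" "e' 0 \<in> lifts (B K) w" using e by simp_all
  from m consider "m = 0" | j where "m = mvar j" "j < n" by (auto simp: nz_Wpow)
  then show "e m = e' m"
  proof cases
    case 1
    have "beta K wunit w (\<lambda>_. e 0) = beta K wunit w (\<lambda>_. e' 0)"
      using beta_waug[OF w ob_Wpow, of n e] beta_waug[OF w ob_Wpow, of n e'] e eq by simp
    then show ?thesis using betabij_unique[OF betabij_wunit[OF K] w, of "\<lambda>_. e 0" "\<lambda>_. e' 0" 0] c0 1 by simp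
  next
    case (2 j)
    have "beta K W1 w (\<lambda>m. if m = 0 then e 0 else e (mvar j)) = beta K W1 w (\<lambda>m. if m = 0 then e' 0 else e' (mvar j))"
      using beta_Wproj[OF w 2(2), of e] beta_Wproj[OF w 2(2), of e'] e eq by (simp only:)
    moreover have "e (mvar j) \<in> lifts (B K) w" "e' (mvar j) \<in> lifts (B K) w" using e 2 by (simp_all add: nz_Wpow)
    ultimately show ?thesis
      using betabij_unique[OF betabij_W1[OF K] w, of "\<lambda>m. if m = 0 then e 0 else e (mvar j)" "\<lambda>m. if m = 0 then e' 0 else e' (mvar j)" "mvar 0"] c0 2
      by (simp add: nz_W1)
  qed
qed

text \<open>
  Coordinates exist first over \<open>K T\<^sub>A\<close> for the second factor, and then over \<open>K\<close> for each of these.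
\<close>

lemma betabij_wten:
  assumes A: "weil_ob A" and A': "weil_ob A'" and K: "actlike K"
    and b: "betabij K A" and b': "betabij (K \<circ> T A) A'"
  shows "betabij K (wten A A')"
proof -
  let ?AA = "wten A A'" let ?K = "K \<circ> T A"
  have aK: "actlike ?K" by (rule actlike_comp[OF K A])
  note E = endo_simps[OF actlike_endo[OF K]]
  have nt: "nt X (?K \<circ> T A') (K \<circ> T ?AA) (\<lambda>x. K (multA X A A' x))"
    using nt_left[OF nt_mult[OF A A'] actlike_endo[OF K]] by (simp add: o_assoc)
  have ab: "is_bundle (B (?K \<circ> T A'))" "is_bundle (B (K \<circ> T ?AA))"
    using abB[OF actlike_comp[OF aK A']] abB[OF actlike_comp[OF K ob_wten[OF A A']]] by auto
  have mor: "bundle_mor (B (?K \<circ> T A')) (B (K \<circ> T ?AA)) (K (multA X A A' tE)) (K (multA X A A' M))"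
    by (rule nt_bundle_mor[OF nt abE ab])
  have iso: "is_iso X (K (multA X A A' tE))" "is_iso X (K (multA X A A' M))"
    using endo_iso[OF actlike_endo[OF K]] multA(4)[OF A A'] by simp_all
  have inj: "inj_on (\<lambda>(m, m'). mten A m m') (nz A \<times> nz A')" and img: "(\<lambda>(m, m'). mten A m m') ` (nz A \<times> nz A') = nz ?AA"
    using nz_wten[OF A A'] by (simp_all add: bij_betw_def)
  show ?thesis
  proof (rule betabijI)
    fix w y assume w: "over K w" and y: "y \<in> lifts (B (K \<circ> T ?AA)) (K (zsec ?AA M) \<cdot> w)"
    note O = overD[OF w] and z = over_zsec[OF w A]
    let ?w = "K (zsec A M) \<cdot> w"
    note zz = over_zsec[OF z(1) A']
    have base: "K (multA X A A' M) \<cdot> (?K (zsec A' M) \<cdot> ?w) = K (zsec ?AA M) \<cdot> w"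
    proof -
      note m\<mu> = multA[OF A A' obE(2)]
      have "K (multA X A A' M \<cdot> (T A (zsec A' M) \<cdot> zsec A M)) = K (multA X A A' M) \<cdot> (K (T A (zsec A' M)) \<cdot> K (zsec A M))"
        using E(4)[of "zsec A M" "T A (zsec A' M)"] E(4)[of "T A (zsec A' M) \<cdot> zsec A M" "multA X A A' M"] A A' m\<mu> by simp
      then have "K (zsec ?AA M) \<cdot> w = (K (multA X A A' M) \<cdot> (K (T A (zsec A' M)) \<cdot> K (zsec A M))) \<cdot> w"
        using zsec_mult[OF A A' obE(2)] by simp
      also have "\<dots> = K (multA X A A' M) \<cdot> (?K (zsec A' M) \<cdot> ?w)" using E A A' m\<mu> O by simp
      finally show ?thesis ..
    qed
    note i = bundle_mor_iso_carrier[OF ab mor iso overD(3,5)[OF zz(1)] y[folded base]]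
    obtain f where f: "\<And>m. m \<in> nz A' \<Longrightarrow> f m \<in> lifts (B ?K) ?w"
      "beta ?K A' ?w f = inv_arrow X (K (multA X A A' tE)) \<cdot> y"
      using betabij_ex[OF b' z(1) i(1)] by blast
    have "\<forall>m'\<in>nz A'. \<exists>e. (\<forall>m\<in>nz A. e m \<in> lifts (B K) w) \<and> beta K A w e = f m'"
      using betabij_ex[OF b w f(1)] by metis
    then obtain g where g: "\<And>m m'. m \<in> nz A \<Longrightarrow> m' \<in> nz A' \<Longrightarrow> g m' m \<in> lifts (B K) w"
      "\<And>m'. m' \<in> nz A' \<Longrightarrow> beta K A w (g m') = f m'" by metis
    \<comment> \<open>Every basis monomial of the tensor product splits uniquely.\<close>
    define e where "e x = (case inv_into (nz A \<times> nz A') (\<lambda>(m, m'). mten A m m') x of (m, m') \<Rightarrow> g m' m)" for x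
    have eg: "e (mten A m m') = g m' m" if "m \<in> nz A" "m' \<in> nz A'" for m m'
      using inv_into_f_f[OF inj, of "(m, m')"] that by (simp add: e_def)
    have ec: "e x \<in> lifts (B K) w" if "x \<in> nz ?AA" for x
      using that eg g(1) unfolding img[symmetric] by auto
    have "beta K ?AA w e = K (multA X A A' tE) \<cdot> beta ?K A' ?w (\<lambda>m'. beta K A w (\<lambda>m. e (mten A m m')))"
      by (rule beta_tensor[OF w A A' ec, symmetric])
    also have "beta ?K A' ?w (\<lambda>m'. beta K A w (\<lambda>m. e (mten A m m'))) = beta ?K A' ?w f"
    proof (rule beta_cong[OF z(1) A', symmetric, OF f(1)])
      fix m' assume m': "m' \<in> nz A'"
      have "beta K A w (\<lambda>m. e (mten A m m')) = beta K A w (g m')"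
        by (rule beta_cong[OF w A, symmetric, OF g(1)[OF _ m']]) (use eg m' in auto)
      then show "f m' = beta K A w (\<lambda>m. e (mten A m m'))" using g(2)[OF m'] by simp
    qed
    finally have "beta K ?AA w e = y" unfolding f(2) i(2) .
    then show "\<exists>e. (\<forall>m\<in>nz ?AA. e m \<in> lifts (B K) w) \<and> beta K ?AA w e = y" using ec by blast
  next
    fix w e e' x assume w: "over K w" and e: "\<And>m. m \<in> nz ?AA \<Longrightarrow> e m \<in> lifts (B K) w"
      "\<And>m. m \<in> nz ?AA \<Longrightarrow> e' m \<in> lifts (B K) w" and eq: "beta K ?AA w e = beta K ?AA w e'" and x: "x \<in> nz ?AA"
    note z = over_zsec[OF w A]
    let ?w = "K (zsec A M) \<cdot> w"
    let ?in = "\<lambda>e m'. beta K A w (\<lambda>m. e (mten A m m'))"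
    have c: "e (mten A m m') \<in> lifts (B K) w" "e' (mten A m m') \<in> lifts (B K) w"
      if "m \<in> nz A" "m' \<in> nz A'" for m m' using e nz_wten_add[OF A A' that] by auto
    have ic: "?in e m' \<in> lifts (B ?K) ?w" "?in e' m' \<in> lifts (B ?K) ?w" if "m' \<in> nz A'" for m'
      by (rule beta_carrier[OF w A]; use c that in blast)+
    note oc = fibmD[OF beta_carrier[OF z(1) A' ic(1)]] fibmD[OF beta_carrier[OF z(1) A' ic(2)]]
    have "K (multA X A A' tE) \<cdot> beta ?K A' ?w (?in e) = K (multA X A A' tE) \<cdot> beta ?K A' ?w (?in e')"
      using beta_tensor[OF w A A', of e] beta_tensor[OF w A A', of e'] e eq by (simp only:)
    then have bb: "beta ?K A' ?w (?in e) = beta ?K A' ?w (?in e')"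
      by (rule iso_mono[OF iso(1), rotated -1]) (use oc bundle_morD(2)[OF mor] in auto)
    have i: "?in e m' = ?in e' m'" if "m' \<in> nz A'" for m'
      by (rule betabij_unique[where e="?in e" and e'="?in e'" and m=m', OF b' z(1)]) (use bb ic that in auto)
    obtain m m' where m: "m \<in> nz A" "m' \<in> nz A'" "x = mten A m m'" using x unfolding img[symmetric] by auto
    show "e x = e' x"
      using betabij_unique[OF b w, of "\<lambda>m. e (mten A m m')" "\<lambda>m. e' (mten A m m')" m] c m i by simp
  qed
qed

lemma betabij_Wword: "actlike K \<Longrightarrow> betabij K (Wword ks)"
proof (induction ks arbitrary: K)
  case (Cons k ks)
  show ?case unfolding Wword.simps
    by (rule betabij_wten[OF ob_Wpow ob_Wword Cons.prems betabij_Wpow[OF Cons.prems] Cons.IH[OF actlike_comp[OF Cons.prems ob_Wpow]]])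
qed (simp add: betabij_wunit)

theorem betabij: assumes A: "weil_ob A" and K: "actlike K" shows "betabij K A"
proof -
  obtain ks \<phi> where \<phi>: "\<phi> \<in> Hom weil A (Wword ks)" "is_iso weil \<phi>" using iso_Wword[OF A] by blast
  let ?W = "Wword ks"
  have Wo: "weil_ob ?W" by simp
  note W = betabij_Wword[OF K, of ks] and E = endo_simps[OF actlike_endo[OF K]]
  obtain g where g: "wlift A ?W g" "\<phi> = weil_map A ?W g" using \<phi>(1) by (rule hom_weilE)
  have "inv_arrow weil \<phi> \<in> Hom weil ?W A" using \<phi> hom_weilD[OF \<phi>(1)] by (simp add: weil.Hom_iff)
  then obtain h where h: "wlift ?W A h" "inv_arrow weil \<phi> = weil_map ?W A h" by (rule hom_weilE)
  have id: "weil_map ?W A h \<cdot>\<^bsub>weil\<^esub> weil_map A ?W g = Idn weil A"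
    using weil.inv_arrow_simps(4)[OF \<phi>(2)] hom_weilD[OF \<phi>(1)] g h by simp
  have mat: "(\<Sum>k\<in>nz ?W. lookup (subst h (pmon k)) m' * lookup (subst g (pmon m)) k) = (if m = m' then 1 else 0)"
    if m: "m \<in> nz A" "m' \<in> nz A" for m m'
  proof -
    have pm: "pmon m \<in> polys A" using m by (auto simp: nz_def npolys_pmon)
    have "wcls A (subst h (subst g (pmon m))) = wcls A (pmon m)"
      using weil_map(2)[OF wlift_comp[OF g(1) h(1)] pm] id weil_map_comp[OF g(1) h(1)] weil_map(2)[OF wlift_id[OF A] pm]
      by (simp add: Idn_weil[OF A] subst_subst)
    then have "(subst h (subst g (pmon m)), pmon m) \<in> wcong A"
      using wcls_eq_iff[OF A] wlift_subst(1)[OF h(1) wlift_subst(1)[OF g(1) pm]] pm by simp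
    then have "lookup (subst h (subst g (pmon m))) m' = (if m = m' then 1 else 0)"
      using m by (simp add: wcong_iff[OF A] lookup_pmon)
    then show ?thesis using lookup_subst_eq_sum[OF h(1) wlift_subst(1)[OF g(1) pm] m(2)] by (simp add: mult.commute)
  qed
  show ?thesis
  proof (rule betabijI)
    fix w y assume w: "over K w" and y: "y \<in> lifts (B (K \<circ> T A)) (K (zsec A M) \<cdot> w)"
    obtain e where e: "\<And>m. m \<in> nz ?W \<Longrightarrow> e m \<in> lifts (B K) w" "beta K ?W w e = K (Tn \<phi> tE) \<cdot> y"
      using betabij_ex[OF W w K_Tnt_carrier[OF w \<phi>(1) y]] by blast
    let ?e = "\<lambda>m. lincomb (fib (B K) w) (nz ?W) (\<lambda>k. lookup (subst h (pmon k)) m) e"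
    have "beta K A w ?e = K (Tn (weil_map ?W A h) tE) \<cdot> (K (Tn \<phi> tE) \<cdot> y)"
      using beta_natural[OF w h(1), of e] e by (simp only:)
    also have "\<dots> = Idn X (fo X K (actO X A tE)) \<cdot> y"
    proof (rule comp_extend1)
      note HD = hom_weilD[OF \<phi>(1)] hom_weilD[OF weil_map(1)[OF h(1)]]
      have "Tn (weil_map ?W A h) tE \<cdot> Tn \<phi> tE = Idn X (actO X A tE)"
        using Tnt_comp[of \<phi> "weil_map ?W A h" tE] HD id g A by (simp add: Tnt_Idn)
      then show "K (Tn (weil_map ?W A h) tE) \<cdot> K (Tn \<phi> tE) = Idn X (fo X K (actO X A tE))"
        using E(4)[of "Tn \<phi> tE" "Tn (weil_map ?W A h) tE"] HD A E(5)[of "actO X A tE"] by simp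
    qed (use E hom_weilD[OF \<phi>(1)] hom_weilD[OF weil_map(1)[OF h(1)]] fibmD[OF y] fo_comp[OF actlike_endo[OF K] endo_Tar[OF A] obE(1)] in auto)
    also have "\<dots> = y" using fibmD[OF y] fo_comp[OF actlike_endo[OF K] endo_Tar[OF A] obE(1)] fo_Tar[OF A obE(1)] by simp
    finally show "\<exists>e. (\<forall>m\<in>nz A. e m \<in> lifts (B K) w) \<and> beta K A w e = y"
      by (intro exI[of _ ?e] conjI ballI) (rule comm_monoid.lincomb_closed[OF cm_over[OF w]], rule e(1))
  next
    fix w e e' m assume w: "over K w" and e: "\<And>m. m \<in> nz A \<Longrightarrow> e m \<in> lifts (B K) w"
      "\<And>m. m \<in> nz A \<Longrightarrow> e' m \<in> lifts (B K) w" and eq: "beta K A w e = beta K A w e'" and m: "m \<in> nz A"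
    interpret G: comm_monoid "fib (B K) w" by (rule cm_over[OF w])
    \<comment> \<open>The matrix of the isomorphism preserves coordinates, and the inverse matrix recovers them.\<close>
    let ?P = "\<lambda>e k. lincomb (fib (B K) w) (nz A) (\<lambda>m. lookup (subst g (pmon m)) k) e"
    have PP: "?P e k = ?P e' k" if "k \<in> nz ?W" for k
    proof (rule betabij_unique[OF W w _ _ _ that])
      show "beta K ?W w (?P e) = beta K ?W w (?P e')"
        using beta_natural[OF w g(1), of e] beta_natural[OF w g(1), of e'] e eq by (simp only:)
    qed (use G.lincomb_closed e in blast)+
    have rec: "lincomb (fib (B K) w) (nz ?W) (\<lambda>k. lookup (subst h (pmon k)) m) (?P e) = e m"
      if e: "\<And>m. m \<in> nz A \<Longrightarrow> e m \<in> lifts (B K) w" for e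
    proof -
      have "lincomb (fib (B K) w) (nz ?W) (\<lambda>k. lookup (subst h (pmon k)) m) (?P e) =
        lincomb (fib (B K) w) (nz A) (\<lambda>j. \<Sum>k\<in>nz ?W. lookup (subst h (pmon k)) m * lookup (subst g (pmon j)) k) e"
        by (rule G.lincomb_lincomb[OF finite_nz[OF Wo] finite_nz[OF A] e])
      also have "\<dots> = e m"
        by (rule G.lincomb_delta) (use e m mat finite_nz[OF A] in auto)
      finally show ?thesis .
    qed
    have "lincomb (fib (B K) w) (nz ?W) (\<lambda>k. lookup (subst h (pmon k)) m) (?P e) =
      lincomb (fib (B K) w) (nz ?W) (\<lambda>k. lookup (subst h (pmon k)) m) (?P e')"
      by (rule G.lincomb_cong) (use PP G.lincomb_closed e in auto)
    then show "e m = e' m" using rec[of e] rec[of e'] e by (simp only:)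
  qed
qed

end

section \<open>Biproducts of powers of a bundle\<close>

context cat begin

lemma tup_one:
  assumes b: "is_bundle b" and v: "arr v" "cod v = bbase b" and e: "e 0 \<in> lifts b v"
  shows "tup C b (Suc 0) v e = e 0"
proof -
  note D = bundleD[OF b]
  have e': "\<And>i. i < Suc 0 \<Longrightarrow> e i \<in> lifts b v" using e by simp
  note t = tup[where n="Suc 0" and e=e, OF b v e']
  have "cod (tup C b (Suc 0) v e) = btot b" using t(3) D(2) D(12) by (simp add: bpowO_def)
  then show ?thesis using t(1) t(5)[of 0] D(13) by simp
qed

lemma nt_tup:
  assumes n: "nt C F G \<phi>" and b: "is_bundle b" and F: "is_bundle (bmap C F b)" and G: "is_bundle (bmap C G b)"
    and v: "arr v" "cod v = fo C F (bbase b)" and e: "\<And>i. i < n \<Longrightarrow> e i \<in> lifts (bmap C F b) v"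
  shows "\<phi> (bpowO C b n) \<cdot> tup C (bmap C F b) n v e = tup C (bmap C G b) n (\<phi> (bbase b) \<cdot> v) (\<lambda>i. \<phi> (btot b) \<cdot> e i)"
proof (rule tup_unique[OF G])
  note N = ntD[OF n] and D = bundleD[OF b]
  have v': "cod v = bbase (bmap C F b)" using v by simp
  let ?t = "tup C (bmap C F b) n v e"
  have t: "arr ?t" "dom ?t = dom v" "cod ?t = bpowO C (bmap C F b) n" "bpow (bmap C F b) n \<cdot> ?t = v"
    "\<And>i. i < n \<Longrightarrow> bprj (bmap C F b) n i \<cdot> ?t = e i"
    using tup[OF F v(1) v', of n e] e by auto
  have P: "bpowO C b n \<in> Ob C" using D(15)[of n] D(16)[of n] Dom_Ob by metis
  have tc: "cod ?t = fo C F (bpowO C b n)" using t(3) bpowO_bmap[OF b N(1)] by simp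
  have B: "bbase b \<in> Ob C" "btot b \<in> Ob C" using D(1,2,3) Dom_Ob Cod_Ob by metis+
  show "\<phi> (bpowO C b n) \<cdot> ?t \<in> Ar C" "cod (\<phi> (bpowO C b n) \<cdot> ?t) = bpowO C (bmap C G b) n"
    using t(1) tc N(3-5)[OF P] bpowO_bmap[OF b N(2)] by simp_all
  have "bpow (bmap C G b) n \<cdot> (\<phi> (bpowO C b n) \<cdot> ?t) = \<phi> (bbase b) \<cdot> (F (bpow b n) \<cdot> ?t)"
  proof (rule comp_extend)
    show "bpow (bmap C G b) n \<cdot> \<phi> (bpowO C b n) = \<phi> (bbase b) \<cdot> F (bpow b n)"
      using N(6)[of "bpow b n"] D(15-17)[of n] by simp
  qed (use t(1) tc N(3-5)[OF P] N(3-5)[OF B(1)] D(15-17)[of n] endo_simps[OF N(1)] endo_simps[OF N(2)] in auto)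
  then show "bpow (bmap C G b) n \<cdot> (\<phi> (bpowO C b n) \<cdot> ?t) = \<phi> (bbase b) \<cdot> v" using t(4) by simp
  fix i assume i: "i < n"
  have "bprj (bmap C G b) n i \<cdot> (\<phi> (bpowO C b n) \<cdot> ?t) = \<phi> (btot b) \<cdot> (F (bprj b n i) \<cdot> ?t)"
  proof (rule comp_extend)
    show "bprj (bmap C G b) n i \<cdot> \<phi> (bpowO C b n) = \<phi> (btot b) \<cdot> F (bprj b n i)"
      using N(6)[of "bprj b n i"] D(18-20)[OF i] by simp
  qed (use t(1) tc N(3-5)[OF P] N(3-5)[OF B(2)] D(18-20)[OF i] endo_simps[OF N(1)] endo_simps[OF N(2)] in auto)
  then show "bprj (bmap C G b) n i \<cdot> (\<phi> (bpowO C b n) \<cdot> ?t) = \<phi> (btot b) \<cdot> e i" using t(5)[OF i] by simp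
qed

lemma ind_ar_0:
  assumes b: "is_bundle b" and r: "dim_row r = 0"
  shows "ind_ar C b r = bpow b (dim_col r)"
proof -
  note I = ind_ar[OF b, where a=r] and D = bundleD[OF b]
  have "bpowO C b 0 = bbase b" unfolding bpowO_def D(11) using Cod_Ob[OF D(1)] D(3) by simp
  then have "cod (ind_ar C b r) = bbase b" using I(3) r by simp
  then show ?thesis using I(1,4) r D(11) by simp
qed

text \<open>
  The equations say that \<open>t\<close> and \<open>l\<close> are the projections of a biproduct. They are preserved by any
  functor on matrices, and an arrow into the bundle power of index \<open>m + n\<close> is a pair of arrows over the base.
\<close>

lemma is_pullback_ind_ar:
  fixes t l s\<^sub>1 s\<^sub>2 :: "nat mat"
  assumes b: "is_bundle b"
    and d: "t \<in> carrier_mat m p" "l \<in> carrier_mat n p" "s\<^sub>1 \<in> carrier_mat p m" "s\<^sub>2 \<in> carrier_mat p n"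
    "r \<in> carrier_mat 0 m" "r' \<in> carrier_mat 0 n"
    and ts: "t * s\<^sub>1 = 1\<^sub>m m" "t * s\<^sub>2 = 0\<^sub>m m n" "l * s\<^sub>1 = 0\<^sub>m n m" "l * s\<^sub>2 = 1\<^sub>m n" "s\<^sub>1 * t + s\<^sub>2 * l = 1\<^sub>m p"
  shows "is_pullback C (ind_ar C b t) (ind_ar C b l) (ind_ar C b r) (ind_ar C b r')"
proof -
  note D = bundleD[OF b] and I = ind_ar[OF b]
  let ?F = "ind_ar C b"
  have dims [simp]: "dim_row t = m" "dim_col t = p" "dim_row l = n" "dim_col l = p" "dim_row r = 0" "dim_col r = m"
    "dim_row r' = 0" "dim_col r' = n" "dim_row s\<^sub>1 = p" "dim_col s\<^sub>1 = m" "dim_row s\<^sub>2 = p" "dim_col s\<^sub>2 = n" using d by auto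
  \<comment> \<open>The projections stacked and the injections side by side are inverse matrices.\<close>
  define T where "T = mat (m + n) p (\<lambda>(i, j). if i < m then t $$ (i, j) else l $$ (i - m, j))"
  define S where "S = mat p (m + n) (\<lambda>(i, j). if j < m then s\<^sub>1 $$ (i, j) else s\<^sub>2 $$ (i, j - m))"
  have dT [simp]: "dim_row T = m + n" "dim_col T = p" "dim_row S = p" "dim_col S = m + n" by (simp_all add: T_def S_def)
  have prod_nth: "(a * a') $$ (i, j) = (\<Sum>k<dim_col a. a $$ (i, k) * a' $$ (k, j))"
    if "i < dim_row a" "j < dim_col a'" "dim_row a' = dim_col a" for a a' :: "nat mat" and i j
    using that by (auto simp: scalar_prod_def lessThan_atLeast0 intro!: sum.cong)
  have TS: "T * S = 1\<^sub>m (m + n)"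
  proof (rule eq_matI)
    fix i j assume "i < dim_row (1\<^sub>m (m + n) :: nat mat)" "j < dim_col (1\<^sub>m (m + n) :: nat mat)"
    then have ij: "i < m + n" "j < m + n" by auto
    have "(T * S) $$ (i, j) = (\<Sum>k<p. T $$ (i, k) * S $$ (k, j))" using ij by (subst prod_nth) auto
    also have "\<dots> = (if i < m then (if j < m then (t * s\<^sub>1) $$ (i, j) else (t * s\<^sub>2) $$ (i, j - m))
      else (if j < m then (l * s\<^sub>1) $$ (i - m, j) else (l * s\<^sub>2) $$ (i - m, j - m)))"
      using ij by (auto simp: prod_nth T_def S_def simp del: index_mult_mat)
    also have "\<dots> = 1\<^sub>m (m + n) $$ (i, j)" unfolding ts using ij by auto
    finally show "(T * S) $$ (i, j) = 1\<^sub>m (m + n) $$ (i, j)" .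
  qed auto
  have ST: "S * T = 1\<^sub>m p"
  proof (rule eq_matI)
    fix i j assume "i < dim_row (1\<^sub>m p :: nat mat)" "j < dim_col (1\<^sub>m p :: nat mat)"
    then have ij: "i < p" "j < p" by auto
    have "(S * T) $$ (i, j) = (\<Sum>k<m + n. S $$ (i, k) * T $$ (k, j))" using ij by (subst prod_nth) auto
    also have "\<dots> = (\<Sum>k<m. S $$ (i, k) * T $$ (k, j)) + (\<Sum>k<n. S $$ (i, m + k) * T $$ (m + k, j))"
      by (induction n) auto
    also have "\<dots> = (s\<^sub>1 * t) $$ (i, j) + (s\<^sub>2 * l) $$ (i, j)"
      using ij by (simp add: prod_nth T_def S_def del: index_mult_mat)
    also have "\<dots> = (s\<^sub>1 * t + s\<^sub>2 * l) $$ (i, j)" using ij by simp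
    finally show "(S * T) $$ (i, j) = 1\<^sub>m p $$ (i, j)" unfolding ts .
  qed auto
  have Tt: "bprj b (m + n) i \<cdot> ?F T = bprj b m i \<cdot> ?F t" if "i < m" for i
  proof -
    have "lincomb (fib b (bpow b p)) {..<p} (\<lambda>j. T $$ (i, j)) (bprj b p) = lincomb (fib b (bpow b p)) {..<p} (\<lambda>j. t $$ (i, j)) (bprj b p)"
      by (rule comm_monoid.lincomb_cong[OF comm_monoid_fibm[OF b D(15,17)]]) (use that bprj_carrier[OF b] in \<open>auto simp: T_def\<close>)
    then show ?thesis using I(5)[of i T] I(5)[of i t] that by simp
  qed
  have Tl: "bprj b (m + n) (m + i) \<cdot> ?F T = bprj b n i \<cdot> ?F l" if "i < n" for i
  proof -
    have "lincomb (fib b (bpow b p)) {..<p} (\<lambda>j. T $$ (m + i, j)) (bprj b p) = lincomb (fib b (bpow b p)) {..<p} (\<lambda>j. l $$ (i, j)) (bprj b p)"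
      by (rule comm_monoid.lincomb_cong[OF comm_monoid_fibm[OF b D(15,17)]]) (use that bprj_carrier[OF b] in \<open>auto simp: T_def\<close>)
    then show ?thesis using I(5)[of "m + i" T] I(5)[of i l] that by simp
  qed
  have FT: "?F T \<cdot> ?F S = Idn C (bpowO C b (m + n))" "?F S \<cdot> ?F T = Idn C (bpowO C b p)"
    using ind_ar_mult[OF b, of T S] ind_ar_mult[OF b, of S T] ind_ar_one[OF b] TS ST by simp_all
  note It = I(1-4)[of t, simplified] and Il = I(1-4)[of l, simplified] and IT = I(1-4)[of T, simplified] and IS = I(1-4)[of S, simplified]
  have prT: "bprj b m i \<cdot> (?F t \<cdot> h) = bprj b (m + n) i \<cdot> (?F T \<cdot> h)" if "i < m" "arr h" "cod h = bpowO C b p" for i h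
    by (rule comp_extend[OF Tt[symmetric]]) (use that D(18-20)[of i m] D(18-20)[of i "m + n"] It IT in auto)
  have prL: "bprj b n i \<cdot> (?F l \<cdot> h) = bprj b (m + n) (m + i) \<cdot> (?F T \<cdot> h)" if "i < n" "arr h" "cod h = bpowO C b p" for i h
    by (rule comp_extend[OF Tl[symmetric]]) (use that D(18-20)[of i n] D(18-20)[of "m + i" "m + n"] Il IT in auto)
  have pw: "bpow b m \<cdot> (?F t \<cdot> h) = bpow b p \<cdot> h" "bpow b n \<cdot> (?F l \<cdot> h) = bpow b p \<cdot> h" "bpow b (m + n) \<cdot> (?F T \<cdot> h) = bpow b p \<cdot> h"
    if "arr h" "cod h = bpowO C b p" for h
    using comp_extend1[OF It(4)] comp_extend1[OF Il(4)] comp_extend1[OF IT(4)] that It Il IT D(15,16) by simp_all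
  have r: "?F r = bpow b m" "?F r' = bpow b n" using ind_ar_0[OF b] by simp_all
  show ?thesis unfolding r
  proof (rule is_pullbackI)
    fix f g assume f: "arr f" "cod f = dom (bpow b m)" and g: "arr g" "cod g = dom (bpow b n)"
      and fg: "dom f = dom g" "bpow b m \<cdot> f = bpow b n \<cdot> g"
    let ?v = "bpow b m \<cdot> f" and ?e = "\<lambda>i. if i < m then bprj b m i \<cdot> f else bprj b n (i - m) \<cdot> g"
    have v: "arr ?v" "cod ?v = bbase b" "dom ?v = dom f" using f D by auto
    have f': "cod f = bpowO C b m" and g': "cod g = bpowO C b n" using f g D by auto
    have e: "?e i \<in> lifts b ?v" if "i < m + n" for i
      using lift_carrier[OF b f(1) f' HOL.refl, of i] lift_carrier[OF b g(1) g' fg(2)[symmetric], of "i - m"] that by auto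
    let ?k = "tup C b (m + n) ?v ?e" and ?h = "?F S \<cdot> tup C b (m + n) ?v ?e"
    have k: "arr ?k" "dom ?k = dom f" "cod ?k = bpowO C b (m + n)" "bpow b (m + n) \<cdot> ?k = ?v"
      "\<And>i. i < m + n \<Longrightarrow> bprj b (m + n) i \<cdot> ?k = ?e i"
      using tup[OF b v(1,2), of "m + n" ?e] e v(3) by auto
    have h: "arr ?h" "dom ?h = dom f" "cod ?h = bpowO C b p" using k IS by auto
    have Th: "?F T \<cdot> ?h = ?k" using comp_extend1[OF FT(1)] k IS IT by simp
    have bh: "bpow b p \<cdot> ?h = ?v" using pw(3)[OF h(1,3)] Th k(4) by simp
    have "?F t \<cdot> ?h = f"
    proof (rule bundle_eqI[OF b])
      show "bprj b m i \<cdot> (?F t \<cdot> ?h) = bprj b m i \<cdot> f" if "i < m" for i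
        unfolding prT[OF that h(1,3)] Th using k(5)[of i] that by simp
      show "bpow b m \<cdot> (?F t \<cdot> ?h) = bpow b m \<cdot> f" unfolding pw(1)[OF h(1,3)] bh ..
    qed (use h It f f' in auto)
    moreover have "?F l \<cdot> ?h = g"
    proof (rule bundle_eqI[OF b])
      show "bprj b n i \<cdot> (?F l \<cdot> ?h) = bprj b n i \<cdot> g" if "i < n" for i
        unfolding prL[OF that h(1,3)] Th using k(5)[of "m + i"] that by simp
      show "bpow b n \<cdot> (?F l \<cdot> ?h) = bpow b n \<cdot> g" unfolding pw(2)[OF h(1,3)] bh by (rule fg(2))
    qed (use h Il g g' fg in auto)
    ultimately show "\<exists>h. arr h \<and> dom h = dom g \<and> cod h = dom (?F t) \<and> ?F t \<cdot> h = f \<and> ?F l \<cdot> h = g"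
      using h fg It by (intro exI[of _ ?h]) simp
  next
    fix h h' assume h: "arr h" "cod h = dom (?F t)" and h': "arr h'" "cod h' = dom (?F t)" and hh: "dom h = dom h'"
      and eq: "?F t \<cdot> h = ?F t \<cdot> h'" "?F l \<cdot> h = ?F l \<cdot> h'"
    have c: "cod h = bpowO C b p" "cod h' = bpowO C b p" using h h' It by auto
    have "?F T \<cdot> h = ?F T \<cdot> h'"
    proof (rule bundle_eqI[OF b])
      have "bpow b p \<cdot> h = bpow b p \<cdot> h'" using pw(1)[OF h(1) c(1)] pw(1)[OF h'(1) c(2)] eq by simp
      then show "bpow b (m + n) \<cdot> (?F T \<cdot> h) = bpow b (m + n) \<cdot> (?F T \<cdot> h')" unfolding pw(3)[OF h(1) c(1)] pw(3)[OF h'(1) c(2)] .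
      fix i assume i: "i < m + n"
      show "bprj b (m + n) i \<cdot> (?F T \<cdot> h) = bprj b (m + n) i \<cdot> (?F T \<cdot> h')"
      proof (cases "i < m")
        case True
        then show ?thesis using prT[OF True h(1) c(1)] prT[OF True h'(1) c(2)] eq by simp
      next
        case False
        then obtain j where j: "i = m + j" "j < n" using i by (metis add_less_cancel_left le_Suc_ex not_less)
        show ?thesis using prL[OF j(2) h(1) c(1)] prL[OF j(2) h'(1) c(2)] eq j by simp
      qed
    qed (use h h' c hh IT in auto)
    then have "?F S \<cdot> (?F T \<cdot> h) = ?F S \<cdot> (?F T \<cdot> h')" by simp
    moreover have "?F S \<cdot> (?F T \<cdot> k) = k" if "arr k" "cod k = bpowO C b p" for k
      by (subst comp_extend1[OF FT(2)]) (use that IT IS in auto)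
    ultimately show "h = h'" using h h' c by metis
  qed (use It Il D in auto)
qed

end

section \<open>The category of matrices\<close>

lemma Nbul_simps [simp]: "Ob Nbul = UNIV" "Ar Nbul = UNIV" "Dom Nbul f = dim_col f" "Cod Nbul f = dim_row f" "Idn Nbul k = 1\<^sub>m k"
  "f \<cdot>\<^bsub>Nbul\<^esub> g = f * g" "actO Nbul A k = wdim A * k" "actA Nbul = nat_actA" "unitA Nbul k = 1\<^sub>m k" "multA Nbul = nat_mult"
  by (simp_all add: Nbul_def)

lemma Hom_Nbul [simp]: "f \<in> Hom Nbul m n \<longleftrightarrow> f \<in> carrier_mat n m"
  by (auto simp: Hom_def)

lemma category_Nbul: "category Nbul"
  unfolding category_def
proof (intro conjI allI ballI)
  fix w x y z f g h assume "f \<in> Hom Nbul w x" "g \<in> Hom Nbul x y" "h \<in> Hom Nbul y z"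
  then show "h \<cdot>\<^bsub>Nbul\<^esub> g \<cdot>\<^bsub>Nbul\<^esub> f = h \<cdot>\<^bsub>Nbul\<^esub> (g \<cdot>\<^bsub>Nbul\<^esub> f)"
    unfolding Nbul_simps Hom_Nbul by (metis assoc_mult_mat)
qed simp_all

lemma terminal_Nbul: "is_terminal Nbul n \<longleftrightarrow> n = 0"
proof
  assume t: "is_terminal Nbul n"
  have "\<exists>!f. f \<in> Hom Nbul 1 n" using t unfolding is_terminal_def by simp
  then have "\<exists>!f. f \<in> (carrier_mat n 1 :: nat mat set)" unfolding Hom_Nbul .
  then have "mat n 1 (\<lambda>_. 0::nat) = mat n 1 (\<lambda>_. 1)" by (blast intro: mat_carrier)
  show "n = 0"
  proof (rule ccontr)
    assume "n \<noteq> 0"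
    then have "mat n 1 (\<lambda>_. 0::nat) $$ (0, 0) = 0" "mat n 1 (\<lambda>_. 1::nat) $$ (0, 0) = 1" by simp_all
    then show False using \<open>mat n 1 (\<lambda>_. 0::nat) = mat n 1 (\<lambda>_. 1)\<close> by simp
  qed
next
  assume "n = 0"
  then show "is_terminal Nbul n"
    unfolding is_terminal_def by (auto intro!: ex1I[of _ "0\<^sub>m 0 _"] eq_matI)
qed

text \<open>
  The universal property for the identity and zero matrices gives the injections. The last equation
  holds because both sides have the same composites with the projections.
\<close>

lemma pullback_Nbul:
  assumes pb: "is_pullback Nbul t l r b" and r: "dim_row r = 0"
  obtains s\<^sub>1 s\<^sub>2 where "s\<^sub>1 \<in> carrier_mat (dim_col t) (dim_row t)" "s\<^sub>2 \<in> carrier_mat (dim_col t) (dim_row l)"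
    "t * s\<^sub>1 = 1\<^sub>m (dim_row t)" "t * s\<^sub>2 = 0\<^sub>m (dim_row t) (dim_row l)" "l * s\<^sub>1 = 0\<^sub>m (dim_row l) (dim_row t)" "l * s\<^sub>2 = 1\<^sub>m (dim_row l)"
    "s\<^sub>1 * t + s\<^sub>2 * l = 1\<^sub>m (dim_col t)"
proof -
  let ?m = "dim_row t" and ?n = "dim_row l" and ?p = "dim_col t"
  have d: "dim_col l = ?p" "dim_col r = ?m" "dim_col b = ?n" "dim_row b = 0"
    using pb r unfolding is_pullback_def by auto
  have c: "t \<in> carrier_mat ?m ?p" "l \<in> carrier_mat ?n ?p" using d by auto
  have U: "\<exists>!h. h \<in> carrier_mat ?p z \<and> t * h = f \<and> l * h = g" if "f \<in> carrier_mat ?m z" "g \<in> carrier_mat ?n z" for f g z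
  proof -
    have rb: "r * f = b * g" by (rule eq_matI) (use r d that in auto)
    have P: "\<forall>z. \<forall>f\<in>Hom Nbul z (dim_col r). \<forall>g\<in>Hom Nbul z (dim_col b). r * f = b * g \<longrightarrow>
        (\<exists>!h. h \<in> Hom Nbul z (dim_col t) \<and> t * h = f \<and> l * h = g)"
      using pb unfolding is_pullback_def Nbul_simps by (elim conjE)
    have f: "f \<in> Hom Nbul z (dim_col r)" "g \<in> Hom Nbul z (dim_col b)" using that d by simp_all
    show ?thesis using P[rule_format, OF f rb] unfolding Hom_Nbul .
  qed
  obtain s\<^sub>1 where s1: "s\<^sub>1 \<in> carrier_mat ?p ?m" "t * s\<^sub>1 = 1\<^sub>m ?m" "l * s\<^sub>1 = 0\<^sub>m ?n ?m"
    using ex1_implies_ex[OF U[OF one_carrier_mat zero_carrier_mat]] by blast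
  obtain s\<^sub>2 where s2: "s\<^sub>2 \<in> carrier_mat ?p ?n" "t * s\<^sub>2 = 0\<^sub>m ?m ?n" "l * s\<^sub>2 = 1\<^sub>m ?n"
    using ex1_implies_ex[OF U[OF zero_carrier_mat one_carrier_mat]] by blast
  have st: "s\<^sub>1 * t \<in> carrier_mat ?p ?p" "s\<^sub>2 * l \<in> carrier_mat ?p ?p" by (rule mult_carrier_mat[OF s1(1) c(1)], rule mult_carrier_mat[OF s2(1) c(2)])
  have dist: "a * (s\<^sub>1 * t + s\<^sub>2 * l) = (a * s\<^sub>1) * t + (a * s\<^sub>2) * l" if "a \<in> carrier_mat k ?p" for a k
    using mult_add_distrib_mat[OF that st] assoc_mult_mat[OF that s1(1) c(1)] assoc_mult_mat[OF that s2(1) c(2)] by metis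
  have "t * (s\<^sub>1 * t + s\<^sub>2 * l) = 1\<^sub>m ?m * t + 0\<^sub>m ?m ?n * l" using dist[OF c(1)] s1 s2 by metis
  also have "\<dots> = t + 0\<^sub>m ?m ?p" using left_mult_one_mat[OF c(1)] left_mult_zero_mat[OF c(2)] by metis
  also have "\<dots> = t" by (rule right_add_zero_mat[OF c(1)])
  finally have 1: "t * (s\<^sub>1 * t + s\<^sub>2 * l) = t" .
  have "l * (s\<^sub>1 * t + s\<^sub>2 * l) = 0\<^sub>m ?n ?m * t + 1\<^sub>m ?n * l" using dist[OF c(2)] s1 s2 by metis
  also have "\<dots> = 0\<^sub>m ?n ?p + l" using left_mult_one_mat[OF c(2)] left_mult_zero_mat[OF c(1)] by metis
  also have "\<dots> = l" by (rule left_add_zero_mat[OF c(2)])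
  finally have 2: "l * (s\<^sub>1 * t + s\<^sub>2 * l) = l" .
  have "\<exists>!h. h \<in> carrier_mat ?p ?p \<and> t * h = t \<and> l * h = l" by (rule U[OF c])
  then have "s\<^sub>1 * t + s\<^sub>2 * l = 1\<^sub>m ?p"
    using 1 2 st c by (metis add_carrier_mat one_carrier_mat right_mult_one_mat)
  then show ?thesis using that s1 s2 by blast
qed

lemma permutation_matrix:
  assumes \<pi>: "bij_betw \<pi> {..<N} {..<N}"
  shows "mat N N (\<lambda>(i, c). if i = \<pi> c then 1 else 0) * mat N N (\<lambda>(c, i). if i = \<pi> c then 1 else 0) = (1\<^sub>m N :: nat mat)" (is "?P * ?Q = _")
    "mat N N (\<lambda>(c, i). if i = \<pi> c then 1 else 0) * mat N N (\<lambda>(i, c). if i = \<pi> c then 1 else 0) = (1\<^sub>m N :: nat mat)"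
proof -
  show "?P * ?Q = 1\<^sub>m N"
  proof (rule eq_matI)
    fix i j assume "i < dim_row (1\<^sub>m N :: nat mat)" "j < dim_col (1\<^sub>m N :: nat mat)"
    then have ij: "i < N" "j < N" by auto
    obtain c where c: "c < N" "\<pi> c = i" using \<pi> ij(1) unfolding bij_betw_def by (metis imageE lessThan_iff)
    have u: "i = \<pi> k \<longleftrightarrow> k = c" if "k < N" for k using \<pi> that c unfolding bij_betw_def inj_on_def by auto
    have "(?P * ?Q) $$ (i, j) = (\<Sum>k<N. (if i = \<pi> k then 1 else 0) * (if j = \<pi> k then 1 else 0))"
      using ij by (auto simp: scalar_prod_def lessThan_atLeast0 intro!: sum.cong)
    also have "\<dots> = (\<Sum>k<N. if k = c then (if j = \<pi> k then 1 else 0) else 0)" by (rule sum.cong) (use u in auto)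
    also have "\<dots> = 1\<^sub>m N $$ (i, j)" using c ij by simp
    finally show "(?P * ?Q) $$ (i, j) = 1\<^sub>m N $$ (i, j)" .
  qed auto
  show "?Q * ?P = 1\<^sub>m N"
  proof (rule eq_matI)
    fix i j assume "i < dim_row (1\<^sub>m N :: nat mat)" "j < dim_col (1\<^sub>m N :: nat mat)"
    then have ij: "i < N" "j < N" by auto
    have u: "\<pi> i = \<pi> j \<longleftrightarrow> i = j" "\<pi> i < N" using \<pi> ij unfolding bij_betw_def inj_on_def by auto
    have "(?Q * ?P) $$ (i, j) = (\<Sum>k<N. (if k = \<pi> i then 1 else 0) * (if k = \<pi> j then 1 else 0))"
      using ij by (auto simp: scalar_prod_def lessThan_atLeast0 intro!: sum.cong)
    also have "\<dots> = (\<Sum>k<N. if k = \<pi> i then (if k = \<pi> j then 1 else 0) else 0)" by (rule sum.cong) auto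
    also have "\<dots> = 1\<^sub>m N $$ (i, j)" using u ij by simp
    finally show "(?Q * ?P) $$ (i, j) = 1\<^sub>m N $$ (i, j)" .
  qed auto
qed

lemma block_index: "p < (d::nat) \<Longrightarrow> q < l \<Longrightarrow> p * l + q < d * l"
  by (metis add.commute add_less_cancel_left less_le_trans mult.commute mult_Suc mult_le_mono2 Suc_leI)

lemma wdim_wten: assumes "weil_ob A" "weil_ob B" shows "wdim (wten A B) = wdim A * wdim B"
  using bij_betw_same_card[OF nz_wten[OF assms]] wbasis(3)[OF assms(1)] wbasis(3)[OF assms(2)] wbasis(3)[OF ob_wten[OF assms]]
  by (simp add: card_cartesian_product)

text \<open>
  Re-bracketing a tensor product only permutes the basis vectors. The inverse occurs in
  the definition of the components at tensor products.
\<close>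

lemma nat_mult_iso:
  assumes A: "weil_ob A" and B: "weil_ob B"
  shows "inverse_arrows Nbul (nat_mult A B k) (inv_arrow Nbul (nat_mult A B k))"
    and "dim_row (nat_mult A B k) = wdim (wten A B) * k" "dim_col (nat_mult A B k) = wdim A * (wdim B * k)"
proof -
  show d: "dim_row (nat_mult A B k) = wdim (wten A B) * k" "dim_col (nat_mult A B k) = wdim A * (wdim B * k)"
    by (simp_all add: nat_mult_def)
  let ?N = "wdim A * (wdim B * k)" and ?AB = "wten A B"
  have N: "wdim ?AB * k = ?N" by (simp add: wdim_wten[OF A B])
  note AB = ob_wten[OF A B]
  \<comment> \<open>The position of the basis vector \<open>ab \<otimes> e\<close> if \<open>c\<close> is the position of \<open>a \<otimes> (b \<otimes> e)\<close>.\<close>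
  define \<pi> where "\<pi> c = wpos ?AB (wbasis A ! (c div (wdim B * k)) + mshift (fst A) (wbasis B ! (c mod (wdim B * k) div k))) * k + c mod k" for c
  have c: "c div (wdim B * k) < wdim A" "c mod (wdim B * k) div k < wdim B" "c mod k < k" "0 < k" if "c < ?N" for c
  proof -
    have z: "0 < wdim B * k" "0 < k" using that by (auto intro: gr0I)
    show "c div (wdim B * k) < wdim A" using that by (simp add: less_mult_imp_div_less)
    show "c mod (wdim B * k) div k < wdim B" using z by (simp add: less_mult_imp_div_less)
    show "c mod k < k" "0 < k" using z by auto
  qed
  have nzc: "wbasis A ! (c div (wdim B * k)) + mshift (fst A) (wbasis B ! (c mod (wdim B * k) div k)) \<in> nz ?AB" if "c < ?N" for c
    by (rule nz_wten_add[OF A B wbasis_nth_nz[OF A] wbasis_nth_nz[OF B]]) (use c[OF that] in auto)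
  have dm: "\<pi> c div k = wpos ?AB (wbasis A ! (c div (wdim B * k)) + mshift (fst A) (wbasis B ! (c mod (wdim B * k) div k)))"
    "\<pi> c mod k = c mod k" if "c < ?N" for c using c[OF that] by (simp_all add: \<pi>_def)
  have \<pi>N: "\<pi> c < ?N" if "c < ?N" for c
    unfolding N[symmetric] \<pi>_def by (rule block_index) (use wpos(1)[OF AB nzc[OF that]] c[OF that] in auto)
  have eqv: "wbasis ?AB ! (i div k) = wbasis A ! (c div (wdim B * k)) + mshift (fst A) (wbasis B ! (c mod (wdim B * k) div k))
      \<and> i mod k = c mod k \<longleftrightarrow> i = \<pi> c" if i: "i < ?N" and cN: "c < ?N" for i c
  proof
    assume h: "wbasis ?AB ! (i div k) = wbasis A ! (c div (wdim B * k)) + mshift (fst A) (wbasis B ! (c mod (wdim B * k) div k)) \<and> i mod k = c mod k"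
    have "i div k < wdim ?AB" using i N by (metis less_mult_imp_div_less)
    then have "wpos ?AB (wbasis ?AB ! (i div k)) = i div k" by (rule wpos_nth[OF AB])
    then have "\<pi> c = i div k * k + i mod k" using h by (simp add: \<pi>_def)
    then show "i = \<pi> c" by simp
  qed (use dm[OF cN] wpos(2)[OF AB nzc[OF cN]] in simp)
  have inj: "inj_on \<pi> {..<?N}"
  proof (rule inj_onI)
    fix c c' assume cc: "c \<in> {..<?N}" "c' \<in> {..<?N}" "\<pi> c = \<pi> c'"
    then have N': "c < ?N" "c' < ?N" by auto
    note x = c[OF N'(1)] c[OF N'(2)]
    have "wbasis A ! (c div (wdim B * k)) + mshift (fst A) (wbasis B ! (c mod (wdim B * k) div k)) =
      wbasis A ! (c' div (wdim B * k)) + mshift (fst A) (wbasis B ! (c' mod (wdim B * k) div k))"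
      using cc(3) dm(1)[OF N'(1)] dm(1)[OF N'(2)] wpos(2)[OF AB nzc[OF N'(1)]] wpos(2)[OF AB nzc[OF N'(2)]] by metis
    then have "wbasis A ! (c div (wdim B * k)) = wbasis A ! (c' div (wdim B * k)) \<and> wbasis B ! (c mod (wdim B * k) div k) = wbasis B ! (c' mod (wdim B * k) div k)"
      using nz_wten[OF A B] wbasis_nth_nz[OF A x(1)] wbasis_nth_nz[OF A x(5)] wbasis_nth_nz[OF B x(2)] wbasis_nth_nz[OF B x(6)]
      unfolding bij_betw_def inj_on_def by fastforce
    then have 1: "c div (wdim B * k) = c' div (wdim B * k)" "c mod (wdim B * k) div k = c' mod (wdim B * k) div k"
      using wpos_nth[OF A x(1)] wpos_nth[OF A x(5)] wpos_nth[OF B x(2)] wpos_nth[OF B x(6)] by metis+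
    have 2: "c mod k = c' mod k" using cc(3) dm(2)[OF N'(1)] dm(2)[OF N'(2)] by simp
    have "c mod (wdim B * k) mod k = c mod k" "c' mod (wdim B * k) mod k = c' mod k" by (simp_all add: mod_mult2_eq mult.commute)
    then have "c mod (wdim B * k) = c' mod (wdim B * k)" using 1(2) 2 by (metis div_mult_mod_eq)
    then show "c = c'" using 1(1) by (metis div_mult_mod_eq)
  qed
  have bij: "bij_betw \<pi> {..<?N} {..<?N}"
    unfolding bij_betw_def using inj endo_inj_surj[OF _ _ inj] \<pi>N by auto
  have m: "nat_mult A B k = mat ?N ?N (\<lambda>(i, c). if i = \<pi> c then 1 else 0)"
    unfolding nat_mult_def N by (rule eq_matI) (auto simp: eqv)
  have "inverse_arrows Nbul (nat_mult A B k) (mat ?N ?N (\<lambda>(c, i). if i = \<pi> c then 1 else 0))"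
    unfolding inverse_arrows_def using permutation_matrix[OF bij] by (auto simp: m)
  then show "inverse_arrows Nbul (nat_mult A B k) (inv_arrow Nbul (nat_mult A B k))"
    using cat.inv_arrow_eq[OF cat.intro[OF category_Nbul]] by metis
qed

context comm_monoid begin

text \<open>
  The coordinates of \<open>A \<otimes> \<nat>\<^sup>l\<close> come in blocks of length \<open>l\<close>, one for each basis monomial of \<open>A\<close>.
\<close>

lemma lincomb_blocks:
  fixes d l :: nat
  assumes h: "bij_betw h {..<d} S" and pos: "\<And>p. p < d \<Longrightarrow> pos (h p) = p" and e: "\<And>i. i < d * l \<Longrightarrow> e i \<in> carrier G"
  shows "lincomb G {..<d * l} (\<lambda>c. b (h (c div l)) * a (c mod l)) e = lincomb G S b (\<lambda>m. lincomb G {..<l} a (\<lambda>j. e (pos m * l + j)))"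
proof -
  have ec: "e (p * l + q) \<in> carrier G" if "p < d" "q < l" for p q by (rule e[OF block_index[OF that]])
  have inner: "lincomb G {..<l} a (\<lambda>j. e (pos (h p) * l + j)) \<in> carrier G" if "p < d" for p
    by (rule lincomb_closed) (use ec pos that in auto)
  have "lincomb G {..<d * l} (\<lambda>c. b (h (c div l)) * a (c mod l)) e =
    finprod G (\<lambda>p. finprod G (\<lambda>q. e (p * l + q) [^] (b (h ((p * l + q) div l)) * a ((p * l + q) mod l))) {..<l}) {..<d}"
    unfolding lincomb_def by (rule finprod_lessThan_mult) (use e in auto)
  also have "\<dots> = finprod G (\<lambda>p. lincomb G {..<l} a (\<lambda>j. e (pos (h p) * l + j)) [^] b (h p)) {..<d}"
  proof (rule finprod_cong')
    fix p assume p: "p \<in> {..<d}"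
    have x: "b (h ((p * l + q) div l)) * a ((p * l + q) mod l) = a q * b (h p)" if "q < l" for q using that by (simp add: mult.commute)
    have "finprod G (\<lambda>q. e (p * l + q) [^] (b (h ((p * l + q) div l)) * a ((p * l + q) mod l))) {..<l} =
      finprod G (\<lambda>q. (e (p * l + q) [^] a q) [^] b (h p)) {..<l}"
      by (rule finprod_cong') (use ec p x in \<open>auto simp: nat_pow_pow mult.commute[of "b (h p)"]\<close>)
    also have "\<dots> = finprod G (\<lambda>q. e (p * l + q) [^] a q) {..<l} [^] b (h p)"
      by (rule finprod_pow[symmetric]) (use ec p in auto)
    finally show "finprod G (\<lambda>q. e (p * l + q) [^] (b (h ((p * l + q) div l)) * a ((p * l + q) mod l))) {..<l} =
      lincomb G {..<l} a (\<lambda>j. e (pos (h p) * l + j)) [^] b (h p)"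
      unfolding lincomb_def using pos p by simp
  qed (use inner in auto)
  also have "\<dots> = finprod G (\<lambda>m. lincomb G {..<l} a (\<lambda>j. e (pos m * l + j)) [^] b m) (h ` {..<d})"
    by (rule finprod_reindex[symmetric]) (use inner h in \<open>auto simp: bij_betw_def\<close>)
  also have "h ` {..<d} = S" using h by (simp add: bij_betw_def)
  finally show ?thesis unfolding lincomb_def .
qed

end

context dbundle begin

section \<open>The comparison maps in coordinates\<close>

text \<open>
  The image of the tuple \<open>e\<close> of elements under the component at \<open>A\<close>, with
  the numbering of coordinates used for \<open>A \<otimes> \<nat>\<^sup>l\<close>.
\<close>

definition bvec :: "('a \<Rightarrow> 'a) \<Rightarrow> wob \<Rightarrow> nat \<Rightarrow> 'a \<Rightarrow> (nat \<Rightarrow> 'a) \<Rightarrow> 'a" where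
  "bvec K A l w e = tup X (B (K \<circ> T A)) l (K (zsec A M) \<cdot> w) (\<lambda>j. beta K A w (\<lambda>m. e (wpos A m * l + j)))"

text \<open>The component at \<open>A\<close> itself, as the image of the universal tuple.\<close>

definition bet :: "wob \<Rightarrow> nat \<Rightarrow> 'a" where
  "bet A l = bvec id A l (bpow E (wdim A * l)) (bprj E (wdim A * l))"

lemma bvec_id: "bvec id A l v e = tup X (B (T A)) l (zsec A M \<cdot> v) (\<lambda>j. beta id A v (\<lambda>m. e (wpos A m * l + j)))"
  by (simp add: bvec_def)

lemma tup_bmap_id [simp]: "tup X (B id) n v e = tup X E n v e"
  by (simp add: tup_def fibre_tuple_def)

lemma powE_Ob: "bpowO X E l \<in> Ob X"
  using Dom_Ob[OF DE(15)[of l]] DE(16)[of l] by simp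

lemma over_id: "over id v \<longleftrightarrow> arr v \<and> cod v = M"
  by (simp add: over_def actlike_id fo_def)

lemma over_bpow: "over id (bpow E n)"
  using DE by (simp add: over_id)

lemma bvec_beta_carrier:
  assumes w: "over K w" and A: "weil_ob A" and e: "\<forall>i<wdim A * l. e i \<in> lifts (B K) w" and j: "j < l"
  shows "m \<in> nz A \<Longrightarrow> e (wpos A m * l + j) \<in> lifts (B K) w"
    "beta K A w (\<lambda>m. e (wpos A m * l + j)) \<in> lifts (B (K \<circ> T A)) (K (zsec A M) \<cdot> w)"
proof -
  show 1: "e (wpos A m * l + j) \<in> lifts (B K) w" if "m \<in> nz A" for m
    using e block_index[OF wpos(1)[OF A that] j] by blast
  show "beta K A w (\<lambda>m. e (wpos A m * l + j)) \<in> lifts (B (K \<circ> T A)) (K (zsec A M) \<cdot> w)"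
    by (rule beta_carrier[OF w A 1])
qed

lemma bvec:
  assumes w: "over K w" and A: "weil_ob A" and e: "\<forall>i<wdim A * l. e i \<in> lifts (B K) w"
  shows "bvec K A l w e \<in> Ar X" "dom (bvec K A l w e) = dom w" "cod (bvec K A l w e) = fo X K (actO X A (bpowO X E l))"
    "K (T A (bpow E l)) \<cdot> bvec K A l w e = K (zsec A M) \<cdot> w"
    "j < l \<Longrightarrow> K (T A (bprj E l j)) \<cdot> bvec K A l w e = beta K A w (\<lambda>m. e (wpos A m * l + j))"
proof -
  note z = over_zsec[OF w A]
  note P = powE_Ob[of l]
  have "fo X (K \<circ> T A) (bpowO X E l) = fo X K (actO X A (bpowO X E l))"
    using fo_comp[OF overD(2)[OF w] endo_Tar[OF A] P] fo_Tar[OF A P] by simp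
  note b = this bpowO_bmap[OF abE overD(2)[OF z(1)], of l]
  note t = tup[OF overD(6,3,5)[OF z(1)], of l "\<lambda>j. beta K A w (\<lambda>m. e (wpos A m * l + j))"]
  note c = bvec_beta_carrier(2)[OF w A e]
  show "bvec K A l w e \<in> Ar X" "dom (bvec K A l w e) = dom w" "cod (bvec K A l w e) = fo X K (actO X A (bpowO X E l))"
    "K (T A (bpow E l)) \<cdot> bvec K A l w e = K (zsec A M) \<cdot> w"
    "j < l \<Longrightarrow> K (T A (bprj E l j)) \<cdot> bvec K A l w e = beta K A w (\<lambda>m. e (wpos A m * l + j))"
    using t c b z(2) unfolding bvec_def by simp_all
qed

lemma bvec_cong:
  assumes w: "over K w" and A: "weil_ob A" and e: "\<forall>i<wdim A * l. e i \<in> lifts (B K) w"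
    and eq: "\<And>i. i < wdim A * l \<Longrightarrow> e i = e' i"
  shows "bvec K A l w e = bvec K A l w e'"
  unfolding bvec_def
proof (rule tup_cong[OF overD(6,3,5)[OF over_zsec(1)[OF w A]]])
  fix j assume j: "j < l"
  show "beta K A w (\<lambda>m. e (wpos A m * l + j)) \<in> lifts (B (K \<circ> T A)) (K (zsec A M) \<cdot> w)"
    by (rule bvec_beta_carrier(2)[OF w A e j])
  show "beta K A w (\<lambda>m. e (wpos A m * l + j)) = beta K A w (\<lambda>m. e' (wpos A m * l + j))"
    by (rule beta_cong[OF w A bvec_beta_carrier(1)[OF w A e j]]) (use eq block_index[OF wpos(1)[OF A] j] in auto)
qed

lemma bvec_comp:
  assumes w: "over K w" and A: "weil_ob A" and e: "\<forall>i<wdim A * l. e i \<in> lifts (B K) w"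
    and k: "arr k" "cod k = dom w"
  shows "bvec K A l w e \<cdot> k = bvec K A l (w \<cdot> k) (\<lambda>i. e i \<cdot> k)"
proof -
  note z = over_zsec[OF w A] and O = overD[OF w] and E = endo_simps[OF overD(2)[OF w]]
  note c = bvec_beta_carrier[OF w A e]
  have a: "(K (zsec A M) \<cdot> w) \<cdot> k = K (zsec A M) \<cdot> (w \<cdot> k)"
    by (rule comp_assoc) (use O k E A in auto)
  have "bvec K A l w e \<cdot> k = tup X (B (K \<circ> T A)) l (K (zsec A M) \<cdot> (w \<cdot> k)) (\<lambda>j. beta K A w (\<lambda>m. e (wpos A m * l + j)) \<cdot> k)"
    unfolding bvec_def a[symmetric] by (rule tup_comp[OF overD(6,3,5)[OF z(1)]]) (use c k z(2) in auto)
  also have "\<dots> = bvec K A l (w \<cdot> k) (\<lambda>i. e i \<cdot> k)"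
    unfolding bvec_def
  proof (rule tup_cong[OF overD(6,3,5)[OF over_zsec(1)[OF over_comp[OF w k] A]]])
    fix j assume j: "j < l"
    show "beta K A w (\<lambda>m. e (wpos A m * l + j)) \<cdot> k = beta K A (w \<cdot> k) (\<lambda>m. e (wpos A m * l + j) \<cdot> k)"
      by (rule beta_comp[OF w A c(1)[OF j] k])
    show "beta K A w (\<lambda>m. e (wpos A m * l + j)) \<cdot> k \<in> lifts (B (K \<circ> T A)) (K (zsec A M) \<cdot> (w \<cdot> k))"
      unfolding a[symmetric] by (rule carrier_comp[OF overD(6)[OF z(1)] c(2)[OF j] k(1)]) (use k z(2) in simp)
  qed
  finally show ?thesis .
qed

lemma K_over:
  assumes v: "over id v" and K: "actlike K" and A: "weil_ob A"
  shows "over K (K v)" "K (zsec A M \<cdot> v) = K (zsec A M) \<cdot> K v"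
  using v endo_simps[OF actlike_endo[OF K]] K A fo_id[OF obE(2)] by (auto simp: over_id over_def)

lemma K_beta:
  assumes v: "over id v" and K: "actlike K" and A: "weil_ob A" and e: "\<And>m. m \<in> nz A \<Longrightarrow> e m \<in> lifts E v"
  shows "K (beta id A v e) = beta K A (K v) (\<lambda>m. K (e m))"
proof -
  note E = endo_simps[OF actlike_endo[OF K]] and bb = bmap_bmap_E[OF actlike_endo[OF K] endo_Tar[OF A]]
  have vv: "arr v" "cod v = M" using v by (auto simp: over_id)
  note ov = K_over(1)[OF v K A] and z = K_over(2)[OF v K A]
  have ab: "is_bundle (B (K \<circ> T A))" by (rule abB[OF actlike_comp[OF K A]])
  have zv: "zsec A M \<cdot> v \<in> Ar X" "cod (zsec A M \<cdot> v) = bbase (B (T A))" using vv A by simp_all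
  have mm: "monoid_map (fib (B (T A)) (zsec A M \<cdot> v)) (fib (B (K \<circ> T A)) (K (zsec A M \<cdot> v))) K"
    using bmap_monoid_map[OF abT[OF A] actlike_endo[OF K] _ zv] ab unfolding bb by simp
  have t: "lam A m \<cdot> e m \<in> lifts (B (T A)) (zsec A M \<cdot> v)" if "m \<in> nz A" for m
    using beta_term[OF v A that] e[OF that] by simp
  have "K (beta id A v e) = finprod (fib (B (K \<circ> T A)) (K (zsec A M \<cdot> v))) (\<lambda>m. K (lam A m \<cdot> e m)) (nz A)"
    unfolding beta_def id_comp id_apply
    by (rule monoid_map_finprod[OF comm_monoid_fibm[OF abT[OF A] zv] comm_monoid_fibm[OF ab] mm]) (use t zv E A vv fo_comp[OF actlike_endo[OF K] endo_Tar[OF A] obE(2)] in auto)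
  also have "\<dots> = beta K A (K v) (\<lambda>m. K (e m))"
    unfolding beta_def z
  proof (rule comm_monoid.finprod_cong'[OF cm_over[OF over_zsec(1)[OF ov A]]])
    fix m assume m: "m \<in> nz A"
    show "K (lam A m \<cdot> e m) = K (lam A m) \<cdot> K (e m)" by (rule E(4)) (use fibmD[OF e[OF m]] A m in auto)
  next
    have "K (e m) \<in> lifts (B K) (K v)" if "m \<in> nz A" for m
      by (rule bmap_carrier[OF abE actlike_endo[OF K] abB[OF K] e[OF that]])
    then show "(\<lambda>m. K (lam A m) \<cdot> K (e m)) \<in> nz A \<rightarrow> lifts (B (K \<circ> T A)) (K (zsec A M) \<cdot> K v)"
      using beta_term[OF ov A] by auto
  qed simp
  finally show ?thesis .
qed

lemma bet_carrier: "\<forall>i<wdim A * l. bprj E (wdim A * l) i \<in> lifts (B id) (bpow E (wdim A * l))"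
  using bprj_carrier[OF abE] by simp

text \<open>
  Evaluation of a component on elements, also inside another action; the latter is needed for tensor products.
\<close>

lemma K_bet:
  assumes w: "over K w" and A: "weil_ob A" and e: "\<forall>i<wdim A * l. e i \<in> lifts (B K) w"
  shows "K (bet A l) \<cdot> tup X (B K) (wdim A * l) w e = bvec K A l w e"
proof -
  note O = overD[OF w] and E = endo_simps[OF overD(2)[OF w]] and bb = bmap_bmap_E[OF overD(2)[OF w] endo_Tar[OF A]]
  let ?n = "wdim A * l"
  let ?k = "tup X (B K) ?n w e"
  have k: "arr ?k" "dom ?k = dom w" "cod ?k = bpowO X (B K) ?n" "K (bpow E ?n) \<cdot> ?k = w"
    "\<And>i. i < ?n \<Longrightarrow> K (bprj E ?n i) \<cdot> ?k = e i"
    using tup[OF O(6,3,5), of ?n e] e by auto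
  note ov = K_over(1)[OF over_bpow O(1) A, of ?n]
  have zv: "zsec A M \<cdot> bpow E ?n \<in> Ar X" "cod (zsec A M \<cdot> bpow E ?n) = bbase (B (T A))" using DE A by simp_all
  have pc: "\<forall>i<?n. K (bprj E ?n i) \<in> lifts (B K) (K (bpow E ?n))"
    using bmap_carrier[OF abE O(2,6) bprj_carrier[OF abE]] by simp
  note bc = bvec_beta_carrier[OF over_bpow A bet_carrier, simplified]
  have b0: "bet A l = tup X (B (T A)) l (zsec A M \<cdot> bpow E ?n) (\<lambda>j. beta id A (bpow E ?n) (\<lambda>m. bprj E ?n (wpos A m * l + j)))"
    by (simp add: bet_def bvec_def)
  have "K (bet A l) = tup X (B (K \<circ> T A)) l (K (zsec A M \<cdot> bpow E ?n)) (\<lambda>j. K (beta id A (bpow E ?n) (\<lambda>m. bprj E ?n (wpos A m * l + j))))"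
    unfolding b0 bb[symmetric]
    by (rule bmap_tup[OF abT[OF A] O(2) _ zv]) (use bc overD(6)[OF over_zsec(1)[OF w A]] bb in auto)
  also have "\<dots> = bvec K A l (K (bpow E ?n)) (\<lambda>i. K (bprj E ?n i))"
  proof -
    have z: "K (zsec A M \<cdot> bpow E ?n) = K (zsec A M) \<cdot> K (bpow E ?n)" by (rule K_over(2)[OF over_bpow O(1) A])
    show ?thesis unfolding bvec_def z
    proof (rule tup_cong[OF overD(6,3,5)[OF over_zsec(1)[OF ov A]], symmetric])
      fix j assume j: "j < l"
      show "beta K A (K (bpow E ?n)) (\<lambda>m. K (bprj E ?n (wpos A m * l + j))) \<in> lifts (B (K \<circ> T A)) (K (zsec A M) \<cdot> K (bpow E ?n))"
        by (rule bvec_beta_carrier(2)[OF ov A pc j])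
      show "beta K A (K (bpow E ?n)) (\<lambda>m. K (bprj E ?n (wpos A m * l + j))) = K (beta id A (bpow E ?n) (\<lambda>m. bprj E ?n (wpos A m * l + j)))"
        by (rule K_beta[OF over_bpow O(1) A, symmetric]) (use bc(1) j in auto)
    qed
  qed
  finally have "K (bet A l) \<cdot> ?k = bvec K A l (K (bpow E ?n)) (\<lambda>i. K (bprj E ?n i)) \<cdot> ?k" by simp
  also have "\<dots> = bvec K A l w (\<lambda>i. K (bprj E ?n i) \<cdot> ?k)"
    using bvec_comp[OF ov A pc k(1)] k(3,4) bpowO_bmap[OF abE O(2), of ?n] E(2)[OF DE(15)[of ?n]] DE(16)[of ?n] by simp
  also have "\<dots> = bvec K A l w e" by (rule bvec_cong[OF w A e, symmetric]) (use k in auto)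
  finally show ?thesis .
qed

lemma block_div:
  fixes p q d :: nat assumes "q < d"
  shows "(p * d + q) div d = p" "(p * d + q) mod d = q"
  using assms by simp_all

lemma ind_ar_bvec:
  assumes v: "over id v" and A: "weil_ob A" and f: "f \<in> carrier_mat n l"
    and e: "\<forall>i<wdim A * l. e i \<in> lifts E v"
  shows "T A (FE f) \<cdot> bvec id A l v e =
    tup X (B (T A)) n (zsec A M \<cdot> v) (\<lambda>i. beta id A v (\<lambda>m. lincomb (fib E v) {..<l} (\<lambda>j. f $$ (i, j)) (\<lambda>j. e (wpos A m * l + j))))"
proof -
  note vv = v[unfolded over_id]
  have zv: "zsec A M \<cdot> v \<in> Ar X" "cod (zsec A M \<cdot> v) = bbase (B (T A))" using vv A by simp_all
  have e': "\<forall>i<wdim A * l. e i \<in> lifts (B id) v" using e by simp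
  note c = bvec_beta_carrier[OF v A e', simplified]
  have "T A (FE f) = ind_ar X (B (T A)) f" by (rule bmap_ind_ar[OF abE endo_Tar[OF A] abT[OF A]])
  moreover have "bvec id A l v e = tup X (B (T A)) (dim_col f) (zsec A M \<cdot> v) (\<lambda>j. beta id A v (\<lambda>m. e (wpos A m * l + j)))"
    using f by (simp add: bvec_def)
  moreover have "ind_ar X (B (T A)) f \<cdot> tup X (B (T A)) (dim_col f) (zsec A M \<cdot> v) (\<lambda>j. beta id A v (\<lambda>m. e (wpos A m * l + j))) =
     tup X (B (T A)) (dim_row f) (zsec A M \<cdot> v) (\<lambda>i. lincomb (fib (B (T A)) (zsec A M \<cdot> v)) {..<dim_col f} (\<lambda>j. f $$ (i, j)) (\<lambda>j. beta id A v (\<lambda>m. e (wpos A m * l + j))))"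
    by (rule ind_ar_tup[OF abT[OF A] zv]) (use c(2) f in auto)
  moreover have "tup X (B (T A)) n (zsec A M \<cdot> v) (\<lambda>i. lincomb (fib (B (T A)) (zsec A M \<cdot> v)) {..<l} (\<lambda>j. f $$ (i, j)) (\<lambda>j. beta id A v (\<lambda>m. e (wpos A m * l + j)))) =
     tup X (B (T A)) n (zsec A M \<cdot> v) (\<lambda>i. beta id A v (\<lambda>m. lincomb (fib E v) {..<l} (\<lambda>j. f $$ (i, j)) (\<lambda>j. e (wpos A m * l + j))))"
  proof (rule tup_cong[OF abT[OF A] zv])
    fix i assume "i < n"
    show "lincomb (fib (B (T A)) (zsec A M \<cdot> v)) {..<l} (\<lambda>j. f $$ (i, j)) (\<lambda>j. beta id A v (\<lambda>m. e (wpos A m * l + j))) \<in> lifts (B (T A)) (zsec A M \<cdot> v)"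
      by (rule lincomb_fibm(1)[OF abT[OF A] zv]) (use c(2) in auto)
    have "beta id A v (\<lambda>m. lincomb (fib (B id) v) {..<l} (\<lambda>j. f $$ (i, j)) (\<lambda>j. e (wpos A m * l + j))) =
      lincomb (fib (B (id \<circ> T A)) (id (zsec A M) \<cdot> v)) {..<l} (\<lambda>j. f $$ (i, j)) (\<lambda>j. beta id A v (\<lambda>m. e (wpos A m * l + j)))"
      by (rule beta_lincomb[OF v A]) (use c(1) in auto)
    then show "lincomb (fib (B (T A)) (zsec A M \<cdot> v)) {..<l} (\<lambda>j. f $$ (i, j)) (\<lambda>j. beta id A v (\<lambda>m. e (wpos A m * l + j))) =
      beta id A v (\<lambda>m. lincomb (fib E v) {..<l} (\<lambda>j. f $$ (i, j)) (\<lambda>j. e (wpos A m * l + j)))" by simp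
  qed
  ultimately show ?thesis using f by simp
qed

lemma nat_actA_dim:
  assumes "\<theta> \<in> Hom weil A A'"
  shows "dim_row (nat_actA \<theta> f) = wdim A' * dim_row f" "dim_col (nat_actA \<theta> f) = wdim A * dim_col f"
proof -
  have h: "\<theta> = (A, A', wapp \<theta>)" using assms by (simp add: Hom_weil)
  show "dim_row (nat_actA \<theta> f) = wdim A' * dim_row f" "dim_col (nat_actA \<theta> f) = wdim A * dim_col f"
    by (subst h, simp add: nat_actA_def)+
qed

lemma nat_actA_entry:
  assumes g: "wlift A A' g" and f: "f \<in> carrier_mat n l" and m': "m' \<in> nz A'" and i: "i < n" and c: "c < wdim A * l"
  shows "nat_actA (weil_map A A' g) f $$ (wpos A' m' * n + i, c) =
    lookup (subst g (pmon (wbasis A ! (c div l)))) m' * f $$ (i, c mod l)"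
proof -
  note AA = wliftD(1,2)[OF g]
  have p: "c div l < wdim A" using c by (simp add: less_mult_imp_div_less)
  then have pm: "pmon (wbasis A ! (c div l)) \<in> polys A" using wbasis_nth_nz[OF AA(1) p] by (auto simp: nz_def npolys_pmon)
  have h: "weil_map A A' g = (A, A', wapp (weil_map A A' g))" using weil_map(1)[OF g] by (simp add: Hom_weil)
  have "wcoeff (wapp (weil_map A A' g) (wcls A (pmon (wbasis A ! (c div l))))) m' = lookup (subst g (pmon (wbasis A ! (c div l)))) m'"
    unfolding weil_map(2)[OF g pm] by (rule wcoeff_wcls[OF AA(2) wlift_subst(1)[OF g pm] m'])
  moreover have "nat_actA (weil_map A A' g) f $$ (wpos A' m' * n + i, c) =
     wcoeff (wapp (weil_map A A' g) (wcls A (pmon (wbasis A ! (c div l))))) (wbasis A' ! ((wpos A' m' * n + i) div n)) * f $$ ((wpos A' m' * n + i) mod n, c mod l)"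
    by (subst h) (use f c block_index[OF wpos(1)[OF AA(2) m'] i] in \<open>simp add: nat_actA_def\<close>)
  ultimately show ?thesis using i wpos(2)[OF AA(2) m'] by simp
qed

text \<open>
  A matrix on the right factor acts linearly on each coordinate, a morphism of Weil algebras acts by its
  matrix, and the Kronecker product collects both into one linear combination.
\<close>

lemma bvec_natural:
  assumes v: "over id v" and g: "wlift A A' g" and f: "f \<in> carrier_mat n l"
    and e: "\<forall>i<wdim A * l. e i \<in> lifts E v"
  shows "bvec id A' n v (\<lambda>i. lincomb (fib E v) {..<wdim A * l} (\<lambda>c. nat_actA (weil_map A A' g) f $$ (i, c)) e) =
    actA X (weil_map A A' g) (FE f) \<cdot> bvec id A l v e"
proof -
  let ?\<theta> = "weil_map A A' g"
  note AA = wliftD(1,2)[OF g] and th = weil_map(1)[OF g] and H = hom_weilD[OF weil_map(1)[OF g]]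
  note I = ind_ar[OF abE, where a=f] and vv = v[unfolded over_id]
  interpret G: comm_monoid "fib E v" using cm_over[OF v] by simp
  have e': "\<forall>i<wdim A * l. e i \<in> lifts (B id) v" using e by simp
  note c = bvec_beta_carrier[OF v AA(1) e', simplified] and bv = bvec[OF v AA(1) e']
  have zv: "zsec A M \<cdot> v \<in> Ar X" "cod (zsec A M \<cdot> v) = fo X (T A) M" "cod (zsec A M \<cdot> v) = bbase (B (T A))"
    using vv AA by simp_all
  note P = powE_Ob
  let ?a = "\<lambda>i m. lincomb (fib E v) {..<l} (\<lambda>j. f $$ (i, j)) (\<lambda>j. e (wpos A m * l + j))"
  have ac: "?a i m \<in> lifts (B id) v" if "m \<in> nz A" for i m
    using G.lincomb_closed[of "{..<l}" "\<lambda>j. e (wpos A m * l + j)"] c(1) that by simp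
  have bc: "beta id A v (?a i) \<in> lifts (B (T A)) (zsec A M \<cdot> v)" for i
    using beta_carrier[OF v AA(1) ac] by simp
  have "actA X ?\<theta> (FE f) \<cdot> bvec id A l v e = Tn ?\<theta> (bpowO X E n) \<cdot> (T A (FE f) \<cdot> bvec id A l v e)"
  proof -
    have "actA X ?\<theta> (FE f) = Tn ?\<theta> (bpowO X E n) \<cdot> T A (FE f)"
      using actA_split(1)[OF H(1) I(1)] H(2) I(3) f by simp
    moreover have "cod (bvec id A l v e) = actO X A (bpowO X E l)" using bv(3) P fo_id AA by (simp add: actO_Ob)
    ultimately show ?thesis using bv(1) I f H P AA by simp
  qed
  also have "\<dots> = Tn ?\<theta> (bpowO X E n) \<cdot> tup X (B (T A)) n (zsec A M \<cdot> v) (\<lambda>i. beta id A v (?a i))"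
    unfolding ind_ar_bvec[OF v AA(1) f e] ..
  also have "\<dots> = tup X (B (T A')) n (Tn ?\<theta> M \<cdot> (zsec A M \<cdot> v)) (\<lambda>i. Tn ?\<theta> tE \<cdot> beta id A v (?a i))"
    by (rule nt_tup[OF nt_Tnt[OF th] abE abT[OF AA(1)] abT[OF AA(2)] zv(1,2)]) (rule bc)
  also have "Tn ?\<theta> M \<cdot> (zsec A M \<cdot> v) = zsec A' M \<cdot> v"
    by (rule comp_extend1[OF Tnt_zsec[OF th obE(2)]]) (use H vv AA in auto)
  also have "tup X (B (T A')) n (zsec A' M \<cdot> v) (\<lambda>i. Tn ?\<theta> tE \<cdot> beta id A v (?a i)) =
    bvec id A' n v (\<lambda>i. lincomb (fib E v) {..<wdim A * l} (\<lambda>c. nat_actA ?\<theta> f $$ (i, c)) e)"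
    unfolding bvec_id
  proof (rule tup_cong[OF abT[OF AA(2)]])
    show "zsec A' M \<cdot> v \<in> Ar X" "cod (zsec A' M \<cdot> v) = bbase (B (T A'))" using vv AA by simp_all
    fix i assume i: "i < n"
    show "Tn ?\<theta> tE \<cdot> beta id A v (?a i) \<in> lifts (B (T A')) (zsec A' M \<cdot> v)"
      using K_Tnt_carrier[OF v th, of "beta id A v (?a i)"] bc by simp
    have "Tn ?\<theta> tE \<cdot> beta id A v (?a i) = beta id A' v (\<lambda>m'. lincomb (fib E v) (nz A) (\<lambda>m. lookup (subst g (pmon m)) m') (?a i))"
      using beta_natural[OF v g, of "?a i"] ac by simp
    also have "\<dots> = beta id A' v (\<lambda>m'. lincomb (fib E v) {..<wdim A * l} (\<lambda>c. nat_actA ?\<theta> f $$ (wpos A' m' * n + i, c)) e)"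
    proof (rule beta_cong[OF v AA(2)])
      fix m' assume m': "m' \<in> nz A'"
      show "lincomb (fib E v) (nz A) (\<lambda>m. lookup (subst g (pmon m)) m') (?a i) \<in> lifts (B id) v"
        using G.lincomb_closed[of "nz A" "?a i"] ac by simp
      have "lincomb (fib E v) {..<wdim A * l} (\<lambda>c. nat_actA ?\<theta> f $$ (wpos A' m' * n + i, c)) e =
         lincomb (fib E v) {..<wdim A * l} (\<lambda>c. lookup (subst g (pmon (wbasis A ! (c div l)))) m' * f $$ (i, c mod l)) e"
        by (rule G.lincomb_cong) (use e nat_actA_entry[OF g f m' i] in auto)
      also have "\<dots> = lincomb (fib E v) (nz A) (\<lambda>m. lookup (subst g (pmon m)) m') (?a i)"
        by (rule G.lincomb_blocks[OF bij_betw_wbasis[OF AA(1)], where b="\<lambda>m. lookup (subst g (pmon m)) m'"])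
          (use wpos_nth[OF AA(1)] e in auto)
      finally show "lincomb (fib E v) (nz A) (\<lambda>m. lookup (subst g (pmon m)) m') (?a i) =
         lincomb (fib E v) {..<wdim A * l} (\<lambda>c. nat_actA ?\<theta> f $$ (wpos A' m' * n + i, c)) e" ..
    qed
    finally show "Tn ?\<theta> tE \<cdot> beta id A v (?a i) =
      beta id A' v (\<lambda>m'. lincomb (fib E v) {..<wdim A * l} (\<lambda>c. nat_actA ?\<theta> f $$ (wpos A' m' * n + i, c)) e)" .
  qed
  finally show ?thesis ..
qed

lemma bet_tup:
  assumes v: "over id v" and A: "weil_ob A" and e: "\<forall>i<wdim A * l. e i \<in> lifts E v"
  shows "bet A l \<cdot> tup X E (wdim A * l) v e = bvec id A l v e"
  using K_bet[OF v A, of l e] e by simp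

lemma bet:
  assumes A: "weil_ob A"
  shows "bet A l \<in> Ar X" "dom (bet A l) = bpowO X E (wdim A * l)" "cod (bet A l) = actO X A (bpowO X E l)"
    "T A (bpow E l) \<cdot> bet A l = zsec A M \<cdot> bpow E (wdim A * l)"
    "j < l \<Longrightarrow> T A (bprj E l j) \<cdot> bet A l = beta id A (bpow E (wdim A * l)) (\<lambda>m. bprj E (wdim A * l) (wpos A m * l + j))"
proof -
  note P = powE_Ob[of l]
  note b = bvec[OF over_bpow A bet_carrier, folded bet_def]
  show "bet A l \<in> Ar X" "dom (bet A l) = bpowO X E (wdim A * l)" "cod (bet A l) = actO X A (bpowO X E l)"
    "T A (bpow E l) \<cdot> bet A l = zsec A M \<cdot> bpow E (wdim A * l)"
    "j < l \<Longrightarrow> T A (bprj E l j) \<cdot> bet A l = beta id A (bpow E (wdim A * l)) (\<lambda>m. bprj E (wdim A * l) (wpos A m * l + j))"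
    using b DE fo_id[OF actO_Ob[OF A P]] by simp_all
qed

lemma bet_natural:
  assumes th: "\<theta> \<in> Hom weil A A'" and f: "f \<in> carrier_mat n l"
  shows "bet A' n \<cdot> FE (nat_actA \<theta> f) = actA X \<theta> (FE f) \<cdot> bet A l"
proof -
  obtain g where g: "wlift A A' g" "\<theta> = weil_map A A' g" using th by (rule hom_weilE)
  have d: "dim_row (nat_actA \<theta> f) = wdim A' * n" "dim_col (nat_actA \<theta> f) = wdim A * l"
    using nat_actA_dim[OF th, of f] f by simp_all
  have c: "lincomb (fib E (bpow E (wdim A * l))) {..<wdim A * l} (\<lambda>c. nat_actA \<theta> f $$ (i, c)) (bprj E (wdim A * l)) \<in> lifts E (bpow E (wdim A * l))" for i
    by (rule lincomb_fibm(1)[OF abE DE(15,17)]) (use bprj_carrier[OF abE] in auto)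
  have "bet A' n \<cdot> FE (nat_actA \<theta> f) = bvec id A' n (bpow E (wdim A * l))
     (\<lambda>i. lincomb (fib E (bpow E (wdim A * l))) {..<wdim A * l} (\<lambda>c. nat_actA \<theta> f $$ (i, c)) (bprj E (wdim A * l)))"
    unfolding ind_ar_eq_tup[OF abE] d
    by (rule bet_tup[OF over_bpow wliftD(2)[OF g(1)]]) (use c in auto)
  also have "\<dots> = actA X \<theta> (FE f) \<cdot> bet A l"
    unfolding g(2) bet_def by (rule bvec_natural[OF over_bpow g(1) f]) (use bprj_carrier[OF abE] in auto)
  finally show ?thesis .
qed

lemma bet_unit: "bet wunit l = unitA X (bpowO X E l)"
proof -
  have nzw: "wdim wunit = 1" using wbasis(3)[OF ob_wunit] by (simp add: nz_wunit)
  have p0: "wpos wunit 0 = 0" using wpos(1)[OF ob_wunit, of 0] nzw by simp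
  note P = powE_Ob[of l]
  have t: "tup X E l (bpow E l) (bprj E l) = Idn X (bpowO X E l)"
    by (rule tup_unique[OF abE, symmetric]) (use P DE in auto)
  have "unitA X (bpowO X E l) \<cdot> tup X (B id) l (bpow E l) (bprj E l) =
     tup X (B (T wunit)) l (unitA X M \<cdot> bpow E l) (\<lambda>i. unitA X tE \<cdot> bprj E l i)"
    by (rule nt_tup[OF nt_unit abE abB[OF actlike_id] abT[OF ob_wunit]]) (use DE fo_id[OF obE(2)] bprj_carrier[OF abE] in auto)
  also have "\<dots> = bet wunit l"
    unfolding bet_def bvec_id zsec_wunit[OF obE(2)] nzw mult_1
  proof (rule tup_cong[OF abT[OF ob_wunit]])
    show u: "unitA X M \<cdot> bpow E l \<in> Ar X" "cod (unitA X M \<cdot> bpow E l) = bbase (B (T wunit))" using DE unitA[OF obE(2)] by simp_all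
    fix j assume j: "j < l"
    have "beta id wunit (bpow E l) (\<lambda>m. bprj E l (wpos wunit m * l + j)) = unitA X tE \<cdot> bprj E l j"
      using beta_wunit[OF over_bpow[of l], of "\<lambda>m. bprj E l (wpos wunit m * l + j)"] bprj_carrier[OF abE j] p0 by simp
    then show "unitA X tE \<cdot> bprj E l j = beta id wunit (bpow E l) (\<lambda>m. bprj E l (wpos wunit m * l + j))" ..
    show "unitA X tE \<cdot> bprj E l j \<in> lifts (B (T wunit)) (unitA X M \<cdot> bpow E l)"
      using bundle_mor_carrier[OF abB[OF actlike_id] abT[OF ob_wunit], of "unitA X tE" "unitA X M" "bprj E l j" "bpow E l"]
        K_unit_mor(1)[OF actlike_id] bprj_carrier[OF abE j] by simp
  qed
  finally show ?thesis unfolding tup_bmap_id t using unitA[OF P] by simp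
qed

text \<open>
  The matrix of the structure isomorphism selects the coordinate with the product monomial, so this is
  \<open>beta_tensor\<close> in coordinates.
\<close>

lemma bet_mult:
  assumes A: "weil_ob A" and A': "weil_ob A'"
  shows "bet (wten A A') l \<cdot> FE (nat_mult A A' l) = multA X A A' (bpowO X E l) \<cdot> (T A (bet A' l) \<cdot> bet A (wdim A' * l))"
proof -
  let ?AA = "wten A A'" and ?d = "wdim A' * l"
  let ?N = "wdim A * ?d"
  let ?v = "bpow E ?N" and ?p = "bprj E ?N"
  note v = over_bpow[of ?N] and AA = ob_wten[OF A A']
  note vv = v[unfolded over_id]
  have dN: "dim_row (nat_mult A A' l) = wdim ?AA * l" "dim_col (nat_mult A A' l) = ?N" by (simp_all add: nat_mult_iso[OF A A'])
  interpret G: comm_monoid "fib E ?v" using cm_over[OF v] by simp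
  have pc: "?p i \<in> lifts E ?v" if "i < ?N" for i using bprj_carrier[OF abE that] .
  have pc': "\<forall>i<wdim A * ?d. ?p i \<in> lifts (B id) ?v" using pc by simp
  note c = bvec_beta_carrier[OF v A pc', simplified]
  let ?e = "\<lambda>i. lincomb (fib E ?v) {..<?N} (\<lambda>c. nat_mult A A' l $$ (i, c)) ?p"
  have ec: "?e i \<in> lifts E ?v" for i by (rule G.lincomb_closed) (use pc in auto)
  have ee: "?e (wpos ?AA (mten A m m') * l + j) = ?p (wpos A m * ?d + (wpos A' m' * l + j))"
    if m: "m \<in> nz A" "m' \<in> nz A'" and j: "j < l" for m m' j
  proof (rule G.lincomb_delta)
    note x = nz_wten_add[OF A A' m]
    have q: "wpos A' m' * l + j < ?d" by (rule block_index[OF wpos(1)[OF A' m(2)] j])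
    show kN: "wpos A m * ?d + (wpos A' m' * l + j) \<in> {..<?N}" using block_index[OF wpos(1)[OF A m(1)] q] by simp
    show "?p (wpos A m * ?d + (wpos A' m' * l + j)) \<in> lifts E ?v" using pc kN by simp
    show "\<And>i. i \<in> {..<?N} \<Longrightarrow> ?p i \<in> lifts E ?v" using pc by simp
    fix k assume "k \<in> {..<?N}"
    then have k: "k < ?N" by simp
    have z: "0 < ?d" "0 < l" using k by (auto intro: gr0I)
    have kd: "k div ?d < wdim A" "k mod ?d div l < wdim A'" using k z by (simp_all add: less_mult_imp_div_less)
    have r: "wpos ?AA (mten A m m') * l + j < wdim ?AA * l" by (rule block_index[OF wpos(1)[OF AA x] j])
    have "nat_mult A A' l $$ (wpos ?AA (mten A m m') * l + j, k) =
       (if mten A m m' = wbasis A ! (k div ?d) + mshift (fst A) (wbasis A' ! (k mod ?d div l)) \<and> j = k mod l then 1 else 0)"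
      unfolding nat_mult_def using r k j wpos(2)[OF AA x] by simp
    also have "mten A m m' = wbasis A ! (k div ?d) + mshift (fst A) (wbasis A' ! (k mod ?d div l)) \<longleftrightarrow>
       m = wbasis A ! (k div ?d) \<and> m' = wbasis A' ! (k mod ?d div l)"
      using nz_wten[OF A A'] m wbasis_nth_nz[OF A kd(1)] wbasis_nth_nz[OF A' kd(2)] unfolding bij_betw_def inj_on_def by fastforce
    also have "\<dots> \<longleftrightarrow> k div ?d = wpos A m \<and> k mod ?d div l = wpos A' m'"
      using wpos_nth[OF A kd(1)] wpos_nth[OF A' kd(2)] wpos(2)[OF A m(1)] wpos(2)[OF A' m(2)] by metis
    also have "k mod l = k mod ?d mod l" by (simp add: mod_mult2_eq mult.commute)
    also have "(if (k div ?d = wpos A m \<and> k mod ?d div l = wpos A' m') \<and> j = k mod ?d mod l then 1 else 0) =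
       (if k = wpos A m * ?d + (wpos A' m' * l + j) then 1 else (0::nat))"
    proof -
      have "k = wpos A m * ?d + (wpos A' m' * l + j)" if "k div ?d = wpos A m" "k mod ?d div l = wpos A' m'" "j = k mod ?d mod l"
        unfolding that(1,2)[symmetric] that(3) by (metis div_mult_mod_eq)
      moreover have "k div ?d = wpos A m" "k mod ?d div l = wpos A' m'" "j = k mod ?d mod l" if "k = wpos A m * ?d + (wpos A' m' * l + j)"
        unfolding that using block_div[OF q] block_div[OF j] by simp_all
      ultimately show ?thesis by auto
    qed
    finally show "nat_mult A A' l $$ (wpos ?AA (mten A m m') * l + j, k) = (if k = wpos A m * ?d + (wpos A' m' * l + j) then 1 else 0)" .
  qed simp
  let ?w = "zsec A M \<cdot> ?v"
  have w: "over (T A) ?w" using over_zsec(1)[OF v A] by simp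
  let ?f = "\<lambda>i. beta id A ?v (\<lambda>m. ?p (wpos A m * ?d + i))"
  have fc: "\<forall>i<wdim A' * l. ?f i \<in> lifts (B (T A)) ?w" using c(2) by simp
  have fc': "beta (T A) A' ?w (\<lambda>m'. ?f (wpos A' m' * l + j)) \<in> lifts (B (T A \<circ> T A')) (T A (zsec A' M) \<cdot> ?w)" if "j < l" for j
    by (rule bvec_beta_carrier(2)[OF w A' fc that])
  have ww: "over (T A \<circ> T A') (T A (zsec A' M) \<cdot> ?w)" by (rule over_zsec(1)[OF w A'])
  have b: "bet A ?d = tup X (B (T A)) ?d ?w ?f" by (simp add: bet_def bvec_def)
  have "multA X A A' (bpowO X E l) \<cdot> (T A (bet A' l) \<cdot> bet A ?d) = multA X A A' (bpowO X E l) \<cdot> bvec (T A) A' l ?w ?f"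
    unfolding b K_bet[OF w A' fc] ..
  also have "\<dots> = tup X (B (T ?AA)) l (multA X A A' M \<cdot> (T A (zsec A' M) \<cdot> ?w)) (\<lambda>j. multA X A A' tE \<cdot> beta (T A) A' ?w (\<lambda>m'. ?f (wpos A' m' * l + j)))"
    unfolding bvec_def
    by (rule nt_tup[OF nt_mult[OF A A'] abE overD(6)[OF ww] abT[OF AA] overD(3,4)[OF ww]]) (rule fc')
  also have base: "multA X A A' M \<cdot> (T A (zsec A' M) \<cdot> ?w) = zsec ?AA M \<cdot> ?v"
  proof -
    have "zsec ?AA M \<cdot> ?v = (multA X A A' M \<cdot> (T A (zsec A' M) \<cdot> zsec A M)) \<cdot> ?v" using zsec_mult[OF A A' obE(2)] by simp
    also have "\<dots> = multA X A A' M \<cdot> (T A (zsec A' M) \<cdot> ?w)" using vv A A' multA[OF A A' obE(2)] by simp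
    finally show ?thesis ..
  qed
  also have "tup X (B (T ?AA)) l (zsec ?AA M \<cdot> ?v) (\<lambda>j. multA X A A' tE \<cdot> beta (T A) A' ?w (\<lambda>m'. ?f (wpos A' m' * l + j))) =
     bvec id ?AA l ?v ?e"
    unfolding bvec_id
  proof (rule tup_cong[OF abT[OF AA], symmetric])
    show "zsec ?AA M \<cdot> ?v \<in> Ar X" "cod (zsec ?AA M \<cdot> ?v) = bbase (B (T ?AA))" using vv AA by simp_all
    fix j assume j: "j < l"
    have ec': "\<And>i. ?e i \<in> lifts (B id) ?v" using ec by simp
    show "beta id ?AA ?v (\<lambda>m. ?e (wpos ?AA m * l + j)) \<in> lifts (B (T ?AA)) (zsec ?AA M \<cdot> ?v)"
      using beta_carrier[OF v AA, of "\<lambda>m. ?e (wpos ?AA m * l + j)"] ec by simp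
    have "beta id ?AA ?v (\<lambda>m. ?e (wpos ?AA m * l + j)) = multA X A A' tE \<cdot> beta (T A) A' ?w (\<lambda>m'. beta id A ?v (\<lambda>m. ?e (wpos ?AA (mten A m m') * l + j)))"
      using beta_tensor[OF v A A', of "\<lambda>m. ?e (wpos ?AA m * l + j)"] ec by simp
    also have "beta (T A) A' ?w (\<lambda>m'. beta id A ?v (\<lambda>m. ?e (wpos ?AA (mten A m m') * l + j))) = beta (T A) A' ?w (\<lambda>m'. ?f (wpos A' m' * l + j))"
    proof (rule beta_cong[OF w A', symmetric, OF bvec_beta_carrier(1)[OF w A' fc j]])
      fix m' assume m': "m' \<in> nz A'"
      show "?f (wpos A' m' * l + j) = beta id A ?v (\<lambda>m. ?e (wpos ?AA (mten A m m') * l + j))"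
        by (rule beta_cong[OF v A, symmetric], rule ec', rule ee[OF _ m' j])
    qed
    finally show "beta id ?AA ?v (\<lambda>m. ?e (wpos ?AA m * l + j)) = multA X A A' tE \<cdot> beta (T A) A' ?w (\<lambda>m'. ?f (wpos A' m' * l + j))" .
  qed
  also have "\<dots> = bet ?AA l \<cdot> FE (nat_mult A A' l)"
    unfolding ind_ar_eq_tup[OF abE] dN by (rule bet_tup[OF v AA, symmetric]) (use ec in auto)
  finally show ?thesis ..
qed

end

context dbundle begin

section \<open>Identification with the defined components\<close>

text \<open>
  The two arguments are the coordinates at \<open>1\<close> and \<open>x\<close>; commutativity exchanges the summands.
\<close>

lemma alpha_W_pair:
  assumes v: "over id v" and a: "a \<in> lifts E v" and b: "b \<in> lifts E v"
  shows "alpha_W X E \<cdot> bpair X E a b = beta id W1 v (\<lambda>m. if m = 0 then a else b)"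
proof -
  have W: "weil_ob W1" by simp
  note vv = v[unfolded over_id] and o2 = over_bpow[of 2]
  let ?e = "\<lambda>m::monomial. if m = 0 then bprj E 2 0 else bprj E 2 1"
  have ec: "?e m \<in> lifts E (bpow E 2)" for m using bprj_carrier[OF abE, of 0 2] bprj_carrier[OF abE, of 1 2] by simp
  have zv: "zsec W1 M \<cdot> bpow E 2 \<in> Ar X" "cod (zsec W1 M \<cdot> bpow E 2) = bbase (B (T W1))" using DE by simp_all
  interpret H: comm_monoid "fib (B (T W1)) (zsec W1 M \<cdot> bpow E 2)" by (rule comm_monoid_fibm[OF abT[OF W] zv])
  have t: "zsec W1 tE \<cdot> bprj E 2 0 \<in> lifts (B (T W1)) (zsec W1 M \<cdot> bpow E 2)"
    "lft \<cdot> bprj E 2 1 \<in> lifts (B (T W1)) (zsec W1 M \<cdot> bpow E 2)"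
    using beta_term[OF o2 W, of 0 "bprj E 2 0"] beta_term[OF o2 W, of "mvar 0" "bprj E 2 1"] ec[of 0] ec[of "mvar 0"]
    by (simp_all add: nz_W1 lam_W1)
  have "alpha_W X E = fib_add X (B (T W1)) (zsec W1 tE \<cdot> bprj E 2 0) (lft \<cdot> bprj E 2 1)"
    by (simp add: alpha_W_def fib_add_def Tbundle_eq tan_zero_eq)
  also have "\<dots> = fib_add X (B (T W1)) (lft \<cdot> bprj E 2 1) (zsec W1 tE \<cdot> bprj E 2 0)"
    using H.m_comm[OF t] by simp
  also have "\<dots> = beta id W1 (bpow E 2) ?e"
    using beta_W1[OF o2, of ?e] ec[of 0] ec[of "mvar 0"] by simp
  finally have aW: "alpha_W X E = beta id W1 (bpow E 2) ?e" .
  have p: "bpair X E a b \<in> Ar X" "dom (bpair X E a b) = dom v" "cod (bpair X E a b) = bpowO X E 2"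
    "bpow E 2 \<cdot> bpair X E a b = v" "bprj E 2 0 \<cdot> bpair X E a b = a" "bprj E 2 (Suc 0) \<cdot> bpair X E a b = b"
    using bpair[OF abE _ _ a b] vv by auto
  have "alpha_W X E \<cdot> bpair X E a b = beta id W1 (bpow E 2 \<cdot> bpair X E a b) (\<lambda>m. ?e m \<cdot> bpair X E a b)"
    unfolding aW by (rule beta_comp[OF o2 W]) (use ec p DE in auto)
  also have "(\<lambda>m. ?e m \<cdot> bpair X E a b) = (\<lambda>m. if m = 0 then a else b)" using p by auto
  finally show ?thesis unfolding p .
qed

lemma wdim_Wpow: "wdim (Wpow k) = k + 1"
proof -
  have "nz (Wpow k) = insert 0 (mvar ` {..<k})" by (auto simp: nz_Wpow)
  moreover have "card (mvar ` {..<k}) = k" by (simp add: card_image inj_on_subset[OF inj_mvar])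
  moreover have "0 \<notin> mvar ` {..<k}" using mvar_neq_0 by (metis imageE)
  ultimately show ?thesis using wbasis(3)[OF ob_Wpow[of k]] by simp
qed

text \<open>The sum over monomials has the prescribed components, and those determine it.\<close>

lemma alpha_Wk_1: "alpha_Wk_1 X E k = bet (Wpow k) 1"
proof -
  let ?A = "Wpow k" and ?v = "bpow E (k + 1)"
  let ?\<rho> = "\<lambda>m. bprj E (k + 1) (wpos (Wpow k) m)"
  let ?h = "beta id ?A ?v ?\<rho>"
  have A: "weil_ob ?A" by simp
  note v = over_bpow[of "k + 1"] and d = wdim_Wpow[of k]
  have \<rho>: "?\<rho> m \<in> lifts (B id) ?v" if "m \<in> nz ?A" for m
    using bprj_carrier[OF abE] wpos(1)[OF A that] d by simp
  have zn: "0 \<in> nz ?A" "\<And>i. i < k \<Longrightarrow> mvar i \<in> nz ?A" by (simp_all add: nz_Wpow)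
  note AU = hom_weilD[OF waug_Hom[OF A]] and WP = hom_weilD[OF Wproj_Hom[of k]] and U = unitA[OF obE(1)]
  have hc: "?h \<in> lifts (B (T ?A)) (zsec ?A M \<cdot> ?v)" using beta_carrier[OF v A \<rho>] by simp
  have h: "arr ?h" "dom ?h = bpowO X E (k + 1)" "cod ?h = actO X ?A tE"
    using fibmD(1-3)[OF hc] DE by simp_all
  have haug: "Tn (waug ?A) tE \<cdot> ?h = unitA X tE \<cdot> ?\<rho> 0"
    using beta_waug[OF v A \<rho>] beta_wunit[OF v, of "\<lambda>_. ?\<rho> 0"] \<rho>[OF zn(1)] by simp
  have hpr: "Tn (Wproj k i) tE \<cdot> ?h = alpha_W X E \<cdot> bpair X E (?\<rho> 0) (?\<rho> (mvar i))" if "i < k" for i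
    using beta_Wproj[OF v that \<rho>] alpha_W_pair[OF v, of "?\<rho> 0" "?\<rho> (mvar i)"] \<rho>[OF zn(1)] \<rho>[OF zn(2)[OF that]] by simp
  have as: "(inv_arrow X (unitA X tE) \<cdot> Tn (waug ?A) tE) \<cdot> h = inv_arrow X (unitA X tE) \<cdot> (Tn (waug ?A) tE \<cdot> h)"
    if "arr h" "cod h = actO X ?A tE" for h
    by (rule comp_assoc) (use that AU U in auto)
  have r0: "?\<rho> 0 \<in> Ar X" "cod (?\<rho> 0) = tE" using fibmD[OF \<rho>[OF zn(1)]] by (simp_all add: fo_id)
  have c0: "inv_arrow X (unitA X tE) \<cdot> (unitA X tE \<cdot> ?\<rho> 0) = ?\<rho> 0"
    by (rule inv_arrow_cancel(1)[OF U(4) r0(1)]) (use r0 U in simp)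
  have "alpha_Wk_1 X E k = ?h"
    unfolding alpha_Wk_1_def Let_def
  proof (rule the_equality)
    show "?h \<in> Hom X (bpowO X E (k + 1)) (Tob X ?A tE) \<and>
       inv_arrow X (unitA X tE) \<cdot> Tn (waug ?A) tE \<cdot> ?h = ?\<rho> 0 \<and>
       (\<forall>i<k. Tn (Wproj k i) tE \<cdot> ?h = alpha_W X E \<cdot> bpair X E (?\<rho> 0) (?\<rho> (mvar i)))"
      using h hpr unfolding as[OF h(1,3)] haug Hom_iff c0 by simp
  next
    fix h' assume h': "h' \<in> Hom X (bpowO X E (k + 1)) (Tob X ?A tE) \<and>
       inv_arrow X (unitA X tE) \<cdot> Tn (waug ?A) tE \<cdot> h' = ?\<rho> 0 \<and>
       (\<forall>i<k. Tn (Wproj k i) tE \<cdot> h' = alpha_W X E \<cdot> bpair X E (?\<rho> 0) (?\<rho> (mvar i)))"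
    have hh: "arr h'" "dom h' = bpowO X E (k + 1)" "cod h' = actO X ?A tE" using h' by (auto simp: Hom_iff)
    have i: "inv_arrow X (unitA X tE) \<cdot> (Tn (waug ?A) tE \<cdot> h') = ?\<rho> 0" using h' as[OF hh(1,3)] by metis
    have "Tn (waug ?A) tE \<cdot> h' = unitA X tE \<cdot> (inv_arrow X (unitA X tE) \<cdot> (Tn (waug ?A) tE \<cdot> h'))"
      by (rule inv_arrow_cancel(2)[OF U(4), symmetric]) (use hh AU U in auto)
    then have a: "Tn (waug ?A) tE \<cdot> h' = Tn (waug ?A) tE \<cdot> ?h" unfolding i haug .
    show "h' = ?h"
    proof (rule wide_pb_eq[OF wide_pb_actlike_Wpow[OF actlike_id obE(1), of k, unfolded id_apply]])
      show "Tn (Wproj k i) tE \<cdot> h' = Tn (Wproj k i) tE \<cdot> ?h" if "i < k" for i using h' hpr that by simp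
    qed (use a h hh AU in auto)
  qed
  also have "?h = bet ?A 1"
  proof -
    have "bet ?A 1 = tup X (B (T ?A)) (Suc 0) (zsec ?A M \<cdot> ?v) (\<lambda>j. beta id ?A ?v (\<lambda>m. bprj E (k + 1) (wpos ?A m * 1 + j)))"
      unfolding bet_def bvec_id d mult_1_right by simp
    also have "\<dots> = beta id ?A ?v (\<lambda>m. bprj E (k + 1) (wpos ?A m * 1 + 0))"
      by (rule tup_one[OF abT[OF A]]) (use DE A hc in auto)
    finally show ?thesis by simp
  qed
  finally show ?thesis .
qed

lemma ind_ar_nat_prj: assumes j: "j < l" shows "FE (nat_prj l j) = bprj E l j"
proof -
  have d: "dim_row (nat_prj l j) = Suc 0" "dim_col (nat_prj l j) = l" by (simp_all add: nat_prj_def)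
  have z: "bpow E l \<in> Ar X" "cod (bpow E l) = bbase E" using DE by auto
  have "FE (nat_prj l j) = tup X E (Suc 0) (bpow E l) (\<lambda>i. lincomb (fib E (bpow E l)) {..<l} (\<lambda>c. nat_prj l j $$ (i, c)) (bprj E l))"
    unfolding ind_ar_eq_tup[OF abE] d ..
  also have "\<dots> = lincomb (fib E (bpow E l)) {..<l} (\<lambda>c. nat_prj l j $$ (0, c)) (bprj E l)"
    by (rule tup_one[OF abE z]) (rule lincomb_fibm(1)[OF abE z], use bprj_carrier[OF abE] in auto)
  also have "\<dots> = bprj E l j"
    by (rule comm_monoid.lincomb_delta[OF comm_monoid_fibm[OF abE z]]) (use j bprj_carrier[OF abE] in \<open>auto simp: nat_prj_def\<close>)
  finally show ?thesis .
qed

lemma alpha_Wk: "alpha_Wk X E k l = bet (Wpow k) l"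
  unfolding alpha_Wk_def
proof (rule the_equality)
  let ?A = "Wpow k" and ?h = "bet (Wpow k) l"
  have A: "weil_ob ?A" by simp
  note b = bet[OF A, of l]
  have a0: "alpha_Wk_0 X E k = zsec ?A M" by (simp add: alpha_Wk_0_def zsec_def)
  have pr: "T ?A (bprj E l j) \<cdot> ?h = alpha_Wk_1 X E k \<cdot> FE (Tar Nbul ?A (nat_prj l j))" if "j < l" for j
    using bet_natural[OF weil_Idn_Hom[OF A], of "nat_prj l j" 1 l] ind_ar_nat_prj[OF that]
    unfolding alpha_Wk_1 by (simp add: Tar_def nat_prj_def)
  show "?h \<in> Hom X (ind_ob X E (Tob Nbul ?A l)) (Tob X ?A (ind_ob X E l)) \<and>
      T ?A (bpow E l) \<cdot> ?h = alpha_Wk_0 X E k \<cdot> bpow E (Tob Nbul ?A l) \<and>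
      (\<forall>j<l. T ?A (bprj E l j) \<cdot> ?h = alpha_Wk_1 X E k \<cdot> FE (Tar Nbul ?A (nat_prj l j)))"
    using b pr by (simp add: Hom_iff ind_ob_def a0)
  fix h' assume h': "h' \<in> Hom X (ind_ob X E (Tob Nbul ?A l)) (Tob X ?A (ind_ob X E l)) \<and>
      T ?A (bpow E l) \<cdot> h' = alpha_Wk_0 X E k \<cdot> bpow E (Tob Nbul ?A l) \<and>
      (\<forall>j<l. T ?A (bprj E l j) \<cdot> h' = alpha_Wk_1 X E k \<cdot> FE (Tar Nbul ?A (nat_prj l j)))"
  show "h' = ?h"
  proof (rule bundle_eqI[OF abT[OF A], of _ _ l])
    show "bprj (B (T ?A)) l j \<cdot> h' = bprj (B (T ?A)) l j \<cdot> ?h" if "j < l" for j using h' pr[OF that] that by simp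
    show "bpow (B (T ?A)) l \<cdot> h' = bpow (B (T ?A)) l \<cdot> ?h" using h' b(4) by (simp add: a0)
  qed (use h' b bpowO_bmap[OF abE endo_Tar[OF A], of l] powE_Ob[of l] in \<open>auto simp: Hom_iff ind_ob_def\<close>)
qed

text \<open>
  Both sides satisfy the same recursion, on one side by definition and on the other by \<open>bet_mult\<close>.
\<close>

lemma alpha_word: "alpha_word X E ks l = bet (Wword ks) l"
proof (induction ks arbitrary: l)
  case Nil
  then show ?case by (simp add: bet_unit ind_ob_def)
next
  case (Cons k ks)
  let ?A = "Wpow k" and ?B = "Wword ks"
  have A: "weil_ob ?A" "weil_ob ?B" "weil_ob (wten ?A ?B)" by auto
  let ?n = "nat_mult ?A ?B l"
  let ?i = "inv_arrow Nbul ?n"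
  note N = nat_mult_iso[OF A(1,2), of l]
  have i: "dim_col ?i = wdim (wten ?A ?B) * l" "dim_row ?i = wdim ?A * (wdim ?B * l)" "?n * ?i = 1\<^sub>m (wdim (wten ?A ?B) * l)"
    using N unfolding inverse_arrows_def by auto
  note I = ind_ar[OF abE, where a="?i"] and J = ind_ar[OF abE, where a="?n"]
  note m = multA[OF A(1,2) powE_Ob[of l]] and b1 = bet[OF A(2), of l] and b2 = bet[OF A(1), of "wdim ?B * l"] and b3 = bet[OF A(3), of l]
  have "alpha_word X E (k # ks) l = multA X ?A ?B (bpowO X E l) \<cdot> T ?A (bet ?B l) \<cdot> bet ?A (wdim ?B * l) \<cdot> FE ?i"
    using Cons.IH by (simp add: alpha_Wk ind_ob_def)
  also have "\<dots> = multA X ?A ?B (bpowO X E l) \<cdot> (T ?A (bet ?B l) \<cdot> bet ?A (wdim ?B * l)) \<cdot> FE ?i"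
    using m b1 b2 I i A powE_Ob by simp
  also have "\<dots> = (bet (wten ?A ?B) l \<cdot> FE ?n) \<cdot> FE ?i" unfolding bet_mult[OF A(1,2)] ..
  also have "\<dots> = bet (wten ?A ?B) l \<cdot> (FE ?n \<cdot> FE ?i)" by (rule comp_assoc) (use I J i b3 N in auto)
  also have "FE ?n \<cdot> FE ?i = Idn X (bpowO X E (wdim (wten ?A ?B) * l))"
    using ind_ar_mult[OF abE, of ?n ?i] ind_ar_one[OF abE] i N by simp
  finally show ?case using b3 by simp
qed

text \<open>Naturality along the chosen isomorphism makes the result independent of it.\<close>

lemma ind_alpha: assumes A: "weil_ob A" shows "ind_alpha X E A l = bet A l"
proof -
  obtain ks \<phi> where w: "wdecomp A = (ks, \<phi>)" using surj_pair[of "wdecomp A"] by blast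
  note \<phi> = wdecomp[OF A w] and H = hom_weilD[OF wdecomp(1)[OF A w]]
  note b = bet[OF A, of l] and P = powE_Ob[of l]
  have i: "FE (1\<^sub>m l) = Idn X (bpowO X E l)" by (rule ind_ar_one[OF abE])
  have iv: "inv_arrow weil \<phi> \<in> Ar weil" "Dom weil (inv_arrow weil \<phi>) = Wword ks" "Cod weil (inv_arrow weil \<phi>) = A" "inv_arrow weil \<phi> \<cdot>\<^bsub>weil\<^esub> \<phi> = Idn weil A"
    using weil.inv_arrow_simps[OF \<phi>(2)] H by simp_all
  have N: "bet (Wword ks) l \<cdot> FE (Tnt Nbul \<phi> l) = Tn \<phi> (bpowO X E l) \<cdot> bet A l"
    using bet_natural[OF \<phi>(1), of "1\<^sub>m l" l l] i by (simp add: Tnt_def)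
  have d: "dim_row (Tnt Nbul \<phi> l) = wdim (Wword ks) * l" using nat_actA_dim(1)[OF \<phi>(1)] by (simp add: Tnt_def)
  note I = ind_ar[OF abE, where a="Tnt Nbul \<phi> l"]
  have "ind_alpha X E A l = Tn (inv_arrow weil \<phi>) (bpowO X E l) \<cdot> bet (Wword ks) l \<cdot> FE (Tnt Nbul \<phi> l)"
    by (simp add: ind_alpha_def w alpha_word ind_ob_def)
  also have "\<dots> = Tn (inv_arrow weil \<phi>) (bpowO X E l) \<cdot> (bet (Wword ks) l \<cdot> FE (Tnt Nbul \<phi> l))"
    by (rule comp_assoc) (use I d bet[OF ob_Wword[of ks], of l] iv P in auto)
  also have "\<dots> = Tn (inv_arrow weil \<phi>) (bpowO X E l) \<cdot> (Tn \<phi> (bpowO X E l) \<cdot> bet A l)" unfolding N ..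
  also have "\<dots> = Idn X (actO X A (bpowO X E l)) \<cdot> bet A l"
  proof (rule comp_extend1)
    show "Tn (inv_arrow weil \<phi>) (bpowO X E l) \<cdot> Tn \<phi> (bpowO X E l) = Idn X (actO X A (bpowO X E l))"
      using Tnt_comp[OF H(1) iv(1) _ P] iv H Tnt_Idn[OF A P] by simp
  qed (use iv H b P in auto)
  also have "\<dots> = bet A l" using b by simp
  finally show ?thesis .
qed

section \<open>Naturality squares are pullbacks\<close>

lemma bet_comp:
  assumes A: "weil_ob A" and h: "arr h" "cod h = bpowO X E (wdim A * l)"
  shows "bet A l \<cdot> h = bvec id A l (bpow E (wdim A * l) \<cdot> h) (\<lambda>i. bprj E (wdim A * l) i \<cdot> h)"
  unfolding bet_def by (rule bvec_comp[OF over_bpow A bet_carrier]) (use h DE in auto)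

text \<open>Elements over the same base point with the same image have the same coordinates.\<close>

lemma bet_mono:
  assumes A: "weil_ob A" and h: "arr h" "cod h = bpowO X E (wdim A * l)" and h': "arr h'" "cod h' = bpowO X E (wdim A * l)"
    and base: "bpow E (wdim A * l) \<cdot> h = bpow E (wdim A * l) \<cdot> h'" and eq: "bet A l \<cdot> h = bet A l \<cdot> h'"
  shows "h = h'"
proof -
  let ?n = "wdim A * l"
  let ?v = "bpow E ?n \<cdot> h" and ?e = "\<lambda>i. bprj E ?n i \<cdot> h" and ?e' = "\<lambda>i. bprj E ?n i \<cdot> h'"
  have v: "over id ?v" using h DE by (simp add: over_id)
  have e: "\<forall>i<?n. ?e i \<in> lifts (B id) ?v" using lift_carrier[OF abE h] by simp
  have e': "\<forall>i<?n. ?e' i \<in> lifts (B id) ?v" using lift_carrier[OF abE h'] base by simp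
  have d: "dom h = dom h'" using base h h' DE by (metis Dom_comp)
  show ?thesis
  proof (rule bundle_eqI[OF abE h(1) h'(1) d h(2) h'(2) base])
    fix i assume i: "i < ?n"
    have l: "0 < l" using i by (auto intro: gr0I)
    define m j where "m = wbasis A ! (i div l)" and "j = i mod l"
    have p: "i div l < wdim A" using i by (simp add: less_mult_imp_div_less)
    have mj: "m \<in> nz A" "j < l" "wpos A m * l + j = i"
      using wbasis_nth_nz[OF A p] wpos_nth[OF A p] l by (simp_all add: m_def j_def)
    have bb: "beta id A ?v (\<lambda>m. ?e (wpos A m * l + j)) = beta id A ?v (\<lambda>m. ?e' (wpos A m * l + j))"
      using bvec(5)[OF v A e mj(2)] bvec(5)[OF v A e' mj(2)] eq bet_comp[OF A h] bet_comp[OF A h'] base by metis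
    have "?e (wpos A m * l + j) = ?e' (wpos A m * l + j)"
      by (rule betabij_unique[where e="\<lambda>m. ?e (wpos A m * l + j)" and e'="\<lambda>m. ?e' (wpos A m * l + j)", OF betabij[OF A actlike_id] v])
        (rule bvec_beta_carrier(1)[OF v A e mj(2)], assumption, rule bvec_beta_carrier(1)[OF v A e' mj(2)], assumption, rule bb, rule mj(1))
    then show "?e i = ?e' i" unfolding mj(3) .
  qed
qed

text \<open>
  A pair of arrows that agree in \<open>T\<^sub>A E\<^sub>n\<close> lies over a zero vector of \<open>M\<close>, so the first one has coordinates; these
  form the factorisation, and its second composite is correct because the bottom side of the square is monic
  over the base.
\<close>

lemma bet_pullback:
  assumes A: "weil_ob A" and f: "f \<in> carrier_mat n l"
  shows "is_pullback X (bet A l) (FE (nat_actA (Idn weil A) f)) (T A (FE f)) (bet A n)"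
proof -
  let ?Ff = "FE f" and ?D = "nat_actA (Idn weil A) f"
  note I = ind_ar[OF abE, where a=f] and J = ind_ar[OF abE, where a="?D"]
  note bl = bet[OF A, of l] and bn = bet[OF A, of n] and P = powE_Ob
  have D: "dim_row ?D = wdim A * n" "dim_col ?D = wdim A * l" using nat_actA_dim[OF weil_Idn_Hom[OF A], of f] f by simp_all
  have nat: "bet A n \<cdot> FE ?D = T A ?Ff \<cdot> bet A l"
    using bet_natural[OF weil_Idn_Hom[OF A] f] by (simp add: Tar_def)
  have bb: "bpowO X (B (T A)) l = actO X A (bpowO X E l)" using bpowO_bmap[OF abE endo_Tar[OF A]] P A by simp
  show ?thesis
  proof (rule is_pullbackI)
    fix \<phi> g assume \<phi>: "arr \<phi>" "cod \<phi> = dom (T A ?Ff)" and g: "arr g" "cod g = dom (bet A n)"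
      and dd: "dom \<phi> = dom g" and eq: "T A ?Ff \<cdot> \<phi> = bet A n \<cdot> g"
    have \<phi>c: "cod \<phi> = actO X A (bpowO X E l)" using \<phi> I f A by simp
    have gc: "cod g = bpowO X E (wdim A * n)" using g bn by simp
    let ?v = "bpow E (wdim A * n) \<cdot> g"
    have v: "over id ?v" using g gc DE by (simp add: over_id)
    have zv: "zsec A M \<cdot> ?v \<in> Ar X" "cod (zsec A M \<cdot> ?v) = bbase (B (T A))" "dom (zsec A M \<cdot> ?v) = dom g"
      using g gc DE A by simp_all
    have base: "T A (bpow E l) \<cdot> \<phi> = zsec A M \<cdot> ?v"
    proof -
      have "T A (bpow E l) = T A (bpow E n) \<cdot> T A ?Ff"
        using Tar_comp[OF A I(1) DE(15)[of n]] I f DE by simp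
      then have "T A (bpow E l) \<cdot> \<phi> = T A (bpow E n) \<cdot> (T A ?Ff \<cdot> \<phi>)"
        using \<phi> I f A DE by simp
      also have "\<dots> = T A (bpow E n) \<cdot> (bet A n \<cdot> g)" unfolding eq ..
      also have "\<dots> = (zsec A M \<cdot> bpow E (wdim A * n)) \<cdot> g"
        by (rule comp_extend1[OF bn(4)]) (use bn gc g A DE in auto)
      also have "\<dots> = zsec A M \<cdot> ?v" using g gc DE A by simp
      finally show ?thesis .
    qed
    have \<phi>j: "T A (bprj E l j) \<cdot> \<phi> \<in> lifts (B (id \<circ> T A)) (id (zsec A M) \<cdot> ?v)" if "j < l" for j
      using lift_carrier[OF abT[OF A] \<phi>(1), of l "zsec A M \<cdot> ?v" j] that base \<phi>c bb by simp
    have "\<forall>j. \<exists>e. j < l \<longrightarrow> (\<forall>m\<in>nz A. e m \<in> lifts (B id) ?v) \<and> beta id A ?v e = T A (bprj E l j) \<cdot> \<phi>"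
      using betabij_ex[OF betabij[OF A actlike_id] v \<phi>j] by metis
    then obtain e where e: "\<And>j m. j < l \<Longrightarrow> m \<in> nz A \<Longrightarrow> e j m \<in> lifts (B id) ?v"
      "\<And>j. j < l \<Longrightarrow> beta id A ?v (e j) = T A (bprj E l j) \<cdot> \<phi>" by metis
    \<comment> \<open>The coordinate numbered \<open>c\<close> belongs to the monomial \<open>c div l\<close> and the component \<open>c mod l\<close>.\<close>
    let ?e = "\<lambda>c. e (c mod l) (wbasis A ! (c div l))"
    have ec: "\<forall>c<wdim A * l. ?e c \<in> lifts E ?v"
    proof (intro allI impI)
      fix c assume c: "c < wdim A * l"
      then have "0 < l" by (auto intro: gr0I)
      then show "?e c \<in> lifts E ?v"
        using e(1)[of "c mod l" "wbasis A ! (c div l)"] wbasis_nth_nz[OF A, of "c div l"] c by (simp add: less_mult_imp_div_less)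
    qed
    let ?h = "tup X E (wdim A * l) ?v ?e"
    have vv: "arr ?v" "cod ?v = bbase E" "dom ?v = dom g" using g gc DE by simp_all
    have h: "arr ?h" "dom ?h = dom g" "cod ?h = bpowO X E (wdim A * l)" "bpow E (wdim A * l) \<cdot> ?h = ?v"
      using tup[OF abE vv(1,2), of "wdim A * l" ?e] ec vv(3) by auto
    have ec': "\<forall>c<wdim A * l. ?e c \<in> lifts (B id) ?v" using ec by simp
    note bv = bvec[OF v A ec']
    have bh: "bet A l \<cdot> ?h = \<phi>"
      unfolding bet_tup[OF v A ec]
    proof (rule bundle_eqI[OF abT[OF A], of _ _ l])
      show "bpow (B (T A)) l \<cdot> bvec id A l ?v ?e = bpow (B (T A)) l \<cdot> \<phi>" using bv(4) base by simp
      fix j assume j: "j < l"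
      have "T A (bprj E l j) \<cdot> bvec id A l ?v ?e = beta id A ?v (\<lambda>m. ?e (wpos A m * l + j))" using bv(5)[OF j] by simp
      also have "\<dots> = beta id A ?v (e j)"
        by (rule beta_cong[OF v A bvec_beta_carrier(1)[OF v A ec' j]]) (use block_div[OF j] wpos(2)[OF A] in auto)
      finally show "bprj (B (T A)) l j \<cdot> bvec id A l ?v ?e = bprj (B (T A)) l j \<cdot> \<phi>" using e(2)[OF j] by simp
    qed (use bv bb \<phi>(1) \<phi>c dd vv P A fo_id in auto)
    have "FE ?D \<cdot> ?h = g"
    proof (rule bet_mono[OF A, of _ n])
      show "bpow E (wdim A * n) \<cdot> (FE ?D \<cdot> ?h) = bpow E (wdim A * n) \<cdot> g"
        using comp_extend1[OF J(4)[unfolded D]] J D h DE by simp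
      have "bet A n \<cdot> (FE ?D \<cdot> ?h) = T A ?Ff \<cdot> (bet A l \<cdot> ?h)"
        by (rule comp_extend[OF nat]) (use J D h bn bl I f A in auto)
      then show "bet A n \<cdot> (FE ?D \<cdot> ?h) = bet A n \<cdot> g" unfolding bh eq .
    qed (use J D h g gc in auto)
    then show "\<exists>h. arr h \<and> dom h = dom g \<and> cod h = dom (bet A l) \<and> bet A l \<cdot> h = \<phi> \<and> FE ?D \<cdot> h = g"
      using h bh bl by (intro exI[of _ ?h]) simp
  next
    fix h h' assume h: "arr h" "arr h'" "cod h = dom (bet A l)" "cod h' = dom (bet A l)"
      and eq: "bet A l \<cdot> h = bet A l \<cdot> h'" "FE ?D \<cdot> h = FE ?D \<cdot> h'"
    have c: "cod h = bpowO X E (wdim A * l)" "cod h' = bpowO X E (wdim A * l)" using h bl by simp_all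
    have J4: "bpow E (wdim A * n) \<cdot> FE ?D = bpow E (wdim A * l)" using J(4) unfolding D .
    have "bpow E (wdim A * l) \<cdot> k = bpow E (wdim A * n) \<cdot> (FE ?D \<cdot> k)" if "arr k" "cod k = bpowO X E (wdim A * l)" for k
      by (rule comp_extend1[OF J4, symmetric]) (use that J D DE in auto)
    then have "bpow E (wdim A * l) \<cdot> h = bpow E (wdim A * l) \<cdot> h'" using h c eq(2) by metis
    then show "h = h'" by (rule bet_mono[OF A h(1) c(1) h(2) c(2) _ eq(1)])
  qed (use nat J D I f bl bn A in auto)
qed

end

theorem proposition5p8:
  fixes X :: "('o, 'a) acteg" and E :: "('o, 'a) dbun"
  assumes "tangent_actegory X"
    and "differential_bundle X E"
  shows "differential_functor Nbul X (ind_ob X E) (ind_ar X E) (ind_alpha X E)"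
proof -
  interpret dbundle X E using assms by unfold_locales (auto simp: tangent_actegory_def actegory_def)
  have F: "is_functor Nbul X (ind_ob X E) (ind_ar X E)"
    unfolding is_functor_def
  proof (intro conjI allI ballI)
    fix x y f assume "f \<in> Hom Nbul x y"
    then show "ind_ar X E f \<in> Hom X (ind_ob X E x) (ind_ob X E y)"
      using ind_ar[OF abE, where a=f] by (auto simp: Hom_iff ind_ob_def)
  next
    fix x y z f g assume "f \<in> Hom Nbul x y" "g \<in> Hom Nbul y z"
    then show "ind_ar X E (g \<cdot>\<^bsub>Nbul\<^esub> f) = ind_ar X E g \<cdot>\<^bsub>X\<^esub> ind_ar X E f"
      using ind_ar_mult[OF abE, of g f] by auto
  qed (use powE_Ob ind_ar_one[OF abE] in \<open>simp_all add: ind_ob_def\<close>)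
  have O: "oplax_linear_functor Nbul X (ind_ob X E) (ind_ar X E) (ind_alpha X E)"
    unfolding oplax_linear_functor_def
  proof (intro conjI allI ballI F)
    fix A x assume "A \<in> Ob weil"
    then show "ind_alpha X E A x \<in> Hom X (ind_ob X E (Tob Nbul A x)) (Tob X A (ind_ob X E x))"
      using bet[of A x] by (simp add: ind_alpha Hom_iff ind_ob_def)
  next
    fix A B x y \<theta> f assume th: "\<theta> \<in> Hom weil A B" and f: "f \<in> Hom Nbul x y"
    note H = hom_weilD[OF th]
    show "ind_alpha X E B y \<cdot>\<^bsub>X\<^esub> ind_ar X E (actA Nbul \<theta> f) = actA X \<theta> (ind_ar X E f) \<cdot>\<^bsub>X\<^esub> ind_alpha X E A x"
      using bet_natural[OF th, of f y x] f by (simp add: ind_alpha H)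
  next
    fix A B x assume "A \<in> Ob weil" "B \<in> Ob weil"
    then have A: "weil_ob A" "weil_ob B" by simp_all
    note m = multA[OF A powE_Ob[of x]] and b1 = bet[OF A(2), of x] and b2 = bet[OF A(1), of "wdim B * x"]
    show "ind_alpha X E (wten A B) x \<cdot>\<^bsub>X\<^esub> ind_ar X E (multA Nbul A B x) =
        multA X A B (ind_ob X E x) \<cdot>\<^bsub>X\<^esub> Tar X A (ind_alpha X E B x) \<cdot>\<^bsub>X\<^esub> ind_alpha X E A (Tob Nbul B x)"
      using bet_mult[OF A, of x] m b1 b2 A powE_Ob by (simp add: ind_alpha ind_ob_def)
  next
    fix x
    show "ind_alpha X E wunit x \<cdot>\<^bsub>X\<^esub> ind_ar X E (unitA Nbul x) = unitA X (ind_ob X E x)"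
      using bet_unit[of x] ind_ar_one[OF abE, of x] unitA[OF powE_Ob[of x]] by (simp add: ind_alpha ind_ob_def)
  qed
  show ?thesis
    unfolding differential_functor_def
  proof (intro conjI allI ballI impI O)
    show "\<exists>s. is_terminal Nbul s" by (simp add: terminal_Nbul)
  next
    fix A t l r b assume "A \<in> Ob weil" and tl: "is_pullback Nbul t l r b \<and> is_terminal Nbul (Cod Nbul r)"
    then have A: "weil_ob A" by simp
    have pb: "is_pullback Nbul t l r b" and r: "dim_row r = 0" using tl terminal_Nbul[of "dim_row r"] by auto
    obtain s\<^sub>1 s\<^sub>2 where s: "s\<^sub>1 \<in> carrier_mat (dim_col t) (dim_row t)" "s\<^sub>2 \<in> carrier_mat (dim_col t) (dim_row l)"
      "t * s\<^sub>1 = 1\<^sub>m (dim_row t)" "t * s\<^sub>2 = 0\<^sub>m (dim_row t) (dim_row l)" "l * s\<^sub>1 = 0\<^sub>m (dim_row l) (dim_row t)" "l * s\<^sub>2 = 1\<^sub>m (dim_row l)"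
      "s\<^sub>1 * t + s\<^sub>2 * l = 1\<^sub>m (dim_col t)" using pullback_Nbul[OF pb r] .
    have d: "dim_col l = dim_col t" "dim_col r = dim_row t" "dim_col b = dim_row l" "dim_row b = 0"
      using pb r unfolding is_pullback_def by auto
    have F: "Tar X A (ind_ar X E a) = ind_ar X (B (Tar X A)) a" for a by (rule bmap_ind_ar[OF abE endo_Tar[OF A] abT[OF A]])
    show "is_pullback X (Tar X A (ind_ar X E t)) (Tar X A (ind_ar X E l)) (Tar X A (ind_ar X E r)) (Tar X A (ind_ar X E b))"
      unfolding F
      by (rule is_pullback_ind_ar[OF abT[OF A], where m="dim_row t" and n="dim_row l" and p="dim_col t" and s\<^sub>1=s\<^sub>1 and s\<^sub>2=s\<^sub>2])
        (use s d r in auto)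
  next
    fix A x y f assume "A \<in> Ob weil" and f: "f \<in> Hom Nbul x y"
    then have A: "weil_ob A" by simp
    show "is_pullback X (ind_alpha X E A x) (ind_ar X E (Tar Nbul A f)) (Tar X A (ind_ar X E f)) (ind_alpha X E A y)"
      using bet_pullback[OF A, of f y x] f by (simp add: ind_alpha[OF A] Tar_def)
  qed
qed

end
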